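(* Let $M$ be the hyperfinite $\mathrm{II}_1$ factor and let $A\subset M$ be the unique (up to conjugacy) subfactor of index $[M:A]=2+\sqrt{2}$. Then the optimal (i.e. largest) value of $\alpha\in(0,1]$ such that $$\alpha\,\Vert u-\mathbb{E}_A(u)\Vert_2\le \Vert \mathbb{E}_A-\mathbb{E}_{uAu^*}\Vert_{\infty,2}\quad\text{for all unitaries }u\in M$$ lies between $\sqrt{\sqrt{2}(\sqrt{2}-1)}$ and $\sqrt{2(\sqrt{2}-1)}$ (inclusive).
   Context: $M$ has its unique normal faithful tracial state $\tau$, $\Vert x\Vert_2=\tau(x^*x)^{1/2}$, and $\Vert x\Vert$ is the operator norm. $[M:A]$ is the Jones index. It is known that the hyperfinite $\mathrm{II}_1$ factor has a subfactor of index $2+\sqrt2$ and that it is unique up to conjugacy (i.e. up to an automorphism of $M$). For a von Neumann subalgebra $B\subseteq M$, $\mathbb{E}_B$ denotes the unique normal faithful $\tau$-preserving conditional expectation of $M$ onto $B$. For a linear map $T:M\to M$, $\Vert T\Vert_{\infty,2}=\sup\{\Vert T(x)\Vert_2 : x\in M,\ \Vert x\Vert\le 1\}$. *)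

theory Defs
  imports "HOL-Analysis.Analysis"
begin

section \<open>Complex Hilbert spaces\<close>

text \<open>The inner product is linear in its first and antilinear in its second argument.
  The real Banach space structure is the one underlying the complex structure.\<close>

class complex_hilbert_space = banach +
  fixes scaleC :: "complex \<Rightarrow> 'a \<Rightarrow> 'a"  (infixr "*\<^sub>C" 75)
    and cinner :: "'a \<Rightarrow> 'a \<Rightarrow> complex"
  assumes scaleC_add_right: "c *\<^sub>C (x + y) = c *\<^sub>C x + c *\<^sub>C y"
    and scaleC_add_left: "(c + d) *\<^sub>C x = c *\<^sub>C x + d *\<^sub>C x"
    and scaleC_scaleC: "c *\<^sub>C (d *\<^sub>C x) = (c * d) *\<^sub>C x"
    and scaleC_of_real: "complex_of_real r *\<^sub>C x = r *\<^sub>R x"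
    and cinner_commute: "cinner x y = cnj (cinner y x)"
    and cinner_add_left: "cinner (x + y) z = cinner x z + cinner y z"
    and cinner_scaleC_left: "cinner (c *\<^sub>C x) y = c * cinner x y"
    and cinner_norm: "cinner x x = complex_of_real ((norm x)\<^sup>2)"

lemma norm_scaleC: "norm (c *\<^sub>C x) = cmod c * norm (x::'a::complex_hilbert_space)"
proof -
  have "cinner (c *\<^sub>C x) (c *\<^sub>C x) = c * cnj c * cinner x x"
    using cinner_commute[of x "c *\<^sub>C x"] cinner_commute[of x x]
    by (simp add: cinner_scaleC_left)
  hence "complex_of_real ((norm (c *\<^sub>C x))\<^sup>2) = complex_of_real ((cmod c)\<^sup>2 * (norm x)\<^sup>2)"
    by (simp only: cinner_norm complex_norm_square of_real_mult)
  hence "(norm (c *\<^sub>C x))\<^sup>2 = (cmod c * norm x)\<^sup>2"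
    by (simp only: of_real_eq_iff power_mult_distrib)
  thus ?thesis by simp
qed

lemma bounded_linear_scaleC: "bounded_linear (\<lambda>x::'a::complex_hilbert_space. c *\<^sub>C x)"
proof (rule bounded_linear_intro)
  fix x y :: 'a and r :: real
  show "c *\<^sub>C (x + y) = c *\<^sub>C x + c *\<^sub>C y" by (rule scaleC_add_right)
  show "c *\<^sub>C (r *\<^sub>R x) = r *\<^sub>R (c *\<^sub>C x)"
    unfolding scaleC_of_real[symmetric] scaleC_scaleC by (simp add: mult.commute)
  show "norm (c *\<^sub>C x) \<le> norm x * cmod c" by (simp add: norm_scaleC mult.commute)
qed


section \<open>Bounded operators\<close>

text \<open>Operators live in the type of bounded real-linear maps, whose norm is the operator norm;
  \<open>bounded_ops\<close> is the algebra of bounded complex-linear operators.\<close>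

type_synonym 'h oper = "'h \<Rightarrow>\<^sub>L 'h"

definition bounded_ops :: "'h::complex_hilbert_space oper set" where
  "bounded_ops = {T. \<forall>c x. blinfun_apply T (c *\<^sub>C x) = c *\<^sub>C blinfun_apply T x}"

definition scalar_op :: "complex \<Rightarrow> 'h::complex_hilbert_space oper" where
  "scalar_op c = Blinfun (\<lambda>x. c *\<^sub>C x)"

lemma scalar_op_apply [simp]: "blinfun_apply (scalar_op c) x = c *\<^sub>C x"
  by (simp add: scalar_op_def bounded_linear_Blinfun_apply bounded_linear_scaleC)

definition scale_op :: "complex \<Rightarrow> 'h::complex_hilbert_space oper \<Rightarrow> 'h oper" where
  "scale_op c T = scalar_op c o\<^sub>L T"

definition adj :: "'h::complex_hilbert_space oper \<Rightarrow> 'h oper" where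
  "adj T = (THE S. \<forall>x y. cinner (blinfun_apply T x) y = cinner x (blinfun_apply S y))"

definition positive_op :: "'h::complex_hilbert_space oper \<Rightarrow> bool" where
  "positive_op T \<longleftrightarrow> T \<in> bounded_ops \<and> (\<forall>x. cinner (blinfun_apply T x) x \<in> \<real>\<^sub>\<ge>\<^sub>0)"

definition op_le :: "'h::complex_hilbert_space oper \<Rightarrow> 'h oper \<Rightarrow> bool" where
  "op_le S T \<longleftrightarrow> positive_op (T - S)"

definition proj_onto :: "'h::complex_hilbert_space set \<Rightarrow> 'h oper" where
  "proj_onto V = (THE P. P \<in> bounded_ops \<and> P o\<^sub>L P = P \<and> adj P = P \<and> range (blinfun_apply P) = V)"


section \<open>Von Neumann algebras and factors\<close>

definition commutant :: "'h::complex_hilbert_space oper set \<Rightarrow> 'h oper set" where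
  "commutant S = {T \<in> bounded_ops. \<forall>X\<in>S. X o\<^sub>L T = T o\<^sub>L X}"

definition star_subalgebra :: "'h::complex_hilbert_space oper set \<Rightarrow> bool" where
  "star_subalgebra Q \<longleftrightarrow> Q \<subseteq> bounded_ops \<and> id_blinfun \<in> Q \<and>
     (\<forall>x\<in>Q. \<forall>y\<in>Q. x + y \<in> Q \<and> x o\<^sub>L y \<in> Q) \<and>
     (\<forall>x\<in>Q. adj x \<in> Q \<and> (\<forall>c. scale_op c x \<in> Q))"

definition von_neumann_algebra :: "'h::complex_hilbert_space oper set \<Rightarrow> bool" where
  "von_neumann_algebra M \<longleftrightarrow> star_subalgebra M \<and> commutant (commutant M) = M"

definition factor :: "'h::complex_hilbert_space oper set \<Rightarrow> bool" where
  "factor M \<longleftrightarrow> von_neumann_algebra M \<and> M \<inter> commutant M = range scalar_op"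

text \<open>\<open>span\<close> is the real span; for complex subspaces finite-dimensionality over the reals and
  over the complex numbers agree.\<close>

definition finite_dim :: "'h::complex_hilbert_space oper set \<Rightarrow> bool" where
  "finite_dim Q \<longleftrightarrow> (\<exists>S. finite S \<and> Q \<subseteq> span S)"


section \<open>Normal maps, traces and conditional expectations\<close>

definition directed_positive :: "'h::complex_hilbert_space oper set \<Rightarrow> 'h oper set \<Rightarrow> bool" where
  "directed_positive M D \<longleftrightarrow> D \<noteq> {} \<and> D \<subseteq> M \<and> (\<forall>d\<in>D. positive_op d) \<and>
     (\<forall>a\<in>D. \<forall>b\<in>D. \<exists>c\<in>D. op_le a c \<and> op_le b c)"

definition is_op_lub :: "'h::complex_hilbert_space oper set \<Rightarrow> 'h oper set \<Rightarrow> 'h oper \<Rightarrow> bool" where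
  "is_op_lub M D x \<longleftrightarrow> x \<in> M \<and> (\<forall>d\<in>D. op_le d x) \<and>
     (\<forall>y\<in>M. (\<forall>d\<in>D. op_le d y) \<longrightarrow> op_le x y)"

definition state_on :: "'h::complex_hilbert_space oper set \<Rightarrow> ('h oper \<Rightarrow> complex) \<Rightarrow> bool" where
  "state_on M \<tau> \<longleftrightarrow>
     (\<forall>x\<in>M. \<forall>y\<in>M. \<tau> (x + y) = \<tau> x + \<tau> y) \<and> (\<forall>x\<in>M. \<forall>c. \<tau> (scale_op c x) = c * \<tau> x) \<and>
     (\<forall>x\<in>M. positive_op x \<longrightarrow> \<tau> x \<in> \<real>\<^sub>\<ge>\<^sub>0) \<and> \<tau> id_blinfun = 1"

definition normal_functional :: "'h::complex_hilbert_space oper set \<Rightarrow> ('h oper \<Rightarrow> complex) \<Rightarrow> bool" where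
  "normal_functional M \<tau> \<longleftrightarrow>
     (\<forall>D x. directed_positive M D \<and> is_op_lub M D x \<longrightarrow> Re (\<tau> x) = (SUP d\<in>D. Re (\<tau> d)))"

definition normal_faithful_tracial_state ::
    "'h::complex_hilbert_space oper set \<Rightarrow> ('h oper \<Rightarrow> complex) \<Rightarrow> bool" where
  "normal_faithful_tracial_state M \<tau> \<longleftrightarrow> state_on M \<tau> \<and> normal_functional M \<tau> \<and>
     (\<forall>x\<in>M. \<tau> (adj x o\<^sub>L x) = 0 \<longrightarrow> x = 0) \<and>
     (\<forall>x\<in>M. \<forall>y\<in>M. \<tau> (x o\<^sub>L y) = \<tau> (y o\<^sub>L x))"

text \<open>The normal faithful tracial state of a factor is unique on the factor when it exists; it is
  extended by 0 to make it unique as a function on the whole operator type.\<close>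

definition trace_of :: "'h::complex_hilbert_space oper set \<Rightarrow> 'h oper \<Rightarrow> complex" where
  "trace_of M = (THE \<tau>. normal_faithful_tracial_state M \<tau> \<and> (\<forall>x. x \<notin> M \<longrightarrow> \<tau> x = 0))"

definition II1_factor :: "'h::complex_hilbert_space oper set \<Rightarrow> bool" where
  "II1_factor M \<longleftrightarrow> factor M \<and> \<not> finite_dim M \<and> (\<exists>\<tau>. normal_faithful_tracial_state M \<tau>)"

text \<open>By the bicommutant theorem, the double commutant below is the weak closure of the union.\<close>

definition hyperfinite :: "'h::complex_hilbert_space oper set \<Rightarrow> bool" where
  "hyperfinite M \<longleftrightarrow> (\<exists>Q::nat \<Rightarrow> 'h oper set. incseq Q \<and>
     (\<forall>n. star_subalgebra (Q n) \<and> finite_dim (Q n)) \<and> M = commutant (commutant (\<Union>n. Q n)))"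

definition subfactor :: "'h::complex_hilbert_space oper set \<Rightarrow> 'h oper set \<Rightarrow> bool" where
  "subfactor A M \<longleftrightarrow> factor A \<and> A \<subseteq> M"

text \<open>\<open>is_cond_exp M B E\<close>: on \<open>M\<close>, the map \<open>E\<close> is a normal faithful trace-preserving conditional
  expectation onto \<open>B\<close>. As for traces, extension by 0 makes it unique as a function.\<close>

definition is_cond_exp ::
    "'h::complex_hilbert_space oper set \<Rightarrow> 'h oper set \<Rightarrow> ('h oper \<Rightarrow> 'h oper) \<Rightarrow> bool" where
  "is_cond_exp M B E \<longleftrightarrow>
     (\<forall>x\<in>M. \<forall>y\<in>M. E (x + y) = E x + E y) \<and> (\<forall>x\<in>M. \<forall>c. E (scale_op c x) = scale_op c (E x)) \<and>
     E ` M \<subseteq> B \<and> (\<forall>b\<in>B. E b = b) \<and>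
     (\<forall>x\<in>M. positive_op x \<longrightarrow> positive_op (E x)) \<and>
     (\<forall>x\<in>M. \<forall>b\<in>B. \<forall>c\<in>B. E (b o\<^sub>L x o\<^sub>L c) = b o\<^sub>L E x o\<^sub>L c) \<and>
     (\<forall>D x. directed_positive M D \<and> is_op_lub M D x \<longrightarrow> is_op_lub M (E ` D) (E x)) \<and>
     (\<forall>x\<in>M. E (adj x o\<^sub>L x) = 0 \<longrightarrow> x = 0) \<and>
     (\<forall>x\<in>M. trace_of M (E x) = trace_of M x)"

definition cond_exp ::
    "'h::complex_hilbert_space oper set \<Rightarrow> 'h oper set \<Rightarrow> 'h oper \<Rightarrow> 'h oper" where
  "cond_exp M B = (THE E. is_cond_exp M B E \<and> (\<forall>x. x \<notin> M \<longrightarrow> E x = 0))"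


section \<open>Jones index\<close>

text \<open>Murray--von Neumann dimension (coupling constant) of the space on which the finite factor
  \<open>N\<close> acts: it is \<open>\<tau>\<^sub>N [N'\<xi>] / \<tau>\<^sub>N\<^sub>' [N\<xi>]\<close> for every vector \<open>\<xi> \<noteq> 0\<close> if the commutant
  \<open>N'\<close> is finite, where \<open>[N\<xi>]\<close> is the projection onto the closure of \<open>N\<xi>\<close>, and infinite
  otherwise.\<close>

definition orbit_proj :: "'h::complex_hilbert_space oper set \<Rightarrow> 'h \<Rightarrow> 'h oper" where
  "orbit_proj N \<xi> = proj_onto (closure ((\<lambda>T. blinfun_apply T \<xi>) ` N))"

definition vn_dim :: "'h::complex_hilbert_space oper set \<Rightarrow> ereal" where
  "vn_dim N =
     (if \<exists>\<tau>. normal_faithful_tracial_state (commutant N) \<tau>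
      then ereal (THE d. \<forall>\<xi>. \<xi> \<noteq> 0 \<longrightarrow>
        d = Re (trace_of N (orbit_proj (commutant N) \<xi>))
              / Re (trace_of (commutant N) (orbit_proj N \<xi>)))
      else \<infinity>)"

text \<open>\<open>standard_rep M \<pi> \<Omega>\<close>: \<open>\<pi>\<close> is (up to unitary equivalence) the representation of \<open>M\<close> by left
  multiplication on the Hilbert space completion of \<open>M\<close> with respect to the inner product
  \<open>\<tau>(y\<^sup>*x)\<close>, and \<open>\<Omega>\<close> is the vector corresponding to the unit.\<close>

definition standard_rep ::
    "'h::complex_hilbert_space oper set \<Rightarrow> ('h oper \<Rightarrow> 'k::complex_hilbert_space oper) \<Rightarrow> 'k \<Rightarrow> bool" where
  "standard_rep M \<pi> \<Omega> \<longleftrightarrow> \<pi> ` M \<subseteq> bounded_ops \<and> \<pi> id_blinfun = id_blinfun \<and>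
     (\<forall>x\<in>M. \<forall>y\<in>M. \<pi> (x + y) = \<pi> x + \<pi> y \<and> \<pi> (x o\<^sub>L y) = \<pi> x o\<^sub>L \<pi> y) \<and>
     (\<forall>x\<in>M. \<pi> (adj x) = adj (\<pi> x) \<and> (\<forall>c. \<pi> (scale_op c x) = scale_op c (\<pi> x))) \<and>
     closure ((\<lambda>x. blinfun_apply (\<pi> x) \<Omega>) ` M) = UNIV \<and>
     (\<forall>x\<in>M. cinner (blinfun_apply (\<pi> x) \<Omega>) \<Omega> = trace_of M x)"

text \<open>The index \<open>[M:A]\<close> is the dimension of \<open>L\<^sup>2(M)\<close> over \<open>A\<close>. A type cannot depend on \<open>M\<close>, so the
  type \<open>'k\<close> of a Hilbert space that realises \<open>L\<^sup>2(M)\<close> is a parameter; the value \<open>d\<close> does not depend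
  on the realisation.\<close>

definition has_jones_index ::
    "'k::complex_hilbert_space itself \<Rightarrow> 'h::complex_hilbert_space oper set \<Rightarrow> 'h oper set \<Rightarrow> ereal \<Rightarrow> bool" where
  "has_jones_index _ M A d \<longleftrightarrow>
     (\<exists>(\<pi>::'h oper \<Rightarrow> 'k oper) \<Omega>. standard_rep M \<pi> \<Omega> \<and> vn_dim (\<pi> ` A) = d)"


section \<open>Norms and unitaries\<close>

definition norm2 :: "'h::complex_hilbert_space oper set \<Rightarrow> 'h oper \<Rightarrow> real" where
  "norm2 M x = sqrt (Re (trace_of M (adj x o\<^sub>L x)))"

definition norm_inf2 :: "'h::complex_hilbert_space oper set \<Rightarrow> ('h oper \<Rightarrow> 'h oper) \<Rightarrow> real" where
  "norm_inf2 M T = (SUP x\<in>{x \<in> M. norm x \<le> 1}. norm2 M (T x))"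

definition unitaries :: "'h::complex_hilbert_space oper set \<Rightarrow> 'h oper set" where
  "unitaries M = {u \<in> M. adj u o\<^sub>L u = id_blinfun \<and> u o\<^sub>L adj u = id_blinfun}"

definition conj_by :: "'h::complex_hilbert_space oper \<Rightarrow> 'h oper set \<Rightarrow> 'h oper set" where
  "conj_by u A = (\<lambda>a. u o\<^sub>L a o\<^sub>L adj u) ` A"

definition admissible :: "'h::complex_hilbert_space oper set \<Rightarrow> 'h oper set \<Rightarrow> real set" where
  "admissible M A = {\<alpha> \<in> {0<..1}. \<forall>u\<in>unitaries M.
     \<alpha> * norm2 M (u - cond_exp M A u)
       \<le> norm_inf2 M (\<lambda>x. cond_exp M A x - cond_exp M (conj_by u A) x)}"

end

(*
  Let e be the projection of L^2(M) onto L^2(A), E the conditional expectation of M onto A, rho the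
  commuting right action of M, and lam = 1 / (2 + sqrt 2) the trace of e in the commutant of A. A
  decomposition of 1 - e in the relative commutant of A and rho A would contain a sub-bimodule of
  left dimension below sqrt 2, hence of dimension one, and these do not occur; so the relative
  commutant is spanned by e and 1 - e.

  Lower bound: the average of rho(u) e rho(u)^-1 over the unitary group of A is therefore a
  combination of e and 1 - e, whose coefficients are read off from traces. This bounds the minimum
  of ||E(u v u^-1)||_2 over the unitaries v of A in terms of ||E u||_2.

  Upper bound: comparison of projections and pushing down yield n in M such that U = 1 - n^* n is a
  symmetry with E U = 0 and ||E(U a U)||_2 >= (sqrt 2 - 1) ||a||_2 on A. The constant comes from a gap
  in the spectrum of a positive operator around 1.

  Index: the coupling constant turns the hypothesis into tn e = lam. It applies to the image of M in
  the given standard representation because images of von Neumann subalgebras are again von Neumann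
  algebras, their unit balls being complete in the trace norm.
*)
theory Submission
  imports Defs
begin

unbundle no vec_syntax

text \<open>Functional calculus enters only through square roots, inverses and positive parts, each
  carrying the clause that it commutes with whatever commutes with the given operator; the
  bicommutant then contains it. Directed suprema are reduced to increasing sequences by a faithful
  trace. A sub-bimodule of dimension one is excluded because it yields a unitary that normalises A
  and, corrected by a unitary of A, fixes a projection q with E q = lam. Its powers then produce
  either a projection above q with expectation 1/2 or 1/3, which the index forbids, or four
  orthogonal unitaries fixing q, which forces lam <= 1/4. For the constants, put t = ||E u||_2^2.
  The lower argument bounds the squared distance from below by (1 - t)(2 - sqrt 2 + sqrt 2 t), which
  is at least (2 - sqrt 2)(1 - t). The symmetry has t = 0, and its gap sqrt 2 - 1 bounds the squared
  distance from above by 1 - (sqrt 2 - 1)^2 = 2 (sqrt 2 - 1). The two estimates do not meet at t =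
  0, which leaves an interval. The given representation is not known to be normal, which is why its
  images need a completeness argument.\<close>

abbreviation LIMSEQ_ascii (infixr "---->" 60) where
 "X ----> L \<equiv> (X \<longlongrightarrow> L) sequentially"

section \<open>Complex inner products\<close>

lemma cinner_add_right: "cinner x (y + z) = cinner x y + cinner x (z::'a::complex_hilbert_space)"
 by (metis cinner_commute cinner_add_left complex_cnj_add)

lemma cinner_scaleC_right: "cinner x (c *\<^sub>C y) = cnj c * cinner x (y::'a::complex_hilbert_space)"
 by (metis cinner_commute cinner_scaleC_left complex_cnj_mult)

lemma cinner_scaleR_left: "cinner (r *\<^sub>R x) y = of_real r * cinner x (y::'a::complex_hilbert_space)"
 by (metis cinner_scaleC_left scaleC_of_real)

lemma cinner_scaleR_right: "cinner x (r *\<^sub>R y) = of_real r * cinner x (y::'a::complex_hilbert_space)"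
 by (metis cinner_scaleC_right scaleC_of_real complex_cnj_complex_of_real)

text \<open>A discriminant criterion that covers \<open>C = 0\<close>. It yields Cauchy-Schwarz, its
  analogue for a positive operator, and, with \<open>A = 0\<close>, the first-order condition at a
  nearest point.\<close>

lemma quadratic_discriminant_le:
 fixes A B C :: real
 assumes "!!r. 0 <= A + 2 * r * B + r\<^sup>2 * C" "0 <= C"
 shows "B\<^sup>2 <= A * C"
proof (cases "C = 0")
 case True
 show ?thesis
 proof (cases "B = 0")
  case False
  \<comment> \<open>This \<open>r\<close> makes the affine function \<open>A + 2 * r * B\<close>
    equal to -1.\<close>
  have "0 <= A + 2 * (-(A+1)/(2*B)) * B" using assms(1)[of "-(A+1)/(2*B)"] True by simp
  moreover have "2 * (-(A+1)/(2*B)) * B = - (A+1)" using False by simp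
  ultimately show ?thesis by linarith
 qed (simp add: True)
next
 case False
 hence C: "C > 0" using assms(2) by simp
 have "0 <= A + 2 * (-B/C) * B + (-B/C)\<^sup>2 * C" by (rule assms(1))
 hence "0 <= A - B\<^sup>2 / C" using C by (simp add: field_simps power2_eq_square)
 thus ?thesis using C by (simp add: field_simps)
qed

lemma norm_add_sq:
 fixes x y :: "'a::complex_hilbert_space"
 shows "(norm (x + y))\<^sup>2 = (norm x)\<^sup>2 + 2 * Re (cinner x y) + (norm y)\<^sup>2"
proof -
 have "complex_of_real ((norm (x + y))\<^sup>2) = cinner x x + cinner x y + cinner y x + cinner y y"
  unfolding cinner_norm[symmetric] cinner_add_left cinner_add_right by simp
 also have "cinner y x = cnj (cinner x y)" by (rule cinner_commute)
 finally have "Re (complex_of_real ((norm (x + y))\<^sup>2)) = Re (cinner x x + cinner x y + cnj (cinner x y) + cinner y y)"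
  by simp
 thus ?thesis by (simp add: cinner_norm)
qed

lemma Re_cinner_le: "\<bar>Re (cinner x y)\<bar> <= norm x * norm (y::'a::complex_hilbert_space)"
proof -
 have "(Re (cinner x y))\<^sup>2 <= (norm x)\<^sup>2 * (norm y)\<^sup>2"
 proof (rule quadratic_discriminant_le)
  fix r :: real
  have "(norm (x + r *\<^sub>R y))\<^sup>2 = (norm x)\<^sup>2 + 2 * r * Re (cinner x y) + r\<^sup>2 * (norm y)\<^sup>2"
   by (simp add: norm_add_sq cinner_scaleR_right power_mult_distrib)
  thus "0 <= (norm x)\<^sup>2 + 2 * r * Re (cinner x y) + r\<^sup>2 * (norm y)\<^sup>2"
   by (metis zero_le_power2)
 qed simp
 hence "\<bar>Re (cinner x y)\<bar>\<^sup>2 <= (norm x * norm y)\<^sup>2" by (simp add: power_mult_distrib)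
 thus ?thesis by (rule power2_le_imp_le) simp
qed

lemma cinner_cauchy_schwarz: "cmod (cinner x y) <= norm x * norm (y::'a::complex_hilbert_space)"
proof (cases "cinner x y = 0")
 case False
 \<comment> \<open>The phase \<open>c\<close> turns the inner product into its modulus, so the
   estimate of the real part suffices.\<close>
 define c where "c = cnj (cinner x y) / of_real (cmod (cinner x y))"
 have nc: "cmod c = 1" using False by (simp add: c_def norm_divide)
 have "cinner (c *\<^sub>C x) y = (cinner x y * cnj (cinner x y)) / of_real (cmod (cinner x y))"
  by (simp add: cinner_scaleC_left c_def)
 also have "... = of_real ((cmod (cinner x y))\<^sup>2) / of_real (cmod (cinner x y))"
  by (simp only: complex_norm_square)
 also have "... = of_real (cmod (cinner x y))"
  using False by (simp only: of_real_divide[symmetric] power2_eq_square) simp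
 finally have "cinner (c *\<^sub>C x) y = of_real (cmod (cinner x y))" .
 hence "cmod (cinner x y) = Re (cinner (c *\<^sub>C x) y)" by simp
 also have "... <= norm (c *\<^sub>C x) * norm y" using Re_cinner_le[of "c *\<^sub>C x" y] by simp
 finally show ?thesis by (simp add: norm_scaleC nc)
qed simp

lemma bounded_bilinear_cinner: "bounded_bilinear (cinner :: 'a::complex_hilbert_space => 'a => complex)"
proof (rule bounded_bilinear.intro)
 fix a a' b b' :: 'a and r :: real
 show "cinner (a + a') b = cinner a b + cinner a' b" by (rule cinner_add_left)
 show "cinner a (b + b') = cinner a b + cinner a b'" by (rule cinner_add_right)
 show "cinner (r *\<^sub>R a) b = r *\<^sub>R cinner a b" unfolding scaleR_conv_of_real by (rule cinner_scaleR_left)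
 show "cinner a (r *\<^sub>R b) = r *\<^sub>R cinner a b" unfolding scaleR_conv_of_real by (rule cinner_scaleR_right)
 show "\<exists>K. \<forall>a b::'a. cmod (cinner a b) <= norm a * norm b * K"
  using cinner_cauchy_schwarz by (intro exI[of _ 1] allI) simp
qed

lemmas cinner_diff_left = bounded_bilinear.diff_left[OF bounded_bilinear_cinner]
 and cinner_diff_right = bounded_bilinear.diff_right[OF bounded_bilinear_cinner]
 and cinner_minus_left = bounded_bilinear.minus_left[OF bounded_bilinear_cinner]
 and cinner_minus_right = bounded_bilinear.minus_right[OF bounded_bilinear_cinner]
 and cinner_zero_left [simp] = bounded_bilinear.zero_left[OF bounded_bilinear_cinner]
 and cinner_zero_right [simp] = bounded_bilinear.zero_right[OF bounded_bilinear_cinner]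
 and tendsto_cinner [tendsto_intros] = bounded_bilinear.tendsto[OF bounded_bilinear_cinner]
 and cinner_sum_left = bounded_bilinear.sum_left[OF bounded_bilinear_cinner]
 and cinner_sum_right = bounded_bilinear.sum_right[OF bounded_bilinear_cinner]

lemmas cinner_simps = cinner_add_left cinner_add_right cinner_diff_left cinner_diff_right
 cinner_minus_left cinner_minus_right cinner_scaleC_left cinner_scaleC_right
 cinner_scaleR_left cinner_scaleR_right

lemma cinner_self_Re: "Re (cinner x x) = (norm (x::'a::complex_hilbert_space))\<^sup>2"
 by (simp add: cinner_norm)

lemma cinner_eq_0_all: "(!!y. cinner x y = 0) ==> x = (0::'a::complex_hilbert_space)"
 using cinner_self_Re[of x] by simp

lemma cinner_commute_Re: "Re (cinner x y) = Re (cinner y (x::'a::complex_hilbert_space))"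
 by (subst cinner_commute) simp

lemma norm_diff_sq:
 fixes x y :: "'a::complex_hilbert_space"
 shows "(norm (x - y))\<^sup>2 = (norm x)\<^sup>2 - 2 * Re (cinner x y) + (norm y)\<^sup>2"
 using norm_add_sq[of x "-y"] by (simp add: cinner_minus_right)

lemma scaleC_zero_left [simp]: "0 *\<^sub>C x = (0::'a::complex_hilbert_space)"
 using norm_scaleC[of 0 x] by simp

lemma scaleC_zero_right [simp]: "c *\<^sub>C 0 = (0::'a::complex_hilbert_space)"
 using norm_scaleC[of c 0] by simp

lemma scaleC_one [simp]: "1 *\<^sub>C x = (x::'a::complex_hilbert_space)"
 using scaleC_of_real[of 1 x] by simp

lemma scaleC_minus_right: "c *\<^sub>C (- x) = - (c *\<^sub>C (x::'a::complex_hilbert_space))"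
 by (rule linear_neg[OF bounded_linear.linear[OF bounded_linear_scaleC]])

lemma scaleC_diff_right: "c *\<^sub>C (x - y) = c *\<^sub>C x - c *\<^sub>C (y::'a::complex_hilbert_space)"
 by (rule linear_diff[OF bounded_linear.linear[OF bounded_linear_scaleC]])

lemma tendsto_scaleC [tendsto_intros]:
 "(f \<longlongrightarrow> a) F ==> ((%x. c *\<^sub>C f x) \<longlongrightarrow> c *\<^sub>C (a::'a::complex_hilbert_space)) F"
 by (rule bounded_linear.tendsto[OF bounded_linear_scaleC])

lemma scaleR_scaleC_commute: "r *\<^sub>R (c *\<^sub>C x) = c *\<^sub>C (r *\<^sub>R (x::'a::complex_hilbert_space))"
 by (simp add: scaleC_of_real[symmetric] scaleC_scaleC mult.commute)


section \<open>Minimising sequences\<close>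

text \<open>Both the nearest-point projection and the averaging argument below rest on the fact that a
 minimising sequence of a quadratic form in a convex set is Cauchy, by the parallelogram law.\<close>

lemma minimising_sequence:
 fixes q :: "'a::real_vector => real"
 assumes S: "convex S" "S ~= {}" and q0: "!!x. 0 <= q x"
  and par: "!!x y. x \<in> S ==> y \<in> S ==> q (x + y) + q (x - y) = 2 * q x + 2 * q y"
  and hom: "!!r x. x \<in> S ==> q (r *\<^sub>R x) = r\<^sup>2 * q x"
 shows "\<exists>x d. (\<forall>n. x n \<in> S) & (\<forall>s\<in>S. d <= q s) & (\<forall>n. q (x n) <= d + 1 / (real n + 1)) \<and>
  (\<forall>n. \<forall>s\<in>S. q (x n - s) <= 2 * (1 / (real n + 1)) + 2 * (q s - d))"
proof -
 define d where "d = (INF s\<in>S. q s)"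
 have bdd: "bdd_below (q ` S)" by (rule bdd_belowI[of _ 0]) (auto simp: q0)
 have dle: "d <= q s" if "s \<in> S" for s unfolding d_def using bdd that by (rule cINF_lower)
 have "\<exists>s\<in>S. q s < d + 1 / (real n + 1)" for n
 proof -
  have "(INF s\<in>S. q s) < d + 1 / (real n + 1)" by (simp add: d_def)
  thus ?thesis using cINF_less_iff[OF S(2) bdd] by simp
 qed
 then obtain x where x: "!!n. x n \<in> S" "!!n. q (x n) < d + 1 / (real n + 1)" by metis
 have half: "4 * d <= q (s + t)" if "s \<in> S" "t \<in> S" for s t
 proof -
  have m: "(1/2) *\<^sub>R s + (1/2) *\<^sub>R t \<in> S" using S(1) that by (simp add: convex_def)
  have "q (2 *\<^sub>R ((1/2) *\<^sub>R s + (1/2) *\<^sub>R t)) = 4 * q ((1/2) *\<^sub>R s + (1/2) *\<^sub>R t)"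
   using hom[OF m, of 2] by simp
  thus ?thesis using dle[OF m] by (simp add: scaleR_add_right)
 qed
 show ?thesis
 proof (rule exI[of _ x], rule exI[of _ d], intro conjI allI ballI)
  fix n s assume s: "s \<in> S"
  have "q (x n - s) = 2 * q (x n) + 2 * q s - q (x n + s)" using par[OF x(1)[of n] s] by simp
  also have "... <= 2 * (1 / (real n + 1)) + 2 * (q s - d)" using half[OF x(1)[of n] s] x(2)[of n] by simp
  finally show "q (x n - s) <= 2 * (1 / (real n + 1)) + 2 * (q s - d)" .
 qed (use x dle in \<open>auto intro: less_imp_le\<close>)
qed

definition csubspace :: "'a::complex_hilbert_space set => bool" where
 "csubspace S \<longleftrightarrow> 0 \<in> S & (\<forall>x\<in>S. \<forall>y\<in>S. x + y \<in> S) & (\<forall>c. \<forall>x\<in>S. c *\<^sub>C x \<in> S)"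

lemma csubspaceD:
 assumes "csubspace S" "x \<in> S"
 shows "r *\<^sub>R x \<in> S" "- x \<in> S" "y \<in> S ==> x - y \<in> S" "y \<in> S ==> x + y \<in> S" "c *\<^sub>C x \<in> S"
proof -
 show r: "r *\<^sub>R x \<in> S" for r using assms by (metis csubspace_def scaleC_of_real)
 show "- x \<in> S" using r[of "-1"] by simp
 show "x + y \<in> S" if "y \<in> S" using assms that by (simp add: csubspace_def)
 show "x - y \<in> S" if "y \<in> S"
 proof -
  have "(-1) *\<^sub>R y \<in> S" using assms that by (metis csubspace_def scaleC_of_real)
  thus ?thesis using assms by (simp add: csubspace_def) (metis add_uminus_conv_diff)
 qed
 show "c *\<^sub>C x \<in> S" using assms by (simp add: csubspace_def)
qed

lemma orthogonal_decomposition: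
 fixes x :: "'a::complex_hilbert_space"
 assumes S: "csubspace S" "closed S"
 shows "\<exists>p\<in>S. \<forall>s\<in>S. cinner (x - p) s = 0"
proof -
 define T where "T = (%s. x - s) ` S"
 have conv: "convex T" unfolding T_def
 proof (rule convexI)
  fix a b and u v :: real
  assume ab: "a \<in> (%s. x - s) ` S" "b \<in> (%s. x - s) ` S" and uv: "0 <= u" "0 <= v" "u + v = 1"
  then obtain s t where st: "s \<in> S" "t \<in> S" "a = x - s" "b = x - t" by auto
  have xx: "x = u *\<^sub>R x + v *\<^sub>R x" by (metis uv(3) scaleR_add_left scaleR_one)
  have "u *\<^sub>R a + v *\<^sub>R b = (u *\<^sub>R x + v *\<^sub>R x) - (u *\<^sub>R s + v *\<^sub>R t)"
   unfolding st scaleR_diff_right by simp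
  hence "u *\<^sub>R a + v *\<^sub>R b = x - (u *\<^sub>R s + v *\<^sub>R t)" by (simp only: xx[symmetric])
  moreover have "u *\<^sub>R s + v *\<^sub>R t \<in> S"
   by (intro csubspaceD(4)[OF S(1)] csubspaceD(1)[OF S(1)] st)
  ultimately show "u *\<^sub>R a + v *\<^sub>R b \<in> (%s. x - s) ` S" by blast
 qed
 have ne: "T ~= {}" using S(1) by (auto simp: T_def csubspace_def)
 have par: "(norm (x + y))\<^sup>2 + (norm (x - y))\<^sup>2 = 2 * (norm x)\<^sup>2 + 2 * (norm y)\<^sup>2" for x y :: 'a
  by (simp add: norm_add_sq norm_diff_sq)
 have hom: "(norm (r *\<^sub>R x))\<^sup>2 = r\<^sup>2 * (norm x)\<^sup>2" for r and x :: 'a by (simp add: power_mult_distrib)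
 obtain y d where y: "!!n. y n \<in> T" and d: "!!s. s \<in> T ==> d <= (norm s)\<^sup>2"
  and yd: "!!n. (norm (y n))\<^sup>2 <= d + 1 / (real n + 1)"
  and yy: "!!n s. s \<in> T ==> (norm (y n - s))\<^sup>2 <= 2 * (1 / (real n + 1)) + 2 * ((norm s)\<^sup>2 - d)"
  using minimising_sequence[OF conv ne zero_le_power2 par hom] by blast
 have c: "(norm (y n - y m))\<^sup>2 <= 4 / (real N + 1)" if "n \<ge> N" "m \<ge> N" for n m N
 proof -
  have "(norm (y n - y m))\<^sup>2 <= 2 * (1 / (real n + 1)) + 2 * (1 / (real m + 1))"
   using order_trans[OF yy[OF y[of m], of n] add_left_mono] yd[of m] by force
  also have "... <= 2 * (1 / (real N + 1)) + 2 * (1 / (real N + 1))"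
   using that by (intro add_mono mult_left_mono frac_le) auto
  finally show ?thesis by simp
 qed
 have "Cauchy y"
 proof (rule metric_CauchyI)
  fix e :: real assume e: "e > 0"
  obtain N where N: "4 / e\<^sup>2 < real N" using reals_Archimedean2 by blast
  have "4 / e\<^sup>2 < real N + 1" using N by simp
  hence N': "4 / (real N + 1) < e\<^sup>2" using e
   by (simp add: pos_divide_less_eq mult.commute)
  show "\<exists>M. \<forall>m\<ge>M. \<forall>n\<ge>M. dist (y m) (y n) < e"
  proof (intro exI allI impI)
   fix m n assume "N <= m" "N <= n"
   hence "(norm (y m - y n))\<^sup>2 < e\<^sup>2" using c[of N m n] N' by simp
   thus "dist (y m) (y n) < e" using e by (simp add: dist_norm power2_less_imp_less)
  qed
 qed
 then obtain z where z: "y ----> z" using Cauchy_convergent convergent_def by blast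
 have xy: "x - y n \<in> S" for n using y[of n] by (auto simp: T_def)
 have zS: "x - z \<in> S"
  by (rule closed_sequentially[OF S(2), of "%n. x - y n"]) (use xy in \<open>auto intro: tendsto_diff z\<close>)
 have nz: "(norm z)\<^sup>2 <= d"
 proof (rule LIMSEQ_le)
  show "(%n. (norm (y n))\<^sup>2) ----> (norm z)\<^sup>2" by (rule tendsto_power[OF tendsto_norm[OF z]])
  show "(%n. d + 1 / (real n + 1)) ----> d"
   using tendsto_add[OF tendsto_const[of d] LIMSEQ_inverse_real_of_nat] by (simp add: inverse_eq_divide add.commute)
 qed (use yd in auto)
 have orth: "Re (cinner z s) = 0" if s: "s \<in> S" for s
 proof -
  have "(Re (cinner z s))\<^sup>2 <= 0 * (norm s)\<^sup>2"
  proof (rule quadratic_discriminant_le)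
   fix r :: real
   have "z + r *\<^sub>R s = x - ((x - z) - r *\<^sub>R s)" by simp
   moreover have "(x - z) - r *\<^sub>R s \<in> S" by (intro csubspaceD(3)[OF S(1)] csubspaceD(1)[OF S(1)] zS s)
   ultimately have "z + r *\<^sub>R s \<in> T" unfolding T_def by blast
   from order_trans[OF nz d[OF this]] have "(norm z)\<^sup>2 <= (norm (z + r *\<^sub>R s))\<^sup>2" .
   thus "0 <= 0 + 2 * r * Re (cinner z s) + r\<^sup>2 * (norm s)\<^sup>2"
    by (simp add: norm_add_sq cinner_scaleR_right power_mult_distrib)
  qed simp
  thus ?thesis by simp
 qed
 have "cinner z s = 0" if s: "s \<in> S" for s
 proof (rule complex_eqI)
  \<comment> \<open>Minimality only kills real parts; testing with \<open>\<i> *\<^sub>C s\<close>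
    gives the imaginary ones.\<close>
  have "\<i> *\<^sub>C s \<in> S" by (rule csubspaceD(5)[OF S(1) s])
  from orth[OF this] show "Im (cinner z s) = Im 0" by (simp add: cinner_scaleC_right)
 qed (use orth[OF s] in simp)
 thus ?thesis using zS by (intro bexI[of _ "x - z"]) auto
qed

lemma csubspace_closure:
 assumes S: "csubspace S" shows "csubspace (closure S)"
 unfolding csubspace_def
proof (intro conjI ballI allI)
 show "0 \<in> closure S" using S closure_subset by (auto simp: csubspace_def)
 fix x assume x: "x \<in> closure S"
 then obtain f where f: "!!n. f n \<in> S" "f ----> x" unfolding closure_sequential by blast
 show "c *\<^sub>C x \<in> closure S" for c
  unfolding closure_sequential
  by (rule exI[of _ "%n. c *\<^sub>C f n"], intro conjI allI csubspaceD[OF S] f(1) tendsto_scaleC f(2))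
 fix y assume y: "y \<in> closure S"
 then obtain g where g: "!!n. g n \<in> S" "g ----> y" unfolding closure_sequential by blast
 show "x + y \<in> closure S" unfolding closure_sequential
  by (rule exI[of _ "%n. f n + g n"], intro conjI allI csubspaceD(4)[OF S] f g tendsto_add)
qed

lemma orthogonal_complement_dense:
 fixes S :: "'a::complex_hilbert_space set"
 assumes "csubspace S" "!!x. (!!s. s \<in> S ==> cinner x s = 0) ==> x = 0"
 shows "closure S = UNIV"
proof -
 have "x \<in> closure S" for x
 proof -
  obtain p where p: "p \<in> closure S" "!!s. s \<in> closure S ==> cinner (x - p) s = 0"
   using orthogonal_decomposition[OF csubspace_closure[OF assms(1)] closed_closure] by blast
  have "x - p = 0" by (rule assms(2)) (use p(2) closure_subset in blast)
  thus ?thesis using p(1) by simp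
 qed
 thus ?thesis by auto
qed

lemma riesz_representation:
 fixes f :: "'a::complex_hilbert_space => complex"
 assumes f: "bounded_linear f" and fC: "!!c x. f (c *\<^sub>C x) = c * f x"
 shows "\<exists>y. \<forall>x. f x = cinner x y"
proof (cases "\<forall>x. f x = 0")
 case True thus ?thesis by (intro exI[of _ 0]) simp
next
 case False
 then obtain x0 where x0: "f x0 ~= 0" by blast
 interpret f: bounded_linear f by (rule f)
 define S where "S = f -` {0}"
 have S: "csubspace S" by (auto simp: csubspace_def S_def f.add f.zero fC)
 have cl: "closed S" unfolding S_def
  by (rule closed_vimage) (auto intro: linear_continuous_on f simp: f.continuous_on continuous_on_id)
 obtain p where p: "p \<in> S" "!!s. s \<in> S ==> cinner (x0 - p) s = 0"
  using orthogonal_decomposition[OF S cl] by blast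
 define z where "z = x0 - p"
 have fz: "f z ~= 0" using p(1) x0 by (simp add: z_def f.diff S_def)
 hence z0: "z ~= 0" using f.zero by auto
 hence nz: "cinner z z ~= 0" by (simp add: cinner_norm)
 have "f x = cinner x ((cnj (f z / cinner z z)) *\<^sub>C z)" for x
 proof -
  have "f z *\<^sub>C x - f x *\<^sub>C z \<in> S" by (simp add: S_def f.diff fC)
  hence "cinner z (f z *\<^sub>C x - f x *\<^sub>C z) = 0" using p(2) by (simp add: z_def)
  hence "cnj (cinner z (f z *\<^sub>C x - f x *\<^sub>C z)) = 0" by simp
  hence "cinner (f z *\<^sub>C x - f x *\<^sub>C z) z = 0" using cinner_commute by metis
  hence "f z * cinner x z = f x * cinner z z" by (simp add: cinner_simps)
  thus ?thesis using nz by (simp add: cinner_scaleC_right field_simps)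
 qed
 thus ?thesis by blast
qed


section \<open>The star algebra of bounded operators\<close>

text \<open>On the type of bounded complex-linear operators, unlike on bounded real-linear maps, adjoints
 and complex scalars are available without side conditions.\<close>

typedef (overloaded) 'h cop = "bounded_ops :: 'h::complex_hilbert_space oper set"
 morphisms oper_of Cop
 by (rule exI[of _ 0]) (simp add: bounded_ops_def)

definition appl :: "'h::complex_hilbert_space cop => 'h => 'h" (infixr "$" 75) where
 "x $ v = blinfun_apply (oper_of x) v"

lemma oper_of_eqI: "(!!v. x $ v = y $ v) ==> x = y"
 by (metis appl_def blinfun_eqI oper_of_inject)

lemma appl_scaleC [simp]: "x $ (c *\<^sub>C v) = c *\<^sub>C (x $ v)"
 using oper_of[of x] by (simp add: appl_def bounded_ops_def)

lemma bounded_linear_appl: "bounded_linear (%v. x $ v)"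
 unfolding appl_def by (rule blinfun.bounded_linear_right)

lemma appl_add [simp]: "x $ (v + w) = x $ v + x $ w"
 and appl_diff [simp]: "x $ (v - w) = x $ v - x $ w"
 and appl_zero [simp]: "x $ 0 = 0"
 and appl_minus [simp]: "x $ (- v) = - (x $ v)"
 and appl_scaleR [simp]: "x $ (r *\<^sub>R v) = r *\<^sub>R (x $ v)"
 by (simp_all add: appl_def blinfun.bilinear_simps)

lemma appl_sum: "x $ (\<Sum>i\<in>I. f i) = (\<Sum>i\<in>I. x $ f i)"
 by (rule linear_sum[OF bounded_linear.linear[OF bounded_linear_appl]])

lemma tendsto_appl [tendsto_intros]: "(f \<longlongrightarrow> v) F ==> ((%n. x $ f n) \<longlongrightarrow> x $ v) F"
 by (rule bounded_linear.tendsto[OF bounded_linear_appl])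

definition nrm :: "'h::complex_hilbert_space cop => real" where
 "nrm x = norm (oper_of x)"

lemma nrm_nonneg [simp]: "0 <= nrm x"
 by (simp add: nrm_def)

lemma norm_appl: "norm (x $ v) <= nrm x * norm v"
 unfolding appl_def nrm_def by (rule norm_blinfun)

lemma nrm_leI: "0 <= C ==> (!!v. norm (x $ v) <= C * norm v) ==> nrm x <= C"
 unfolding appl_def nrm_def by (rule norm_blinfun_bound)

lemma operator_exists:
 fixes f :: "'h::complex_hilbert_space => 'h"
 assumes "!!v w. f (v + w) = f v + f w" "!!c v. f (c *\<^sub>C v) = c *\<^sub>C f v" "!!v. norm (f v) <= C * norm v"
 shows "\<exists>x. \<forall>v. x $ v = f v"
proof -
 have bl: "bounded_linear f"
 proof (rule bounded_linear_intro)
  show "f (r *\<^sub>R x) = r *\<^sub>R f x" for r x by (metis assms(2) scaleC_of_real)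
  show "norm (f x) <= norm x * C" for x using assms(3)[of x] by (simp add: mult.commute)
 qed (rule assms(1))
 have "Blinfun f \<in> bounded_ops" by (simp add: bounded_ops_def bounded_linear_Blinfun_apply[OF bl] assms(2))
 hence "Cop (Blinfun f) $ v = f v" for v by (simp add: appl_def Cop_inverse bounded_linear_Blinfun_apply[OF bl])
 thus ?thesis by blast
qed

instantiation cop :: (complex_hilbert_space) real_vector
begin
definition zero_cop :: "'a cop" where "0 = Cop 0"
definition plus_cop :: "'a cop => 'a cop => 'a cop" where "x + y = Cop (oper_of x + oper_of y)"
definition minus_cop :: "'a cop => 'a cop => 'a cop" where "x - y = Cop (oper_of x - oper_of y)"
definition uminus_cop :: "'a cop => 'a cop" where "- x = Cop (- oper_of x)"
definition scaleR_cop :: "real => 'a cop => 'a cop" where "r *\<^sub>R x = Cop (r *\<^sub>R oper_of x)"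

lemma oper_of_zero: "oper_of (0::'a cop) = 0"
 by (simp add: zero_cop_def Cop_inverse bounded_ops_def)
lemma oper_of_add: "oper_of (x + y :: 'a cop) = oper_of x + oper_of y"
 using oper_of[of x] oper_of[of y]
 by (simp add: plus_cop_def Cop_inverse bounded_ops_def blinfun.bilinear_simps scaleC_add_right)
lemma oper_of_diff: "oper_of (x - y :: 'a cop) = oper_of x - oper_of y"
 using oper_of[of x] oper_of[of y]
 by (simp add: minus_cop_def Cop_inverse bounded_ops_def blinfun.bilinear_simps scaleC_diff_right)
lemma oper_of_uminus: "oper_of (- x :: 'a cop) = - oper_of x"
 using oper_of[of x]
 by (simp add: uminus_cop_def Cop_inverse bounded_ops_def blinfun.bilinear_simps scaleC_minus_right)
lemma oper_of_scaleR: "oper_of (r *\<^sub>R x :: 'a cop) = r *\<^sub>R oper_of x"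
 using oper_of[of x]
 by (simp add: scaleR_cop_def Cop_inverse bounded_ops_def blinfun.bilinear_simps scaleR_scaleC_commute)

instance
 by standard (simp_all add: oper_of_inject[symmetric] oper_of_zero oper_of_add oper_of_diff oper_of_uminus
   oper_of_scaleR algebra_simps)
end

lemma appl_cop_simps [simp]:
 "(0::'h::complex_hilbert_space cop) $ v = 0" "(x + y) $ v = x $ v + y $ v" "(x - y) $ v = x $ v - y $ v"
 "(- x) $ v = - (x $ v)" "(r *\<^sub>R x) $ v = r *\<^sub>R (x $ v)"
 by (simp_all add: appl_def oper_of_zero oper_of_add oper_of_diff oper_of_uminus oper_of_scaleR blinfun.bilinear_simps)

lemma sum_appl: "(\<Sum>i\<in>I. f i) $ v = (\<Sum>i\<in>I. f i $ v)" for f :: "'b => 'h::complex_hilbert_space cop"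
 by (induction I rule: infinite_finite_induct) auto

instantiation cop :: (complex_hilbert_space) "{ring, monoid_mult, real_algebra}"
begin
definition times_cop :: "'a cop => 'a cop => 'a cop" where "x * y = Cop (oper_of x o\<^sub>L oper_of y)"
definition one_cop :: "'a cop" where "1 = Cop id_blinfun"

lemma oper_of_mult: "oper_of (x * y :: 'a cop) = oper_of x o\<^sub>L oper_of y"
 using oper_of[of x] oper_of[of y] by (simp add: times_cop_def Cop_inverse bounded_ops_def)
lemma oper_of_one: "oper_of (1 :: 'a cop) = id_blinfun"
 by (simp add: one_cop_def Cop_inverse bounded_ops_def)
lemma appl_mult [simp]: "(x * y) $ v = x $ y $ v" for x y :: "'a cop"
 by (simp add: appl_def oper_of_mult)
lemma appl_one [simp]: "(1 :: 'a cop) $ v = v"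
 by (simp add: appl_def oper_of_one)
instance
 by standard (auto intro!: oper_of_eqI simp: algebra_simps)
end

definition cscale :: "complex => 'h::complex_hilbert_space cop => 'h cop" where
 "cscale c x = Cop (scale_op c (oper_of x))"

lemma oper_of_cscale: "oper_of (cscale c x) = scale_op c (oper_of x)"
 using oper_of[of x] by (simp add: cscale_def Cop_inverse bounded_ops_def scale_op_def scaleC_scaleC mult.commute)

lemma appl_cscale [simp]: "cscale c x $ v = c *\<^sub>C (x $ v)"
 by (simp add: appl_def oper_of_cscale scale_op_def)

lemma cscale_mult: "cscale c x * y = cscale c (x * y)" "x * cscale c y = cscale c (x * y)"
 by (auto intro!: oper_of_eqI)

lemma cscale_add: "cscale c (x + y) = cscale c x + cscale c y" "cscale (c + d) x = cscale c x + cscale d x"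
 by (auto intro!: oper_of_eqI simp: scaleC_add_right scaleC_add_left)

lemma cscale_cscale: "cscale c (cscale d x) = cscale (c * d) x"
 by (auto intro!: oper_of_eqI simp: scaleC_scaleC)

lemma cscale_of_real: "cscale (of_real r) x = r *\<^sub>R x"
 by (auto intro!: oper_of_eqI simp: scaleC_of_real)

lemma cscale_simps [simp]: "cscale 0 x = 0" "cscale 1 x = x" "cscale c 0 = 0"
 by (auto intro!: oper_of_eqI)

lemma cscale_minus_one: "cscale (-1) x = - x"
 using cscale_of_real[of "-1" x] by simp


subsection \<open>Adjoints\<close>

lemma adjoint_exists: "\<exists>y. \<forall>v w. cinner (x $ v) w = cinner v (y $ w)"
proof -
 have "\<exists>z. \<forall>v. cinner (x $ v) w = cinner v z" for w
  by (rule riesz_representation)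
   (auto simp: cinner_scaleC_left intro!: bounded_linear_compose[OF bounded_bilinear.bounded_linear_left[OF bounded_bilinear_cinner] bounded_linear_appl])
 then obtain f where f: "!!w v. cinner (x $ v) w = cinner v (f w)" by metis
 have "\<exists>y. \<forall>w. y $ w = f w"
 proof (rule operator_exists)
  fix v w :: 'a and c
  have "cinner (f (v + w) - (f v + f w)) u = 0" for u
   using f[of u] by (subst cinner_commute) (simp add: cinner_simps flip: f)
  from cinner_eq_0_all[OF this] show "f (v + w) = f v + f w" by simp
  have "cinner (f (c *\<^sub>C v) - c *\<^sub>C f v) u = 0" for u
   by (subst cinner_commute) (simp add: cinner_simps flip: f)
  from cinner_eq_0_all[OF this] show "f (c *\<^sub>C v) = c *\<^sub>C f v" by simp
  have "(norm (f v))\<^sup>2 = Re (cinner (x $ f v) v)" by (simp add: f cinner_self_Re)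
  also have "... <= norm (x $ f v) * norm v" using Re_cinner_le[of "x $ f v" v] by linarith
  also have "... <= (nrm x * norm (f v)) * norm v" by (intro mult_right_mono norm_appl) simp
  finally have "norm (f v) * norm (f v) <= norm (f v) * (nrm x * norm v)" by (simp add: power2_eq_square mult_ac)
  thus "norm (f v) <= nrm x * norm v"
   by (cases "norm (f v) = 0") auto
 qed
 thus ?thesis using f by metis
qed

definition star :: "'h::complex_hilbert_space cop => 'h cop" where
 "star x = (SOME y. \<forall>v w. cinner (x $ v) w = cinner v (y $ w))"

lemma cinner_star: "cinner (x $ v) w = cinner v (star x $ w)"
 using someI_ex[OF adjoint_exists[of x]] unfolding star_def by blast

lemma star_eqI:
 assumes "!!v w. cinner (x $ v) w = cinner v (y $ w)" shows "star x = y"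
proof (rule oper_of_eqI)
 fix w
 have "cinner (star x $ w - y $ w) v = 0" for v
  by (subst cinner_commute) (simp add: cinner_diff_right flip: assms cinner_star)
 from cinner_eq_0_all[OF this] show "star x $ w = y $ w" by simp
qed

lemma cinner_star': "cinner (star x $ v) w = cinner v (x $ w)"
 by (metis cinner_star cinner_commute)

lemma star_star [simp]: "star (star x) = x"
 by (rule star_eqI) (rule cinner_star')

lemma star_mult: "star (x * y) = star y * star x"
 by (rule star_eqI) (simp add: cinner_star)

lemma star_add: "star (x + y) = star x + star y"
 and star_diff: "star (x - y) = star x - star y"
 and star_minus: "star (- x) = - star x"
 and star_scaleR: "star (r *\<^sub>R x) = r *\<^sub>R star x"
 and star_cscale: "star (cscale c x) = cscale (cnj c) (star x)"
 and star_zero [simp]: "star 0 = 0"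
 and star_one [simp]: "star 1 = 1"
 by (rule star_eqI; simp add: cinner_simps cinner_star)+

lemmas star_simps = star_mult star_add star_diff star_minus star_scaleR star_cscale

lemma star_inj: "star x = star y \<longleftrightarrow> x = y"
 by (metis star_star)

text \<open>\<open>adj\<close> is a definite description over all bounded real-linear maps, so
  uniqueness has to be shown there and not only among complex-linear operators.\<close>

lemma oper_of_star: "oper_of (star x) = adj (oper_of x)"
proof -
 have 1: "\<forall>v w. cinner (blinfun_apply (oper_of x) v) w = cinner v (blinfun_apply (oper_of (star x)) w)"
  using cinner_star[of x] by (simp add: appl_def)
 have 2: "S = oper_of (star x)"
  if "\<forall>v w. cinner (blinfun_apply (oper_of x) v) w = cinner v (blinfun_apply S w)" for S
 proof (rule blinfun_eqI)
  fix w
  have "cinner (blinfun_apply S w - blinfun_apply (oper_of (star x)) w) v = 0" for v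
   using that 1 by (subst cinner_commute) (simp add: cinner_diff_right)
  from cinner_eq_0_all[OF this] show "blinfun_apply S w = blinfun_apply (oper_of (star x)) w" by simp
 qed
 show ?thesis unfolding adj_def by (rule the_equality[symmetric]) (use 1 2 in auto)
qed

lemma norm_appl_star: "(norm (x $ v))\<^sup>2 = Re (cinner (star x $ x $ v) v)"
 by (simp add: cinner_star' cinner_self_Re)

text \<open>Testing with \<open>u + v\<close> gives the symmetric part of the form and testing with
  \<open>u + \<i> *\<^sub>C v\<close> the antisymmetric one. Complex scalars are essential: over the
  reals a rotation by a right angle is a counterexample.\<close>

lemma cinner_polarization:
 assumes "!!v. cinner (x $ v) v = 0" shows "x = 0"
proof (rule oper_of_eqI)
 fix u
 have "cinner (x $ u) v = 0" for v
 proof -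
  have 1: "cinner (x $ u) v + cinner (x $ v) u = 0"
   using assms[of "u + v"] assms[of u] assms[of v] by (simp add: cinner_simps add.commute)
  have "cinner (x $ u) (\<i> *\<^sub>C v) + cinner (x $ (\<i> *\<^sub>C v)) u = 0"
   using assms[of "u + \<i> *\<^sub>C v"] assms[of u] assms[of "\<i> *\<^sub>C v"] by (simp only: cinner_simps appl_add) simp
  hence "\<i> * (cinner (x $ v) u - cinner (x $ u) v) = 0" by (simp add: cinner_simps algebra_simps)
  hence "cinner (x $ v) u = cinner (x $ u) v" by simp
  with 1 show ?thesis by simp
 qed
 from cinner_eq_0_all[OF this] show "x $ u = 0 $ u" by simp
qed


subsection \<open>Order\<close>

instantiation cop :: (complex_hilbert_space) ordered_real_vector
begin
text \<open>The condition on the imaginary part makes \<open>y - x\<close> self-adjoint and the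
  relation antisymmetric; with real parts alone, all skew-adjoint operators would be equivalent to
  0.\<close>

definition less_eq_cop :: "'a cop => 'a cop => bool" where
 "x <= y \<longleftrightarrow> (\<forall>v. Im (cinner ((y - x) $ v) v) = 0 & 0 <= Re (cinner ((y - x) $ v) v))"
definition less_cop :: "'a cop => 'a cop => bool" where "x < y \<longleftrightarrow> x <= y & \<not> y <= (x :: 'a cop)"
instance
proof
 fix x y z :: "'a cop" and a b :: real
 show "x < y \<longleftrightarrow> x <= y & \<not> y <= x" by (rule less_cop_def)
 show "x <= x" by (simp add: less_eq_cop_def)
 have tr: "Im (cinner ((z - x) $ v) v) = Im (cinner ((z - y) $ v) v) + Im (cinner ((y - x) $ v) v)"
   "Re (cinner ((z - x) $ v) v) = Re (cinner ((z - y) $ v) v) + Re (cinner ((y - x) $ v) v)" for v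
  by (simp_all add: cinner_simps)
 show "x <= y ==> y <= z ==> x <= z" unfolding less_eq_cop_def tr by simp
 show "x <= y ==> z + x <= z + y" by (simp add: less_eq_cop_def)
 show "x <= y ==> 0 <= a ==> a *\<^sub>R x <= a *\<^sub>R y"
  by (simp add: less_eq_cop_def cinner_scaleR_left flip: scaleR_diff_right)
 show "a <= b ==> 0 <= x ==> a *\<^sub>R x <= b *\<^sub>R x"
  by (simp add: less_eq_cop_def cinner_scaleR_left flip: scaleR_diff_left)
 assume xy: "x <= y" "y <= x"
 have "y - x = 0"
 proof (rule cinner_polarization)
  fix v
  have "Re (cinner ((x - y) $ v) v) = - Re (cinner ((y - x) $ v) v)" by (simp add: cinner_simps)
  moreover have "0 <= Re (cinner ((x - y) $ v) v)" "0 <= Re (cinner ((y - x) $ v) v)" "Im (cinner ((y - x) $ v) v) = 0"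
   using xy unfolding less_eq_cop_def by blast+
  ultimately show "cinner ((y - x) $ v) v = 0" by (simp add: complex_eq_iff)
 qed
 thus "x = y" by simp
qed
end

definition qf :: "'h::complex_hilbert_space cop => 'h => real" where
 "qf x v = Re (cinner (x $ v) v)"

lemma qf_simps: "qf (x + y) v = qf x v + qf y v" "qf (x - y) v = qf x v - qf y v" "qf (- x) v = - qf x v"
 "qf (r *\<^sub>R x) v = r * qf x v" "qf 0 v = 0" "qf 1 v = (norm v)\<^sup>2" "qf (star x * x) v = (norm (x $ v))\<^sup>2"
 by (simp_all add: qf_def cinner_simps cinner_self_Re cinner_star')

lemma self_adjoint_iff: "star x = x \<longleftrightarrow> (\<forall>v. Im (cinner (x $ v) v) = 0)"
proof
 assume x: "star x = x"
 show "\<forall>v. Im (cinner (x $ v) v) = 0"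
 proof
  fix v
  have "cinner (x $ v) v = cnj (cinner (x $ v) v)" using cinner_star[of x v v] cinner_commute x by metis
  thus "Im (cinner (x $ v) v) = 0" by (metis complex_cnj_cancel_iff cnj.sel(2) complex.sel(2) equal_neg_zero)
 qed
next
 assume x: "\<forall>v. Im (cinner (x $ v) v) = 0"
 have "x - star x = 0"
 proof (rule cinner_polarization)
  fix v
  have "cinner (star x $ v) v = cnj (cinner (x $ v) v)" by (metis cinner_star' cinner_commute)
  thus "cinner ((x - star x) $ v) v = 0" using x by (simp add: cinner_diff_left complex_eq_iff)
 qed
 thus "star x = x" by simp
qed

lemma pos_iff: "0 <= x \<longleftrightarrow> star x = x & (\<forall>v. 0 <= qf x v)"
 by (auto simp: less_eq_cop_def self_adjoint_iff qf_def)

lemma pos_self_adjoint: "0 <= x ==> star x = x"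
 by (simp add: pos_iff)

lemma le_iff_qf: "star x = x ==> star y = y ==> x <= y \<longleftrightarrow> (\<forall>v. qf x v <= qf y v)"
 using pos_iff[of "y - x"] by (simp add: star_simps qf_simps)

lemma qf_mono: "x <= y ==> qf x v <= qf y v"
 using pos_iff[of "y - x"] by (simp add: qf_simps)

lemma positive_op_iff: "positive_op (oper_of x) \<longleftrightarrow> 0 <= x"
 using oper_of[of x] by (simp add: positive_op_def less_eq_cop_def complex_nonneg_Reals_iff appl_def) blast

lemma op_le_iff: "op_le (oper_of x) (oper_of y) \<longleftrightarrow> x <= y"
 using positive_op_iff[of "y - x"] by (simp add: op_le_def oper_of_diff)

lemma star_mult_self_pos [simp]: "0 <= star x * x"
 unfolding pos_iff by (simp add: star_mult qf_simps)

lemma self_mult_star_pos [simp]: "0 <= x * star x"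
 using star_mult_self_pos[of "star x"] by simp

lemma qf_conj: "qf (star x * a * x) v = qf a (x $ v)"
 by (simp add: qf_def cinner_star')

lemma conj_pos: "0 <= a ==> 0 <= star x * a * x"
 unfolding pos_iff by (simp add: star_mult qf_conj mult.assoc) (simp add: qf_conj flip: mult.assoc)

lemma conj_pos': "0 <= a ==> 0 <= x * a * star x"
 using conj_pos[of a "star x"] by simp

lemma conj_mono: "a <= b ==> star x * a * x <= star x * b * x"
 using conj_pos[of "b - a" x] by (simp add: algebra_simps)

lemma pos_one [simp]: "0 <= (1 :: 'h::complex_hilbert_space cop)"
 using star_mult_self_pos[of 1] by simp

lemma star_mult_self_eq_0: "star x * x = 0 ==> x = 0"
 by (rule oper_of_eqI) (metis appl_cop_simps(1) norm_eq_zero qf_simps(5,7) zero_eq_power2)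

lemma Re_cinner_pos_le:
 assumes a: "0 <= a" shows "(Re (cinner (a $ v) w))\<^sup>2 <= qf a v * qf a w"
proof (rule quadratic_discriminant_le)
 fix r :: real
 have "Re (cinner (a $ w) v) = Re (cinner (a $ v) w)"
  using pos_self_adjoint[OF a] by (metis cinner_star cinner_commute_Re)
 hence "qf a (v + r *\<^sub>R w) = qf a v + 2 * r * Re (cinner (a $ v) w) + r\<^sup>2 * qf a w"
  by (simp add: qf_def cinner_simps algebra_simps power2_eq_square)
 thus "0 <= qf a v + 2 * r * Re (cinner (a $ v) w) + r\<^sup>2 * qf a w"
  using a by (metis pos_iff)
qed (use a pos_iff in auto)

text \<open>This is a^2 <= C a. Applying Cauchy-Schwarz for the form of \<open>a\<close> to the
  vectors \<open>v\<close> and \<open>a $ v\<close> avoids a square root of \<open>a\<close>, whose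
  construction will depend on this estimate.\<close>

lemma norm_pos_appl_le:
 assumes a: "0 <= a" "!!v. qf a v <= C * (norm v)\<^sup>2"
 shows "(norm (a $ v))\<^sup>2 <= C * qf a v"
proof (cases "a $ v = 0")
 case True
 thus ?thesis using a by (simp add: qf_def)
next
 case False
 have q: "0 <= qf a v" using a(1) pos_iff by blast
 have "((norm (a $ v))\<^sup>2)\<^sup>2 = (Re (cinner (a $ v) (a $ v)))\<^sup>2" by (simp add: cinner_self_Re)
 also have "... <= qf a v * qf a (a $ v)" by (rule Re_cinner_pos_le[OF a(1)])
 also have "... <= qf a v * (C * (norm (a $ v))\<^sup>2)" by (intro mult_left_mono a(2) q)
 finally have "(norm (a $ v))\<^sup>2 * (norm (a $ v))\<^sup>2 <= (C * qf a v) * (norm (a $ v))\<^sup>2"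
  by (simp add: power2_eq_square mult_ac)
 thus ?thesis by (rule mult_right_le_imp_le) (simp add: False)
qed

lemma nrm_pos_le:
 assumes a: "0 <= a" "a <= C *\<^sub>R 1" "0 <= C" shows "nrm a <= C"
proof (rule nrm_leI[OF a(3)])
 fix v
 have b: "qf a v <= C * (norm v)\<^sup>2" for v using qf_mono[OF a(2)] by (simp add: qf_simps)
 have "(norm (a $ v))\<^sup>2 <= C * qf a v" by (rule norm_pos_appl_le[OF a(1) b])
 also have "... <= C * (C * (norm v)\<^sup>2)" by (intro mult_left_mono b a(3))
 finally have "(norm (a $ v))\<^sup>2 <= (C * norm v)\<^sup>2" by (simp add: power2_eq_square mult_ac)
 thus "norm (a $ v) <= C * norm v" by (rule power2_le_imp_le) (simp add: a(3))
qed

lemma abs_qf_le: "\<bar>qf x v\<bar> <= nrm x * (norm v)\<^sup>2"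
proof -
 have "\<bar>qf x v\<bar> <= norm (x $ v) * norm v" unfolding qf_def by (rule Re_cinner_le)
 also have "... <= (nrm x * norm v) * norm v" by (intro mult_right_mono norm_appl) simp
 finally show ?thesis by (simp add: power2_eq_square mult_ac)
qed

lemma self_adjoint_le_nrm:
 assumes "star x = x" shows "x <= nrm x *\<^sub>R 1" "- (nrm x *\<^sub>R 1) <= x"
 using abs_qf_le[of x] assms by (auto simp: le_iff_qf star_simps qf_simps abs_le_iff minus_le_iff)

lemma norm_pos_appl_nrm: "0 <= a ==> (norm (a $ v))\<^sup>2 <= nrm a * qf a v"
 by (rule norm_pos_appl_le) (use abs_qf_le abs_le_iff in \<open>auto\<close>)

lemma star_mult_self_le: "star x * x <= (nrm x)\<^sup>2 *\<^sub>R 1"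
proof -
 have "(norm (x $ v))\<^sup>2 <= (nrm x)\<^sup>2 * (norm v)\<^sup>2" for v
  using norm_appl[of x v] power_mono[of "norm (x $ v)" "nrm x * norm v" 2] by (simp add: power_mult_distrib)
 thus ?thesis by (simp add: le_iff_qf star_simps qf_simps)
qed

lemma nrm_star [simp]: "nrm (star x) = nrm x"
proof -
 have "nrm (star x) <= nrm x" for x :: "'a cop"
 proof (rule nrm_leI[OF nrm_nonneg])
  fix v
  have "(norm (star x $ v))\<^sup>2 = Re (cinner (x $ star x $ v) v)" using norm_appl_star[of "star x" v] by simp
  also have "... <= norm (x $ star x $ v) * norm v" using Re_cinner_le[of "x $ star x $ v" v] by linarith
  also have "... <= (nrm x * norm (star x $ v)) * norm v" by (intro mult_right_mono norm_appl) simp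
  finally have "norm (star x $ v) * norm (star x $ v) <= norm (star x $ v) * (nrm x * norm v)" by (simp add: power2_eq_square mult_ac)
  thus "norm (star x $ v) <= nrm x * norm v"
   by (cases "norm (star x $ v) = 0") auto
 qed
 from this[of x] this[of "star x"] show ?thesis by simp
qed

lemma nrm_mult: "nrm (x * y) <= nrm x * nrm y"
 unfolding nrm_def oper_of_mult by (rule norm_blinfun_compose)

lemma nrm_add: "nrm (x + y) <= nrm x + nrm y"
 unfolding nrm_def oper_of_add by (rule norm_triangle_ineq)

lemma nrm_scaleR: "nrm (r *\<^sub>R x) = \<bar>r\<bar> * nrm x"
 unfolding nrm_def oper_of_scaleR by simp

section \<open>Strong convergence\<close>

definition slim :: "(nat => 'h::complex_hilbert_space cop) => 'h cop => bool" where
 "slim f l \<longleftrightarrow> (\<forall>v. (%n. f n $ v) ----> l $ v)"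

lemma slimD: "slim f l ==> (%n. f n $ v) ----> l $ v"
 by (simp add: slim_def)

lemma slim_const: "slim (%n. x) x" by (simp add: slim_def)

lemma slim_add: "slim f x ==> slim g y ==> slim (%n. f n + g n) (x + y)"
 unfolding slim_def by (simp add: tendsto_add)

lemma slim_diff: "slim f x ==> slim g y ==> slim (%n. f n - g n) (x - y)"
 unfolding slim_def by (simp add: tendsto_diff)

lemma slim_mult_left: "slim f x ==> slim (%n. a * f n) (a * x)"
 unfolding slim_def by (simp add: tendsto_appl)

lemma slim_mult_right: "slim f x ==> slim (%n. f n * a) (x * a)"
 unfolding slim_def by simp

lemma slim_scaleR: "slim f x ==> slim (%n. r *\<^sub>R f n) (r *\<^sub>R x)"
 unfolding slim_def by (simp add: tendsto_scaleR)

lemma slim_unique: "slim f x ==> slim f y ==> x = y"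
 by (rule oper_of_eqI) (metis slim_def LIMSEQ_unique)

lemma slim_mult:
 assumes f: "slim f x" "!!n. nrm (f n) <= C" and g: "slim g y"
 shows "slim (%n. f n * g n) (x * y)"
 unfolding slim_def
proof
 fix v
 have "(%n. f n $ (g n $ v - y $ v)) ----> 0"
 proof (rule tendsto_norm_zero_cancel, rule tendsto_sandwich)
  show "\<forall>\<^sub>F n in sequentially. 0 <= norm (f n $ (g n $ v - y $ v))" by simp
  show "\<forall>\<^sub>F n in sequentially. norm (f n $ (g n $ v - y $ v)) <= C * norm (g n $ v - y $ v)"
   by (rule always_eventually) (meson f(2) mult_right_mono norm_appl norm_ge_zero order_trans)
  have "(%n. norm (g n $ v - y $ v)) ----> 0"
   using tendsto_norm_zero[OF LIM_zero[OF slimD[OF g, of v]]] .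
  from tendsto_mult_right_zero[OF this] show "(%n. C * norm (g n $ v - y $ v)) ----> 0" by (simp add: mult.commute)
 qed simp
 from tendsto_add[OF this slimD[OF f(1), of "y $ v"]]
 show "(%n. (f n * g n) $ v) ----> (x * y) $ v" by simp
qed

lemma slim_qf: "slim f x ==> (%n. qf (f n) v) ----> qf x v"
 unfolding qf_def by (intro tendsto_Re tendsto_cinner slimD tendsto_const)

lemma slim_self_adjoint:
 assumes "slim f x" "!!n. star (f n) = f n" shows "star x = x"
 unfolding self_adjoint_iff
proof
 fix v
 have "(%n. Im (cinner (f n $ v) v)) ----> Im (cinner (x $ v) v)"
  by (intro tendsto_Im tendsto_cinner slimD tendsto_const assms(1))
 moreover have "Im (cinner (f n $ v) v) = 0" for n using assms(2)[of n] self_adjoint_iff[of "f n"] by simp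
 ultimately have "(%n. 0) ----> Im (cinner (x $ v) v)" by simp
 thus "Im (cinner (x $ v) v) = 0" by (metis LIMSEQ_unique tendsto_const)
qed

lemma slim_pos:
 assumes "slim f x" "!!n. 0 <= f n" shows "0 <= x"
 unfolding pos_iff
proof (intro conjI allI)
 show "star x = x" by (rule slim_self_adjoint[OF assms(1)]) (rule pos_self_adjoint[OF assms(2)])
 show "0 <= qf x v" for v
  by (rule LIMSEQ_le_const[OF slim_qf[OF assms(1)]]) (use assms(2) pos_iff in blast)
qed

lemma slim_le: "slim f x ==> slim g y ==> (!!n. f n <= g n) ==> x <= y"
 using slim_pos[OF slim_diff, of g y f x] by simp

lemma slim_ignore: "slim f x ==> slim (%n. f (n + k)) x"
 unfolding slim_def using LIMSEQ_ignore_initial_segment by blast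

lemma slim_exists:
 assumes "!!v. convergent (%n. f n $ v)" "!!n. nrm (f n) <= C"
 shows "\<exists>x. slim f x"
proof -
 define g where "g v = lim (%n. f n $ v)" for v
 have g: "(%n. f n $ v) ----> g v" for v unfolding g_def using assms(1) by (simp add: convergent_LIMSEQ_iff)
 have "\<exists>x. \<forall>v. x $ v = g v"
 proof (rule operator_exists)
  fix v w c
  show "g (v + w) = g v + g w" using tendsto_add[OF g g, of v w] g[of "v + w"] by (simp add: LIMSEQ_unique)
  show "g (c *\<^sub>C v) = c *\<^sub>C g v" using tendsto_scaleC[OF g, of c v] g[of "c *\<^sub>C v"] by (simp add: LIMSEQ_unique)
  show "norm (g v) <= C * norm v"
  proof (rule LIMSEQ_le_const2[OF tendsto_norm[OF g]])
   show "\<exists>N. \<forall>n\<ge>N. norm (f n $ v) <= C * norm v"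
    by (meson assms(2) mult_right_mono norm_appl norm_ge_zero order_trans)
  qed
 qed
 thus ?thesis unfolding slim_def using g by metis
qed

text \<open>The quadratic forms converge because they are monotone and bounded. All differences are
  positive and bounded by the same \<open>K\<close>, so \<open>norm_pos_appl_le\<close> turns
  convergence of forms into convergence of vectors.\<close>

lemma increasing_slim_exists:
 assumes inc: "incseq f" and bd: "!!n. f n <= b"
 shows "\<exists>x. slim f x & (\<forall>n. f n <= x) & x <= b"
proof -
 define K where "K = nrm (b - f 0)"
 have d: "0 <= f m - f n & (\<forall>v. qf (f m - f n) v <= K * (norm v)\<^sup>2)" if "n <= m" for m n
 proof (intro conjI allI)
  show p: "0 <= f m - f n" using inc that by (simp add: incseqD)
  have "f m - f n <= b - f 0" using bd[of m] incseqD[OF inc, of 0 n] by (simp add: diff_mono)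
  from qf_mono[OF this] abs_qf_le[of "b - f 0"]
  show "qf (f m - f n) v <= K * (norm v)\<^sup>2" for v unfolding K_def by (smt (verit))
 qed
 have nd: "(norm ((f m - f n) $ v))\<^sup>2 <= K * (qf (f m) v - qf (f n) v)" if "n <= m" for m n v
  using norm_pos_appl_le[of "f m - f n" K v] d[OF that] by (simp add: qf_simps)
 have conv: "convergent (%n. f n $ v)" for v
 proof -
  have "incseq (%n. qf (f n) v)" using inc by (auto simp: incseq_def qf_mono)
  moreover have "!!n. qf (f n) v <= qf b v" using bd qf_mono by blast
  ultimately obtain L where L: "(%n. qf (f n) v) ----> L" "!!n. qf (f n) v <= L" using incseq_convergent by blast
  have "Cauchy (%n. f n $ v)"
  proof (rule metric_CauchyI)
   fix e :: real assume e: "e > 0"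
   have "(%n. K * (L - qf (f n) v)) ----> K * (L - L)" by (intro tendsto_intros L)
   hence "\<forall>\<^sub>F n in sequentially. K * (L - qf (f n) v) < e\<^sup>2" using e by (auto intro: order_tendstoD)
   then obtain N where N: "!!n. n \<ge> N ==> K * (L - qf (f n) v) < e\<^sup>2" by (auto simp: eventually_sequentially)
   have K0: "0 <= K" by (simp add: K_def)
   have *: "norm (f m $ v - f n $ v) < e" if "N <= n" "n <= m" for m n
   proof -
    have "(norm ((f m - f n) $ v))\<^sup>2 <= K * (L - qf (f n) v)"
     using nd[OF that(2), of v] mult_left_mono[OF _ K0, of "qf (f m) v - qf (f n) v" "L - qf (f n) v"] L(2)[of m] by simp
    also have "... < e\<^sup>2" using N that by blast
    finally show ?thesis using e power2_less_imp_less by fastforce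
   qed
   show "\<exists>M. \<forall>m\<ge>M. \<forall>n\<ge>M. dist (f m $ v) (f n $ v) < e"
    by (rule exI[of _ N]) (metis * dist_norm dist_commute nle_le)
  qed
  thus ?thesis by (rule Cauchy_convergent)
 qed
 have "nrm (f n) <= nrm (f 0) + K" for n
 proof -
  have "nrm (f n - f 0) <= K"
  proof (rule nrm_leI)
   fix v
   have "(norm ((f n - f 0) $ v))\<^sup>2 <= K * qf (f n - f 0) v" by (rule norm_pos_appl_le) (use d[of 0 n] in auto)
   also have "... <= K * (K * (norm v)\<^sup>2)" using d[of 0 n] by (intro mult_left_mono) (auto simp: K_def)
   finally have "(norm ((f n - f 0) $ v))\<^sup>2 <= (K * norm v)\<^sup>2" by (simp add: power2_eq_square mult_ac)
   thus "norm ((f n - f 0) $ v) <= K * norm v" by (rule power2_le_imp_le) (simp add: K_def)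
  qed (simp add: K_def)
  thus ?thesis using nrm_add[of "f n - f 0" "f 0"] by simp
 qed
 from slim_exists[OF conv this] obtain x where x: "slim f x" by blast
 have "f n <= x" for n
  by (rule slim_le[OF slim_const slim_ignore[OF x, of n]]) (simp add: inc incseqD)
 moreover have "x <= b" by (rule slim_le[OF x slim_const bd])
 ultimately show ?thesis using x by blast
qed


section \<open>Inverses, square roots and polar decomposition\<close>

lemma pos_bounded_below_norm:
 assumes "e *\<^sub>R 1 <= a" "0 <= e" shows "e * norm v <= norm (a $ v)"
proof (cases "v = 0")
 case False
 have "e * (norm v)\<^sup>2 <= qf a v" using qf_mono[OF assms(1), of v] by (simp add: qf_simps)
 also have "... <= norm (a $ v) * norm v" using Re_cinner_le[of "a $ v" v] by (simp add: qf_def)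
 finally have "e * norm v * norm v <= norm (a $ v) * norm v" by (simp add: power2_eq_square)
 thus ?thesis by (rule mult_right_le_imp_le) (simp add: False)
qed simp

text \<open>With \<open>K\<close> above the norm, \<open>1 - (1/K) *\<^sub>R a\<close> has norm
  below 1, so solving \<open>a $ v = w\<close> is a contractive fixed point problem. The lower bound
  \<open>e\<close> gives injectivity and the bound of the inverse.\<close>

lemma inverse_exists:
 fixes a :: "'h::complex_hilbert_space cop"
 assumes e: "0 < e" "e *\<^sub>R 1 <= a"
 shows "\<exists>b. a * b = 1 & b * a = 1 & 0 <= b & b <= (1/e) *\<^sub>R 1"
proof -
 have a0: "0 <= a" using e order_trans[OF scaleR_nonneg_nonneg[of e 1] e(2)] by simp
 define K where "K = nrm a + e"
 have K: "0 < K" "e <= K" using e(1) nrm_nonneg[of a] by (simp_all add: K_def add_nonneg_pos)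
 have aK: "a <= K *\<^sub>R 1"
 proof -
  have "a <= nrm a *\<^sub>R 1" by (rule self_adjoint_le_nrm(1)[OF pos_self_adjoint[OF a0]])
  also have "... <= K *\<^sub>R 1" by (rule scaleR_right_mono) (simp_all add: K_def e(1) less_imp_le)
  finally show ?thesis .
 qed
 define c where "c = 1 - e / K"
 have c: "0 <= c" "c < 1" using K e(1) by (simp_all add: c_def)
 have n: "nrm (1 - (1/K) *\<^sub>R a) <= c"
 proof (rule nrm_pos_le[OF _ _ c(1)])
  have "(1/K) *\<^sub>R a <= (1/K) *\<^sub>R (K *\<^sub>R 1)" by (rule scaleR_left_mono[OF aK]) (use K in simp)
  thus "0 <= 1 - (1/K) *\<^sub>R a" using K by simp
  have "(1/K) *\<^sub>R (e *\<^sub>R 1) <= (1/K) *\<^sub>R a" by (rule scaleR_left_mono[OF e(2)]) (use K in simp)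
  thus "1 - (1/K) *\<^sub>R a <= c *\<^sub>R 1" by (simp add: c_def scaleR_diff_left)
 qed
 have ex: "\<exists>v. a $ v = w" for w
 proof -
  have "\<exists>!v. v - (1/K) *\<^sub>R (a $ v - w) = v"
  proof (rule banach_fix_type[OF c])
   show "\<forall>x y. dist (x - (1/K) *\<^sub>R (a $ x - w)) (y - (1/K) *\<^sub>R (a $ y - w)) <= c * dist x y"
   proof (intro allI)
    fix x y :: 'h
    have "(x - (1/K) *\<^sub>R (a $ x - w)) - (y - (1/K) *\<^sub>R (a $ y - w)) = (1 - (1/K) *\<^sub>R a) $ (x - y)"
     by (simp add: algebra_simps)
    moreover have "norm ((1 - (1/K) *\<^sub>R a) $ (x - y)) <= c * norm (x - y)"
     by (rule order_trans[OF norm_appl mult_right_mono[OF n]]) simp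
    ultimately show "dist (x - (1/K) *\<^sub>R (a $ x - w)) (y - (1/K) *\<^sub>R (a $ y - w)) <= c * dist x y"
     by (simp only: dist_norm)
   qed
  qed
  then obtain v where "v - (1/K) *\<^sub>R (a $ v - w) = v" by blast
  hence "(1/K) *\<^sub>R (a $ v - w) = 0" by simp
  thus ?thesis using K by auto
 qed
 then obtain f where f: "!!w. a $ f w = w" by metis
 have inj: "v = w" if "a $ v = a $ w" for v w
 proof -
  have "e * norm (v - w) <= norm (a $ (v - w))" by (rule pos_bounded_below_norm[OF e(2)]) (use e in simp)
  thus ?thesis using that e(1) by (simp add: mult_le_0_iff)
 qed
 have "\<exists>b. \<forall>v. b $ v = f v"
 proof (rule operator_exists)
  fix v w k
  show "f (v + w) = f v + f w" by (rule inj) (simp add: f)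
  show "f (k *\<^sub>C v) = k *\<^sub>C f v" by (rule inj) (simp add: f)
  show "norm (f v) <= (1/e) * norm v"
   using pos_bounded_below_norm[OF e(2), of "f v"] e(1) by (simp add: f field_simps)
 qed
 then obtain b where b: "!!v. b $ v = f v" by blast
 have ab: "a * b = 1" by (rule oper_of_eqI) (simp add: b f)
 have ba: "b * a = 1" by (rule oper_of_eqI, rule inj) (simp add: b f)
 have sb: "star b = b"
 proof -
  have "star b * a = 1" using arg_cong[OF ab, of star] by (simp add: star_mult pos_self_adjoint[OF a0])
  thus ?thesis by (metis ab mult.assoc mult_1_left mult_1_right)
 qed
 have "star b * a * b = b" using ab sb by (simp add: mult.assoc)
 hence b0: "0 <= b" using conj_pos[OF a0, of b] by simp
 have "b <= (1/e) *\<^sub>R 1"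
 proof -
  have "qf b v <= (1/e) * (norm v)\<^sup>2" for v
  proof -
   have "qf b v <= norm (b $ v) * norm v" using Re_cinner_le[of "b $ v" v] by (simp add: qf_def)
   also have "... <= ((1/e) * norm v) * norm v"
    by (intro mult_right_mono) (use pos_bounded_below_norm[OF e(2), of "f v"] e(1) in \<open>simp_all add: b f field_simps\<close>)
   finally show ?thesis by (simp add: power2_eq_square)
  qed
  thus ?thesis by (simp add: le_iff_qf sb star_simps qf_simps)
 qed
 thus ?thesis using ab ba b0 by blast
qed

lemma inverse_commutes:
 fixes a :: "'a::monoid_mult"
 assumes "a * b = 1" "b * a = 1" "t * a = a * t" shows "t * b = b * t"
proof -
 have "t * b = b * a * t * b" by (simp add: assms(2))
 also have "... = b * (a * t) * b" by (simp only: mult.assoc)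
 also have "... = b * t * (a * b)" by (simp only: assms(3)[symmetric] mult.assoc)
 finally show ?thesis by (simp add: assms(1))
qed

text \<open>The square root of a positive contraction \<open>1 - b\<close> is \<open>1 - y\<close>, where \<open>y\<close> is the limit of the
 iteration \<open>y \<mapsto> (b + y\<^sup>2)/2\<close>. The iterates and their successive differences are polynomials in
 \<open>b\<close> with nonnegative coefficients, so the iteration is increasing.\<close>

inductive_set nonneg_polys :: "'h::complex_hilbert_space cop => 'h cop set" for b where
 npow: "b ^ n \<in> nonneg_polys b"
| nadd: "x \<in> nonneg_polys b ==> y \<in> nonneg_polys b ==> x + y \<in> nonneg_polys b"
| nscale: "0 <= r ==> x \<in> nonneg_polys b ==> r *\<^sub>R x \<in> nonneg_polys b"

lemma nonneg_polys_mult: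
 assumes "x \<in> nonneg_polys b" "y \<in> nonneg_polys b" shows "x * y \<in> nonneg_polys b"
 using assms(1)
proof induction
 case (npow n)
 show ?case using assms(2)
 proof induction
  case (npow m) thus ?case by (simp flip: power_add add: nonneg_polys.npow)
 next
  case (nadd x y) thus ?case by (simp add: distrib_left nonneg_polys.nadd)
 next
  case (nscale r x) thus ?case by (simp add: nonneg_polys.nscale)
 qed
next
 case (nadd x y) thus ?case by (simp add: distrib_right nonneg_polys.nadd)
next
 case (nscale r x) thus ?case by (simp add: nonneg_polys.nscale)
qed

lemma star_power: "star (b ^ n) = star b ^ n"
 by (induction n) (simp_all add: star_mult power_commutes)

lemma nonneg_polys_pos:
 assumes b: "0 <= b" and x: "x \<in> nonneg_polys b" shows "0 <= x"
 using x
proof induction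
 case (npow n)
 have s: "star b = b" by (rule pos_self_adjoint[OF b])
 show ?case
 proof (cases "even n")
  case True
  then obtain k where "n = k + k" by (metis even_two_times_div_two mult_2)
  hence "b ^ n = star (b ^ k) * b ^ k" by (simp add: star_power s power_add)
  thus ?thesis by simp
 next
  case False
  then obtain k where "n = k + 1 + k" by (metis oddE mult_2 add.commute add.left_commute)
  hence "b ^ n = star (b ^ k) * b * b ^ k" by (simp only: star_power s power_add power_one_right)
  thus ?thesis using conj_pos[OF b] by simp
 qed
qed (simp_all add: add_nonneg_nonneg scaleR_nonneg_nonneg)

lemma nonneg_polys_commute:
 assumes t: "t * b = b * t" and x: "x \<in> nonneg_polys b" shows "t * x = x * t"
 using x
proof induction
 case (npow n)
 show ?case
 proof (induction n)
  case (Suc n)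
  have "t * b ^ Suc n = b * (t * b ^ n)" using t by (simp flip: mult.assoc)
  thus ?case using Suc by (simp add: mult.assoc)
 qed simp
qed (simp_all add: algebra_simps)

lemma sqrt_exists_contraction:
 fixes a :: "'h::complex_hilbert_space cop"
 assumes a: "0 <= a" "a <= 1"
 shows "\<exists>s. 0 <= s & s * s = a & (\<forall>t. t * a = a * t --> t * s = s * t)"
proof -
 define b where "b = 1 - a"
 have b: "0 <= b" "b <= 1" using a by (simp_all add: b_def)
 define y where "y = rec_nat 0 (%_ z. (1/2) *\<^sub>R (b + z * z))"
 have y0: "y 0 = 0" and yS: "y (Suc n) = (1/2) *\<^sub>R (b + y n * y n)" for n by (simp_all add: y_def)
 have z: "0 \<in> nonneg_polys b" using nscale[OF order_refl npow[of b 0]] by simp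
 have b1: "b \<in> nonneg_polys b" using npow[of b 1] by simp
 have yP: "y n \<in> nonneg_polys b" for n
  by (induction n) (auto simp: y0 yS z intro!: nscale nadd b1 nonneg_polys_mult)
 have dP: "y (Suc n) - y n \<in> nonneg_polys b" for n
 proof (induction n)
  case 0 show ?case by (simp add: yS y0) (intro nscale b1, simp)
 next
  case (Suc n)
  \<comment> \<open>The difference of two squares is split without commuting factors, which keeps
    all coefficients nonnegative.\<close>
  have "y (Suc (Suc n)) - y (Suc n) = (1/2) *\<^sub>R ((y (Suc n) - y n) * y (Suc n) + y n * (y (Suc n) - y n))"
   by (subst (1) yS, subst (2) yS) (simp add: algebra_simps)
  thus ?case using Suc yP by (auto intro!: nscale nadd nonneg_polys_mult)
 qed
 have inc: "incseq y" by (rule incseq_SucI) (use nonneg_polys_pos[OF b(1) dP] in simp)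
 have ny: "nrm (y n) <= 1" for n
 proof (induction n)
  case 0 show ?case by (rule nrm_leI) (simp_all add: y0)
 next
  case (Suc n)
  have "nrm (y n * y n) <= 1 * 1" by (rule order_trans[OF nrm_mult mult_mono]) (use Suc in auto)
  moreover have "nrm b <= 1" using nrm_pos_le[OF b(1), of 1] b(2) by simp
  ultimately show ?case using nrm_add[of b "y n * y n"] by (simp add: yS nrm_scaleR)
 qed
 have y1: "y n <= 1" for n
 proof -
  have "y n <= nrm (y n) *\<^sub>R 1"
   by (rule self_adjoint_le_nrm(1)[OF pos_self_adjoint[OF nonneg_polys_pos[OF b(1) yP]]])
  also have "... <= 1 *\<^sub>R 1" by (rule scaleR_right_mono[OF ny]) simp
  finally show ?thesis by simp
 qed
 obtain l where l: "slim y l" "l <= 1" using increasing_slim_exists[OF inc y1] by blast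
 have "slim (%n. y (Suc n)) ((1/2) *\<^sub>R (b + l * l))" unfolding yS
  by (intro slim_scaleR slim_add slim_const slim_mult[OF l(1) ny l(1)])
 from slim_unique[OF this] slim_ignore[OF l(1), of 1] have "l = (1/2) *\<^sub>R (b + l * l)" by simp
 hence "2 *\<^sub>R l = 2 *\<^sub>R ((1/2) *\<^sub>R (b + l * l))" by simp
 hence "2 *\<^sub>R l = b + l * l" by simp
 hence sq: "(1 - l) * (1 - l) = a" by (simp add: algebra_simps b_def scaleR_2)
 have cm: "t * (1 - l) = (1 - l) * t" if "t * a = a * t" for t
 proof -
  have "t * b = b * t" using that by (simp add: b_def algebra_simps)
  hence "t * y n = y n * t" for n by (rule nonneg_polys_commute[OF _ yP])
  with slim_mult_left[OF l(1), of t] have "slim (%n. y n * t) (t * l)" by simp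
  from slim_unique[OF this slim_mult_right[OF l(1)]] have "t * l = l * t" .
  thus ?thesis by (simp add: algebra_simps)
 qed
 have "0 <= 1 - l" using l(2) by simp
 with sq cm show ?thesis by blast
qed

lemma sqrt_exists:
 fixes a :: "'h::complex_hilbert_space cop"
 assumes a: "0 <= a"
 shows "\<exists>s. 0 <= s & s * s = a & (\<forall>t. t * a = a * t --> t * s = s * t)"
proof -
 define K where "K = nrm a + 1"
 have K: "K > 0" by (simp add: K_def add_nonneg_pos)
 have "a <= nrm a *\<^sub>R 1" by (rule self_adjoint_le_nrm(1)[OF pos_self_adjoint[OF a]])
 also have "... <= K *\<^sub>R 1" by (rule scaleR_right_mono) (simp_all add: K_def)
 finally have "(1/K) *\<^sub>R a <= (1/K) *\<^sub>R (K *\<^sub>R 1)" by (rule scaleR_left_mono) (use K in simp)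
 hence a1: "(1/K) *\<^sub>R a <= 1" using K by simp
 have a0: "0 <= (1/K) *\<^sub>R a" by (rule scaleR_nonneg_nonneg) (use K a in simp_all)
 obtain s where s: "0 <= s" "s * s = (1/K) *\<^sub>R a" "!!t. t * ((1/K) *\<^sub>R a) = ((1/K) *\<^sub>R a) * t ==> t * s = s * t"
  using sqrt_exists_contraction[OF a0 a1] by blast
 show ?thesis
 proof (intro exI[of _ "sqrt K *\<^sub>R s"] conjI allI impI)
  show "0 <= sqrt K *\<^sub>R s" by (rule scaleR_nonneg_nonneg) (use K s(1) in simp_all)
  show "sqrt K *\<^sub>R s * sqrt K *\<^sub>R s = a" using K by (simp add: s(2))
  show "t * sqrt K *\<^sub>R s = sqrt K *\<^sub>R s * t" if t: "t * a = a * t" for t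
  proof -
   have "t * ((1/K) *\<^sub>R a) = ((1/K) *\<^sub>R a) * t" by (simp only: mult_scaleR_right mult_scaleR_left t)
   from s(3)[OF this] show ?thesis by (simp only: mult_scaleR_right mult_scaleR_left)
  qed
 qed
qed

text \<open>The choice is made among roots that commute with everything commuting with
  \<open>a\<close>; this clause places the root in every von Neumann algebra that contains
  \<open>a\<close>.\<close>

definition psqrt :: "'h::complex_hilbert_space cop => 'h cop" where
 "psqrt a = (SOME s. 0 <= s & s * s = a & (\<forall>t. t * a = a * t --> t * s = s * t))"

lemma psqrt:
 assumes "0 <= a"
 shows "0 <= psqrt a" "psqrt a * psqrt a = a" "t * a = a * t ==> t * psqrt a = psqrt a * t"
 using someI_ex[OF sqrt_exists[OF assms]] unfolding psqrt_def by blast+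

text \<open>Here \<open>h\<close> plays the role of |a|. Since \<open>(h - a) * (h + a) = 0\<close>,
  the operator \<open>h - a\<close> vanishes on the closed range of \<open>h + a\<close>, while on
  the kernel of \<open>h + a\<close>, its orthogonal complement, it equals
  \<open>2 *\<^sub>R h\<close>.\<close>

lemma abs_minus_self_pos:
 assumes h: "0 <= h" "star a = a" "h * h = a * a" "a * h = h * a"
 shows "0 <= h - (a :: 'h::complex_hilbert_space cop)"
 unfolding pos_iff
proof (intro conjI allI)
 have sh: "star h = h" by (rule pos_self_adjoint[OF h(1)])
 show sd: "star (h - a) = h - a" by (simp add: star_simps sh h(2))
 fix v
 define S where "S = range (%w. (h + a) $ w)"
 have S: "csubspace S" unfolding csubspace_def S_def
 proof (intro conjI ballI allI)
  show "0 \<in> range (%w. (h + a) $ w)" by (rule range_eqI[of _ _ 0]) simp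
  fix x assume "x \<in> range (%w. (h + a) $ w)"
  then obtain u where u: "x = (h + a) $ u" by blast
  show "c *\<^sub>C x \<in> range (%w. (h + a) $ w)" for c by (rule range_eqI[of _ _ "c *\<^sub>C u"]) (simp add: u scaleC_add_right)
  fix y assume "y \<in> range (%w. (h + a) $ w)"
  then obtain w where w: "y = (h + a) $ w" by blast
  show "x + y \<in> range (%w. (h + a) $ w)" by (rule range_eqI[of _ _ "u + w"]) (simp add: u w)
 qed
 obtain p where p: "p \<in> closure S" "!!s. s \<in> closure S ==> cinner (v - p) s = 0"
  using orthogonal_decomposition[OF csubspace_closure[OF S] closed_closure] by blast
 define q where "q = v - p"
 have hq: "(h + a) $ q = 0"
 proof (rule cinner_eq_0_all)
  fix y
  have "(h + a) $ y \<in> closure S" by (rule subsetD[OF closure_subset]) (simp add: S_def)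
  from p(2)[OF this] show "cinner ((h + a) $ q) y = 0"
   using cinner_star[of "h + a" q y] by (simp add: q_def star_simps sh h(2))
 qed
 have ann: "(h - a) * (h + a) = 0" by (simp add: algebra_simps h(3,4))
 have hp: "(h - a) $ p = 0"
 proof -
  obtain f where f: "!!n. f n \<in> S" "f ----> p" using p(1) unfolding closure_sequential by blast
  have "(h - a) $ f n = 0" for n
  proof -
   obtain u where u: "f n = (h + a) $ u" using f(1)[of n] by (auto simp: S_def)
   show ?thesis unfolding u appl_mult[symmetric] ann by simp
  qed
  with tendsto_appl[OF f(2), of "h - a"] show ?thesis by (simp add: LIMSEQ_const_iff)
 qed
 have v: "v = p + q" by (simp add: q_def)
 have "(h - a) $ v = (h - a) $ q" using hp unfolding v appl_add by simp
 also have "... = 2 *\<^sub>R (h $ q) - (h + a) $ q" by (simp add: scaleR_2)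
 finally have e: "(h - a) $ v = 2 *\<^sub>R (h $ q)" using hq by simp
 have "cinner ((h - a) $ v) p = cinner v ((h - a) $ p)" using cinner_star[of "h - a" v p] sd by simp
 hence "cinner ((h - a) $ v) p = 0" using hp by simp
 hence "cinner ((h - a) $ v) v = cinner ((h - a) $ v) q" by (subst (2) v) (simp only: cinner_add_right add_0_left)
 hence "qf (h - a) v = 2 * qf h q" by (simp only: qf_def e) (simp add: cinner_simps)
 thus "0 <= qf (h - a) v" using h(1) pos_iff by force
qed

text \<open>The parts are (|a| + a)/2 and (|a| - a)/2. The last clause keeps both in any von Neumann
  algebra that contains \<open>a\<close>.\<close>

lemma jordan_decomposition:
 fixes a :: "'h::complex_hilbert_space cop"
 assumes a: "star a = a"
 shows "\<exists>p n. 0 <= p & 0 <= n & a = p - n & p * n = 0 & n * p = 0 \<and>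
  (\<forall>t. t * a = a * t --> t * p = p * t & t * n = n * t)"
proof -
 have aa: "0 <= a * a" using star_mult_self_pos[of a] a by simp
 define h where "h = psqrt (a * a)"
 note h = psqrt[OF aa, folded h_def]
 have c: "a * h = h * a" by (rule h(3)) (simp add: mult.assoc)
 have m: "0 <= h - a" by (rule abs_minus_self_pos[OF h(1) a h(2) c])
 have p: "0 <= h - (- a)" by (rule abs_minus_self_pos[OF h(1)]) (simp_all add: a star_simps h(2) c)
 show ?thesis
 proof (rule exI[of _ "(1/2) *\<^sub>R (h + a)"], rule exI[of _ "(1/2) *\<^sub>R (h - a)"], intro conjI allI impI)
  show "0 <= (1/2) *\<^sub>R (h + a)" using p by (intro scaleR_nonneg_nonneg) auto
  show "0 <= (1/2) *\<^sub>R (h - a)" using m by (intro scaleR_nonneg_nonneg) auto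
  show "a = (1/2) *\<^sub>R (h + a) - (1/2) *\<^sub>R (h - a)"
   by (simp add: scaleR_diff_right scaleR_add_right flip: scaleR_add_left)
  show "(1/2) *\<^sub>R (h + a) * (1/2) *\<^sub>R (h - a) = 0" "(1/2) *\<^sub>R (h - a) * (1/2) *\<^sub>R (h + a) = 0"
   by (simp_all add: algebra_simps c h(2))
  fix t assume t: "t * a = a * t"
  have "t * (a * a) = (a * a) * t" using t by (metis mult.assoc)
  hence "t * h = h * t" by (rule h(3))
  thus "t * (1/2) *\<^sub>R (h + a) = (1/2) *\<^sub>R (h + a) * t" "t * (1/2) *\<^sub>R (h - a) = (1/2) *\<^sub>R (h - a) * t"
   using t by (simp_all only: mult_scaleR_right mult_scaleR_left distrib_left distrib_right left_diff_distrib right_diff_distrib)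
 qed
qed

section \<open>Projections\<close>

definition isproj :: "'h::complex_hilbert_space cop => bool" where
 "isproj p \<longleftrightarrow> star p = p & p * p = p"

lemma isproj_appl: "isproj p ==> p $ p $ v = p $ v"
 by (simp add: isproj_def flip: appl_mult)

lemma isproj_pos: "isproj p ==> 0 <= p"
 using star_mult_self_pos[of p] by (simp add: isproj_def)

lemma isproj_compl: "isproj p ==> isproj (1 - p)"
 by (simp add: isproj_def star_simps algebra_simps)

lemma isproj_le_one: "isproj p ==> p <= 1"
 using isproj_pos[OF isproj_compl] by simp

lemma isproj_simps [simp]: "isproj 0" "isproj 1"
 by (simp_all add: isproj_def)

lemma isproj_le_iff:
 assumes "isproj p" "isproj q" shows "p <= q \<longleftrightarrow> q * p = p"
proof
 assume le: "p <= q"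
 have "qf p ((1 - q) $ v) <= qf q ((1 - q) $ v)" for v by (rule qf_mono[OF le])
 moreover have "q $ (1 - q) $ v = 0" for v
  using assms(2) by (simp add: isproj_def flip: appl_mult)
 ultimately have "qf p ((1 - q) $ v) <= 0" for v by (simp add: qf_def)
 moreover have "qf p w = (norm (p $ w))\<^sup>2" for w using qf_simps(7)[of p w] assms(1) by (simp add: isproj_def)
 ultimately have "norm (p $ (1 - q) $ v) = 0" for v by (metis zero_le_power2 order_antisym zero_eq_power2)
 hence "p * (1 - q) = 0" by (intro oper_of_eqI) (simp only: appl_mult norm_eq_zero appl_cop_simps(1))
 hence "p = p * q" by (simp add: algebra_simps)
 thus "q * p = p" using assms by (metis isproj_def star_mult)
next
 assume qp: "q * p = p"
 hence pq: "p * q = p" using assms by (metis isproj_def star_mult)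
 have "isproj (q - p)" using assms qp pq by (simp add: isproj_def star_simps algebra_simps)
 from isproj_pos[OF this] show "p <= q" by simp
qed

lemma isproj_diff: "isproj p ==> isproj q ==> p <= q ==> isproj (q - p)"
 using isproj_le_iff[of p q] by (simp add: isproj_def star_simps algebra_simps) (metis star_mult)

lemma isproj_norm: "isproj p ==> qf p v = (norm (p $ v))\<^sup>2"
 using qf_simps(7)[of p v] by (simp add: isproj_def)

lemma isproj_nrm_le: "isproj p ==> nrm p <= 1"
 using nrm_pos_le[OF isproj_pos isproj_le_one[THEN order_trans], of p 1] isproj_le_one by simp

lemma convergent_dense:
 fixes f :: "nat => 'h::complex_hilbert_space cop"
 assumes bd: "!!n. nrm (f n) <= C" and D: "closure D = UNIV" and cv: "!!d. d \<in> D ==> convergent (%n. f n $ d)"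
 shows "convergent (%n. f n $ v)"
proof (rule Cauchy_convergent, rule metric_CauchyI)
 fix e :: real assume e: "e > 0"
 define K where "K = \<bar>C\<bar> + 1"
 have K: "K > 0" "nrm (f n) <= K" for n using bd[of n] by (auto simp: K_def)
 have "v \<in> closure D" using D by simp
 then obtain d where d: "d \<in> D" "dist d v < e / (4 * K)"
  using closure_approachable[of v D] e K(1) by (metis divide_pos_pos mult_pos_pos zero_less_numeral)
 have small: "norm (f n $ v - f n $ d) < e / 4" for n
 proof -
  have "norm (f n $ v - f n $ d) <= nrm (f n) * norm (v - d)" using norm_appl[of "f n" "v - d"] by simp
  also have "... <= K * norm (v - d)" by (intro mult_right_mono K) simp
  also have "... < K * (e / (4 * K))" by (intro mult_strict_left_mono K) (use d(2) in \<open>simp add: dist_norm norm_minus_commute\<close>)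
  finally show ?thesis using K(1) by simp
 qed
 have "Cauchy (%n. f n $ d)" using cv[OF d(1)] by (rule convergent_Cauchy)
 then obtain N where N: "!!m n. m \<ge> N ==> n \<ge> N ==> dist (f m $ d) (f n $ d) < e / 2"
  using e by (metis metric_CauchyD half_gt_zero)
 have "dist (f m $ v) (f n $ v) < e" if "m \<ge> N" "n \<ge> N" for m n
 proof -
  have "dist (f m $ v) (f n $ v) <= dist (f m $ v) (f m $ d) + dist (f m $ d) (f n $ d) + dist (f n $ d) (f n $ v)"
   using dist_triangle[of "f m $ v" "f n $ v" "f m $ d"] dist_triangle[of "f m $ d" "f n $ v" "f n $ d"] by linarith
  thus ?thesis using small[of m] small[of n] N[OF that] by (simp add: dist_norm norm_minus_commute)
 qed
 thus "\<exists>M. \<forall>m\<ge>M. \<forall>n\<ge>M. dist (f m $ v) (f n $ v) < e" by blast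
qed

lemma eq_on_dense:
 assumes "closure D = UNIV" "!!d. d \<in> D ==> x $ d = y $ d" shows "x = y"
proof (rule oper_of_eqI)
 fix v
 have "v \<in> closure D" using assms(1) by simp
 then obtain f where f: "!!n. f n \<in> D" "f ----> v" unfolding closure_sequential by blast
 have "(%n. x $ f n) ----> y $ v" using tendsto_appl[OF f(2), of y] assms(2) f(1) by simp
 thus "x $ v = y $ v" using tendsto_appl[OF f(2), of x] LIMSEQ_unique by blast
qed


section \<open>Von Neumann algebras\<close>

definition comm :: "'h::complex_hilbert_space cop set => 'h cop set" where
 "comm S = {t. \<forall>x\<in>S. x * t = t * x}"

lemma commI: "(!!x. x \<in> S ==> x * t = t * x) ==> t \<in> comm S"
 by (simp add: comm_def)

lemma commD: "t \<in> comm S ==> x \<in> S ==> x * t = t * x"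
 by (simp add: comm_def)

lemma comm_antimono: "S \<subseteq> T ==> comm T \<subseteq> comm S"
 by (auto simp: comm_def)

lemma comm_comm_superset: "S \<subseteq> comm (comm S)"
 by (auto simp: comm_def)

lemma comm_comm_comm [simp]: "comm (comm (comm S)) = comm S"
 using comm_comm_superset[of S] comm_comm_superset[of "comm S"] comm_antimono by blast

lemma comm_slim: "(!!n. f n \<in> comm S) ==> slim f x ==> x \<in> comm S"
proof (rule commI)
 fix s assume f: "!!n. f n \<in> comm S" "slim f x" and s: "s \<in> S"
 have "slim (%n. f n * s) (s * x)" using slim_mult_left[OF f(2), of s] by (simp add: commD[OF f(1) s])
 from slim_unique[OF this slim_mult_right[OF f(2)]] show "s * x = x * s" .
qed

locale star_algebra =
 fixes Q :: "'h::complex_hilbert_space cop set"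
 assumes one: "1 \<in> Q" and add: "x \<in> Q ==> y \<in> Q ==> x + y \<in> Q"
  and mult: "x \<in> Q ==> y \<in> Q ==> x * y \<in> Q" and star: "x \<in> Q ==> star x \<in> Q"
  and cscale: "x \<in> Q ==> cscale c x \<in> Q"
begin

lemma scaleR: "x \<in> Q ==> r *\<^sub>R x \<in> Q"
 using cscale[of x "of_real r"] by (simp add: cscale_of_real)
lemma zero: "0 \<in> Q" using scaleR[OF one, of 0] by simp
lemma uminus: "x \<in> Q ==> - x \<in> Q" using scaleR[of x "-1"] by simp
lemma diff: "x \<in> Q ==> y \<in> Q ==> x - y \<in> Q" using add[OF _ uminus, of x y] by simp
lemma power: "x \<in> Q ==> x ^ n \<in> Q" by (induction n) (simp_all add: one mult)
lemma sum: "(!!i. i \<in> I ==> f i \<in> Q) ==> (\<Sum>i\<in>I. f i) \<in> Q"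
 by (induction I rule: infinite_finite_induct) (simp_all add: zero add)

lemmas closed = one add mult star cscale scaleR zero uminus diff power

lemma csubspace_orbit: "csubspace ((%x. x $ v) ` Q)"
 unfolding csubspace_def
proof (intro conjI ballI allI)
 show "0 \<in> (%x. x $ v) ` Q" by (rule image_eqI[OF _ zero]) simp
 fix a assume "a \<in> (%x. x $ v) ` Q"
 then obtain x where x: "x \<in> Q" "a = x $ v" by blast
 show "c *\<^sub>C a \<in> (%x. x $ v) ` Q" for c by (rule image_eqI[OF _ cscale[OF x(1)]]) (simp add: x)
 fix b assume "b \<in> (%x. x $ v) ` Q"
 then obtain y where y: "y \<in> Q" "b = y $ v" by blast
 show "a + b \<in> (%x. x $ v) ` Q" by (rule image_eqI[OF _ add[OF x(1) y(1)]]) (simp add: x y)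
qed

lemma star_algebra_comm: "star_algebra (comm Q)"
proof
 fix x y c assume x: "x \<in> comm Q"
 show "star x \<in> comm Q"
 proof (rule commI)
  fix q assume "q \<in> Q"
  hence "star q * x = x * star q" using commD[OF x] star by blast
  hence "star (star q * x) = star (x * star q)" by simp
  thus "q * star x = star x * q" by (simp add: star_mult)
 qed
 show "cscale c x \<in> comm Q" using x by (auto simp: comm_def cscale_mult)
 assume y: "y \<in> comm Q"
 show "x + y \<in> comm Q" using x y by (auto simp: comm_def algebra_simps)
 show "x * y \<in> comm Q"
 proof (rule commI)
  fix q assume q: "q \<in> Q"
  show "q * (x * y) = x * y * q" using commD[OF x q] commD[OF y q] by (metis mult.assoc)
 qed
qed (simp add: comm_def)

end

lemma star_algebra_Int: "star_algebra P ==> star_algebra Q ==> star_algebra (P \<inter> Q)"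
 unfolding star_algebra_def by simp

lemma projection_exists:
 fixes S :: "'h::complex_hilbert_space set"
 assumes S: "csubspace S" "closed S"
 shows "\<exists>p. isproj p & (\<forall>v. p $ v \<in> S) & (\<forall>v\<in>S. p $ v = v)"
proof -
 obtain f where f: "!!x. f x \<in> S" "!!x s. s \<in> S ==> cinner (x - f x) s = 0"
  using orthogonal_decomposition[OF S] by metis
 have eqI: "y = f x" if "y \<in> S" "!!s. s \<in> S ==> cinner (x - y) s = 0" for x y
 proof -
  have d: "y - f x \<in> S" by (rule csubspaceD(3)[OF S(1) that(1) f(1)])
  have "cinner (y - f x) (y - f x) = cinner (x - f x) (y - f x) - cinner (x - y) (y - f x)"
   by (simp add: cinner_diff_left)
  also have "... = 0" using f(2)[OF d] that(2)[OF d] by simp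
  finally show ?thesis by (simp add: cinner_norm)
 qed
 have "\<exists>p. \<forall>v. p $ v = f v"
 proof (rule operator_exists)
  fix v w c
  show "f (v + w) = f v + f w"
  proof (rule eqI[symmetric])
   show "f v + f w \<in> S" by (rule csubspaceD(4)[OF S(1) f(1) f(1)])
   fix s assume s: "s \<in> S"
   have "v + w - (f v + f w) = (v - f v) + (w - f w)" by simp
   thus "cinner (v + w - (f v + f w)) s = 0" using f(2)[OF s] by (simp only: cinner_add_left) simp
  qed
  show "f (c *\<^sub>C v) = c *\<^sub>C f v"
  proof (rule eqI[symmetric])
   show "c *\<^sub>C f v \<in> S" by (rule csubspaceD(5)[OF S(1) f(1)])
   fix s assume s: "s \<in> S"
   show "cinner (c *\<^sub>C v - c *\<^sub>C f v) s = 0"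
    using f(2)[OF s, of v] by (simp add: cinner_scaleC_left flip: scaleC_diff_right)
  qed
  have "(norm v)\<^sup>2 = (norm ((v - f v) + f v))\<^sup>2" by simp
  also have "... = (norm (v - f v))\<^sup>2 + (norm (f v))\<^sup>2" using f(2)[OF f(1)] by (simp only: norm_add_sq) simp
  finally have "(norm (f v))\<^sup>2 <= (norm v)\<^sup>2" by simp
  from power2_le_imp_le[OF this] show "norm (f v) <= 1 * norm v" by simp
 qed
 then obtain p where p: "!!v. p $ v = f v" by blast
 have pS: "p $ v = v" if "v \<in> S" for v using eqI[OF that, of v] p by simp
 have "star p = p"
 proof (rule star_eqI)
  fix v w
  have "cinner (p $ v) (w - p $ w) = cnj (cinner (w - f w) (f v))" using cinner_commute p by metis
  hence "cinner (p $ v) (w - p $ w) = 0" using f(2)[OF f(1)] by simp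
  moreover have "cinner (v - p $ v) (p $ w) = 0" using f(2)[OF f(1)] p by simp
  ultimately show "cinner (p $ v) w = cinner v (p $ w)" by (simp add: cinner_simps)
 qed
 moreover have "p * p = p" by (rule oper_of_eqI) (simp add: p, metis pS p f(1))
 ultimately show ?thesis using p f(1) pS by (intro exI[of _ p]) (simp add: isproj_def)
qed

text \<open>The cyclic projection onto the closure of \<open>Q v\<close>;
  \<open>proj_onto_orbp\<close> identifies it with \<open>orbit_proj\<close>.\<close>

definition orbp :: "'h::complex_hilbert_space cop set => 'h => 'h cop" where
 "orbp Q v = (SOME p. isproj p & (\<forall>w. p $ w \<in> closure ((%x. x $ v) ` Q)) \<and>
  (\<forall>w \<in> closure ((%x. x $ v) ` Q). p $ w = w))"

lemma isproj_eqI: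
 assumes "isproj p" "isproj q" "range (appl p) = range (appl q)" shows "p = q"
proof -
 have a: "q * p = p" if "isproj q" "range (appl p) \<subseteq> range (appl q)" for p q :: "'a cop"
 proof (rule oper_of_eqI)
  fix v
  have "p $ v \<in> range (appl q)" using that(2) by blast
  then obtain w where w: "p $ v = q $ w" by blast
  show "(q * p) $ v = p $ v" by (simp add: isproj_appl[OF that(1)] w)
 qed
 have "p * q = q" "q * p = p" using a assms by blast+
 thus ?thesis using assms(1,2) by (metis isproj_def star_mult)
qed

context star_algebra
begin

lemma orbp:
 "isproj (orbp Q v)" "!!w. orbp Q v $ w \<in> closure ((%x. x $ v) ` Q)"
 "!!w. w \<in> closure ((%x. x $ v) ` Q) ==> orbp Q v $ w = w"
 using someI_ex[OF projection_exists[OF csubspace_closure[OF csubspace_orbit[of v]] closed_closure]]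
 unfolding orbp_def by blast+

lemma orbp_orbit: "x \<in> Q ==> orbp Q v $ x $ v = x $ v"
 by (rule orbp(3), rule subsetD[OF closure_subset]) blast

lemma orbp_self: "orbp Q v $ v = v"
 using orbp_orbit[OF one, of v] by simp

lemma orbp_least:
 assumes "!!x. x \<in> Q ==> p $ x $ v = x $ v" shows "p * orbp Q v = orbp Q v"
proof (rule oper_of_eqI)
 fix w
 obtain f where f: "!!n. f n \<in> (%x. x $ v) ` Q" "f ----> orbp Q v $ w"
  using orbp(2)[of v w] unfolding closure_sequential by blast
 have "p $ f n = f n" for n using f(1)[of n] assms by auto
 hence "f ----> p $ orbp Q v $ w" using tendsto_appl[OF f(2), of p] by simp
 from LIMSEQ_unique[OF this f(2)] show "(p * orbp Q v) $ w = orbp Q v $ w" by simp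
qed

lemma orbp_comm: "orbp Q v \<in> comm Q"
proof (rule commI)
 let ?p = "orbp Q v"
 have key: "?p * (x * ?p) = x * ?p" if x: "x \<in> Q" for x
 proof (rule oper_of_eqI)
  fix w
  obtain f where f: "!!n. f n \<in> (%x. x $ v) ` Q" "f ----> ?p $ w"
   using orbp(2)[of v w] unfolding closure_sequential by blast
  have "?p $ x $ f n = x $ f n" for n
  proof -
   obtain y where y: "y \<in> Q" "f n = y $ v" using f(1)[of n] by blast
   show ?thesis using orbp_orbit[OF mult[OF x y(1)], of v] by (simp add: y(2))
  qed
  with tendsto_appl[OF tendsto_appl[OF f(2), of x], of ?p] have "(%n. x $ f n) ----> ?p $ x $ ?p $ w" by simp
  from LIMSEQ_unique[OF this tendsto_appl[OF f(2)]] show "(?p * (x * ?p)) $ w = (x * ?p) $ w" by simp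
 qed
 fix x assume x: "x \<in> Q"
 have "star (?p * (star x * ?p)) = star (star x * ?p)" using key[OF star[OF x]] by simp
 hence "?p * x * ?p = ?p * x" using orbp(1)[of v] by (simp add: star_mult isproj_def)
 with key[OF x] show "x * ?p = ?p * x" by (simp add: mult.assoc)
qed

text \<open>The one-vector step of the density theorem: the projection onto the closed orbit of
  \<open>v\<close> lies in the commutant, so \<open>t\<close> commutes with it and cannot move
  \<open>v\<close> out of the orbit closure.\<close>

lemma bicommutant_approx:
 assumes "t \<in> comm (comm Q)" shows "t $ v \<in> closure ((%x. x $ v) ` Q)"
proof -
 have "orbp Q v * t = t * orbp Q v" by (rule commD[OF assms orbp_comm])
 hence "orbp Q v $ t $ v = t $ orbp Q v $ v" by (simp flip: appl_mult)
 hence "t $ v = orbp Q v $ t $ v" by (simp add: orbp_self)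
 thus ?thesis using orbp(2)[of v "t $ v"] by simp
qed

end

locale vn_algebra = star_algebra Q for Q :: "'h::complex_hilbert_space cop set" +
 assumes bicomm: "comm (comm Q) = Q"
begin

lemma slim_closed: "(!!n. f n \<in> Q) ==> slim f x ==> x \<in> Q"
 using comm_slim[of f "comm Q" x] by (simp add: bicomm)

lemma bicommI: "(!!t. t \<in> comm Q ==> t * x = x * t) ==> x \<in> Q"
 using commI[of "comm Q" x] by (simp add: bicomm)

lemma bicommutant_memI:
 assumes "a \<in> Q" "!!t. t * a = a * t ==> t * x = x * t" shows "x \<in> Q"
proof (rule bicommI, rule assms(2))
 fix t assume "t \<in> comm Q"
 thus "t * a = a * t" using commD[OF _ assms(1)] by simp
qed

lemma psqrt_mem: "a \<in> Q ==> 0 <= a ==> psqrt a \<in> Q"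
 by (rule bicommutant_memI[of a]) (use psqrt(3) in auto)

lemma inverse_mem: "a \<in> Q ==> a * b = 1 ==> b * a = 1 ==> b \<in> Q"
 by (rule bicommutant_memI[of a]) (use inverse_commutes in auto)

lemma comm_vn: "vn_algebra (comm Q)"
 by (intro vn_algebra.intro star_algebra_comm vn_algebra_axioms.intro) simp

text \<open>\<open>v\<close> is the strong limit of \<open>x * g n\<close>, where \<open>g n\<close>
  inverts \<open>h + d n\<close> and \<open>d n\<close> tends to 0. The clauses about
  \<open>y\<close> and \<open>z\<close> say that \<open>v\<close> has no larger left or right
  support than \<open>x\<close>.\<close>

lemma polar_decomposition:
 assumes x: "x \<in> Q"
 shows "\<exists>v h. v \<in> Q & h \<in> Q & 0 <= h & h * h = star x * x & v * h = x \<and>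
  isproj (star v * v) & isproj (v * star v) & v * star v * v = v & v * star v * x = x \<and>
  (\<forall>y. y * x = x --> y * v = v) & (\<forall>z. x * z = 0 --> v * z = 0) & x * (star v * v) = x"
proof -
 have xx: "0 <= star x * x" by simp
 define h where "h = psqrt (star x * x)"
 note h = psqrt(1,2)[OF xx, folded h_def]
 have hQ: "h \<in> Q" unfolding h_def by (intro psqrt_mem mult star x xx)
 have sh: "star h = h" by (rule pos_self_adjoint[OF h(1)])
 have nh: "norm (h $ u) = norm (x $ u)" for u
 proof -
  have "(norm (h $ u))\<^sup>2 = (norm (x $ u))\<^sup>2" using qf_simps(7)[of h u] qf_simps(7)[of x u] sh h(2) by simp
  thus ?thesis by (simp add: power2_eq_iff_nonneg)
 qed
 define d where "d n = 1 / (real n + 1)" for n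
 have d: "0 < d n" for n by (simp add: d_def)
 have dlim: "d ----> 0" unfolding d_def using LIMSEQ_inverse_real_of_nat by (simp add: inverse_eq_divide add.commute)
 have "\<exists>b. (h + d n *\<^sub>R 1) * b = 1 & b * (h + d n *\<^sub>R 1) = 1 & 0 <= b & b <= (1 / d n) *\<^sub>R 1" for n
  by (rule inverse_exists[OF d]) (use h(1) in simp)
 then obtain g where g: "!!n. (h + d n *\<^sub>R 1) * g n = 1" "!!n. g n * (h + d n *\<^sub>R 1) = 1" "!!n. 0 <= g n" "!!n. g n <= (1 / d n) *\<^sub>R 1"
  by metis
 have gQ: "g n \<in> Q" for n by (rule inverse_mem[OF _ g(1,2)]) (intro add scaleR one hQ)
 have gh: "g n * h = 1 - d n *\<^sub>R g n" and hg: "h * g n = 1 - d n *\<^sub>R g n" for n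
  using g(1,2)[of n] by (simp_all add: algebra_simps)
 have sg: "star (g n) = g n" for n by (rule pos_self_adjoint[OF g(3)])
 have nhg: "nrm (h * g n) <= 1" for n
 proof (rule nrm_pos_le)
  have "d n *\<^sub>R g n <= d n *\<^sub>R ((1 / d n) *\<^sub>R 1)" by (rule scaleR_left_mono[OF g(4)]) (use d in \<open>simp add: less_imp_le\<close>)
  thus "0 <= h * g n" using d[of n] by (simp add: hg)
  have "0 <= d n *\<^sub>R g n" by (rule scaleR_nonneg_nonneg[OF _ g(3)]) (use d in \<open>simp add: less_imp_le\<close>)
  thus "h * g n <= 1 *\<^sub>R 1" by (simp add: hg)
 qed simp
 have nxg: "norm (x $ g n $ u) <= norm u" for n u
  using norm_appl[of "h * g n" u] mult_right_mono[OF nhg[of n], of "norm u"] by (simp add: nh)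
 have bd: "nrm (x * g n) <= 1" for n by (rule nrm_leI) (simp_all add: nxg)
 \<comment> \<open>The limit can be computed on the range of \<open>h\<close>, where it is
   \<open>x\<close>, and on the kernel of \<open>h\<close>, where it is 0; their sum is
   dense.\<close>
 define D where "D = {p + q | p q. p \<in> range (appl h) & h $ q = 0}"
 have Dw: "h $ w + u \<in> D" if "h $ u = 0" for w u
  using that unfolding D_def by blast
 have DI: "h $ w \<in> D" "h $ u = 0 ==> u \<in> D" for w u
  using Dw[of 0 w] Dw[of u 0] by simp_all
 have "csubspace D" unfolding csubspace_def
 proof (intro conjI ballI allI)
  show "0 \<in> D" by (rule DI(2)) simp
  fix a assume "a \<in> D"
  then obtain w q where a: "a = h $ w + q" "h $ q = 0" unfolding D_def by blast
  show "c *\<^sub>C a \<in> D" for c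
   using Dw[of "c *\<^sub>C q" "c *\<^sub>C w"] a by (simp add: scaleC_add_right)
  fix b assume "b \<in> D"
  then obtain w' q' where b: "b = h $ w' + q'" "h $ q' = 0" unfolding D_def by blast
  show "a + b \<in> D"
   using Dw[of "q + q'" "w + w'"] a b by (simp add: ac_simps)
 qed
 hence dense: "closure D = UNIV"
 proof (rule orthogonal_complement_dense)
  fix u assume u: "!!s. s \<in> D ==> cinner u s = 0"
  have "h $ u = 0"
  proof (rule cinner_eq_0_all)
   fix y show "cinner (h $ u) y = 0" using u[OF DI(1)[of y]] cinner_star[of h u y] sh by simp
  qed
  from u[OF DI(2)[OF this]] show "u = 0" by (simp add: cinner_norm)
 qed
 have onrange: "(%n. (x * g n) $ h $ w) ----> x $ w" for w
 proof -
  have e: "(x * g n) $ h $ w = x $ w - d n *\<^sub>R (x $ g n $ w)" for n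
  proof -
   have "(x * g n) $ h $ w = x $ (g n * h) $ w" by simp
   thus ?thesis by (simp only: gh) simp
  qed
  have "(%n. d n *\<^sub>R (x $ g n $ w)) ----> 0"
  proof (rule Lim_null_comparison)
   show "\<forall>\<^sub>F n in sequentially. norm (d n *\<^sub>R (x $ g n $ w)) <= d n * norm w"
    by (rule always_eventually) (use d nxg in \<open>simp add: less_imp_le mult_left_mono\<close>)
   show "(%n. d n * norm w) ----> 0" by (rule tendsto_mult_left_zero[OF dlim])
  qed
  from tendsto_diff[OF tendsto_const[of "x $ w"] this] show ?thesis by (simp only: e diff_zero)
 qed
 have onker: "(x * g n) $ u = 0" if "h $ u = 0" for n u
 proof -
  have "u = g n $ (h + d n *\<^sub>R 1) $ u" using g(2)[of n] by (simp only: flip: appl_mult) simp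
  hence "u = d n *\<^sub>R (g n $ u)" using that by simp
  hence "x $ u = d n *\<^sub>R (x $ g n $ u)" by (metis appl_scaleR)
  moreover have "x $ u = 0" using nh[of u] that by simp
  ultimately show ?thesis using d[of n] by simp
 qed
 have "convergent (%n. (x * g n) $ a)" for a
 proof (rule convergent_dense[OF bd dense])
  fix a assume "a \<in> D"
  then obtain w q where a: "a = h $ w + q" "h $ q = 0" unfolding D_def by blast
  have "(%n. (x * g n) $ a) ----> x $ w" using onrange[of w] onker[OF a(2)] unfolding a(1) appl_add by simp
  thus "convergent (%n. (x * g n) $ a)" by (rule convergentI)
 qed
 from slim_exists[OF this bd] obtain v where v: "slim (%n. x * g n) v" by blast
 have vQ: "v \<in> Q" by (rule slim_closed[OF _ v]) (intro mult x gQ)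
 have vh: "v * h = x"
  by (rule oper_of_eqI) (use LIMSEQ_unique[OF slimD[OF v] onrange] in simp)
 have vk: "v $ u = 0" if "h $ u = 0" for u
  using slimD[OF v, of u] onker[OF that] by (simp add: LIMSEQ_const_iff)
 \<comment> \<open>The defect \<open>r\<close> of \<open>v\<close> from being isometric satisfies
   \<open>star (r * h) * (r * h) = h * h - star x * x = 0\<close>, so \<open>v\<close> is isometric
   on the range of \<open>h\<close>.\<close>
 have svx: "star v * x = h"
 proof -
  have "(norm (v $ u))\<^sup>2 <= (norm u)\<^sup>2" for u
   using LIMSEQ_le_const2[OF tendsto_norm[OF slimD[OF v, of u]]] nxg by (simp add: power_mono)
  hence a0: "0 <= 1 - star v * v" by (simp add: le_iff_qf star_simps qf_simps)
  define r where "r = psqrt (1 - star v * v)"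
  have r: "star r = r" "r * r = 1 - star v * v" using psqrt(1,2)[OF a0] pos_self_adjoint by (auto simp: r_def)
  have "star (r * h) * (r * h) = h * (r * r) * h" by (simp only: star_mult sh r(1) mult.assoc)
  also have "... = h * h - star (v * h) * (v * h)" by (simp add: r(2) right_diff_distrib left_diff_distrib star_mult sh mult.assoc)
  also have "... = 0" unfolding vh h(2) by simp
  finally have "r * h = 0" by (rule star_mult_self_eq_0)
  hence "r * r * h = 0" by (simp only: mult.assoc mult_zero_right)
  thus ?thesis by (simp add: r(2) left_diff_distrib mult.assoc vh)
 qed
 have vsv: "v * (star v * v) = v"
 proof (rule eq_on_dense[OF dense])
  fix a assume "a \<in> D"
  then obtain w q where a: "a = h $ w + q" "h $ q = 0" unfolding D_def by blast
  have "(v * (star v * v)) $ h $ w = (v * (star v * (v * h))) $ w" by simp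
  also have "... = (v * h) $ w" by (simp only: vh svx)
  finally show "(v * (star v * v)) $ a = v $ a" using vk[OF a(2)] by (simp add: a(1))
 qed
 have "star v * v * (star v * v) = star v * v" using vsv by (simp add: mult.assoc)
 hence p1: "isproj (star v * v)" by (simp add: isproj_def star_mult)
 have "v * star v * (v * star v) = v * star v" using vsv by (metis mult.assoc)
 hence p2: "isproj (v * star v)" by (simp add: isproj_def star_mult)
 have yv: "y * v = v" if y: "y * x = x" for y
 proof -
  have "slim (%n. x * g n) (y * v)" using slim_mult_left[OF v, of y] y by (simp flip: mult.assoc)
  from slim_unique[OF this v] show ?thesis .
 qed
 have vz: "v * z = 0" if z: "x * z = 0" for z
 proof (rule oper_of_eqI)
  fix u
  have "x $ z $ u = 0" using z by (simp flip: appl_mult)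
  hence "h $ z $ u = 0" using nh[of "z $ u"] by simp
  from vk[OF this] show "(v * z) $ u = 0 $ u" by simp
 qed
 have hs: "h * (star v * v) = h"
 proof -
  have "star v * v * h = h" using vh svx by (simp add: mult.assoc)
  hence "star (star v * v * h) = h" using sh by simp
  thus ?thesis by (simp add: star_mult sh mult.assoc)
 qed
 have xs: "x * (star v * v) = x" using hs vh by (metis mult.assoc)
 have vvx: "v * star v * x = x" using svx vh by (simp add: mult.assoc)
 have "v * star v * v = v" using vsv by (simp add: mult.assoc)
 with vQ hQ h vh p1 p2 yv vz vvx xs show ?thesis by blast
qed

end


section \<open>Traces on factors\<close>

text \<open>An exhaustion principle: always choose, up to a factor two, the available step of largest gain.
 If the total gain is bounded, then steps that remain available forever gain nothing.\<close>

lemma greedy_sequence: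
 fixes Av :: "'s => 'w set" and \<gamma> :: "'w => real" and \<Phi> :: "'s => real"
 assumes start: "Inv s0" and ne: "!!s. Inv s ==> Av s ~= {}"
  and step: "!!s w. Inv s ==> w \<in> Av s ==> Inv (nx s w)"
  and gain: "!!s w. Inv s ==> w \<in> Av s ==> \<Phi> (nx s w) = \<Phi> s + \<gamma> w"
  and nonneg: "!!s w. Inv s ==> w \<in> Av s ==> 0 <= \<gamma> w"
  and bound: "!!s. Inv s ==> \<Phi> s <= B"
 shows "\<exists>S W. S 0 = s0 & (\<forall>n. Inv (S n) & W n \<in> Av (S n) & S (Suc n) = nx (S n) (W n)) \<and>
  (\<forall>w. (\<forall>n. w \<in> Av (S n)) --> \<gamma> w = 0)"
proof -
 have "\<exists>w\<in>Av s. \<forall>w'\<in>Av s. \<gamma> w' <= 2 * \<gamma> w" if s: "Inv s" for s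
 proof -
  define m where "m = (SUP w\<in>Av s. \<gamma> w)"
  have "\<gamma> w <= B - \<Phi> s" if "w \<in> Av s" for w using bound[OF step[OF s that]] gain[OF s that] by simp
  hence bdd: "bdd_above (\<gamma> ` Av s)" by (rule bdd_aboveI2)
  have le: "\<gamma> w <= m" if "w \<in> Av s" for w unfolding m_def by (rule cSUP_upper[OF that bdd])
  show ?thesis
  proof (cases "m <= 0")
   case True
   obtain w where w: "w \<in> Av s" using ne[OF s] by blast
   show ?thesis by (rule bexI[OF _ w]) (use le nonneg[OF s w] True in force)
  next
   case False
   hence "m / 2 < m" by simp
   then obtain w where w: "w \<in> Av s" "m / 2 < \<gamma> w" using less_cSUP_iff[OF ne[OF s] bdd] unfolding m_def by blast
   show ?thesis by (rule bexI[OF _ w(1)]) (use le w(2) in force)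
  qed
 qed
 then obtain c where c: "!!s. Inv s ==> c s \<in> Av s" "!!s w'. Inv s ==> w' \<in> Av s ==> \<gamma> w' <= 2 * \<gamma> (c s)" by metis
 define S where "S = rec_nat s0 (%_ s. nx s (c s))"
 have S: "S 0 = s0" "S (Suc n) = nx (S n) (c (S n))" for n by (simp_all add: S_def)
 have Inv: "Inv (S n)" for n by (induction n) (simp_all add: S start step c)
 have "incseq (%n. \<Phi> (S n))" by (rule incseq_SucI) (use nonneg[OF Inv c(1)[OF Inv]] in \<open>simp add: S gain Inv c\<close>)
 moreover have "!!n. \<Phi> (S n) <= B" by (rule bound[OF Inv])
 ultimately obtain L where L: "(%n. \<Phi> (S n)) ----> L" using incseq_convergent by blast
 have "(%n. 2 * (\<Phi> (S (Suc n)) - \<Phi> (S n))) ----> 2 * (L - L)"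
  by (intro tendsto_mult tendsto_const tendsto_diff L LIMSEQ_Suc)
 hence lim: "(%n. 2 * \<gamma> (c (S n))) ----> 0" by (simp add: S gain Inv c)
 have "\<gamma> w = 0" if w: "!!n. w \<in> Av (S n)" for w
 proof (rule antisym)
  show "\<gamma> w <= 0" by (rule LIMSEQ_le_const[OF lim]) (use c(2)[OF Inv w] in blast)
  show "0 <= \<gamma> w" by (rule nonneg[OF Inv w])
 qed
 thus ?thesis using S Inv c(1) by (intro exI[of _ S] exI[of _ "%n. c (S n)"]) blast
qed

lemma invariant_projection_commutes:
 assumes p: "isproj p" "!!v. p $ v \<in> S" "!!v. v \<in> S ==> p $ v = v"
  and x: "!!v. v \<in> S ==> x $ v \<in> S" "!!v. v \<in> S ==> star x $ v \<in> S"
 shows "x * p = p * x"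
proof -
 have 1: "p * (x * p) = x * p" by (rule oper_of_eqI) (simp add: p x)
 have "p * (star x * p) = star x * p" by (rule oper_of_eqI) (simp add: p x)
 hence "star (p * (star x * p)) = star (star x * p)" by simp
 hence "p * x * p = p * x" using p(1) by (simp add: star_mult isproj_def)
 with 1 show ?thesis by (simp add: mult.assoc)
qed

text \<open>The real part of a normal trace, neither normalised nor faithful. Normality is asked
  along increasing sequences only; \<open>complex_trace\<close> recovers the complex
  functional.\<close>

definition rtrace :: "'h::complex_hilbert_space cop set => ('h cop => real) => bool" where
 "rtrace P t \<longleftrightarrow> (\<forall>x\<in>P. \<forall>y\<in>P. t (x + y) = t x + t y) & (\<forall>x\<in>P. \<forall>r. t (r *\<^sub>R x) = r * t x) \<and>
  (\<forall>x\<in>P. 0 <= x --> 0 <= t x) & (\<forall>x\<in>P. \<forall>y\<in>P. t (x * y) = t (y * x)) & (\<forall>x\<in>P. t (star x) = t x) \<and>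
  (\<forall>f x. (\<forall>n. f n \<in> P) & incseq f & slim f x --> (%n. t (f n)) ----> t x)"

locale traced_algebra = vn_algebra +
 fixes t assumes rtrace: "rtrace Q t"
begin

lemma tr_add: "x \<in> Q ==> y \<in> Q ==> t (x + y) = t x + t y"
 and tr_scaleR: "x \<in> Q ==> t (r *\<^sub>R x) = r * t x"
 and tr_pos: "x \<in> Q ==> 0 <= x ==> 0 <= t x"
 and tr_comm: "x \<in> Q ==> y \<in> Q ==> t (x * y) = t (y * x)"
 and tr_star: "x \<in> Q ==> t (star x) = t x"
 and tr_lim: "(!!n. f n \<in> Q) ==> incseq f ==> slim f x ==> (%n. t (f n)) ----> t x"
proof -
 note r = rtrace[unfolded rtrace_def]
 show "x \<in> Q ==> y \<in> Q ==> t (x + y) = t x + t y" by (rule r[THEN conjunct1, rule_format])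
 show "x \<in> Q ==> t (r *\<^sub>R x) = r * t x" by (rule r[THEN conjunct2, THEN conjunct1, rule_format])
 show "x \<in> Q ==> 0 <= x ==> 0 <= t x" by (rule r[THEN conjunct2, THEN conjunct2, THEN conjunct1, rule_format])
 show "x \<in> Q ==> y \<in> Q ==> t (x * y) = t (y * x)"
  by (rule r[THEN conjunct2, THEN conjunct2, THEN conjunct2, THEN conjunct1, rule_format])
 show "x \<in> Q ==> t (star x) = t x"
  by (rule r[THEN conjunct2, THEN conjunct2, THEN conjunct2, THEN conjunct2, THEN conjunct1, rule_format])
 show "(!!n. f n \<in> Q) ==> incseq f ==> slim f x ==> (%n. t (f n)) ----> t x"
  by (rule r[THEN conjunct2, THEN conjunct2, THEN conjunct2, THEN conjunct2, THEN conjunct2, rule_format]) simp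
qed

lemma tr_zero: "t 0 = 0" using tr_scaleR[OF zero, of 0] by simp
lemma tr_uminus: "x \<in> Q ==> t (- x) = - t x" using tr_scaleR[of x "-1"] by simp
lemma tr_diff: "x \<in> Q ==> y \<in> Q ==> t (x - y) = t x - t y"
 using tr_add[OF _ uminus, of x y] tr_uminus[of y] by simp
lemma tr_mono: "x \<in> Q ==> y \<in> Q ==> x <= y ==> t x <= t y"
 using tr_pos[OF diff, of y x] tr_diff[of y x] by simp
lemma tr_sum: "(!!i. i \<in> I ==> f i \<in> Q) ==> t (\<Sum>i\<in>I. f i) = (\<Sum>i\<in>I. t (f i))"
 by (induction I rule: infinite_finite_induct) (simp_all add: tr_zero tr_add sum)

lemma tr_cyc: "x \<in> Q ==> y \<in> Q ==> z \<in> Q ==> t (x * y * z) = t (z * x * y)"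
 using tr_comm[OF mult, of x y z] by (simp add: mult.assoc)

lemma tr_proj_mono: "isproj p ==> p \<in> Q ==> t p <= t 1"
 by (rule tr_mono[OF _ one isproj_le_one])

end

locale finite_algebra = traced_algebra +
 assumes faithful: "x \<in> Q ==> 0 <= x ==> t x = 0 ==> x = 0"
begin

lemma faithful_star: "x \<in> Q ==> t (star x * x) = 0 ==> x = 0"
 using faithful[OF mult[OF star]] star_mult_self_eq_0 star_mult_self_pos by blast

lemma tr_pos_strict: "x \<in> Q ==> 0 <= x ==> x ~= 0 ==> 0 < t x"
 using faithful[of x] tr_pos[of x] by force

lemma faithful_all: "x \<in> Q ==> (!!y. y \<in> Q ==> t (y * x) = 0) ==> x = 0"
 using faithful_star[of x] star by blast

lemma isometry_unitary:
 assumes u: "u \<in> Q" "star u * u = 1" shows "u * star u = 1"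
proof -
 have p: "isproj (u * star u)" using u(2) by (simp add: isproj_def star_mult) (metis mult.assoc mult_1_left)
 have "1 - u * star u = 0"
 proof (rule faithful)
  show "1 - u * star u \<in> Q" by (intro diff one mult star u)
  show "0 <= 1 - u * star u" by (rule isproj_pos[OF isproj_compl[OF p]])
  show "t (1 - u * star u) = 0"
   using tr_comm[OF u(1) star[OF u(1)]] u by (simp add: tr_diff one mult star)
 qed
 thus ?thesis by simp
qed

end

locale factor_algebra = vn_algebra +
 assumes center: "Q \<inter> comm Q = range (%c. cscale c 1)"
begin

text \<open>The vectors killed by \<open>z' * m\<close> for every \<open>m\<close> form a closed
  subspace invariant under \<open>Q\<close> and its commutant. Its projection is central, hence
  scalar; it is not 0 because the range of \<open>z\<close> lies in the subspace, and being
  everything would force \<open>z' = 0\<close>.\<close>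

lemma factor_nonzero_product:
 assumes z: "z \<in> Q" "z' \<in> Q" "z ~= 0" "z' ~= 0"
 shows "\<exists>m\<in>Q. z' * m * z ~= 0"
proof (rule ccontr)
 assume "\<not> ?thesis"
 hence zero: "z' * m * z = 0" if "m \<in> Q" for m using that by blast
 define S where "S = {u. \<forall>m\<in>Q. z' $ m $ u = 0}"
 have S: "csubspace S" by (auto simp: csubspace_def S_def)
 have cl: "closed S"
 proof -
  have "S = (\<Inter>m\<in>Q. (%u. (z' * m) $ u) -` {0})" by (auto simp: S_def)
  moreover have "closed ((%u. (z' * m) $ u) -` {0})" for m
   by (rule continuous_closed_vimage[OF closed_singleton])
    (rule linear_continuous_at[OF bounded_linear_appl])
  ultimately show ?thesis by auto
 qed
 obtain p where p: "isproj p" "!!v. p $ v \<in> S" "!!v. v \<in> S ==> p $ v = v"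
  using projection_exists[OF S cl] by blast
 have invQ: "x $ v \<in> S" if "x \<in> Q" "v \<in> S" for x v
  using that mult[OF _ that(1)] by (auto simp: S_def) (metis appl_mult)
 have invC: "x $ v \<in> S" if x: "x \<in> comm Q" and v: "v \<in> S" for x v
 proof -
  have "z' $ m $ x $ v = 0" if m: "m \<in> Q" for m
  proof -
   have "z' * m * x = x * (z' * m)" by (rule commD[OF x mult[OF z(2) m]])
   hence "(z' * m * x) $ v = (x * (z' * m)) $ v" by simp
   thus ?thesis using v m by (simp add: S_def)
  qed
  thus ?thesis by (simp add: S_def)
 qed
 interpret C: star_algebra "comm Q" by (rule star_algebra_comm)
 have "p \<in> comm Q" by (rule commI, rule invariant_projection_commutes[OF p]) (use invQ star in blast)+
 moreover have "p \<in> Q" by (rule bicommI, rule invariant_projection_commutes[OF p]) (use invC C.star in blast)+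
 ultimately obtain c where c: "p = cscale c 1" using center by blast
 have zS: "z $ v \<in> S" for v using zero by (auto simp: S_def simp flip: appl_mult)
 have "c ~= 0"
 proof
  assume "c = 0"
  hence "z = 0" using p(3)[OF zS] c by (intro oper_of_eqI) (metis appl_cop_simps(1) cscale_simps(1))
  thus False using z by simp
 qed
 have "v \<in> S" for v
 proof -
  have "inverse c *\<^sub>C (p $ v) \<in> S" by (rule csubspaceD(5)[OF S p(2)])
  thus ?thesis using c \<open>c ~= 0\<close> by (simp add: scaleC_scaleC)
 qed
 hence "z' $ 1 $ v = 0" for v using one unfolding S_def by blast
 hence "z' = 0" by (intro oper_of_eqI) simp
 thus False using z by simp
qed

lemma comm_factor: "factor_algebra (comm Q)"
 by (intro factor_algebra.intro comm_vn factor_algebra_axioms.intro) (use center bicomm in \<open>simp add: Int_commute\<close>)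

end

section \<open>Uniqueness of the trace on a finite factor\<close>

locale finite_factor = finite_algebra + factor_algebra
begin

text \<open>A Hahn decomposition for a difference \<open>g\<close> of traces. One element with
  \<open>g\<close> positive contains a nonzero \<open>z\<close> below which \<open>g\<close> is
  nowhere negative; traciality spreads this to the conjugates of \<open>z\<close>, and in a factor
  these reach everywhere.\<close>

lemma trace_comparison:
 fixes g :: "'a cop => real"
 assumes gadd: "!!x y. x \<in> Q ==> y \<in> Q ==> g (x + y) = g x + g y"
  and gsc: "!!x r. x \<in> Q ==> g (r *\<^sub>R x) = r * g x"
  and gtr: "!!x y. x \<in> Q ==> y \<in> Q ==> g (x * y) = g (y * x)"
  and glim: "!!f x. (!!n. f n \<in> Q) ==> incseq f ==> slim f x ==> (%n. g (f n)) ----> g x"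
  and gbd: "!!w. w \<in> Q ==> 0 <= w ==> w <= xa ==> - g w <= B"
  and xa: "xa \<in> Q" "0 <= xa" "0 < g xa"
 shows "0 <= g 1"
proof -
 have g0: "g 0 = 0" using gsc[OF zero, of 0] by simp
 have gdiff: "g (x - y) = g x - g y" if "x \<in> Q" "y \<in> Q" for x y
  using gadd[OF that(1) uminus[OF that(2)]] gsc[OF that(2), of "-1"] by simp
 \<comment> \<open>Exhaustion with gain \<open>- g\<close>: pieces of \<open>xa\<close> where
   \<open>g\<close> is at most 0 are collected, and \<open>g\<close> is nonnegative on all of the
   algebra below the remainder \<open>z\<close>.\<close>
 have "\<exists>S W. S 0 = 0 & (\<forall>n. (S n \<in> Q & 0 <= S n & S n <= xa & g (S n) <= 0) \<and>
   W n \<in> {w \<in> Q. 0 <= w & w <= xa - S n & g w <= 0} & S (Suc n) = S n + W n) \<and>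
  (\<forall>w. (\<forall>n. w \<in> {w \<in> Q. 0 <= w & w <= xa - S n & g w <= 0}) --> - g w = 0)"
 proof (rule greedy_sequence[where \<Phi> = "%y. - g y" and B = B])
  show "!!s. s \<in> Q & 0 <= s & s <= xa & g s <= 0 ==> {w \<in> Q. 0 <= w & w <= xa - s & g w <= 0} ~= {}"
   using zero g0 by fastforce
 qed (use xa zero g0 gbd in \<open>auto simp: gadd add algebra_simps intro: add_nonneg_nonneg add_nonpos_nonpos\<close>)
 then obtain S W where SW: "\<forall>n. (S n \<in> Q & 0 <= S n & S n <= xa & g (S n) <= 0) \<and>
   W n \<in> {w \<in> Q. 0 <= w & w <= xa - S n & g w <= 0} & S (Suc n) = S n + W n"
  and Smax: "\<forall>w. (\<forall>n. w \<in> {w \<in> Q. 0 <= w & w <= xa - S n & g w <= 0}) --> - g w = 0"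
  by (elim exE conjE)
 have S: "S n \<in> Q" "S n <= xa" "g (S n) <= 0" "0 <= W n" "S (Suc n) = S n + W n" for n
  using SW[rule_format, of n] by auto
 have inc: "incseq S" by (rule incseq_SucI) (simp add: S)
 obtain y where y: "slim S y" "!!n. S n <= y" "y <= xa" using increasing_slim_exists[OF inc S(2)] by blast
 have yQ: "y \<in> Q" by (rule slim_closed[OF S(1) y(1)])
 have gy: "g y <= 0" by (rule LIMSEQ_le_const2[OF glim[OF S(1) inc y(1)]]) (use S(3) in blast)
 define z where "z = xa - y"
 have z: "z \<in> Q" "0 <= z" using y(3) xa(1) yQ by (simp_all add: z_def diff)
 have "g z = g xa - g y" using gdiff[OF xa(1) yQ] by (simp add: z_def)
 hence "g z > 0" using gy xa(3) by linarith
 hence z0: "z ~= 0" using g0 by auto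
 have gz: "0 <= g w" if w: "w \<in> Q" "0 <= w" "w <= z" for w
 proof (rule ccontr)
  assume n: "\<not> 0 <= g w"
  have "w <= xa - S n" for n
   using w(3) y(2)[of n] unfolding z_def by (meson diff_left_mono order_trans)
  hence "- g w = 0" using n w by (intro Smax[rule_format]) auto
  with n show False by simp
 qed
 \<comment> \<open>With \<open>r\<close> the root of \<open>z\<close>, the element
   \<open>r * (star m * m) * r\<close> lies below a multiple of \<open>z\<close>, and by traciality
   it has the same value of \<open>g\<close> as \<open>m * z * star m\<close>.\<close>
 have gmz: "0 <= g (m * z * star m)" if m: "m \<in> Q" for m
 proof -
  define r where "r = psqrt z"
  note r = psqrt(1,2)[OF z(2), folded r_def]
  have rQ: "r \<in> Q" unfolding r_def by (rule psqrt_mem[OF z])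
  have sr: "star r = r" by (rule pos_self_adjoint[OF r(1)])
  define K where "K = (nrm m)\<^sup>2 + 1"
  have K: "K > 0" "(nrm m)\<^sup>2 <= K" by (simp_all add: K_def add_nonneg_pos)
  have "star m * m <= K *\<^sub>R 1"
   by (rule order_trans[OF star_mult_self_le scaleR_right_mono]) (use K in simp_all)
  from conj_mono[OF this, of r] have le: "r * (star m * m) * r <= K *\<^sub>R z" by (simp add: sr r(2))
  have b0: "0 <= r * (star m * m) * r" using conj_pos[of "star m * m" r] sr by simp
  have bQ: "r * (star m * m) * r \<in> Q" by (intro mult rQ star m)
  have "(1/K) *\<^sub>R (r * (star m * m) * r) <= (1/K) *\<^sub>R (K *\<^sub>R z)" by (rule scaleR_left_mono[OF le]) (use K in simp)
  hence "(1/K) *\<^sub>R (r * (star m * m) * r) <= z" using K by simp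
  hence "0 <= g ((1/K) *\<^sub>R (r * (star m * m) * r))"
   by (intro gz scaleR bQ scaleR_nonneg_nonneg b0) (use K in simp_all)
  hence "0 <= g (r * (star m * m) * r)" using K by (simp add: gsc bQ zero_le_divide_iff)
  also have "g (r * (star m * m) * r) = g ((r * star m) * (m * r))" by (simp add: mult.assoc)
  also have "... = g ((m * r) * (r * star m))" by (intro gtr mult rQ m star)
  also have "(m * r) * (r * star m) = m * z * star m" by (metis mult.assoc r(2))
  finally show ?thesis .
 qed
 \<comment> \<open>Exhaustion with gain \<open>t\<close>: elements with nonnegative \<open>g\<close>
   fill up 1.\<close>
 have "\<exists>S W. S 0 = 0 & (\<forall>n. (S n \<in> Q & 0 <= S n & S n <= 1 & 0 <= g (S n)) \<and>
   W n \<in> {w \<in> Q. 0 <= w & w <= 1 - S n & 0 <= g w} & S (Suc n) = S n + W n) \<and>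
  (\<forall>w. (\<forall>n. w \<in> {w \<in> Q. 0 <= w & w <= 1 - S n & 0 <= g w}) --> t w = 0)"
 proof (rule greedy_sequence[where \<Phi> = t and B = "t 1"])
  show "!!s. s \<in> Q & 0 <= s & s <= 1 & 0 <= g s ==> {w \<in> Q. 0 <= w & w <= 1 - s & 0 <= g w} ~= {}"
   using zero g0 by fastforce
 qed (use zero one g0 in \<open>auto simp: gadd add tr_add algebra_simps intro: tr_pos tr_mono add_nonneg_nonneg\<close>)
 then obtain T V where TV: "\<forall>n. (T n \<in> Q & 0 <= T n & T n <= 1 & 0 <= g (T n)) \<and>
   V n \<in> {w \<in> Q. 0 <= w & w <= 1 - T n & 0 <= g w} & T (Suc n) = T n + V n"
  and Tmax: "\<forall>w. (\<forall>n. w \<in> {w \<in> Q. 0 <= w & w <= 1 - T n & 0 <= g w}) --> t w = 0"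
  by (elim exE conjE)
 have T: "T n \<in> Q" "T n <= 1" "0 <= g (T n)" "0 <= V n" "T (Suc n) = T n + V n" for n
  using TV[rule_format, of n] by auto
 have inc': "incseq T" by (rule incseq_SucI) (simp add: T)
 obtain u where u: "slim T u" "!!n. T n <= u" "u <= 1" using increasing_slim_exists[OF inc' T(2)] by blast
 have uQ: "u \<in> Q" by (rule slim_closed[OF T(1) u(1)])
 have gu: "0 <= g u" by (rule LIMSEQ_le_const[OF glim[OF T(1) inc' u(1)]]) (use T(3) in blast)
 \<comment> \<open>A nonzero remainder would meet \<open>z\<close> by factoriality, and a small
   multiple of the resulting element would have been available at every stage although its trace is
   positive.\<close>
 have "1 - u = 0"
 proof (rule ccontr)
  assume n0: "1 - u ~= 0"
  define z' where "z' = 1 - u"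
  have z': "z' \<in> Q" "0 <= z'" "z' ~= 0" using u(3) n0 by (simp_all add: z'_def diff one uQ)
  define s where "s = psqrt z'"
  note s = psqrt(1,2)[OF z'(2), folded s_def]
  have sQ: "s \<in> Q" unfolding s_def by (rule psqrt_mem[OF z'(1,2)])
  have ss: "star s = s" by (rule pos_self_adjoint[OF s(1)])
  obtain m where m: "m \<in> Q" "z' * m * z ~= 0" using factor_nonzero_product[OF z(1) z'(1) z0 z'(3)] by blast
  define r where "r = psqrt z"
  note r = psqrt(1,2)[OF z(2), folded r_def]
  have sr: "star r = r" by (rule pos_self_adjoint[OF r(1)])
  have "s * m * r ~= 0"
  proof
   assume a: "s * m * r = 0"
   have "z' * m * z = s * (s * m * r) * r" by (metis mult.assoc r(2) s(2))
   with a m(2) show False by simp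
  qed
  have mzm: "0 <= m * z * star m" by (rule conj_pos'[OF z(2)])
  define K where "K = nrm (m * z * star m) + 1"
  have K: "K > 0" "nrm (m * z * star m) <= K" by (simp_all add: K_def add_nonneg_pos)
  define w where "w = (1/K) *\<^sub>R (s * m * z * star (s * m))"
  have "m * z * star m <= K *\<^sub>R 1"
   by (rule order_trans[OF self_adjoint_le_nrm(1)[OF pos_self_adjoint[OF mzm]] scaleR_right_mono]) (use K in simp_all)
  from conj_mono[OF this, of s] have "s * m * z * star (s * m) <= K *\<^sub>R z'"
   by (simp add: ss s(2) star_mult mult.assoc)
  hence "(1/K) *\<^sub>R (s * m * z * star (s * m)) <= (1/K) *\<^sub>R (K *\<^sub>R z')" by (rule scaleR_left_mono) (use K in simp)
  hence wz: "w <= z'" using K by (simp add: w_def)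
  have wQ: "w \<in> Q" unfolding w_def by (intro scaleR mult sQ m z star)
  have w0: "0 <= w" unfolding w_def by (intro scaleR_nonneg_nonneg conj_pos' z) (use K in simp)
  have "0 <= g w" unfolding w_def using gmz[OF mult[OF sQ m(1)]] K
   by (subst gsc) (auto intro!: mult sQ m z star)
  have "w <= 1 - T n" for n using wz u(2)[of n] unfolding z'_def by (meson diff_left_mono order_trans)
  hence "t w = 0" using wQ w0 \<open>0 <= g w\<close> by (intro Tmax[rule_format]) auto
  hence "w = 0" by (rule faithful[OF wQ w0])
  hence "s * m * z * star (s * m) = 0" using K by (simp add: w_def)
  moreover have "s * m * z * star (s * m) = (s * m * r) * star (s * m * r)"
   by (simp add: star_mult sr mult.assoc) (metis mult.assoc r(2))
  ultimately have "star (star (s * m * r)) * star (s * m * r) = 0" by simp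
  hence "star (s * m * r) = 0" by (rule star_mult_self_eq_0)
  hence "s * m * r = 0" using star_inj[of "s * m * r" 0] by simp
  thus False using \<open>s * m * r ~= 0\<close> by simp
 qed
 thus ?thesis using gu by simp
qed

text \<open>\<open>trace_comparison\<close> applied to \<phi> - s t and to s t - \<phi>. It wants
  strict positivity at \<open>x\<close>, so \<open>s\<close> runs on either side of the ratio of the
  values at \<open>x\<close> and then tends to it.\<close>

lemma trace_unique_pos:
 assumes \<phi>: "rtrace Q \<phi>" and x: "x \<in> Q" "0 <= x"
 shows "\<phi> x * t 1 = \<phi> 1 * t x"
proof -
 interpret F: traced_algebra Q \<phi> by unfold_locales (rule \<phi>)
 show ?thesis
 proof (cases "x = 0")
  case True thus ?thesis by (simp add: tr_zero F.tr_zero)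
 next
  case False
  have tx: "0 < t x" by (rule tr_pos_strict[OF x False])
  have t1: "0 <= t 1" by (rule tr_pos[OF one]) simp
  have le: "s * t 1 <= \<phi> 1" if s: "s * t x < \<phi> x" "0 <= s" for s
  proof -
   have "0 <= (%x. \<phi> x - s * t x) 1"
   proof (rule trace_comparison[where xa = x and B = "s * t x"])
    show "- (\<phi> w - s * t w) <= s * t x" if "w \<in> Q" "0 <= w" "w <= x" for w
     using F.tr_pos[OF that(1,2)] mult_left_mono[OF tr_mono[OF that(1) x(1) that(3)] s(2)] by simp
   qed (use s x in \<open>auto simp: tr_add F.tr_add tr_scaleR F.tr_scaleR algebra_simps tr_comm F.tr_comm
      intro!: tendsto_intros tr_lim F.tr_lim\<close>)
   thus ?thesis by simp
  qed
  have ge: "\<phi> 1 <= s * t 1" if s: "\<phi> x < s * t x" "0 <= s" for s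
  proof -
   have "0 <= (%x. s * t x - \<phi> x) 1"
   proof (rule trace_comparison[where xa = x and B = "\<phi> x"])
    show "- (s * t w - \<phi> w) <= \<phi> x" if "w \<in> Q" "0 <= w" "w <= x" for w
     using mult_nonneg_nonneg[OF s(2) tr_pos[OF that(1,2)]] F.tr_mono[OF that(1) x(1) that(3)] by simp
   qed (use s x in \<open>auto simp: tr_add F.tr_add tr_scaleR F.tr_scaleR algebra_simps tr_comm F.tr_comm
      intro!: tendsto_intros tr_lim F.tr_lim\<close>)
   thus ?thesis by simp
  qed
  have px: "0 <= \<phi> x" by (rule F.tr_pos[OF x])
  have p1: "0 <= \<phi> 1" by (rule F.tr_pos[OF one]) simp
  define s where "s = \<phi> x / t x"
  have s: "s * t x = \<phi> x" "0 <= s" using tx px by (simp_all add: s_def)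
  have "s * t 1 <= \<phi> 1"
  proof (cases "s = 0")
   case False
   show ?thesis
   proof (rule field_le_epsilon)
    fix e :: real assume e: "e > 0"
    define d where "d = min s (e / (t 1 + 1))"
    have d: "0 < d" "d <= s" "d <= e / (t 1 + 1)" using False s e t1 by (auto simp: d_def)
    have "(s - d) * t 1 <= \<phi> 1" by (rule le) (use d s tx in \<open>auto simp: left_diff_distrib\<close>)
    moreover have "d * t 1 <= e"
    proof -
     have "d * (t 1 + 1) <= e" using d(3) t1 by (simp add: pos_le_divide_eq)
     thus ?thesis using d(1) by (simp add: distrib_left)
    qed
    ultimately show "s * t 1 <= \<phi> 1 + e" by (simp add: left_diff_distrib)
   qed
  qed (simp add: p1)
  moreover have "\<phi> 1 <= s * t 1"
  proof (rule field_le_epsilon)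
   fix e :: real assume e: "e > 0"
   define d where "d = e / (t 1 + 1)"
   have d: "0 < d" using e t1 by (simp add: d_def)
   have "\<phi> 1 <= (s + d) * t 1" by (rule ge) (use d s tx in \<open>auto simp: distrib_right\<close>)
   moreover have "d * t 1 <= e" using t1 e by (simp add: d_def field_simps)
   ultimately show "\<phi> 1 <= s * t 1 + e" by (simp add: distrib_right)
  qed
  ultimately have "s * t 1 = \<phi> 1" by simp
  thus ?thesis using s(1) tx by (metis mult.assoc mult.commute)
 qed
qed

theorem trace_unique:
 assumes \<phi>: "rtrace Q \<phi>" and x: "x \<in> Q"
 shows "\<phi> x * t 1 = \<phi> 1 * t x"
proof -
 interpret F: traced_algebra Q \<phi> by unfold_locales (rule \<phi>)
 have sa: "\<phi> y * t 1 = \<phi> 1 * t y" if y: "y \<in> Q" "star y = y" for y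
 proof -
  have "0 <= y + nrm y *\<^sub>R 1" using add_right_mono[OF self_adjoint_le_nrm(2)[OF y(2)], of "nrm y *\<^sub>R 1"] by simp
  from trace_unique_pos[OF \<phi> add[OF y(1) scaleR[OF one]] this]
  have "(\<phi> y + nrm y * \<phi> 1) * t 1 = \<phi> 1 * (t y + nrm y * t 1)"
   by (simp add: tr_add F.tr_add tr_scaleR F.tr_scaleR y one scaleR)
  thus ?thesis by (simp add: algebra_simps)
 qed
 have h: "(1/2) *\<^sub>R (x + star x) \<in> Q" by (intro scaleR add star x)
 have "\<phi> ((1/2) *\<^sub>R (x + star x)) = \<phi> x" "t ((1/2) *\<^sub>R (x + star x)) = t x"
  by (simp_all add: tr_add F.tr_add tr_scaleR F.tr_scaleR x star add tr_star F.tr_star)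
 thus ?thesis using sa[OF h] by (simp add: star_simps add.commute)
qed

end


section \<open>Comparison of projections\<close>

lemma partial_isometry_proj:
 assumes "v * star v * v = v" shows "isproj (star v * v)" "isproj (v * star v)"
proof -
 have "star v * v * (star v * v) = star v * (v * star v * v)" by (simp add: mult.assoc)
 thus "isproj (star v * v)" using assms by (simp add: isproj_def star_mult)
 have "v * star v * (v * star v) = v * star v * v * star v" by (simp add: mult.assoc)
 thus "isproj (v * star v)" using assms by (simp add: isproj_def star_mult)
qed

lemma isproj_star_mult_isometry:
 assumes "isproj (star v * v)" shows "v * star v * v = v"
proof -
 let ?d = "v - v * star v * v"
 have sv: "star v * v * (star v * v) = star v * v" using assms by (simp add: isproj_def)
 have "star ?d * ?d = star v * v - star v * v * (star v * v) - star v * v * (star v * v)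
   + star v * v * (star v * v) * (star v * v)"
  by (simp add: star_simps algebra_simps)
 also have "... = 0" by (simp add: sv)
 finally have "?d = 0" by (rule star_mult_self_eq_0)
 thus ?thesis by simp
qed

lemma isproj_slim:
 assumes "slim f p" "!!n. isproj (f n)" shows "isproj p"
proof -
 have "slim (%n. f n * f n) (p * p)" by (rule slim_mult[OF assms(1) _ assms(1)]) (rule isproj_nrm_le[OF assms(2)])
 moreover have "f n * f n = f n" for n using assms(2)[of n] by (simp add: isproj_def)
 ultimately have "slim f (p * p)" by simp
 from slim_unique[OF this assms(1)] have "p * p = p" .
 moreover have "star p = p" by (rule slim_self_adjoint[OF assms(1)]) (use assms(2) isproj_def in auto)
 ultimately show ?thesis by (simp add: isproj_def)
qed

lemma isproj_zero_prod:
 assumes "isproj p" "isproj q" "p * q = 0" shows "q * p = 0" "isproj (p + q)"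
proof -
 have "q * p = star (p * q)" using assms(1,2) by (simp add: star_mult isproj_def)
 thus "q * p = 0" using assms(3) by simp
 thus "isproj (p + q)" using assms by (simp add: isproj_def star_simps algebra_simps)
qed

lemma isproj_le_compl_iff:
 assumes "isproj p" "isproj q" shows "p <= 1 - q \<longleftrightarrow> q * p = 0"
 using isproj_le_iff[OF assms(1) isproj_compl[OF assms(2)]] by (simp add: left_diff_distrib)

lemma isproj_le_mult: "isproj p ==> isproj q ==> p <= q ==> q * p = p & p * q = p"
 using isproj_le_iff[of p q] by (metis isproj_def star_mult)

context vn_algebra
begin

lemma support_exists:
 assumes n: "n \<in> Q" "0 <= n"
 shows "\<exists>s\<in>Q. isproj s & n * s = n & s * n = n & (\<forall>z. n * z = 0 --> s * z = 0)"
proof -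
 obtain v where v: "v \<in> Q" "isproj (star v * v)" "\<forall>z. n * z = 0 --> v * z = 0" "n * (star v * v) = n"
  using polar_decomposition[OF n(1)] by blast
 have "star (n * (star v * v)) = star n" using v(4) by simp
 hence "star v * v * n = n" by (simp add: star_mult pos_self_adjoint[OF n(2)] mult.assoc)
 moreover have "star v * v * z = 0" if "n * z = 0" for z using v(3) that by (simp add: mult.assoc)
 ultimately show ?thesis using v by (intro bexI[of _ "star v * v"]) (auto intro: mult star)
qed

text \<open>Let \<open>m\<close> be the supremum of the \<open>c\<close> with
  \<open>c *\<^sub>R f <= b\<close>. For \<open>e > 0\<close> the negative part of
  \<open>b - (m + e) *\<^sub>R f\<close> is nonzero; its support is a nonzero subprojection of
  \<open>f\<close>, hence \<open>f\<close> itself, which leaves no room for a positive part.\<close>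

lemma minimal_projection_scalar:
 assumes f: "f \<in> Q" "isproj f" and b: "b \<in> Q" "star b = b" "b * f = b"
  and min: "!!p. p \<in> Q ==> isproj p ==> p <= f ==> p = 0 \<or> p = f"
 shows "\<exists>c. b = c *\<^sub>R f"
proof (cases "f = 0")
 case True
 thus ?thesis using b(3) by auto
next
 case False
 have sf: "star f = f" "f * f = f" using f(2) by (simp_all add: isproj_def)
 have fb: "f * b = b" using b(2,3) sf by (metis star_mult)
 have f0: "0 <= f" by (rule isproj_pos[OF f(2)])
 have sand: "star f * b * f = b" using fb b(3) sf by (simp add: mult.assoc)
 have sand1: "star f * (r *\<^sub>R 1) * f = r *\<^sub>R f" for r using sf by simp
 define C where "C = {c. c *\<^sub>R f <= b}"
 have lower: "(- nrm b) *\<^sub>R 1 <= b" using self_adjoint_le_nrm(2)[OF b(2)] by simp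
 have "- nrm b \<in> C" using conj_mono[OF lower, of f] unfolding sand sand1 C_def by simp
 hence ne: "C ~= {}" by blast
 have bdd: "bdd_above C"
 proof (rule bdd_aboveI)
  fix c assume "c \<in> C"
  moreover have "b <= nrm b *\<^sub>R f" using conj_mono[OF self_adjoint_le_nrm(1)[OF b(2)], of f] unfolding sand sand1 .
  ultimately have "c *\<^sub>R f <= nrm b *\<^sub>R f" unfolding C_def using order_trans by blast
  hence "0 <= (nrm b - c) *\<^sub>R f" by (simp add: scaleR_diff_left)
  obtain v where v: "f $ v ~= 0" using False oper_of_eqI[of f 0] by auto
  have "0 <= (nrm b - c) * (norm (f $ v))\<^sup>2"
   using \<open>0 <= (nrm b - c) *\<^sub>R f\<close> isproj_norm[OF f(2)] by (metis pos_iff qf_simps(4))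
  thus "c <= nrm b" using v by (simp add: zero_le_mult_iff)
 qed
 define m where "m = Sup C"
 have up: "b <= (m + e) *\<^sub>R f" if e: "e > 0" for e
 proof -
  define a where "a = b - (m + e) *\<^sub>R f"
  have aQ: "a \<in> Q" unfolding a_def by (intro diff b scaleR f)
  have sa: "star a = a" by (simp add: a_def star_simps b sf)
  obtain p n where pn: "0 <= p" "0 <= n" "a = p - n" "p * n = 0" "n * p = 0"
   "!!t. t * a = a * t ==> t * p = p * t & t * n = n * t"
   using jordan_decomposition[OF sa] by blast
  have nQ: "n \<in> Q" by (rule bicommutant_memI[OF aQ]) (use pn(6) in blast)
  have "m + e \<notin> C" using cSup_upper[OF _ bdd, of "m + e"] e by (auto simp: m_def)
  hence "\<not> 0 <= a" by (simp add: C_def a_def)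
  hence n0: "n ~= 0" using pn(1,3) by auto
  have sn: "star n = n" "star p = p" by (rule pos_self_adjoint[OF pn(2)], rule pos_self_adjoint[OF pn(1)])
  have af: "a * (1 - f) = 0" by (simp add: a_def algebra_simps b(3) sf)
  hence eq: "p * (1 - f) = n * (1 - f)" by (simp add: pn(3) algebra_simps)
  have "n * (n * (1 - f)) = 0" using eq pn(5) by (simp flip: eq mult.assoc)
  hence "star (n * (1 - f)) * (n * (1 - f)) = 0" by (simp add: star_mult sn mult.assoc)
  hence nf: "n * (1 - f) = 0" by (rule star_mult_self_eq_0)
  hence pf: "p * (1 - f) = 0" using eq by simp
  obtain s where s: "s \<in> Q" "isproj s" "n * s = n" "!!z. n * z = 0 ==> s * z = 0"
   using support_exists[OF nQ pn(2)] by blast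
  have "s * (1 - f) = 0" by (rule s(4)[OF nf])
  hence "s * f = s" by (simp add: right_diff_distrib)
  hence "f * s = s" using s(2) sf by (metis isproj_def star_mult)
  hence "s <= f" using isproj_le_iff[OF s(2) f(2)] by simp
  moreover have "s ~= 0" using s(3) n0 by auto
  ultimately have "s = f" using min s by blast
  hence "f * p = 0" using s(4)[OF pn(5)] by simp
  hence "star (f * p) = 0" by simp
  hence "p * f = 0" by (simp add: star_mult sn sf)
  with pf have "p = 0" by (simp add: right_diff_distrib)
  hence "a <= 0" using pn(2,3) by simp
  thus ?thesis by (simp add: a_def)
 qed
 have down: "(m - e) *\<^sub>R f <= b" if "e > 0" for e
 proof -
  have "m - e < Sup C" using that by (simp add: m_def)
  from less_cSupE[OF this ne] obtain c where c: "c \<in> C" "m - e < c" by blast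
  have "(m - e) *\<^sub>R f <= c *\<^sub>R f" by (rule scaleR_right_mono) (use c f0 in auto)
  also have "... <= b" using c by (simp add: C_def)
  finally show ?thesis .
 qed
 have sm: "star (r *\<^sub>R f) = r *\<^sub>R f" for r by (simp add: star_simps sf)
 have "b = m *\<^sub>R f"
 proof (rule antisym)
  show "b <= m *\<^sub>R f" unfolding le_iff_qf[OF b(2) sm]
  proof
   fix v show "qf b v <= qf (m *\<^sub>R f) v"
   proof (rule field_le_epsilon)
    fix e :: real assume e: "e > 0"
    define d where "d = e / (qf f v + 1)"
    have q: "0 <= qf f v" using f0 pos_iff by blast
    have "d > 0" using e q by (simp add: d_def)
    from qf_mono[OF up[OF this], of v] have "qf b v <= m * qf f v + d * qf f v" by (simp add: qf_simps algebra_simps)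
    also have "d * qf f v <= e" using q e by (simp add: d_def field_simps)
    finally show "qf b v <= qf (m *\<^sub>R f) v + e" by (simp add: qf_simps)
   qed
  qed
  show "m *\<^sub>R f <= b" unfolding le_iff_qf[OF sm b(2)]
  proof
   fix v show "qf (m *\<^sub>R f) v <= qf b v"
   proof (rule field_le_epsilon)
    fix e :: real assume e: "e > 0"
    define d where "d = e / (qf f v + 1)"
    have q: "0 <= qf f v" using f0 pos_iff by blast
    have "d > 0" using e q by (simp add: d_def)
    from qf_mono[OF down[OF this], of v] have "m * qf f v <= qf b v + d * qf f v" by (simp add: qf_simps algebra_simps)
    also have "d * qf f v <= e" using q e by (simp add: d_def field_simps)
    finally show "qf (m *\<^sub>R f) v <= qf b v + e" by (simp add: qf_simps)
   qed
  qed
 qed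
 thus ?thesis by blast
qed

end

context finite_factor
begin

lemma nonzero_subequivalence:
 assumes p: "p \<in> Q" "p ~= 0" and q: "q \<in> Q" "isproj q" "q ~= 0"
 shows "\<exists>w\<in>Q. w ~= 0 & w * star w * w = w & (\<forall>z. p * z = 0 --> w * z = 0) & q * w = w"
proof -
 obtain m where m: "m \<in> Q" "q * m * p ~= 0" using factor_nonzero_product[OF p(1) q(1) p(2) q(3)] by blast
 have xQ: "q * m * p \<in> Q" by (intro mult q m p)
 obtain v where v: "v \<in> Q" "v * star v * v = v" "v * star v * (q * m * p) = q * m * p"
  "\<forall>y. y * (q * m * p) = q * m * p --> y * v = v" "\<forall>z. q * m * p * z = 0 --> v * z = 0"
  using polar_decomposition[OF xQ] by blast
 have "v ~= 0" using v(3) m(2) by auto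
 moreover have "q * (q * m * p) = q * m * p" using q(2) by (simp add: isproj_def flip: mult.assoc)
 hence "q * v = v" using v(4) by blast
 moreover have "v * z = 0" if "p * z = 0" for z using v(5) that by (simp add: mult.assoc)
 ultimately show ?thesis using v(1,2) by blast
qed

text \<open>A partial isometry from a subprojection of \<open>p\<close> into \<open>q\<close> is
  enlarged by exhaustion, the gain being the trace of the added initial projection. In a factor it
  stops only when one side is used up, and the traces decide that \<open>p\<close> is.\<close>

theorem comparison:
 assumes p: "p \<in> Q" "isproj p" and q: "q \<in> Q" "isproj q" and le: "t p <= t q"
 shows "\<exists>v\<in>Q. star v * v = p & q * v = v"
proof -
 define Inv where "Inv v \<longleftrightarrow> v \<in> Q & v * star v * v = v & v * p = v & q * v = v" for v
 define Av where "Av v = {w \<in> Q. w * star w * w = w & w * (p - star v * v) = w & (q - v * star v) * w = w}" for v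
 have sp: "star p = p" "p * p = p" and sq: "star q = q" "q * q = q" using p q by (simp_all add: isproj_def)
 have orth: "star v * w = 0 & v * star w = 0 & w * star v = 0 & star w * v = 0 & w * p = w & q * w = w"
  if v: "Inv v" and w: "w \<in> Av v" for v w
 proof -
  have v0: "q * v = v" "v * p = v" "v * star v * v = v" using v by (simp_all add: Inv_def)
  have vq: "star v * q = star v" using arg_cong[OF v0(1), of star] by (simp add: star_mult sq)
  have pv: "p * star v = star v" using arg_cong[OF v0(2), of star] by (simp add: star_mult sp)
  have vv: "star v * v * star v = star v" using arg_cong[OF v0(3), of star] by (simp add: star_mult mult.assoc)
  have w1: "(q - v * star v) * w = w" and w2: "w * (p - star v * v) = w" using w by (simp_all add: Av_def)
  have "star v * w = star v * (q - v * star v) * w" using w1 by (simp add: mult.assoc)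
  also have "star v * (q - v * star v) = 0" using vq vv by (simp add: right_diff_distrib mult.assoc)
  finally have 1: "star v * w = 0" by simp
  have "w * star v = w * ((p - star v * v) * star v)" using w2 by (simp flip: mult.assoc)
  also have "(p - star v * v) * star v = 0" using pv vv by (simp add: left_diff_distrib)
  finally have 2: "w * star v = 0" by simp
  have 3: "star w * v = 0" using arg_cong[OF 1, of star] by (simp add: star_mult)
  have 4: "v * star w = 0" using arg_cong[OF 2, of star] by (simp add: star_mult)
  have 5: "w * p = w" using w2 2 by (simp add: right_diff_distrib flip: mult.assoc)
  have 6: "q * w = w" using w1 1 by (simp add: left_diff_distrib mult.assoc)
  show ?thesis using 1 2 3 4 5 6 by blast
 qed
 have "\<exists>S W. S 0 = 0 & (\<forall>n. Inv (S n) & W n \<in> Av (S n) & S (Suc n) = S n + W n) \<and>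
  (\<forall>w. (\<forall>n. w \<in> Av (S n)) --> t (star w * w) = 0)"
 proof (rule greedy_sequence[where \<Phi> = "%v. t (star v * v)" and B = "t p"])
  show "Inv 0" by (simp add: Inv_def zero)
  fix v assume v: "Inv v"
  have "0 \<in> Av v" by (simp add: Av_def zero)
  thus "Av v ~= {}" by blast
  have vQ: "v \<in> Q" using v by (simp add: Inv_def)
  have pj: "isproj (star v * v)" by (rule partial_isometry_proj) (use v in \<open>simp add: Inv_def\<close>)
  have v0: "v * p = v" using v by (simp add: Inv_def)
  have "p * star v = star v" using arg_cong[OF v0, of star] by (simp add: star_mult sp)
  hence "star v * v <= p" using isproj_le_iff[OF pj p(2)] by (simp flip: mult.assoc)
  thus "t (star v * v) <= t p" by (intro tr_mono mult star vQ p)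
  fix w assume w: "w \<in> Av v"
  note o = orth[OF v w]
  have wQ: "w \<in> Q" using w by (simp add: Av_def)
  have e: "star (v + w) * (v + w) = star v * v + star w * w" using o by (simp add: star_simps algebra_simps)
  show "t (star (v + w) * (v + w)) = t (star v * v) + t (star w * w)"
   unfolding e by (intro tr_add mult star vQ wQ)
  show "0 <= t (star w * w)" by (intro tr_pos mult star wQ) simp
  have "(v + w) * star (v + w) * (v + w) = (v + w) * (star v * v + star w * w)" using e by (simp add: mult.assoc)
  also have "... = v * star v * v + (v * star w) * w + (w * star v) * v + w * star w * w" by (simp add: algebra_simps)
  also have "... = v + w" using o v w by (simp add: Inv_def Av_def)
  finally show "Inv (v + w)" using o v w wQ vQ by (simp add: Inv_def add algebra_simps)
 qed
 then obtain S W where S0: "S 0 = 0" and SW: "\<forall>n. Inv (S n) & W n \<in> Av (S n) & S (Suc n) = S n + W n"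
  and max: "\<forall>w. (\<forall>n. w \<in> Av (S n)) --> t (star w * w) = 0" by (elim exE conjE)
 have S: "Inv (S n)" "W n \<in> Av (S n)" "S (Suc n) = S n + W n" for n using SW by blast+
 have SQ: "S n \<in> Q" "S n * p = S n" "q * S n = S n" "S n * star (S n) * S n = S n" for n using S(1)[of n] by (simp_all add: Inv_def)
 define e where "e n = star (S n) * S n" for n
 have ep: "isproj (e n)" for n unfolding e_def by (rule partial_isometry_proj[OF SQ(4)])
 have pS: "p * star (S n) = star (S n)" for n using arg_cong[OF SQ(2)[of n], of star] by (simp add: star_mult sp)
 have pe: "p * e n = e n" for n by (simp add: e_def pS flip: mult.assoc)
 have eS: "e (Suc n) = e n + star (W n) * W n" for n
  using orth[OF S(1,2)] by (simp add: e_def S(3) star_simps algebra_simps)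
 have Se: "S n * e n = S n" for n by (simp add: e_def SQ(4) flip: mult.assoc)
 have We: "W n * e n = 0" for n using orth[OF S(1,2)] by (simp add: e_def flip: mult.assoc)
 have einc: "incseq e" by (rule incseq_SucI) (simp add: eS)
 have emul: "e m * e n = e n" if "n <= m" for m n
  using isproj_le_mult[OF ep ep incseqD[OF einc that]] by blast
 have Smn: "S m * e n = S n" if "n <= m" for m n
  using that
 proof (induction m rule: dec_induct)
  case base show ?case by (rule Se)
 next
  case (step m)
  have "W m * e n = W m * e m * e n" using emul[OF step(1)] by (simp add: mult.assoc)
  thus ?case using step We by (simp add: S(3) distrib_right)
 qed
 have ele: "e n <= p" for n using isproj_le_iff[OF ep p(2)] pe by simp
 obtain E where E: "slim e E" "!!n. e n <= E" "E <= p" using increasing_slim_exists[OF einc ele] by blast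
 have Ep: "isproj E" by (rule isproj_slim[OF E(1) ep])
 have nS: "nrm (S n) <= 1" for n
 proof (rule nrm_leI)
  fix u
  have "(norm (S n $ u))\<^sup>2 = (norm (e n $ u))\<^sup>2"
   using qf_simps(7)[of "S n" u] isproj_norm[OF ep, of n u] by (simp add: e_def)
  hence "norm (S n $ u) = norm (e n $ u)" by (simp add: power2_eq_iff_nonneg)
  thus "norm (S n $ u) <= 1 * norm u" using norm_appl[of "e n" u] mult_right_mono[OF isproj_nrm_le[OF ep[of n]], of "norm u"] by simp
 qed simp
 have "convergent (%n. S n $ u)" for u
 proof (rule Cauchy_convergent, rule metric_CauchyI)
  fix r :: real assume r: "r > 0"
  have "Cauchy (%n. e n $ u)" using slimD[OF E(1)] by (rule LIMSEQ_imp_Cauchy)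
  then obtain N where N: "!!m n. m \<ge> N ==> n \<ge> N ==> dist (e m $ u) (e n $ u) < r" using r by (metis metric_CauchyD)
  \<comment> \<open>Since \<open>S m - S n = S m * (e m - e n)\<close>, the partial isometries
    converge because their initial projections do.\<close>
  have *: "dist (S m $ u) (S n $ u) < r" if "N <= n" "n <= m" for m n
  proof -
   have "S m - S n = S m * (e m - e n)" using Se[of m] Smn[OF that(2)] by (simp add: right_diff_distrib)
   hence "S m $ u - S n $ u = S m $ (e m $ u - e n $ u)" by (metis appl_cop_simps(3) appl_mult)
   moreover have "norm (S m $ z) <= 1 * norm z" for z by (rule order_trans[OF norm_appl mult_right_mono[OF nS]]) simp
   ultimately have "norm (S m $ u - S n $ u) <= 1 * norm (e m $ u - e n $ u)" by (simp only:)
   thus ?thesis using N[of m n] that by (simp add: dist_norm)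
  qed
  show "\<exists>M. \<forall>m\<ge>M. \<forall>n\<ge>M. dist (S m $ u) (S n $ u) < r"
   by (rule exI[of _ N]) (metis * dist_commute nle_le)
 qed
 from slim_exists[OF this nS] obtain v where v: "slim S v" by blast
 have vQ: "v \<in> Q" by (rule slim_closed[OF SQ(1) v])
 have ve: "v * e n = S n" for n
 proof -
  have "slim (%m. S (m + n) * e n) (v * e n)" by (rule slim_mult_right[OF slim_ignore[OF v]])
  moreover have "S (m + n) * e n = S n" for m by (rule Smn) simp
  ultimately have "slim (%m. S n) (v * e n)" by simp
  from slim_unique[OF slim_const this] show ?thesis by simp
 qed
 have vE: "v * E = v"
 proof -
  have "slim (%n. v * e n) (v * E)" by (rule slim_mult_left[OF E(1)])
  hence "slim S (v * E)" by (simp only: ve)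
  from slim_unique[OF this v] show ?thesis .
 qed
 have vv: "star v * v = E"
 proof (rule antisym)
  have "qf (star v * v) u = qf E u" for u
  proof -
   have "(%n. (norm (S n $ u))\<^sup>2) ----> (norm (v $ u))\<^sup>2" by (intro tendsto_power tendsto_norm slimD[OF v])
   moreover have "(norm (S n $ u))\<^sup>2 = qf (e n) u" for n using qf_simps(7)[of "S n" u] by (simp add: e_def)
   ultimately have "(%n. qf (e n) u) ----> (norm (v $ u))\<^sup>2" by simp
   from LIMSEQ_unique[OF this slim_qf[OF E(1)]] show ?thesis by (simp add: qf_simps(7))
  qed
  moreover have "star E = E" using Ep by (simp add: isproj_def)
  ultimately show "star v * v <= E" "E <= star v * v" by (simp_all add: le_iff_qf star_mult)
 qed
 have vp: "v * p = v" using vE isproj_le_mult[OF Ep p(2) E(3)] by (metis mult.assoc)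
 have qv: "q * v = v"
 proof -
  have "slim S (q * v)" using slim_mult_left[OF v, of q] by (simp only: SQ(3))
  from slim_unique[OF this v] show ?thesis .
 qed
 have pi: "v * star v * v = v" using vv vE by (simp add: mult.assoc)
 \<comment> \<open>An extension of the limit \<open>v\<close> was available at every stage, so its
   gain is 0.\<close>
 have zero_w: "w = 0" if w: "w \<in> Q" "w * star w * w = w" "w * (p - E) = w" "(q - v * star v) * w = w" for w
 proof -
  have Ee: "E * e n = e n" "p * e n = e n" for n using isproj_le_mult[OF ep Ep E(2)] pe by blast+
  have "w * e n = 0" for n
  proof -
   have "w * e n = w * ((p - E) * e n)" using w(3) by (simp flip: mult.assoc)
   thus ?thesis using Ee[of n] by (simp add: left_diff_distrib)
  qed
  moreover have "w * p = w"
  proof -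
   have "w * p = w * ((p - E) * p)" using w(3) by (simp flip: mult.assoc)
   also have "(p - E) * p = p - E" using isproj_le_mult[OF Ep p(2) E(3)] sp by (simp add: left_diff_distrib)
   finally show ?thesis using w(3) by simp
  qed
  ultimately have 1: "w * (p - star (S n) * S n) = w" for n by (simp add: right_diff_distrib flip: e_def)
  have vw: "star v * w = 0"
  proof -
   have vq: "star v * q = star v" using arg_cong[OF qv, of star] by (simp add: star_mult sq)
   have vv3: "star v * v * star v = star v" using arg_cong[OF pi, of star] by (simp add: star_mult mult.assoc)
   have "star v * w = star v * (q - v * star v) * w" using w(4) by (simp add: mult.assoc)
   also have "star v * (q - v * star v) = 0" using vq vv3 by (simp add: right_diff_distrib mult.assoc)
   finally show ?thesis by simp
  qed
  have qw: "q * w = w" using w(4) vw by (simp add: left_diff_distrib mult.assoc)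
  have "star (S n) * w = 0" for n
  proof -
   have "star (S n) = e n * star v" using arg_cong[OF ve[of n], of star] ep[of n] by (simp add: star_mult isproj_def)
   thus ?thesis using vw by (simp add: mult.assoc)
  qed
  hence 2: "(q - S n * star (S n)) * w = w" for n using qw by (simp add: left_diff_distrib mult.assoc)
  have "t (star w * w) = 0" using max w 1 2 by (simp add: Av_def)
  thus "w = 0" by (rule faithful_star[OF w(1)])
 qed
 have EQ: "E \<in> Q" using vv vQ mult star by blast
 have "p = E"
 proof (rule ccontr)
  assume ne: "p ~= E"
  have dp: "p - E \<in> Q" "p - E ~= 0" "isproj (p - E)" using ne by (auto intro: diff p EQ isproj_diff[OF Ep p(2) E(3)])
  have vvp: "isproj (v * star v)" by (rule partial_isometry_proj[OF pi])
  have vvq: "v * star v <= q" using isproj_le_iff[OF vvp q(2)] qv by (simp flip: mult.assoc)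
  have dq: "q - v * star v \<in> Q" "isproj (q - v * star v)" by (intro diff q mult vQ star) (rule isproj_diff[OF vvp q(2) vvq])
  have "q = v * star v"
  proof (rule ccontr)
   assume "q ~= v * star v"
   hence "q - v * star v ~= 0" by simp
   from nonzero_subequivalence[OF dp(1,2) dq this]
   obtain w where w: "w \<in> Q" "w ~= 0" "w * star w * w = w" "\<forall>z. (p - E) * z = 0 --> w * z = 0" "(q - v * star v) * w = w"
    by blast
   have "(p - E) * (1 - (p - E)) = 0" using dp(3) by (simp add: isproj_def right_diff_distrib)
   hence "w * (1 - (p - E)) = 0" using w(4) by blast
   hence "w * (p - E) = w" by (simp add: right_diff_distrib)
   from zero_w[OF w(1,3) this w(5)] w(2) show False by simp
  qed
  hence "t p <= t E" using le tr_comm[OF vQ star[OF vQ]] vv by simp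
  hence "t (p - E) = 0" using tr_mono[OF EQ p(1) E(3)] by (simp add: tr_diff p EQ)
  hence "p - E = 0" by (rule faithful[OF dp(1) isproj_pos[OF dp(3)]])
  with ne show False by simp
 qed
 thus ?thesis using vv qv vQ by blast
qed

corollary equivalence:
 assumes p: "p \<in> Q" "isproj p" and q: "q \<in> Q" "isproj q" and eq: "t p = t q"
 shows "\<exists>v\<in>Q. star v * v = p & v * star v = q"
proof -
 obtain v where v: "v \<in> Q" "star v * v = p" "q * v = v" using comparison[OF p q] eq by auto
 have pr: "isproj (v * star v)" by (rule partial_isometry_proj, rule isproj_star_mult_isometry) (simp add: v p)
 have le: "v * star v <= q" using isproj_le_iff[OF pr q(2)] v(3) by (simp flip: mult.assoc)
 have "q - v * star v = 0"
 proof (rule faithful)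
  show "q - v * star v \<in> Q" by (intro diff q mult v star)
  show "0 <= q - v * star v" using le by simp
  show "t (q - v * star v) = 0" using tr_comm[OF v(1) star[OF v(1)]] v eq by (simp add: tr_diff q mult star)
 qed
 thus ?thesis using v by (intro bexI[of _ v]) auto
qed

text \<open>Copies of \<open>p\<close> are split off as long as the remainder has larger trace than
  \<open>p\<close>; the last remainder is embedded into \<open>p\<close>. The induction is on a
  bound for the number of copies.\<close>

lemma exhaustion:
 assumes p: "p \<in> Q" "isproj p" "p ~= 0"
 shows "\<exists>n v. (\<forall>i<(n::nat). v i \<in> Q & p * v i = v i) & (\<Sum>i<n. star (v i) * v i) = 1"
proof -
 have tp: "0 < t p" by (rule tr_pos_strict[OF p(1) isproj_pos[OF p(2)] p(3)])
 have "\<exists>n v. (\<forall>i<(n::nat). v i \<in> Q & p * v i = v i) & (\<Sum>i<n. star (v i) * v i) = r"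
  if "r \<in> Q" "isproj r" "t r <= real k * t p" for k r
  using that
 proof (induction k arbitrary: r)
  case 0
  hence "t r = 0" using tr_pos[OF 0(1) isproj_pos] by simp
  hence "r = 0" using faithful[OF 0(1) isproj_pos[OF 0(2)]] by simp
  thus ?case by (intro exI[of _ 0]) simp
 next
  case (Suc k)
  show ?case
  proof (cases "t r <= t p")
   case True
   obtain v where "v \<in> Q" "star v * v = r" "p * v = v" using comparison[OF Suc(2,3) p(1,2) True] by blast
   thus ?thesis by (intro exI[of _ 1] exI[of _ "%_. v"]) simp
  next
   case False
   then obtain u where u: "u \<in> Q" "star u * u = p" "r * u = u" using comparison[OF p(1,2) Suc(2,3)] by auto
   have ui: "u * star u * u = u" by (rule isproj_star_mult_isometry) (simp add: u p)
   have pu: "isproj (u * star u)" by (rule partial_isometry_proj[OF ui])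
   have le: "u * star u <= r" using isproj_le_iff[OF pu Suc(3)] u(3) by (simp flip: mult.assoc)
   have uQ: "u * star u \<in> Q" by (intro mult star u)
   have "t (u * star u) = t p" using tr_comm[OF u(1) star[OF u(1)]] u by simp
   hence "t (r - u * star u) <= real k * t p" using Suc(4) by (simp add: tr_diff Suc uQ algebra_simps)
   from Suc(1)[OF diff[OF Suc(2) uQ] isproj_diff[OF pu Suc(3) le] this]
   obtain n v where v: "\<forall>i<(n::nat). v i \<in> Q & p * v i = v i" "(\<Sum>i<n. star (v i) * v i) = r - u * star u" by blast
   have "star u * u * star u = star u" using arg_cong[OF ui, of star] by (simp add: star_mult mult.assoc)
   hence "p * star u = star u" by (simp only: u(2))
   moreover have "(\<Sum>i<Suc n. star ((v(n := star u)) i) * (v(n := star u)) i) = r"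
   proof -
    have "(\<Sum>i<n. star ((v(n := star u)) i) * (v(n := star u)) i) = (\<Sum>i<n. star (v i) * v i)" by (rule sum.cong) auto
    thus ?thesis using v(2) by simp
   qed
   ultimately show ?thesis using v(1) u(1) star
    by (intro exI[of _ "Suc n"] exI[of _ "v(n := star u)"]) (auto simp: less_Suc_eq)
  qed
 qed
 moreover obtain k :: nat where "t 1 / t p <= real k" using real_arch_simple by blast
 hence "t 1 <= real k * t p" using tp by (simp add: field_simps)
 ultimately show ?thesis using one by auto
qed

end


lemma scaleC_minus_left: "(- c) *\<^sub>C x = - (c *\<^sub>C (x::'a::complex_hilbert_space))"
proof -
 have "(- c) *\<^sub>C x + c *\<^sub>C x = 0" by (simp flip: scaleC_add_left)
 thus ?thesis by (simp add: eq_neg_iff_add_eq_0)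
qed

section \<open>Minimal projections and projections of prescribed trace\<close>

context finite_factor
begin

text \<open>The \<open>v i\<close> of \<open>exhaustion\<close> act like a column of matrix units:
  inserting their resolution of 1 on both sides of \<open>x\<close> leaves entries
  \<open>v i * x * star (v j)\<close> in the corner of \<open>p\<close>, which minimality makes
  scalar.\<close>

lemma minimal_projection_finite_dim:
 assumes p: "p \<in> Q" "isproj p" "p ~= 0"
  and min: "!!r. r \<in> Q ==> isproj r ==> r <= p ==> r = 0 \<or> r = p"
 shows "\<exists>S. finite S & Q \<subseteq> span S"
proof -
 obtain n v where v: "!!i. i < (n::nat) ==> v i \<in> Q" "!!i. i < n ==> p * v i = v i" "(\<Sum>i<n. star (v i) * v i) = 1"
  using exhaustion[OF p] by blast
 have sp: "star p = p" "p * p = p" using p(2) by (simp_all add: isproj_def)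
 define S where "S = (%(i,j). star (v i) * v j) ` ({..<n} \<times> {..<n}) \<union>
  (%(i,j). cscale \<i> (star (v i) * v j)) ` ({..<n} \<times> {..<n})"
 have corner: "\<exists>a b. y = a *\<^sub>R p + b *\<^sub>R cscale \<i> p" if y: "y \<in> Q" "p * y = y" "y * p = y" for y
 proof -
  have y': "star y * p = star y" "p * star y = star y"
   using arg_cong[OF y(2), of star] arg_cong[OF y(3), of star] by (simp_all add: star_mult sp)
  define y1 where "y1 = y + star y"
  define y2 where "y2 = cscale (- \<i>) (y - star y)"
  have "\<exists>c. y1 = c *\<^sub>R p"
   by (rule minimal_projection_scalar[OF p(1,2) _ _ _ min])
    (use y y' in \<open>auto simp: y1_def star_simps distrib_right intro: add star\<close>)
  moreover have "\<exists>c. y2 = c *\<^sub>R p"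
  proof (rule minimal_projection_scalar[OF p(1,2) _ _ _ min])
   show "y2 \<in> Q" unfolding y2_def by (intro cscale diff star y)
   have "star y2 = cscale \<i> (star y - y)" by (simp add: y2_def star_simps)
   also have "... = cscale (- \<i>) (y - star y)"
    by (rule oper_of_eqI) (simp add: scaleC_minus_left scaleC_diff_right)
   finally show "star y2 = y2" by (simp add: y2_def)
   show "y2 * p = y2" using y y' by (simp add: y2_def cscale_mult left_diff_distrib)
  qed
  ultimately obtain c d where cd: "y1 = c *\<^sub>R p" "y2 = d *\<^sub>R p" by blast
  have "cscale \<i> y2 = y - star y" by (simp add: y2_def cscale_cscale)
  hence "2 *\<^sub>R y = y1 + cscale \<i> y2" by (simp add: y1_def scaleR_2)
  hence "(1/2) *\<^sub>R (2 *\<^sub>R y) = (1/2) *\<^sub>R (c *\<^sub>R p + cscale \<i> (d *\<^sub>R p))" by (simp only: cd)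
  moreover have "cscale \<i> (d *\<^sub>R p) = d *\<^sub>R cscale \<i> p" by (simp flip: cscale_of_real add: cscale_cscale mult.commute)
  ultimately have "y = (c/2) *\<^sub>R p + (d/2) *\<^sub>R cscale \<i> p" by (simp add: scaleR_add_right)
  thus ?thesis by blast
 qed
 have "x \<in> span S" if x: "x \<in> Q" for x
 proof -
  have pc: "star (v i) * p = star (v i)" if "i < n" for i
   using arg_cong[OF v(2)[OF that], of star] by (simp add: star_mult sp)
  have "x = (\<Sum>i<n. star (v i) * v i) * x * (\<Sum>j<n. star (v j) * v j)" by (simp add: v(3))
  also have "... = (\<Sum>i<n. \<Sum>j<n. star (v i) * (v i * x * star (v j)) * v j)"
   unfolding sum_distrib_right[of _ _ x] sum_product by (simp only: mult.assoc)
  also have "... \<in> span S"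
  proof (intro span_sum)
   fix i j assume ij: "i \<in> {..<n}" "j \<in> {..<n}"
   have "p * (v i * x * star (v j)) = v i * x * star (v j)" using v(2)[of i] ij by (simp flip: mult.assoc)
   moreover have "v i * x * star (v j) * p = v i * x * star (v j)" using pc[of j] ij by (simp add: mult.assoc)
   moreover have "v i * x * star (v j) \<in> Q" using v(1) ij by (intro mult x star) auto
   ultimately obtain a b where ab: "v i * x * star (v j) = a *\<^sub>R p + b *\<^sub>R cscale \<i> p" using corner by blast
   have e: "star (v i) * (v i * x * star (v j)) * v j = a *\<^sub>R (star (v i) * v j) + b *\<^sub>R cscale \<i> (star (v i) * v j)"
    unfolding ab using pc[of i] v(2)[of j] ij by (simp add: algebra_simps cscale_mult)
   show "star (v i) * (v i * x * star (v j)) * v j \<in> span S" unfolding e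
    by (intro span_add span_scale span_base) (use ij in \<open>auto simp: S_def\<close>)
  qed
  finally show ?thesis .
 qed
 moreover have "finite S" by (simp add: S_def)
 ultimately show ?thesis by blast
qed

lemma small_projection:
 assumes inf: "\<nexists>S. finite S & Q \<subseteq> span S" and q: "q \<in> Q" "isproj q" "q ~= 0"
 shows "\<exists>p\<in>Q. isproj p & p ~= 0 & p <= q & t p <= t q / 2 ^ n"
proof (induction n)
 case 0 show ?case using q by auto
next
 case (Suc n)
 then obtain p where p: "p \<in> Q" "isproj p" "p ~= 0" "p <= q" "t p <= t q / 2 ^ n" by blast
 obtain r where r: "r \<in> Q" "isproj r" "r <= p" "r ~= 0" "r ~= p"
  using minimal_projection_finite_dim[OF p(1-3)] inf by blast
 have d: "p - r \<in> Q" "isproj (p - r)" "p - r ~= 0" "p - r <= p"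
  using r isproj_pos[OF r(2)] by (auto intro: diff p isproj_diff[OF r(2) p(2)])
 have s: "t r + t (p - r) = t p" by (simp add: tr_diff p r)
 show ?case
 proof (cases "t r <= t p / 2")
  case True
  thus ?thesis using r p by (intro bexI[of _ r]) (auto intro: order_trans)
 next
  case False
  hence "t (p - r) <= t p / 2" using s by simp
  thus ?thesis using d p order_trans[OF d(4) p(4)] by (intro bexI[of _ "p - r"]) auto
 qed
qed

text \<open>Projections of total trace at most \<open>c\<close> are exhausted. If the limit missed
  \<open>c\<close>, halving a projection of its complement often enough would give one that still
  fits into the gap.\<close>

theorem projection_of_trace:
 assumes inf: "\<nexists>S. finite S & Q \<subseteq> span S" and c: "0 <= c" "c <= t 1"
 shows "\<exists>p\<in>Q. isproj p & t p = c"
proof -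
 have "\<exists>S W. S 0 = 0 & (\<forall>n. (S n \<in> Q & isproj (S n) & t (S n) <= c) \<and>
   W n \<in> {w \<in> Q. isproj w & w <= 1 - S n & t w <= c - t (S n)} & S (Suc n) = S n + W n) \<and>
  (\<forall>w. (\<forall>n. w \<in> {w \<in> Q. isproj w & w <= 1 - S n & t w <= c - t (S n)}) --> t w = 0)"
 proof (rule greedy_sequence[where \<Phi> = t and B = c])
  show "0 \<in> Q & isproj 0 & t 0 <= c" by (simp add: zero tr_zero c)
  fix s assume s: "s \<in> Q & isproj s & t s <= c"
  hence "0 \<in> {w \<in> Q. isproj w & w <= 1 - s & t w <= c - t s}"
   using isproj_le_one[of s] by (auto simp: zero tr_zero)
  thus "{w \<in> Q. isproj w & w <= 1 - s & t w <= c - t s} ~= {}" by blast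
  show "t s <= c" using s by blast
  fix w assume w: "w \<in> {w \<in> Q. isproj w & w <= 1 - s & t w <= c - t s}"
  show "t (s + w) = t s + t w" using s w by (simp add: tr_add)
  show "0 <= t w" using w isproj_pos by (auto intro: tr_pos)
  have "s * w = 0" using isproj_le_compl_iff[of w s] s w by blast
  hence "isproj (s + w)" using isproj_zero_prod(2)[of s w] s w by blast
  thus "s + w \<in> Q & isproj (s + w) & t (s + w) <= c" using s w by (simp add: add tr_add)
 qed
 then obtain S W where SW: "\<forall>n. (S n \<in> Q & isproj (S n) & t (S n) <= c) \<and>
   W n \<in> {w \<in> Q. isproj w & w <= 1 - S n & t w <= c - t (S n)} & S (Suc n) = S n + W n"
  and max: "\<forall>w. (\<forall>n. w \<in> {w \<in> Q. isproj w & w <= 1 - S n & t w <= c - t (S n)}) --> t w = 0"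
  by (elim exE conjE)
 have S: "S n \<in> Q" "isproj (S n)" "t (S n) <= c" "isproj (W n)" "S (Suc n) = S n + W n" for n
  using SW[rule_format, of n] by auto
 have inc: "incseq S" by (rule incseq_SucI) (simp add: S isproj_pos)
 obtain p where p: "slim S p" "!!n. S n <= p" "p <= 1"
  using increasing_slim_exists[OF inc isproj_le_one[OF S(2)]] by blast
 have pQ: "p \<in> Q" by (rule slim_closed[OF S(1) p(1)])
 have pp: "isproj p" by (rule isproj_slim[OF p(1) S(2)])
 have tp: "t p <= c" by (rule LIMSEQ_le_const2[OF tr_lim[OF S(1) inc p(1)]]) (use S(3) in blast)
 have "t p = c"
 proof (rule ccontr)
  assume "t p ~= c"
  hence lt: "t p < c" using tp by simp
  have "1 - p ~= 0" using lt c by auto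
  define q where "q = 1 - p"
  have q: "q \<in> Q" "isproj q" "q ~= 0" unfolding q_def by (intro diff one pQ, rule isproj_compl[OF pp], fact)
  have tq: "0 < t q" by (rule tr_pos_strict[OF q(1) isproj_pos[OF q(2)] q(3)])
  obtain n :: nat where n: "t q / (c - t p) < 2 ^ n" using real_arch_pow[of 2] by auto
  hence "t q / 2 ^ n < c - t p" using lt by (simp add: field_simps)
  then obtain w where w: "w \<in> Q" "isproj w" "w ~= 0" "w <= q" "t w <= c - t p"
   using small_projection[OF inf q, of n] by fastforce
  have "w <= 1 - S n" for n using w(4) p(2)[of n] unfolding q_def by (meson diff_left_mono order_trans)
  moreover have "t w <= c - t (S n)" for n using w(5) tr_mono[OF S(1) pQ p(2), of n] by simp
  ultimately have "t w = 0" using max w by blast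
  with w show False using faithful[OF w(1) isproj_pos[OF w(2)]] by simp
 qed
 thus ?thesis using pQ pp by blast
qed

end


section \<open>Algebras with a tracial vector\<close>

lemma scaleC_half_rotation: "\<i> *\<^sub>C ((1/2) *\<^sub>R ((- \<i>) *\<^sub>C y)) = (1/2) *\<^sub>R (y::'a::complex_hilbert_space)"
proof -
 have "\<i> *\<^sub>C ((- \<i>) *\<^sub>C y) = y" unfolding scaleC_scaleC by simp
 thus ?thesis by (subst scaleR_scaleC_commute[symmetric]) (simp only:)
qed

lemma real_imaginary_parts:
 "x = (1/2) *\<^sub>R (x + star x) + cscale \<i> ((1/2) *\<^sub>R cscale (- \<i>) (x - star x))"
 apply (rule oper_of_eqI)
 apply (subst appl_cop_simps(2), subst appl_cop_simps(5), subst appl_cop_simps(2), subst appl_cscale,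
   subst appl_cop_simps(5), subst appl_cscale, subst scaleC_half_rotation, subst appl_cop_simps(3),
   subst scaleR_add_right[symmetric])
 apply simp
 done

lemma complex_decomposition:
 fixes x :: "'h::complex_hilbert_space cop"
 obtains a b where "star a = a" "star b = b" "x = a + cscale \<i> b"
  "a = (1/2) *\<^sub>R (x + star x)" "b = (1/2) *\<^sub>R cscale (- \<i>) (x - star x)"
proof
 show "star ((1/2) *\<^sub>R (x + star x)) = (1/2) *\<^sub>R (x + star x)" by (simp add: star_simps add.commute)
 show "star ((1/2) *\<^sub>R cscale (- \<i>) (x - star x)) = (1/2) *\<^sub>R cscale (- \<i>) (x - star x)"
  by (rule oper_of_eqI) (simp add: star_simps scaleC_minus_left scaleC_diff_right)
 show "x = (1/2) *\<^sub>R (x + star x) + cscale \<i> ((1/2) *\<^sub>R cscale (- \<i>) (x - star x))"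
  by (rule real_imaginary_parts)
qed (rule refl)+

lemma Cauchy_if_norm_sq_le:
 fixes f :: "nat => 'v::real_normed_vector"
 assumes "!!m n. (norm (f m - f n))\<^sup>2 <= C * (1 / (real m + 1) + 1 / (real n + 1))"
 shows "Cauchy f"
proof (rule metric_CauchyI)
 fix r :: real assume r: "0 < r"
 define K where "K = \<bar>C\<bar> + 1"
 have K: "0 < K" "C <= K" by (auto simp: K_def)
 obtain N :: nat where N: "2 * K / r\<^sup>2 < real N" using reals_Archimedean2 by blast
 have "dist (f m) (f n) < r" if mn: "N <= m" "N <= n" for m n
 proof -
  have "2 * K < real N * r\<^sup>2" using N r by (simp add: field_simps)
  also have "... <= (real N + 1) * r\<^sup>2" by (intro mult_right_mono) auto
  finally have 1: "K * (2 / (real N + 1)) < r\<^sup>2" by (simp add: field_simps)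
  have "1 / (real m + 1) + 1 / (real n + 1) <= 1 / (real N + 1) + 1 / (real N + 1)"
   using mn by (intro add_mono divide_left_mono) auto
  hence "C * (1 / (real m + 1) + 1 / (real n + 1)) <= K * (2 / (real N + 1))"
   using K by (intro mult_mono) auto
  hence "(norm (f m - f n))\<^sup>2 < r\<^sup>2" using assms[of m n] 1 by linarith
  thus ?thesis using r by (simp add: dist_norm power_less_imp_less_base)
 qed
 thus "\<exists>M. \<forall>m\<ge>M. \<forall>n\<ge>M. dist (f m) (f n) < r" by blast
qed

lemma self_adjoint_rescale:
 assumes "star S = S" shows "\<exists>r T. 0 <= T & T <= 1 & S = r *\<^sub>R T - nrm S *\<^sub>R 1 & T = (1 / r) *\<^sub>R (S + nrm S *\<^sub>R 1)"
proof -
 \<comment> \<open>The summand 1 keeps \<open>r\<close> positive when \<open>S = 0\<close>.\<close>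
 define r where "r = 2 * nrm S + 1"
 have r: "0 < r" unfolding r_def using nrm_nonneg[of S] by linarith
 have b: "S <= nrm S *\<^sub>R 1" "- nrm S *\<^sub>R 1 <= S" using self_adjoint_le_nrm[OF assms] by auto
 have "S + nrm S *\<^sub>R 1 <= nrm S *\<^sub>R 1 + nrm S *\<^sub>R 1" using b(1) by (intro add_mono) auto
 also have "... = (2 * nrm S) *\<^sub>R 1" by (simp flip: scaleR_left_distrib)
 also have "... <= r *\<^sub>R 1" by (intro scaleR_right_mono) (auto simp: r_def)
 finally have "(1 / r) *\<^sub>R (S + nrm S *\<^sub>R 1) <= (1 / r) *\<^sub>R (r *\<^sub>R 1)" using r by (intro scaleR_left_mono) auto
 moreover have "0 <= S + nrm S *\<^sub>R 1" using b(2) add_right_mono[of "- nrm S *\<^sub>R 1" S "nrm S *\<^sub>R 1"] by simp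
 hence "0 <= (1 / r) *\<^sub>R (S + nrm S *\<^sub>R 1)" using r by (intro scaleR_nonneg_nonneg) auto
 ultimately show ?thesis using r by (intro exI[of _ r] exI[of _ "(1 / r) *\<^sub>R (S + nrm S *\<^sub>R 1)"]) simp
qed

text \<open>\<open>r\<close> and \<open>r'\<close> are roots of the Jordan parts and
  \<open>s\<close> is the support of the positive part. The purely algebraic form survives a star
  homomorphism, so it can be used in an image that is not yet known to be a von Neumann
  algebra.\<close>

lemma (in vn_algebra) self_adjoint_decomposition:
 assumes b: "b \<in> Q" "star b = b"
 shows "\<exists>r r' s. r \<in> Q & r' \<in> Q & s \<in> Q & star r = r & star r' = r' & isproj s & b = r * r - r' * r' & s * r = r & s * r' = 0"
proof -
 obtain p n where pn: "0 <= p" "0 <= n" "b = p - n" "p * n = 0" "n * p = 0"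
   "!!t. t * b = b * t ==> t * p = p * t & t * n = n * t"
  using jordan_decomposition[OF b(2)] by blast
 have Q: "p \<in> Q" "n \<in> Q" by (rule bicommutant_memI[OF b(1)], use pn(6) in blast)+
 define r r' where "r = psqrt p" and "r' = psqrt n"
 have r: "star r = r" "r * r = p" "r \<in> Q" "star r' = r'" "r' * r' = n" "r' \<in> Q"
  using psqrt(1,2)[OF pn(1)] psqrt(1,2)[OF pn(2)] pos_self_adjoint psqrt_mem Q pn(1,2) by (auto simp: r_def r'_def)
 obtain s where s: "s \<in> Q" "isproj s" "p * s = p" "!!z. p * z = 0 ==> s * z = 0" using support_exists[OF Q(1) pn(1)] by blast
 have "star (r * (1 - s)) * (r * (1 - s)) = star (1 - s) * (p * (1 - s))" using r by (simp add: star_mult mult.assoc flip: r(2))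
 also have "... = 0" by (simp add: right_diff_distrib s(3))
 finally have "r * (1 - s) = 0" by (rule star_mult_self_eq_0)
 hence "star (r * s) = star r" by (simp add: right_diff_distrib)
 hence "s * r = r" using s(2) r by (simp add: star_mult isproj_def)
 moreover have "star (s * r') = 0"
 proof (rule star_mult_self_eq_0)
  have "star (star (s * r')) * star (s * r') = s * (r' * r') * star s" by (simp only: star_star star_mult r(4) mult.assoc)
  thus "star (star (s * r')) * star (s * r') = 0" using s(4)[OF pn(4)] by (simp add: r(5))
 qed
 hence "s * r' = 0" using star_inj[of "s * r'" 0] by simp
 ultimately show ?thesis using r s(1,2) pn(3) by (intro exI[of _ r] exI[of _ r'] exI[of _ s]) simp
qed

text \<open>The orbit of the unit interval of \<open>Q\<close> is convex; were its point \<open>w\<close> nearest to \<open>y\<close> different from \<open>y\<close>,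
 the support projection of the positive part of an approximation to \<open>y - w\<close> would be nearer.\<close>

lemma (in star_algebra) contraction_approximation:
 assumes y: "y \<in> closure ((%x. x $ Om) ` Q)"
  and sym: "!!b c. b \<in> Q ==> c \<in> Q ==> star c = c ==> Re (cinner (star b $ Om) (c $ Om)) = Re (cinner (b $ Om) (c $ Om))"
  and symy: "!!b. b \<in> Q ==> Re (cinner (star b $ Om) y) = Re (cinner (b $ Om) y)"
  and dec: "!!b. b \<in> Q ==> star b = b ==> \<exists>r r' s. r \<in> Q & r' \<in> Q & s \<in> Q & star r = r & star r' = r' \<and>
   isproj s & b = r * r - r' * r' & s * r = r & s * r' = 0"
  and bd: "!!r. r \<in> Q ==> star r = r ==> 0 <= Re (cinner ((r * r) $ Om) y) & Re (cinner ((r * r) $ Om) y) <= (norm (r $ Om))\<^sup>2"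
 shows "\<exists>f. (\<forall>n. f n \<in> Q & 0 <= f n & f n <= 1) & (%n. f n $ Om) ----> y"
proof -
 define C where "C = {c \<in> Q. 0 <= c & c <= 1}"
 have mixC: "r *\<^sub>R c + (1 - r) *\<^sub>R d \<in> C" if "c \<in> C" "d \<in> C" "0 <= r" "r <= 1" for c d r
 proof -
  have "r *\<^sub>R c + (1 - r) *\<^sub>R d <= r *\<^sub>R 1 + (1 - r) *\<^sub>R 1" using that by (intro add_mono scaleR_left_mono) (auto simp: C_def)
  also have "... = 1" by (simp flip: scaleR_left_distrib)
  finally show ?thesis using that by (auto simp: C_def intro!: add scaleR add_nonneg_nonneg scaleR_nonneg_nonneg)
 qed
 define S where "S = (%c. c $ Om - y) ` C"
 have "convex S" unfolding convex_alt S_def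
 proof (intro ballI allI impI, elim imageE conjE)
  fix v w r c d assume "0 <= (r::real)" "r <= 1" and c: "c \<in> C" "v = c $ Om - y" and d: "d \<in> C" "w = d $ Om - y"
  hence "r *\<^sub>R d + (1 - r) *\<^sub>R c \<in> C" by (intro mixC)
  moreover have "(1 - r) *\<^sub>R v + r *\<^sub>R w = (r *\<^sub>R d + (1 - r) *\<^sub>R c) $ Om - y" by (simp add: c d algebra_simps)
  ultimately show "(1 - r) *\<^sub>R v + r *\<^sub>R w \<in> (%c. c $ Om - y) ` C" by blast
 qed
 moreover have "0 \<in> C" by (simp add: C_def zero)
 hence "S ~= {}" by (auto simp: S_def)
 ultimately have "\<exists>x d. (\<forall>n. x n \<in> S) & (\<forall>s\<in>S. d <= (norm s)\<^sup>2) & (\<forall>n. (norm (x n))\<^sup>2 <= d + 1 / (real n + 1)) \<and>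
  (\<forall>n. \<forall>s\<in>S. (norm (x n - s))\<^sup>2 <= 2 * (1 / (real n + 1)) + 2 * ((norm s)\<^sup>2 - d))"
  by (rule minimising_sequence) (simp_all add: norm_add_sq norm_diff_sq power_mult_distrib)
 then obtain x d where x: "!!n. x n \<in> S" "!!s. s \<in> S ==> d <= (norm s)\<^sup>2" "!!n. (norm (x n))\<^sup>2 <= d + 1 / (real n + 1)"
  "!!n s. s \<in> S ==> (norm (x n - s))\<^sup>2 <= 2 * (1 / (real n + 1)) + 2 * ((norm s)\<^sup>2 - d)" by blast
 have "(norm (x m - x n))\<^sup>2 <= 2 * (1 / (real m + 1) + 1 / (real n + 1))" for m n
  using x(4)[OF x(1)[of n], of m] x(3)[of n] by simp
 then obtain z where z: "x ----> z" using Cauchy_if_norm_sq_le Cauchy_convergent convergent_def by blast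
 have "\<forall>n. \<exists>c\<in>C. x n = c $ Om - y" using x(1) by (auto simp: S_def)
 then obtain f where f: "!!n. f n \<in> C" "!!n. x n = f n $ Om - y" by metis
 define w where "w = z + y"
 have fw: "(%n. f n $ Om) ----> w" using tendsto_add[OF z tendsto_const[of y]] by (simp add: f(2) w_def)
 have "(%n. d + inverse (real (Suc n))) ----> d + 0" by (intro tendsto_intros LIMSEQ_inverse_real_of_nat)
 hence nz: "(norm z)\<^sup>2 <= d + 0"
  by (rule LIMSEQ_le[OF tendsto_power[OF tendsto_norm[OF z]]]) (use x(3) in \<open>simp add: inverse_eq_divide add.commute\<close>)
 \<comment> \<open>The first-order condition at the nearest point \<open>w\<close>, read off from
   the segment towards \<open>c $ Om\<close>.\<close>
 have var: "Re (cinner (- z) (c $ Om)) <= Re (cinner (- z) w)" if c: "c \<in> C" for c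
 proof -
  define D where "D = c $ Om - w"
  have "0 <= 2 * Re (cinner z D) + r * (norm D)\<^sup>2" if r: "0 < r" "r <= 1" for r
  proof -
   have "(r *\<^sub>R c + (1 - r) *\<^sub>R f n) $ Om - y \<in> S" for n unfolding S_def by (intro imageI mixC c f) (use r in auto)
   moreover have "(%n. (norm ((r *\<^sub>R c + (1 - r) *\<^sub>R f n) $ Om - y))\<^sup>2) ----> (norm (r *\<^sub>R (c $ Om) + (1 - r) *\<^sub>R w - y))\<^sup>2"
    unfolding appl_cop_simps by (intro tendsto_intros fw)
   ultimately have "d <= (norm (r *\<^sub>R (c $ Om) + (1 - r) *\<^sub>R w - y))\<^sup>2" by (intro LIMSEQ_le_const) (use x(2) in blast)+
   also have "r *\<^sub>R (c $ Om) + (1 - r) *\<^sub>R w - y = z + r *\<^sub>R D" by (simp add: D_def w_def algebra_simps)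
   finally have "0 <= r * (2 * Re (cinner z D) + r * (norm D)\<^sup>2)"
    using nz unfolding norm_add_sq[of z] by (simp add: cinner_scaleR_right power_mult_distrib power2_eq_square algebra_simps)
   thus ?thesis using r by (simp add: zero_le_mult_iff)
  qed
  hence 1: "0 <= 2 * Re (cinner z D) + inverse (real (Suc n)) * (norm D)\<^sup>2" for n by (simp add: inverse_le_1_iff)
  have "(%n. 2 * Re (cinner z D) + inverse (real (Suc n)) * (norm D)\<^sup>2) ----> 2 * Re (cinner z D) + 0 * (norm D)\<^sup>2"
   by (intro tendsto_intros LIMSEQ_inverse_real_of_nat)
  from LIMSEQ_le_const[OF this] 1 have "0 <= 2 * Re (cinner z D) + 0 * (norm D)\<^sup>2" by blast
  thus ?thesis by (simp add: D_def cinner_diff_right cinner_minus_left)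
 qed
 \<comment> \<open>\<open>s\<close> is the support of the positive part of the real part of
   \<open>b\<close>; by \<open>bd\<close> the vector \<open>y\<close> pairs no better with
   \<open>b $ Om\<close> than \<open>s $ Om\<close> does.\<close>
 have key: "\<exists>s\<in>C. norm (s $ Om) <= norm Om & Re (cinner (b $ Om) y) <= Re (cinner (b $ Om) (s $ Om))" if b: "b \<in> Q" for b
 proof -
  define a where "a = (1/2) *\<^sub>R (b + star b)"
  have a: "a \<in> Q" "star a = a" unfolding a_def by (intro scaleR add star b) (simp add: star_simps add.commute)
  obtain r r' s where r: "r \<in> Q" "r' \<in> Q" "s \<in> Q" "star r = r" "star r' = r'" "isproj s" "a = r * r - r' * r'" "s * r = r" "s * r' = 0"
   using dec[OF a] by blast
  have s: "star s = s" using r(6) by (simp add: isproj_def)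
  have "Re (cinner (b $ Om) y) = Re (cinner (a $ Om) y)"
   using symy[OF b] by (simp add: a_def cinner_scaleR_left cinner_add_left)
  also have "... <= (norm (r $ Om))\<^sup>2" using bd[OF r(1,4)] bd[OF r(2,5)] by (simp add: r(7) cinner_diff_left)
  also have "... = Re (cinner ((s * a) $ Om) Om)"
  proof -
   have "s * a = star r * r" by (simp add: r(4,7,8,9) right_diff_distrib flip: mult.assoc)
   thus ?thesis by (simp add: norm_appl_star)
  qed
  also have "... = Re (cinner (a $ Om) (s $ Om))" using cinner_star[of s "a $ Om" Om] by (simp add: s)
  also have "... = Re (cinner (b $ Om) (s $ Om))"
   using sym[OF b r(3) s] by (simp add: a_def cinner_scaleR_left cinner_add_left)
  finally show ?thesis using r(3,6) norm_appl[of s Om] mult_right_mono[OF isproj_nrm_le[OF r(6)], of "norm Om"]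
   by (intro bexI[of _ s]) (auto simp: C_def isproj_pos isproj_le_one)
 qed
 obtain h where h: "\<forall>n. h n \<in> (%x. x $ Om) ` Q" "h ----> y" using y unfolding closure_sequential by blast
 hence "\<forall>n. \<exists>g\<in>Q. h n = g $ Om" by blast
 then obtain g where g: "!!n. g n \<in> Q" "!!n. h n = g n $ Om" by metis
 define b where "b n = g n - f n" for n
 have bQ: "b n \<in> Q" for n unfolding b_def using g(1) f(1) by (intro diff) (auto simp: C_def)
 have bz: "(%n. b n $ Om) ----> - z" using tendsto_diff[OF h(2) fw] by (simp add: b_def g(2) w_def)
 have "Re (cinner (b n $ Om) y) <= norm (b n $ Om + z) * norm Om + Re (cinner (- z) w)" for n
 proof -
  obtain s where s: "s \<in> C" "norm (s $ Om) <= norm Om" "Re (cinner (b n $ Om) y) <= Re (cinner (b n $ Om) (s $ Om))" using key[OF bQ] by blast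
  have "Re (cinner (b n $ Om + z) (s $ Om)) <= norm (b n $ Om + z) * norm (s $ Om)" using Re_cinner_le abs_le_D1 by blast
  also have "... <= norm (b n $ Om + z) * norm Om" by (intro mult_left_mono s) simp
  finally show ?thesis using s(3) var[OF s(1)] by (simp add: cinner_add_left cinner_minus_left)
 qed
 moreover have "(%n. Re (cinner (b n $ Om) y)) ----> Re (cinner (- z) y)" by (intro tendsto_Re tendsto_cinner bz tendsto_const)
 moreover have "(%n. norm (b n $ Om + z) * norm Om + Re (cinner (- z) w)) ----> norm (- z + z) * norm Om + Re (cinner (- z) w)"
  by (intro tendsto_intros bz)
 ultimately have "Re (cinner (- z) y) <= norm (- z + z) * norm Om + Re (cinner (- z) w)" by (intro LIMSEQ_le) auto
 hence "(norm z)\<^sup>2 <= 0" by (simp add: w_def cinner_add_right cinner_minus_left cinner_self_Re)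
 hence "w = y" by (simp add: w_def)
 thus ?thesis using f(1) fw by (intro exI[of _ f]) (simp add: C_def)
qed

text \<open>\<open>M\<close> is only a star algebra, because the image of an algebra in its trace
  representation must be studied before it is known to equal its bicommutant.\<close>

locale tracial_vector = star_algebra M for M :: "'k::complex_hilbert_space cop set" +
 fixes Om :: 'k
 assumes cyclic: "closure ((%x. x $ Om) ` M) = UNIV"
  and tracial: "x \<in> M ==> y \<in> M ==> cinner (x $ y $ Om) Om = cinner (y $ x $ Om) Om"
  and norm_Om: "norm Om = 1"
begin

lemma cinner_star_swap:
 assumes "x \<in> M" "y \<in> M" shows "cinner (x $ Om) (y $ Om) = cinner (star y $ Om) (star x $ Om)"
 using tracial[OF star[OF assms(2)] assms(1)] by (simp add: cinner_star)

lemma norm_star_Om: "x \<in> M ==> norm (star x $ Om) = norm (x $ Om)"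
 using cinner_star_swap[of x x] unfolding cinner_norm of_real_eq_iff by (simp add: power2_eq_iff_nonneg)

lemma norm_right_mult: "x \<in> M ==> m \<in> M ==> norm (x $ m $ Om) <= nrm m * norm (x $ Om)"
proof -
 assume x: "x \<in> M" "m \<in> M"
 have "norm (x $ m $ Om) = norm (star m $ star x $ Om)"
  using norm_star_Om[OF mult[OF x]] by (simp add: star_mult)
 also have "... <= nrm m * norm (star x $ Om)" using norm_appl[of "star m" "star x $ Om"] by simp
 finally show ?thesis by (simp add: norm_star_Om x)
qed

lemma separating: "x \<in> M ==> x $ Om = 0 ==> x = 0"
proof (rule eq_on_dense[OF cyclic])
 fix d assume x: "x \<in> M" "x $ Om = 0" and "d \<in> (%x. x $ Om) ` M"
 then obtain m where m: "m \<in> M" "d = m $ Om" by blast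
 show "x $ d = 0 $ d" using norm_right_mult[OF x(1) m(1)] x(2) m(2) by simp
qed

lemma separating_eq: "x \<in> M ==> y \<in> M ==> x $ Om = y $ Om ==> x = y"
 using separating[OF diff, of x y] by simp

lemma comm_separating: "S \<in> comm M ==> T \<in> comm M ==> S $ Om = T $ Om ==> S = T"
proof (rule eq_on_dense[OF cyclic])
 fix d assume a: "S \<in> comm M" "T \<in> comm M" "S $ Om = T $ Om" and "d \<in> (%x. x $ Om) ` M"
 then obtain m where m: "m \<in> M" "d = m $ Om" by blast
 have "S $ d = (m * S) $ Om" "T $ d = (m * T) $ Om" using commD[OF a(1) m(1)] commD[OF a(2) m(1)] m(2) by simp_all
 thus "S $ d = T $ d" using a(3) by simp
qed

lemma dense_sequence: "\<exists>f. (\<forall>n. f n \<in> M) & (%n. f n $ Om) ----> v"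
proof -
 have "v \<in> closure ((%x. x $ Om) ` M)" using cyclic by simp
 then obtain g where g: "\<forall>n. g n \<in> (%x. x $ Om) ` M" "g ----> v" unfolding closure_sequential by blast
 hence "\<forall>n. \<exists>x\<in>M. g n = x $ Om" by blast
 then obtain f where f: "!!n. f n \<in> M" "!!n. g n = f n $ Om" by metis
 have "g = (%n. f n $ Om)" using f(2) by blast
 thus ?thesis using f(1) g(2) by blast
qed

text \<open>The map is prescribed on elements of \<open>M\<close> rather than on vectors; the norm
  bound makes it well defined on the dense orbit of \<open>Om\<close> and continuous there.\<close>

lemma extension_exists:
 fixes G :: "'k cop => 'k"
 assumes Gadd: "!!x y. x \<in> M ==> y \<in> M ==> G (x + y) = G x + G y"
  and Gsc: "!!x c. x \<in> M ==> G (cscale c x) = c *\<^sub>C G x"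
  and Gbd: "!!x. x \<in> M ==> norm (G x) <= C * norm (x $ Om)"
 shows "\<exists>T. \<forall>x\<in>M. T $ x $ Om = G x"
proof -
 have gd: "G (x - y) = G x - G y" if "x \<in> M" "y \<in> M" for x y
  using Gadd[OF that(1) cscale[OF that(2)], of "-1"] Gsc[OF that(2), of "-1"] by (simp add: cscale_minus_one scaleC_minus_left)
 obtain f where f: "!!v n. f v n \<in> M" "!!v. (%n. f v n $ Om) ----> v" using dense_sequence by metis
 have key: "(%n. G (h n) - G (g n)) ----> 0"
  if hg: "!!n. h n \<in> M" "!!n. g n \<in> M" and l: "(%n. h n $ Om) ----> v" "(%n. g n $ Om) ----> v" for h g :: "nat => 'k cop" and v
 proof (rule Lim_null_comparison)
  show "\<forall>\<^sub>F n in sequentially. norm (G (h n) - G (g n)) <= C * norm (h n $ Om - g n $ Om)"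
   using Gbd[OF diff[OF hg]] gd[OF hg] by (intro always_eventually) simp
  show "(%n. C * norm (h n $ Om - g n $ Om)) ----> 0"
   using tendsto_mult_right_zero[OF tendsto_norm_zero[OF LIM_zero[OF tendsto_diff[OF l]]], of C] by simp
 qed
 have "Cauchy (%n. G (f v n))" for v
 proof (rule metric_CauchyI)
  fix e :: real assume e: "e > 0"
  define K where "K = \<bar>C\<bar> + 1"
  have K: "K > 0" "C <= K" by (simp_all add: K_def)
  have "Cauchy (%n. f v n $ Om)" by (rule LIMSEQ_imp_Cauchy[OF f(2)])
  then obtain N where N: "!!m n. m \<ge> N ==> n \<ge> N ==> dist (f v m $ Om) (f v n $ Om) < e / K"
   using e K by (metis metric_CauchyD divide_pos_pos)
  have "dist (G (f v m)) (G (f v n)) < e" if "m \<ge> N" "n \<ge> N" for m n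
  proof -
   have "dist (G (f v m)) (G (f v n)) <= C * dist (f v m $ Om) (f v n $ Om)"
    using Gbd[OF diff[OF f(1) f(1)], of v m v n] gd[OF f(1) f(1)] by (simp add: dist_norm)
   also have "... <= K * dist (f v m $ Om) (f v n $ Om)" by (intro mult_right_mono K) simp
   also have "... < K * (e / K)" by (intro mult_strict_left_mono N that K)
   finally show ?thesis using K by simp
  qed
  thus "\<exists>M. \<forall>m\<ge>M. \<forall>n\<ge>M. dist (G (f v m)) (G (f v n)) < e" by blast
 qed
 hence "\<exists>l. (%n. G (f v n)) ----> l" for v using Cauchy_convergent convergent_def by blast
 then obtain T where T: "!!v. (%n. G (f v n)) ----> T v" by metis
 have lim: "(%n. G (h n)) ----> T v" if "!!n. h n \<in> M" "(%n. h n $ Om) ----> v" for h :: "nat => 'k cop" and v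
  using tendsto_add[OF key[OF that(1) f(1) that(2) f(2)] T[of v]] by simp
 have "\<exists>t. \<forall>v. t $ v = T v"
 proof (rule operator_exists)
  fix v w c
  have "(%n. G (f v n + f w n)) ----> T (v + w)"
   by (rule lim) (use f in \<open>auto intro: add tendsto_add\<close>)
  thus "T (v + w) = T v + T w" using tendsto_add[OF T T, of v w] by (simp add: Gadd f LIMSEQ_unique)
  have "(%n. G (cscale c (f v n))) ----> T (c *\<^sub>C v)" by (rule lim) (use f in \<open>auto intro: cscale tendsto_scaleC\<close>)
  thus "T (c *\<^sub>C v) = c *\<^sub>C T v" using tendsto_scaleC[OF T, of c v] by (simp add: Gsc f LIMSEQ_unique)
  show "norm (T v) <= C * norm v"
  proof (rule LIMSEQ_le[OF tendsto_norm[OF T]])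
   show "(%n. C * norm (f v n $ Om)) ----> C * norm v" by (intro tendsto_mult tendsto_const tendsto_norm f)
  qed (use Gbd f in blast)
 qed
 then obtain t where t: "!!v. t $ v = T v" by blast
 have "t $ x $ Om = G x" if x: "x \<in> M" for x
  using lim[of "%n. x" "x $ Om"] x by (simp add: t LIMSEQ_const_iff)
 thus ?thesis by blast
qed

text \<open>Right multiplication by \<open>m\<close>, that is, the conjugate of
  \<open>star m\<close> by the modular conjugation; it reverses products.\<close>

definition rho :: "'k cop => 'k cop" where
 "rho m = (SOME T. \<forall>x\<in>M. T $ x $ Om = x $ m $ Om)"

lemma rho_orbit: "m \<in> M ==> x \<in> M ==> rho m $ x $ Om = x $ m $ Om"
proof -
 assume m: "m \<in> M" and x: "x \<in> M"
 have "\<exists>T. \<forall>x\<in>M. T $ x $ Om = x $ m $ Om"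
  by (rule extension_exists[where C = "nrm m"]) (simp_all add: norm_right_mult m)
 from someI_ex[OF this] x show ?thesis unfolding rho_def by blast
qed

lemma rho_Om: "m \<in> M ==> rho m $ Om = m $ Om"
 using rho_orbit[OF _ one, of m] by simp

lemma orbit_eqI: "(!!x. x \<in> M ==> S $ x $ Om = T $ x $ Om) ==> S = T"
 by (rule eq_on_dense[OF cyclic]) blast

lemma rho_comm: "m \<in> M ==> rho m \<in> comm M"
proof (rule commI)
 fix x assume m: "m \<in> M" and x: "x \<in> M"
 show "x * rho m = rho m * x"
 proof (rule orbit_eqI)
  fix y assume y: "y \<in> M"
  show "(x * rho m) $ y $ Om = (rho m * x) $ y $ Om" using rho_orbit[OF m mult[OF x y]] by (simp add: rho_orbit m y)
 qed
qed

lemma rho_eqI: "m \<in> M ==> T \<in> comm M ==> T $ Om = m $ Om ==> rho m = T"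
 by (rule comm_separating) (simp_all add: rho_comm rho_Om)

lemma rho_commutes: "m \<in> M ==> x \<in> M ==> rho m * x = x * rho m"
 using commD[OF rho_comm] by simp

sublocale C: star_algebra "comm M" by (rule star_algebra_comm)

lemma rho_one [simp]: "rho 1 = 1"
 by (rule rho_eqI) (simp_all add: one C.one)

lemma rho_add: "m \<in> M ==> n \<in> M ==> rho (m + n) = rho m + rho n"
 by (rule rho_eqI) (simp_all add: add C.add rho_comm rho_Om)

lemma rho_cscale: "m \<in> M ==> rho (cscale c m) = cscale c (rho m)"
 by (rule rho_eqI) (simp_all add: cscale C.cscale rho_comm rho_Om)

lemma rho_scaleR: "m \<in> M ==> rho (r *\<^sub>R m) = r *\<^sub>R rho m"
 by (rule rho_eqI) (simp_all add: scaleR C.scaleR rho_comm rho_Om)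

lemma rho_diff: "m \<in> M ==> n \<in> M ==> rho (m - n) = rho m - rho n"
 by (rule rho_eqI) (simp_all add: diff C.diff rho_comm rho_Om)

lemma rho_zero [simp]: "rho 0 = 0"
 by (rule rho_eqI) (simp_all add: zero C.zero)

lemma rho_mult: "m \<in> M ==> n \<in> M ==> rho (m * n) = rho n * rho m"
 by (rule rho_eqI) (simp_all add: mult C.mult rho_comm rho_Om rho_orbit)

lemma rho_star: "m \<in> M ==> rho (star m) = star (rho m)"
proof -
 assume m: "m \<in> M"
 have "star (rho m) = rho (star m)"
 proof (rule orbit_eqI)
  fix x assume x: "x \<in> M"
  have "cinner (star (rho m) $ x $ Om - x $ star m $ Om) d = 0" if d: "d \<in> (%x. x $ Om) ` M" for d
  proof -
   obtain y where y: "y \<in> M" "d = y $ Om" using d by blast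
   have "cinner (star (rho m) $ x $ Om) d = cinner (x $ Om) (y $ m $ Om)"
    by (simp add: y cinner_star' rho_orbit m)
   also have "... = cinner (star m $ (star y * x) $ Om) Om" by (simp add: cinner_star')
   also have "... = cinner ((star y * x) $ star m $ Om) Om" by (rule tracial) (intro star mult x y m)+
   also have "... = cinner (x $ star m $ Om) d" by (simp add: y cinner_star')
   finally show ?thesis by (simp add: cinner_diff_left)
  qed
  hence z: "cinner d (star (rho m) $ x $ Om - x $ star m $ Om) = 0" if "d \<in> (%x. x $ Om) ` M" for d
   using that cinner_commute complex_cnj_zero by metis
  obtain f where f: "!!n. f n \<in> M" "(%n. f n $ Om) ----> star (rho m) $ x $ Om - x $ star m $ Om"
   using dense_sequence by blast
  have "(%n. cinner (f n $ Om) (star (rho m) $ x $ Om - x $ star m $ Om)) ---->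
   cinner (star (rho m) $ x $ Om - x $ star m $ Om) (star (rho m) $ x $ Om - x $ star m $ Om)"
   by (intro tendsto_cinner f tendsto_const)
  moreover have "cinner (f n $ Om) (star (rho m) $ x $ Om - x $ star m $ Om) = 0" for n by (rule z) (use f in blast)
  ultimately have "star (rho m) $ x $ Om - x $ star m $ Om = 0" by (simp add: LIMSEQ_const_iff cinner_norm)
  thus "star (rho m) $ x $ Om = rho (star m) $ x $ Om" by (simp add: rho_orbit star m x)
 qed
 thus ?thesis by simp
qed

lemma isproj_rho: "p \<in> M ==> isproj p ==> isproj (rho p)"
 by (simp add: isproj_def flip: rho_star rho_mult)

text \<open>Convergence at \<open>Om\<close> spreads over the dense orbit because
  \<open>f n $ m $ Om = rho m $ f n $ Om\<close>.\<close>

lemma bounded_orbit_limit: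
 assumes f: "!!n. f n \<in> M" "!!n. nrm (f n) <= K" "(%n. f n $ Om) ----> v"
 shows "\<exists>r. slim f r & r $ Om = v"
proof -
 have "convergent (%n. f n $ w)" for w
 proof (rule convergent_dense[OF f(2) cyclic])
  fix d assume "d \<in> (%x. x $ Om) ` M"
  then obtain m where m: "m \<in> M" "d = m $ Om" by blast
  have "f n $ d = rho m $ f n $ Om" for n by (simp add: m rho_orbit f)
  thus "convergent (%n. f n $ d)" using convergentI[OF tendsto_appl[OF f(3), of "rho m"]] by simp
 qed
 from slim_exists[OF this f(2)] obtain r where r: "slim f r" by blast
 show ?thesis using r LIMSEQ_unique[OF slimD[OF r] f(3)] by blast
qed

end

locale standard_form = tracial_vector M Om + vn_algebra M for M Om
begin

text \<open>Positivity tested on \<open>A Om\<close> alone suffices: at \<open>n $ Om\<close>, with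
  \<open>n\<close> the negative part of \<open>x\<close>, the form of \<open>x\<close> is minus that
  of \<open>n\<close>, which forces \<open>n $ Om = 0\<close>.\<close>

lemma order_reflection:
 assumes A: "vn_algebra A" "A \<subseteq> M" and x: "x \<in> A" "star x = x" "!!a. a \<in> A ==> 0 <= qf x (a $ Om)"
 shows "0 <= x"
proof -
 interpret A: vn_algebra A by (rule A(1))
 obtain p n where pn: "0 <= p" "0 <= n" "x = p - n" "p * n = 0" "n * p = 0"
   "!!t. t * x = x * t ==> t * p = p * t & t * n = n * t"
  using jordan_decomposition[OF x(2)] by blast
 have nA: "n \<in> A" by (rule A.bicommutant_memI[OF x(1)]) (use pn(6) in blast)
 have "p $ n $ Om = 0" using pn(4) by (simp flip: appl_mult)
 hence "qf x (n $ Om) = - qf n (n $ Om)" by (simp add: qf_def pn(3) cinner_minus_left)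
 moreover have "0 <= qf n (n $ Om)" using pn(2) pos_iff by blast
 ultimately have "qf n (n $ Om) = 0" using x(3)[OF nA] by simp
 hence "n $ n $ Om = 0" using norm_pos_appl_nrm[OF pn(2), of "n $ Om"] by simp
 hence "cinner (n $ Om) (n $ Om) = 0" using cinner_star'[of n "n $ Om" Om] pos_self_adjoint[OF pn(2)] by simp
 hence "n $ Om = 0" by (simp add: cinner_norm)
 hence "n = 0" using separating nA A(2) by blast
 thus ?thesis using pn(1,3) by simp
qed

end


section \<open>Conditional expectations in the standard form\<close>

locale inclusion = standard_form M Om + A: vn_algebra A
 for M A :: "'k::complex_hilbert_space cop set" and Om :: 'k +
 assumes AM: "A \<subseteq> M"
begin

definition e where "e = orbp A Om"

lemma A_M: "a \<in> A ==> a \<in> M" using AM by blast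

lemma comm_MA: "x \<in> comm M ==> x \<in> comm A" using comm_antimono[OF AM] by blast

sublocale N: vn_algebra "comm A" by (rule A.comm_vn)

lemma e_proj: "isproj e" and e_comm: "e \<in> comm A"
 unfolding e_def by (rule A.orbp, rule A.orbp_comm)

lemma e_star: "star e = e" and e_e: "e * e = e"
 using e_proj by (simp_all add: isproj_def)

lemma e_e_appl [simp]: "e $ e $ v = e $ v"
 by (rule isproj_appl[OF e_proj])

lemma e_orbit: "a \<in> A ==> e $ a $ Om = a $ Om"
 unfolding e_def by (rule A.orbp_orbit)

lemma e_Om [simp]: "e $ Om = Om"
 using e_orbit[OF A.one] by simp

lemma e_A: "a \<in> A ==> e * a = a * e"
 using commD[OF e_comm] by simp

lemma e_approx: "\<exists>f. (\<forall>n. f n \<in> A) & (%n. f n $ Om) ----> e $ v"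
proof -
 have "e $ v \<in> closure ((%x. x $ Om) ` A)" unfolding e_def by (rule A.orbp)
 then obtain g where g: "\<forall>n. g n \<in> (%x. x $ Om) ` A" "g ----> e $ v" unfolding closure_sequential by blast
 hence "\<forall>n. \<exists>x\<in>A. g n = x $ Om" by blast
 then obtain f where f: "!!n. f n \<in> A" "!!n. g n = f n $ Om" by metis
 have "g = (%n. f n $ Om)" using f(2) by blast
 thus ?thesis using f(1) g(2) by blast
qed

lemma e_limit: "(!!n. f n \<in> A) ==> (%n. f n $ Om) ----> v ==> e $ v = v"
 using tendsto_appl[of "%n. f n $ Om" v sequentially e] by (simp add: e_orbit LIMSEQ_unique)

lemma e_eqI:
 assumes "!!a. a \<in> A ==> S $ a $ Om = T $ a $ Om" shows "S * e = T * e"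
proof (rule oper_of_eqI)
 fix v
 obtain f where f: "!!n. f n \<in> A" "(%n. f n $ Om) ----> e $ v" using e_approx by blast
 have "(%n. S $ f n $ Om) ----> T $ e $ v" using tendsto_appl[OF f(2), of T] by (simp add: assms f(1))
 thus "(S * e) $ v = (T * e) $ v" using LIMSEQ_unique[OF tendsto_appl[OF f(2)]] by simp
qed

lemma e_eqI_comm:
 assumes "S \<in> comm A" "T \<in> comm A" "S $ Om = T $ Om" shows "S * e = T * e"
proof (rule e_eqI)
 fix a assume a: "a \<in> A"
 have "S $ a $ Om = (a * S) $ Om" "T $ a $ Om = (a * T) $ Om"
  using commD[OF assms(1) a] commD[OF assms(2) a] by simp_all
 thus "S $ a $ Om = T $ a $ Om" using assms(3) by simp
qed

lemma rho_N: "m \<in> M ==> rho m \<in> comm A"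
 by (rule comm_MA[OF rho_comm])

lemma rho_e: "a \<in> A ==> rho a * e = e * rho a"
proof -
 have inv: "rho a $ v \<in> range (appl e)" if a: "a \<in> A" and v: "v \<in> range (appl e)" for a v
 proof -
  obtain w where w: "v = e $ w" using v by blast
  obtain f where f: "!!n. f n \<in> A" "(%n. f n $ Om) ----> e $ w" using e_approx by blast
  have "(%n. (f n * a) $ Om) ----> rho a $ v" using tendsto_appl[OF f(2), of "rho a"]
   by (simp add: w rho_orbit A_M a f(1))
  from e_limit[OF A.mult[OF f(1) a] this] show ?thesis by (metis rangeI)
 qed
 assume a: "a \<in> A"
 show ?thesis
 proof (rule invariant_projection_commutes[OF e_proj, where S = "range (appl e)"])
  show "star (rho a) $ v \<in> range (appl e)" if "v \<in> range (appl e)" for v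
   using inv[OF A.star[OF a] that] rho_star[OF A_M[OF a]] by simp
 qed (use inv[OF a] in auto)
qed

text \<open>The commutation theorem: the corner of the commutant of \<open>A\<close> cut out by \<open>e\<close> acts on \<open>\<Omega>\<close> as \<open>A\<close>
 does.\<close>

lemma corner_orbit_contraction:
 assumes S: "S \<in> comm A" "e * S = S * e" "0 <= S" "S <= 1"
 shows "\<exists>a\<in>A. S $ Om = a $ Om"
proof -
 have sS: "star S = S" by (rule pos_self_adjoint[OF S(3)])
 have Sa: "a $ S $ Om = S $ a $ Om" if "a \<in> A" for a
  using arg_cong[OF commD[OF S(1) that], of "%x. x $ Om"] by simp
 have "\<exists>f. (\<forall>n. f n \<in> A & 0 <= f n & f n <= 1) & (%n. f n $ Om) ----> S $ Om"
 proof (rule A.contraction_approximation[OF _ _ _ A.self_adjoint_decomposition])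
  have "e $ S $ Om = S $ Om" using arg_cong[OF S(2), of "%x. x $ Om"] by simp
  then obtain f where "!!n. f n \<in> A" "(%n. f n $ Om) ----> S $ Om" using e_approx[of "S $ Om"] by metis
  thus "S $ Om \<in> closure ((%x. x $ Om) ` A)" unfolding closure_sequential by (intro exI[of _ "%n. f n $ Om"]) auto
  show "Re (cinner (star b $ Om) (c $ Om)) = Re (cinner (b $ Om) (c $ Om))" if "b \<in> A" "c \<in> A" "star c = c" for b c
   using cinner_star_swap[of "star b" c] that by (simp add: star A_M cinner_commute_Re)
  show "Re (cinner (star b $ Om) (S $ Om)) = Re (cinner (b $ Om) (S $ Om))" if "b \<in> A" for b
   using cinner_star[of S Om "b $ Om"] cinner_star'[of b Om "S $ Om"] Sa[OF that] by (simp add: sS cinner_commute_Re)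
  fix r assume r: "r \<in> A" "star r = r"
  have "Re (cinner ((r * r) $ Om) (S $ Om)) = qf S (r $ Om)"
   using cinner_star[of r "r $ Om" "S $ Om"] by (simp add: r Sa qf_def cinner_commute_Re)
  thus "0 <= Re (cinner ((r * r) $ Om) (S $ Om)) & Re (cinner ((r * r) $ Om) (S $ Om)) <= (norm (r $ Om))\<^sup>2"
   using qf_mono[OF S(4), of "r $ Om"] S(3) unfolding pos_iff by (simp add: qf_simps)
 qed
 then obtain f where "\<forall>n. f n \<in> A & 0 <= f n & f n <= 1" and flim: "(%n. f n $ Om) ----> S $ Om" by (elim exE conjE)
 hence f: "f n \<in> A" "0 <= f n" "f n <= 1" for n by simp_all
 have nf: "nrm (f n) <= 1" for n using nrm_pos_le[of "f n" 1] f(2,3) by simp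
 from bounded_orbit_limit[OF A_M[OF f(1)] nf flim] obtain a where a: "slim f a" "a $ Om = S $ Om" by blast
 have "a \<in> A" by (rule A.slim_closed[OF f(1) a(1)])
 thus ?thesis using a(2) by (intro bexI[of _ a]) simp_all
qed

lemma corner_orbit_self_adjoint:
 assumes S: "S \<in> comm A" "e * S = S * e" "star S = S"
 shows "\<exists>a\<in>A. S $ Om = a $ Om"
proof -
 obtain r T where T: "0 <= T" "T <= 1" "S = r *\<^sub>R T - nrm S *\<^sub>R 1" "T = (1 / r) *\<^sub>R (S + nrm S *\<^sub>R 1)"
  using self_adjoint_rescale[OF S(3)] by blast
 have "\<exists>a\<in>A. T $ Om = a $ Om"
  by (rule corner_orbit_contraction[OF _ _ T(1,2)]) (use S in \<open>auto simp: T(4) algebra_simps intro: N.scaleR N.add N.one\<close>)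
 then obtain a where "a \<in> A" "T $ Om = a $ Om" by blast
 thus ?thesis by (intro bexI[of _ "r *\<^sub>R a - nrm S *\<^sub>R 1"] A.diff A.scaleR A.one) (subst T(3), simp)
qed

theorem corner_orbit:
 assumes S: "S \<in> comm A" "e * S = S * e"
 shows "\<exists>a\<in>A. S $ Om = a $ Om & S * e = rho a * e"
proof -
 have sS: "e * star S = star S * e" using arg_cong[OF S(2), of star] by (simp add: star_mult e_star)
 obtain X Y where XY: "star X = X" "star Y = Y" "S = X + cscale \<i> Y"
  "X = (1/2) *\<^sub>R (S + star S)" "Y = (1/2) *\<^sub>R cscale (- \<i>) (S - star S)" by (rule complex_decomposition)
 have "\<exists>a\<in>A. X $ Om = a $ Om"
  by (rule corner_orbit_self_adjoint[OF _ _ XY(1)])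
   (use S sS in \<open>auto simp: XY(4) algebra_simps intro: N.scaleR N.add N.star\<close>)
 moreover have "\<exists>b\<in>A. Y $ Om = b $ Om"
  by (rule corner_orbit_self_adjoint[OF _ _ XY(2)])
   (use S sS in \<open>auto simp: XY(5) algebra_simps cscale_mult intro: N.scaleR N.diff N.star N.cscale\<close>)
 ultimately obtain a b where ab: "a \<in> A" "X $ Om = a $ Om" "b \<in> A" "Y $ Om = b $ Om" by blast
 define c where "c = a + cscale \<i> b"
 have cA: "c \<in> A" unfolding c_def by (intro A.add A.cscale ab)
 have "S $ Om = X $ Om + \<i> *\<^sub>C (Y $ Om)" by (subst XY(3)) simp
 hence "S $ Om = c $ Om" by (simp add: c_def ab)
 moreover from this have "S * e = rho c * e" by (intro e_eqI_comm S rho_N A_M cA) (simp add: rho_Om A_M cA)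
 ultimately show ?thesis using cA by blast
qed

end


lemma (in standard_form) commutation_theorem:
 assumes "S \<in> comm M" shows "\<exists>m\<in>M. S = rho m"
proof -
 interpret I: inclusion M M Om by unfold_locales (rule bicomm, simp)
 have "I.e = 1" by (rule orbit_eqI) (simp add: I.e_orbit)
 with I.corner_orbit[OF assms] obtain a where "a \<in> M" "S $ Om = a $ Om" by auto
 thus ?thesis using rho_eqI[OF _ assms] by metis
qed

lemma (in standard_form) vector_eq_0I:
 assumes "!!y. y \<in> M ==> Re (cinner w (y $ Om)) = 0" shows "w = 0"
proof -
 obtain f where f: "!!n. f n \<in> M" "(%n. f n $ Om) ----> w" using dense_sequence by blast
 have "(%n. Re (cinner w (f n $ Om))) ----> Re (cinner w w)" by (intro tendsto_Re tendsto_cinner tendsto_const f)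
 thus ?thesis using assms[OF f(1)] by (simp add: LIMSEQ_const_iff cinner_self_Re)
qed

context inclusion
begin

definition E :: "'k cop => 'k cop" where "E x = (SOME a. a \<in> A & a $ Om = e $ x $ Om)"

text \<open>The compression \<open>e * rho x * e\<close> commutes with \<open>A\<close> and with
  \<open>e\<close>, so \<open>corner_orbit\<close> represents its value at \<open>Om\<close> by an
  element of \<open>A\<close>.\<close>

lemma E: assumes x: "x \<in> M" shows E_mem: "E x \<in> A" and E_Om: "E x $ Om = e $ x $ Om"
proof -
 have S: "e * rho x * e \<in> comm A" by (intro N.mult e_comm rho_N x)
 have c: "e * (e * rho x * e) = e * rho x * e * e" by (simp add: mult.assoc e_e) (simp add: e_e flip: mult.assoc)
 obtain a where "a \<in> A" "(e * rho x * e) $ Om = a $ Om" using corner_orbit[OF S c] by blast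
 hence "\<exists>a. a \<in> A & a $ Om = e $ x $ Om" by (intro exI[of _ a]) (simp add: rho_Om x)
 from someI_ex[OF this] show "E x \<in> A" "E x $ Om = e $ x $ Om" unfolding E_def by blast+
qed

lemma E_eqI: "x \<in> M ==> a \<in> A ==> a $ Om = e $ x $ Om ==> E x = a"
 by (rule separating_eq) (simp_all add: E A_M)

lemma E_id: "a \<in> A ==> E a = a"
 by (rule E_eqI) (simp_all add: A_M e_orbit)

lemma E_add: "x \<in> M ==> y \<in> M ==> E (x + y) = E x + E y"
 by (rule E_eqI) (simp_all add: E add A.add)

lemma E_diff: "x \<in> M ==> y \<in> M ==> E (x - y) = E x - E y"
 by (rule E_eqI) (simp_all add: E diff A.diff)

lemma E_scaleR: "x \<in> M ==> E (r *\<^sub>R x) = r *\<^sub>R E x"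
 by (rule E_eqI) (simp_all add: E scaleR A.scaleR)

lemma E_left: "a \<in> A ==> x \<in> M ==> E (a * x) = a * E x"
proof (rule E_eqI)
 assume a: "a \<in> A" and x: "x \<in> M"
 show "(a * E x) $ Om = e $ (a * x) $ Om"
  using arg_cong[OF e_A[OF a], of "%s. s $ x $ Om"] by (simp add: E x)
qed (auto intro: mult A_M A.mult E)

lemma E_right: "a \<in> A ==> x \<in> M ==> E (x * a) = E x * a"
proof (rule E_eqI)
 assume a: "a \<in> A" and x: "x \<in> M"
 show "(E x * a) $ Om = e $ (x * a) $ Om"
  using arg_cong[OF rho_e[OF a], of "%s. s $ x $ Om"]
   rho_orbit[OF A_M[OF a] A_M[OF E_mem[OF x]]] rho_orbit[OF A_M[OF a] x] by (simp add: E x)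
qed (auto intro: mult A_M A.mult E)

lemma e_M_e: "x \<in> M ==> e * x * e = E x * e"
proof (rule e_eqI)
 fix a assume x: "x \<in> M" and a: "a \<in> A"
 show "(e * x) $ a $ Om = E x $ a $ Om" using E_Om[OF mult[OF x A_M[OF a]]] E_right[OF a x] by simp
qed

lemma e_rho_e: "x \<in> M ==> e * rho x * e = rho (E x) * e"
 by (rule e_eqI_comm) (simp_all add: E rho_Om A_M N.mult e_comm rho_N)

lemma E_star: assumes x: "x \<in> M" shows "E (star x) = star (E x)"
proof (rule E_eqI)
 have "e * star x * e = star (e * x * e)" by (simp add: star_mult e_star mult.assoc)
 also have "... = star (E x) * e" unfolding e_M_e[OF x] using e_A[OF A.star[OF E_mem[OF x]]] by (simp add: star_mult e_star)
 finally have "e * star x * e = star (E x) * e" .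
 from arg_cong[OF this, of "%s. s $ Om"] show "star (E x) $ Om = e $ star x $ Om" by simp
qed (auto intro: star A.star E x)

definition tau :: "'k cop => real" where "tau x = qf x Om"

lemma tau_star_mult: "tau (star x * x) = (norm (x $ Om))\<^sup>2"
 by (simp add: tau_def qf_simps)

lemma tau_E: "x \<in> M ==> tau (E x) = tau x"
 using cinner_star[of e "x $ Om" Om] by (simp add: tau_def qf_def E e_star)

lemma tau_one [simp]: "tau 1 = 1"
 by (simp add: tau_def qf_simps norm_Om)

lemma rtrace_tau: "rtrace M tau"
 unfolding rtrace_def
proof (intro conjI ballI allI impI)
 fix x y assume xy: "x \<in> M" "y \<in> M"
 show "tau (x * y) = tau (y * x)" using tracial[OF xy] by (simp add: tau_def qf_def)
next
 fix x show "tau (star x) = tau x"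
  by (simp add: tau_def qf_def cinner_star' cinner_commute_Re)
next
 fix f x assume "(\<forall>n. f n \<in> M) & incseq f & slim f x"
 thus "(%n. tau (f n)) ----> tau x" unfolding tau_def by (intro slim_qf) blast
qed (auto simp: tau_def qf_simps pos_iff)

lemma rtrace_restrict: "rtrace P s ==> R \<subseteq> P ==> rtrace R s"
 unfolding rtrace_def by (meson subsetD)

lemma finite_algebra_tau: "vn_algebra P ==> P \<subseteq> M ==> finite_algebra P tau"
proof (intro finite_algebra.intro traced_algebra.intro traced_algebra_axioms.intro finite_algebra_axioms.intro)
 assume P: "vn_algebra P" "P \<subseteq> M"
 show "rtrace P tau" by (rule rtrace_restrict[OF rtrace_tau P(2)])
 fix x assume x: "x \<in> P" "0 <= x" "tau x = 0"
 have "x $ Om = 0" using norm_pos_appl_nrm[OF x(2), of Om] x(3) by (simp add: tau_def)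
 thus "x = 0" using separating x P by blast
qed

end

section \<open>Traces on the commutant and pushing down\<close>

locale subfactor_inclusion = inclusion + MF: factor_algebra M + AF: factor_algebra A
begin

sublocale FM: finite_factor M tau
 by (intro finite_factor.intro finite_algebra_tau MF.factor_algebra_axioms) (unfold_locales, simp)

sublocale FA: finite_factor A tau
 by (intro finite_factor.intro finite_algebra_tau AF.factor_algebra_axioms AM) unfold_locales

end

text \<open>Finiteness of the index enters through a trace \<open>tn\<close> on the commutant of \<open>A\<close>.\<close>

locale finite_index = subfactor_inclusion + FN: finite_factor "comm A" tn for tn +
 assumes tn_one: "tn 1 = 1"
begin

definition lam where "lam = tn e"

lemma lam_pos: "0 < lam"
proof -
 have "e ~= 0" using e_Om norm_Om by force
 thus ?thesis unfolding lam_def by (intro FN.tr_pos_strict e_comm isproj_pos[OF e_proj])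
qed

lemma rho_pos: assumes "m \<in> M" "0 <= m" shows "0 <= rho m"
proof -
 have s: "psqrt m \<in> M" "star (psqrt m) = psqrt m" using psqrt_mem[OF assms] pos_self_adjoint psqrt(1)[OF assms(2)] by auto
 have "rho m = star (rho (psqrt m)) * rho (psqrt m)"
  using rho_mult[OF s(1) s(1)] psqrt(2)[OF assms(2)] rho_star[OF s(1)] s(2) by simp
 thus ?thesis by simp
qed

lemma rho_mono: "m \<in> M ==> n \<in> M ==> m <= n ==> rho m <= rho n"
 using rho_pos[OF diff, of n m] by (simp add: rho_diff)

lemma rho_slim:
 assumes "!!n. f n \<in> M" "incseq f" "slim f x" shows "incseq (%n. rho (f n)) & slim (%n. rho (f n)) (rho x)"
proof -
 have x: "x \<in> M" by (rule slim_closed[OF assms(1,3)])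
 have le: "f n <= x" for n by (rule slim_le[OF slim_const slim_ignore[OF assms(3), of n]]) (use assms(2) in \<open>simp add: incseqD\<close>)
 have inc: "incseq (%n. rho (f n))" by (rule incseq_SucI, rule rho_mono) (use assms in \<open>auto simp: incseq_SucD\<close>)
 obtain T where T: "slim (%n. rho (f n)) T"
  using increasing_slim_exists[OF inc, of "rho x"] rho_mono[OF assms(1) x le] by blast
 have "T = rho x"
 proof (rule orbit_eqI)
  fix y assume y: "y \<in> M"
  have "(%n. rho (f n) $ y $ Om) ----> y $ x $ Om"
   using tendsto_appl[OF slimD[OF assms(3)], of y Om] by (simp add: rho_orbit y assms)
  from LIMSEQ_unique[OF slimD[OF T] this] show "T $ y $ Om = rho x $ y $ Om" by (simp add: rho_orbit x y)
 qed
 thus ?thesis using inc T by simp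
qed

text \<open>Since \<open>z\<close> commutes with \<open>rho b\<close>, the map b -> tn (z rho b) is
  again a normal trace on \<open>B\<close>, and uniqueness of the trace makes it a multiple of
  \<open>tau\<close>. That \<open>rho\<close> reverses products does not disturb traciality.\<close>

lemma tn_proj_rho:
 assumes B: "finite_factor B tau" "B \<subseteq> M"
  and z: "z \<in> comm A" "isproj z" "!!b. b \<in> B ==> z * rho b = rho b * z" and b: "b \<in> B"
 shows "tn (z * rho b) = tn z * tau b"
proof -
 interpret B: finite_factor B tau by (rule B(1))
 have BM: "b \<in> M" if "b \<in> B" for b using that B by blast
 have zz: "z * z = z" "star z = z" using z(2) by (simp_all add: isproj_def)
 have conj: "z * rho b = star z * rho b * z" if "b \<in> B" for b
  using z(3)[OF that] zz by (metis mult.assoc)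
 have "rtrace B (%b. tn (z * rho b))" unfolding rtrace_def
 proof (intro conjI ballI allI impI)
  fix x y assume xy: "x \<in> B" "y \<in> B"
  show "tn (z * rho (x + y)) = tn (z * rho x) + tn (z * rho y)"
   by (simp add: rho_add BM xy distrib_left FN.tr_add N.mult z rho_N)
  have "tn (z * rho (x * y)) = tn (z * rho y * rho x)" by (simp add: rho_mult BM xy mult.assoc)
  also have "... = tn (rho x * (z * rho y))" by (rule FN.tr_comm) (intro N.mult z rho_N BM xy)+
  also have "... = tn (z * rho (y * x))" using z(3)[OF xy(1)] by (simp add: rho_mult BM xy) (metis mult.assoc)
  finally show "tn (z * rho (x * y)) = tn (z * rho (y * x))" .
 next
  fix x r assume x: "x \<in> B"
  show "tn (z * rho (r *\<^sub>R x)) = r * tn (z * rho x)" by (simp add: rho_scaleR BM x FN.tr_scaleR N.mult z rho_N)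
  have "star (z * rho x) = z * rho (star x)" using z(3)[OF B.star[OF x]] by (simp add: star_mult zz rho_star BM x)
  thus "tn (z * rho (star x)) = tn (z * rho x)" using FN.tr_star[of "z * rho x"] by (simp add: N.mult z rho_N BM x)
 next
  fix x assume x: "x \<in> B" "0 <= x"
  have "0 <= star z * rho x * z" by (intro conj_pos rho_pos BM x)
  thus "0 <= tn (z * rho x)" unfolding conj[OF x(1), symmetric] by (intro FN.tr_pos N.mult z rho_N BM x)
 next
  fix f x assume f: "(\<forall>n. f n \<in> B) & incseq f & slim f x"
  hence r: "incseq (%n. rho (f n))" "slim (%n. rho (f n)) (rho x)" using rho_slim BM by blast+
  have "incseq (%n. z * rho (f n))"
   using r(1) f conj conj_mono[of _ _ z] by (simp add: incseq_def)
  thus "(%n. tn (z * rho (f n))) ----> tn (z * rho x)"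
   by (intro FN.tr_lim N.mult z rho_N BM slim_mult_left r) (use f in blast)
 qed
 from B.trace_unique[OF this b] show ?thesis by simp
qed

lemma tn_rho: "m \<in> M ==> tn (rho m) = tau m"
 using tn_proj_rho[OF FM.finite_factor_axioms, of 1 m] by (simp add: N.one tn_one)

lemma tn_rho_e: "a \<in> A ==> tn (rho a * e) = lam * tau a"
 using tn_proj_rho[OF FA.finite_factor_axioms AM e_comm e_proj, of a] rho_e by (simp add: lam_def)

text \<open>On the corner of \<open>e\<close>, an element is \<open>rho a * e\<close> with
  \<open>a\<close> in \<open>A\<close>, where \<open>tn\<close> is known; so there \<open>tn\<close>
  is the vector state of \<open>Om\<close> scaled by \<open>lam\<close>.\<close>

lemma tn_corner: assumes x: "x \<in> comm A" shows "tn (e * x * e) = lam * qf x Om"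
proof -
 have "e * x * e \<in> comm A" "e * (e * x * e) = e * x * e * e"
  by (intro N.mult e_comm x) (simp add: mult.assoc e_e, simp add: e_e flip: mult.assoc)
 from corner_orbit[OF this] obtain a where a: "a \<in> A" "(e * x * e) $ Om = a $ Om" "e * x * e * e = rho a * e" by blast
 have "tn (e * x * e) = lam * tau a" using a(3) tn_rho_e[OF a(1)] by (simp add: mult.assoc e_e)
 also have "tau a = qf x Om" using cinner_star[of e "x $ Om" Om] by (simp add: tau_def qf_def a(2)[symmetric] e_star)
 finally show ?thesis .
qed

text \<open>Cutting 1 into pieces equivalent to subprojections of \<open>e\<close> and moving each
  into the corner by traciality writes \<open>tn\<close> as a finite sum of vector functionals.
  Strong convergence of sequences thus passes through \<open>tn\<close> without
  monotonicity.\<close>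

lemma tn_vector_states:
 obtains I and v :: "nat => 'a cop" where "finite I" "!!i. i \<in> I ==> v i \<in> comm A" "!!i. i \<in> I ==> e * v i = v i"
  "(\<Sum>i\<in>I. star (v i) * v i) = 1" "!!x. x \<in> comm A ==> tn x = lam * (\<Sum>i\<in>I. qf x (star (v i) $ Om))"
proof -
 have "e ~= 0" using e_Om norm_Om by force
 then obtain n v where v: "!!i. i < (n::nat) ==> v i \<in> comm A" "!!i. i < n ==> e * v i = v i" "(\<Sum>i<n. star (v i) * v i) = 1"
  using FN.exhaustion[OF e_comm e_proj] by blast
 have "tn x = lam * (\<Sum>i<n. qf x (star (v i) $ Om))" if x: "x \<in> comm A" for x
 proof -
  have "tn x = tn (\<Sum>i<n. x * star (v i) * v i)" by (simp add: v(3) mult.assoc flip: sum_distrib_left)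
  also have "... = (\<Sum>i<n. tn (x * star (v i) * v i))" by (rule FN.tr_sum) (auto intro: N.mult N.star x v)
  also have "... = (\<Sum>i<n. lam * qf x (star (v i) $ Om))"
  proof (rule sum.cong[OF refl])
   fix i assume "i \<in> {..<n}"
   hence i: "i < n" by simp
   have ve: "star (v i) * e = star (v i)" using arg_cong[OF v(2)[OF i], of star] by (simp add: star_mult e_star)
   have "tn (x * star (v i) * v i) = tn (v i * x * star (v i))" by (rule FN.tr_cyc) (intro N.star x v i)+
   also have "v i * x * star (v i) = e * (v i * x * star (v i)) * e" using v(2)[OF i] ve by (simp add: mult.assoc) (simp flip: mult.assoc)
   also have "tn ... = lam * qf (v i * x * star (v i)) Om" by (rule tn_corner) (intro N.mult N.star x v i)
   also have "qf (v i * x * star (v i)) Om = qf x (star (v i) $ Om)" using qf_conj[of "star (v i)" x Om] by simp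
   finally show "tn (x * star (v i) * v i) = lam * qf x (star (v i) $ Om)" .
  qed
  finally show ?thesis by (simp add: sum_distrib_left)
 qed
 with v show ?thesis by (intro that[of "{..<n}" v]) auto
qed

text \<open>\<open>rho n\<close> is the trace-preserving conditional expectation of \<open>v\<close>
  onto the right action of \<open>M\<close>. The \<open>V i\<close>, scaled by sqrt lam, form the
  column of an isometry; compressing \<open>v\<close> by it gives an operator commuting with
  \<open>M\<close>, to which the commutation theorem applies.\<close>

lemma expectation_exists:
 assumes v: "v \<in> comm A"
 shows "\<exists>n\<in>M. \<forall>m\<in>M. tn (v * rho m) = tn (rho n * rho m)"
proof -
 obtain I and w :: "nat => 'a cop" where I: "finite I" and
  tn: "!!x. x \<in> comm A ==> tn x = lam * (\<Sum>i\<in>I. qf x (star (w i) $ Om))"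
  by (rule tn_vector_states) blast
 define z where "z i = star (w i) $ Om" for i
 have "\<exists>V. \<forall>x\<in>M. V $ x $ Om = rho x $ z i" if i: "i \<in> I" for i
 proof (rule extension_exists[where C = "1 / sqrt lam"])
  fix x assume x: "x \<in> M"
  show "rho (cscale c x) $ z i = c *\<^sub>C rho x $ z i" for c by (simp add: rho_cscale x)
  have "lam * (norm (rho x $ z i))\<^sup>2 <= lam * (\<Sum>i\<in>I. (norm (rho x $ z i))\<^sup>2)"
   by (intro mult_left_mono member_le_sum) (use I i lam_pos in auto)
  also have "... = tn (star (rho x) * rho x)" using tn[of "star (rho x) * rho x"] x
   by (simp add: N.mult N.star rho_N qf_simps z_def)
  also have "... = tn (rho (x * star x))" by (simp add: rho_mult rho_star star x)
  also have "... = tau (star (star x) * star x)" by (simp add: tn_rho mult star x)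
  also have "... = (norm (x $ Om))\<^sup>2" unfolding tau_star_mult by (simp add: norm_star_Om x)
  finally have "(norm (rho x $ z i))\<^sup>2 <= (norm (x $ Om) / sqrt lam)\<^sup>2"
   using lam_pos by (simp add: power_divide field_simps)
  from power2_le_imp_le[OF this] lam_pos show "norm (rho x $ z i) <= 1 / sqrt lam * norm (x $ Om)" by simp
 qed (simp add: rho_add)
 then obtain V where V: "!!i x. i \<in> I ==> x \<in> M ==> V i $ x $ Om = rho x $ z i" by metis
 define T where "T = lam *\<^sub>R (\<Sum>i\<in>I. star (V i) * v * V i)"
 \<comment> \<open>This determines \<open>T\<close> by \<open>tn\<close>; the trace property then
   moves a factor \<open>rho m\<close> from one side to the other, which is commutation with
   \<open>M\<close>.\<close>
 have form: "Re (cinner (T $ x $ Om) (y $ Om)) = tn (star (rho y) * v * rho x)" if "x \<in> M" "y \<in> M" for x y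
 proof -
  have "Re (cinner (T $ x $ Om) (y $ Om)) = lam * (\<Sum>i\<in>I. Re (cinner (v $ V i $ x $ Om) (V i $ y $ Om)))"
   by (simp add: T_def sum_appl cinner_scaleR_left bounded_bilinear.sum_left[OF bounded_bilinear_cinner] cinner_star')
  also have "... = lam * (\<Sum>i\<in>I. qf (star (rho y) * v * rho x) (z i))"
   by (intro arg_cong[of _ _ "(*) lam"] sum.cong refl) (simp add: V that qf_def cinner_star')
  also have "... = tn (star (rho y) * v * rho x)"
   using tn[of "star (rho y) * v * rho x"] that v by (simp add: z_def N.mult N.star rho_N)
  finally show ?thesis .
 qed
 have "T \<in> comm M"
 proof (rule commI, rule orbit_eqI)
  fix m x assume m: "m \<in> M" and x: "x \<in> M"
  have "(m * T) $ x $ Om - (T * m) $ x $ Om = 0"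
  proof (rule vector_eq_0I)
   fix y assume y: "y \<in> M"
   have "Re (cinner ((m * T) $ x $ Om) (y $ Om)) = Re (cinner (T $ x $ Om) ((star m * y) $ Om))"
    by (simp add: cinner_star)
   also have "... = tn (rho m * (star (rho y) * v * rho x))"
    unfolding form[OF x mult[OF star[OF m] y]] by (simp add: rho_mult rho_star star m y star_mult mult.assoc)
   also have "... = tn (star (rho y) * v * rho x * rho m)"
    by (rule FN.tr_comm) (intro N.mult N.star rho_N v m x y)+
   also have "... = Re (cinner (T $ (m * x) $ Om) (y $ Om))"
    unfolding form[OF mult[OF m x] y] by (simp add: rho_mult m x mult.assoc)
   finally show "Re (cinner ((m * T) $ x $ Om - (T * m) $ x $ Om) (y $ Om)) = 0" by (simp add: cinner_diff_left)
  qed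
  thus "(m * T) $ x $ Om = (T * m) $ x $ Om" by simp
 qed
 then obtain n where n: "n \<in> M" "T = rho n" using commutation_theorem by blast
 have "tn (v * rho m) = tn (rho n * rho m)" if m: "m \<in> M" for m
 proof -
  have "tn (v * rho m) = Re (cinner (T $ m $ Om) Om)" using form[OF m one] by simp
  also have "... = tau (m * n)" by (simp add: n rho_orbit m tau_def qf_def)
  also have "... = tn (rho n * rho m)" by (simp add: m n mult flip: rho_mult tn_rho)
  finally show ?thesis .
 qed
 thus ?thesis using n by blast
qed

lemma tn_e_rho: "x \<in> M ==> tn (e * rho x) = lam * tau x"
proof -
 assume x: "x \<in> M"
 have "tn (e * rho x) = tn (rho x * e * e)" using FN.tr_comm[OF e_comm rho_N[OF x]] by (simp add: mult.assoc e_e)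
 also have "... = tn (e * rho x * e)" by (rule FN.tr_cyc) (intro rho_N x e_comm)+
 finally show ?thesis by (simp add: tn_corner rho_N x) (simp add: qf_def rho_Om x tau_def)
qed

text \<open>\<open>n\<close> is the expectation of \<open>v\<close> divided by \<open>lam\<close>,
  the factor lost in \<open>tn_e_rho\<close>. The difference \<open>y\<close> of both sides
  satisfies \<open>e * y = y\<close>, and its adjoint kills \<open>Om\<close>; hence
  \<open>star y * e = 0\<close>.\<close>

theorem pushdown:
 assumes v: "v \<in> comm A" "e * v = v"
 shows "\<exists>n\<in>M. v = e * rho n"
proof -
 obtain k where k: "k \<in> M" "!!m. m \<in> M ==> tn (v * rho m) = tn (rho k * rho m)" using expectation_exists[OF v(1)] by blast
 define n where "n = (1 / lam) *\<^sub>R k"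
 have nM: "n \<in> M" unfolding n_def by (intro scaleR k)
 define y where "y = v - e * rho n"
 have yN: "y \<in> comm A" unfolding y_def by (intro N.diff N.mult v e_comm rho_N nM)
 have ey: "e * y = y" by (simp add: y_def right_diff_distrib v e_e flip: mult.assoc)
 have "star y $ Om = 0"
 proof (rule vector_eq_0I)
  fix m assume m: "m \<in> M"
  have "Re (cinner (star y $ Om) (m $ Om)) = qf (y * rho m) Om"
   using cinner_star'[of y Om "m $ Om"] by (simp add: qf_def rho_Om m cinner_commute_Re)
  also have "... = tn (e * (y * rho m) * e) / lam" using lam_pos by (simp add: tn_corner N.mult yN rho_N m)
  also have "tn (e * (y * rho m) * e) = tn (e * e * (y * rho m))" by (rule FN.tr_cyc) (intro e_comm N.mult yN rho_N m)+
  also have "e * e * (y * rho m) = v * rho m - e * rho (m * n)"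
   using ey by (simp add: e_e rho_mult m nM flip: mult.assoc) (simp add: y_def left_diff_distrib mult.assoc)
  also have "tn ... = tn (rho k * rho m) - lam * tau (m * n)"
   by (simp add: FN.tr_diff N.mult v rho_N m nM mult e_comm k tn_e_rho)
  also have "... = tau (m * k) - lam * tau (m * n)" by (simp add: tn_rho mult m k flip: rho_mult)
  also have "... = 0" using lam_pos by (simp add: n_def tau_def qf_simps)
  finally show "Re (cinner (star y $ Om) (m $ Om)) = 0" by simp
 qed
 hence "star y * e = 0 * e" by (intro e_eqI_comm N.star yN N.zero) simp
 hence "star (star y * e) = 0" by simp
 hence "y = 0" using ey by (simp add: star_mult e_star)
 thus ?thesis using nM by (auto simp: y_def)
qed

end


section \<open>Irreducibility\<close>

lemma (in star_algebra) vn_algebra_comm: "vn_algebra (comm Q)"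
 by (intro vn_algebra.intro star_algebra_comm vn_algebra_axioms.intro) simp

lemma vn_algebra_Int:
 assumes "vn_algebra P" "vn_algebra Q" shows "vn_algebra (P \<inter> Q)"
proof (intro vn_algebra.intro star_algebra_Int vn_algebra_axioms.intro)
 show "star_algebra P" "star_algebra Q" using assms vn_algebra.axioms by blast+
 have "comm (comm (P \<inter> Q)) \<subseteq> comm (comm P)" "comm (comm (P \<inter> Q)) \<subseteq> comm (comm Q)"
  by (intro comm_antimono, blast)+
 thus "comm (comm (P \<inter> Q)) = P \<inter> Q" using comm_comm_superset[of "P \<inter> Q"] assms vn_algebra.bicomm by blast
qed

lemma (in vn_algebra) scalars_if_no_projections:
 assumes "!!p. p \<in> Q ==> isproj p ==> p = 0 \<or> p = 1" and x: "x \<in> Q"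
 shows "\<exists>c. x = cscale c 1"
proof -
 obtain a b where ab: "star a = a" "star b = b" "x = a + cscale \<i> b"
  "a = (1/2) *\<^sub>R (x + star x)" "b = (1/2) *\<^sub>R cscale (- \<i>) (x - star x)" by (rule complex_decomposition)
 have "a \<in> Q" "b \<in> Q" unfolding ab(4,5) by (intro scaleR add diff cscale star x)+
 with ab(1,2) assms(1) obtain r s where "a = r *\<^sub>R 1" "b = s *\<^sub>R 1"
  using minimal_projection_scalar[OF one isproj_simps(2), of a] minimal_projection_scalar[OF one isproj_simps(2), of b] by auto
 hence "x = cscale (of_real r + \<i> * of_real s) 1" using ab(3) by (simp add: cscale_add cscale_cscale flip: cscale_of_real)
 thus ?thesis by blast
qed

lemma self_adjoint_scalar: "star (cscale c 1) = cscale c (1 :: 'h::complex_hilbert_space cop) ==> cscale c 1 = (Re c *\<^sub>R 1 :: 'h cop)"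
proof (rule oper_of_eqI)
 fix v assume a: "star (cscale c 1) = cscale c (1 :: 'h cop)"
 have "cscale (cnj c) (1::'h cop) $ v = cscale c 1 $ v" using a by (simp add: star_simps)
 hence 1: "cnj c *\<^sub>C v = c *\<^sub>C v" by simp
 have "(2 * complex_of_real (Re c)) *\<^sub>C v = (c + cnj c) *\<^sub>C v" by (simp add: complex_add_cnj)
 also have "... = c *\<^sub>C v + c *\<^sub>C v" by (simp only: scaleC_add_left 1)
 also have "... = (2 * c) *\<^sub>C v" by (simp only: mult_2 scaleC_add_left)
 finally have "(1/2) *\<^sub>C ((2 * complex_of_real (Re c)) *\<^sub>C v) = (1/2) *\<^sub>C ((2 * c) *\<^sub>C v)" by simp
 hence "complex_of_real (Re c) *\<^sub>C v = c *\<^sub>C v" by (simp add: scaleC_scaleC)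
 thus "cscale c 1 $ v = (Re c *\<^sub>R 1) $ v" by (simp add: scaleC_of_real)
qed

context finite_index
begin

lemma rho_e_inj:
 assumes "a \<in> A" "b \<in> A" and h: "rho a * e = rho b * e" shows "a = b"
proof -
 have "a $ Om = b $ Om" using arg_cong[OF h, of "%s. s $ Om"] assms(1,2) by (simp add: rho_Om A_M)
 thus ?thesis by (rule separating_eq[rotated 2]) (intro A_M assms)+
qed

text \<open>Together with \<open>tn_initial_e_rho\<close> this is the dictionary for pushed-down
  partial isometries: the final projection of \<open>e * rho n\<close> is governed by
  \<open>E (star n * n)\<close> and the initial one by \<open>n * star n\<close>.\<close>

lemma range_e_rho:
 assumes n: "n \<in> M" shows "e * rho n * star (e * rho n) = rho (E (star n * n)) * e"
proof -
 have "e * rho n * star (e * rho n) = e * (rho n * rho (star n)) * e" by (simp add: star_mult e_star rho_star n mult.assoc)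
 also have "... = e * rho (star n * n) * e" by (simp add: rho_mult star n)
 finally show ?thesis by (simp add: e_rho_e mult star n)
qed

lemma tn_initial_e_rho:
 assumes n: "n \<in> M" and m: "m \<in> M"
 shows "tn (star (e * rho n) * (e * rho n) * rho m) = lam * tau (m * (n * star n))"
proof -
 have "star (e * rho n) * (e * rho n) * rho m = rho (star n) * e * (rho n * rho m)"
  by (simp add: star_mult e_star rho_star n mult.assoc) (simp add: e_e flip: mult.assoc)
 also have "tn ... = tn (rho n * rho m * rho (star n) * e)"
  using FN.tr_cyc[of "rho (star n)" e "rho n * rho m"] FN.tr_comm[of "rho n * rho m * rho (star n)" e]
   FN.tr_cyc[of e "rho n * rho m" "rho (star n)"] by (simp add: N.mult rho_N star n m e_comm mult.assoc)
 also have "... = tn (e * rho (star n * m * n))"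
  using FN.tr_comm[of "rho n * rho m * rho (star n)" e] by (simp add: N.mult rho_N star n m e_comm rho_mult mult mult.assoc)
 also have "... = lam * tau (star n * (m * n))" by (simp add: tn_e_rho mult star n m mult.assoc)
 also have "tau (star n * (m * n)) = tau (m * n * star n)" by (rule FM.tr_comm) (intro star mult n m)+
 finally show ?thesis by (simp add: mult.assoc)
qed

lemma tau_separates: "x \<in> M ==> y \<in> M ==> (!!m. m \<in> M ==> tau (m * x) = tau (m * y)) ==> x = y"
 using FM.faithful_all[OF diff, of x y] by (simp add: right_diff_distrib FM.tr_diff mult)

lemma A_scalar: "a \<in> A ==> a \<in> comm A ==> \<exists>c. a = cscale c 1"
 using AF.center by blast

lemma relative_commutant_E:
 assumes x: "x \<in> M" "x \<in> comm A" "star x = x" shows "E x = tau x *\<^sub>R 1"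
proof -
 have "E x \<in> comm A"
 proof (rule commI)
  fix a assume a: "a \<in> A"
  have "a * E x = E (a * x)" by (simp add: E_left a x)
  also have "a * x = x * a" by (rule commD[OF x(2) a])
  finally show "a * E x = E x * a" by (simp add: E_right a x)
 qed
 then obtain c where c: "E x = cscale c 1" using A_scalar E_mem[OF x(1)] by blast
 have "star (E x) = E x" using E_star[OF x(1)] x(3) by simp
 hence 1: "E x = Re c *\<^sub>R 1" unfolding c by (rule self_adjoint_scalar)
 have "tau x = tau (E x)" by (simp add: tau_E x)
 also have "... = Re c" unfolding 1 using FM.tr_scaleR[OF one] by simp
 finally show ?thesis using 1 by simp
qed

text \<open>Since \<open>E p\<close> is the scalar \<open>tau p\<close>, the operator
  \<open>p * e * p\<close> divided by it is a projection of trace \<open>lam\<close>. It lies below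
  \<open>p * rho p\<close>, whose trace is the product on the right.\<close>

lemma relative_commutant_trace:
 assumes p: "p \<in> M" "p \<in> comm A" "isproj p" "p ~= 0" shows "lam <= tn p * tau p"
proof -
 have sp: "star p = p" "p * p = p" using p(3) by (simp_all add: isproj_def)
 have tp: "0 < tau p" by (rule FM.tr_pos_strict[OF p(1) isproj_pos[OF p(3)] p(4)])
 define f where "f = (1 / tau p) *\<^sub>R (p * e * p)"
 have epe: "e * p * e = tau p *\<^sub>R e" using e_M_e[OF p(1)] relative_commutant_E[OF p(1,2) sp(1)] by simp
 have fN: "f \<in> comm A" unfolding f_def by (intro N.scaleR N.mult p e_comm)
 have "p * e * p * (p * e * p) = p * (e * (p * p) * e) * p" by (simp only: mult.assoc)
 also have "... = tau p *\<^sub>R (p * e * p)" by (simp only: sp(2) epe mult_scaleR_left mult_scaleR_right)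
 finally have "p * e * p * (p * e * p) = tau p *\<^sub>R (p * e * p)" .
 hence f: "isproj f" using tp by (simp add: isproj_def f_def star_simps sp e_star mult.assoc)
 have pr: "p * rho p = rho p * p" by (rule rho_commutes[OF p(1,1), symmetric])
 have rp: "isproj (rho p)" by (rule isproj_rho[OF p(1,3)])
 have prp: "isproj (p * rho p)"
  using pr rp sp by (simp add: isproj_def star_mult) (metis mult.assoc)
 have "p * rho p * e = p * e"
 proof (rule e_eqI)
  fix a assume a: "a \<in> A"
  have "(p * rho p) $ a $ Om = p $ (a * p) $ Om" by (simp add: rho_orbit p A_M a)
  also have "... = (p * p) $ a $ Om" using commD[OF p(2) a] by simp
  finally show "(p * rho p) $ a $ Om = p $ a $ Om" by (simp add: sp del: appl_mult)
 qed
 hence "p * rho p * (p * e * p) = p * e * p" using pr sp by (metis mult.assoc)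
 hence "p * rho p * f = f" by (simp add: f_def)
 hence le: "f <= p * rho p" using isproj_le_iff[OF f prp] by simp
 have "tn (p * e * p) = tn (p * p * e)" by (rule FN.tr_cyc) (intro p e_comm)+
 also have "... = tn (e * p * e)" using FN.tr_cyc[of e p e] FN.tr_comm[of p e] by (simp add: sp p e_comm e_e)
 also have "... = tau p * lam" unfolding epe lam_def by (rule FN.tr_scaleR[OF e_comm])
 finally have tf: "tn f = lam" using tp by (simp add: f_def FN.tr_scaleR N.mult p e_comm)
 have "tn f <= tn (p * rho p)" by (rule FN.tr_mono[OF fN _ le]) (intro N.mult p rho_N)+
 also have "tn (p * rho p) = tn p * tau p"
  by (rule tn_proj_rho[OF FM.finite_factor_axioms order_refl p(2,3) _ p(1)]) (simp add: rho_commutes p)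
 finally show ?thesis unfolding tf .
qed

text \<open>With \<open>s\<close> and \<open>t\<close> the two traces of \<open>p\<close>, both
  \<open>s * t\<close> and \<open>(1 - s) * (1 - t)\<close> are at least \<open>lam\<close>, while
  their product is at most 1/16. This is irreducibility below index four.\<close>

lemma irreducible_projection:
 assumes lam: "1 / 4 < lam" and p: "p \<in> M" "p \<in> comm A" "isproj p" shows "p = 0 \<or> p = 1"
proof (rule ccontr)
 assume n: "\<not> ?thesis"
 have q: "1 - p \<in> M" "1 - p \<in> comm A" "isproj (1 - p)" "1 - p ~= 0"
  using n by (auto intro: diff N.diff one N.one p isproj_compl)
 define s t where "s = tn p" and "t = tau p"
 have 1: "lam <= s * t" using relative_commutant_trace[OF p] n by (simp add: s_def t_def)
 have 2: "lam <= (1 - s) * (1 - t)" using relative_commutant_trace[OF q]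
  by (simp add: s_def t_def FN.tr_diff FM.tr_diff p one N.one tn_one)
 have "(s * t) * ((1 - s) * (1 - t)) = (1/4 - (s - 1/2)\<^sup>2) * (1/4 - (t - 1/2)\<^sup>2)" by (simp add: power2_eq_square algebra_simps)
 also have "... <= (1/4) * (1/4)"
 proof (rule mult_mono)
  have "0 <= t" "t <= 1" using FM.tr_pos[OF p(1) isproj_pos[OF p(3)]] FM.tr_proj_mono[OF p(3,1)] by (simp_all add: t_def)
  hence "0 <= t * (1 - t)" by simp
  thus "0 <= 1/4 - (t - 1/2)\<^sup>2" by (simp add: power2_eq_square algebra_simps)
 qed simp_all
 finally have "(s * t) * ((1 - s) * (1 - t)) <= 1 / 16" by simp
 moreover have "lam * lam <= (s * t) * ((1 - s) * (1 - t))" using 1 2 lam by (intro mult_mono) auto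
 moreover have "(1/4) * (1/4) < lam * lam" using lam by (intro mult_strict_mono) auto
 ultimately show False by simp
qed

lemma irreducible:
 assumes lam: "1 / 4 < lam" and x: "x \<in> M" "x \<in> comm A" shows "\<exists>c. x = cscale c 1"
proof -
 interpret R: vn_algebra "M \<inter> comm A" by (rule vn_algebra_Int) unfold_locales
 show ?thesis by (rule R.scalars_if_no_projections) (use irreducible_projection[OF lam] x in auto)
qed

text \<open>The endomorphisms of L^2(M) as an A-A bimodule. Its projections \<open>z\<close> are the
  sub-bimodules, and \<open>tn z / lam\<close> is the left dimension, equal to 1 for
  \<open>e\<close>.\<close>

definition C where "C = comm A \<inter> comm (rho ` A)"

lemma C_comm: "z \<in> C ==> z \<in> comm A" by (simp add: C_def)

lemma C_rho: "z \<in> C ==> a \<in> A ==> rho a * z = z * rho a"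
 unfolding C_def using commD[of z "rho ` A" "rho a"] by blast

lemma C_vn: "vn_algebra C"
proof -
 have "star_algebra (rho ` A)"
 proof
  show "1 \<in> rho ` A" by (rule image_eqI[OF _ A.one]) simp
  fix x assume "x \<in> rho ` A"
  then obtain a where a: "a \<in> A" "x = rho a" by blast
  show "star x \<in> rho ` A" by (rule image_eqI[OF _ A.star[OF a(1)]]) (simp add: a rho_star A_M)
  show "cscale c x \<in> rho ` A" for c by (rule image_eqI[OF _ A.cscale[OF a(1)]]) (simp add: a rho_cscale A_M)
  fix y assume "y \<in> rho ` A"
  then obtain b where b: "b \<in> A" "y = rho b" by blast
  show "x + y \<in> rho ` A" by (rule image_eqI[OF _ A.add[OF a(1) b(1)]]) (simp add: a b rho_add A_M)
  show "x * y \<in> rho ` A" by (rule image_eqI[OF _ A.mult[OF b(1) a(1)]]) (simp add: a b rho_mult A_M)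
 qed
 then interpret R: star_algebra "rho ` A" .
 show ?thesis unfolding C_def by (intro vn_algebra_Int R.vn_algebra_comm) unfold_locales
qed

lemma e_C: "e \<in> C"
 unfolding C_def using e_comm rho_e by (auto intro!: commI)

text \<open>The expectation of \<open>z\<close> onto the right action of \<open>M\<close> is
  \<open>rho n\<close> with \<open>n\<close> commuting with \<open>A\<close>, because
  \<open>z\<close> commutes with \<open>rho a\<close>; irreducibility makes it a scalar, which
  self-adjointness makes real.\<close>

lemma tn_C_rho:
 assumes lam: "1 / 4 < lam" and z: "z \<in> C" "star z = z" and m: "m \<in> M"
 shows "tn (z * rho m) = tn z * tau m"
proof -
 have zN: "z \<in> comm A" by (rule C_comm[OF z(1)])
 obtain n where n: "n \<in> M" "!!m. m \<in> M ==> tn (z * rho m) = tn (rho n * rho m)" using expectation_exists[OF zN] by blast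
 have t: "tau (m * n) = tn (z * rho m)" if "m \<in> M" for m using n that by (simp add: tn_rho mult flip: rho_mult)
 have "n \<in> comm A"
 proof (rule commI)
  fix a assume a: "a \<in> A"
  show "a * n = n * a"
  proof (rule tau_separates)
   fix m assume m: "m \<in> M"
   have "tau (m * (a * n)) = tn (z * rho (m * a))" using t[of "m * a"] by (simp add: mult m A_M a mult.assoc)
   also have "... = tn (rho a * z * rho m)" by (simp add: rho_mult m A_M a C_rho z mult.assoc)
   also have "... = tn (z * rho m * rho a)" using FN.tr_comm[of "rho a" "z * rho m"] by (simp add: N.mult rho_N zN m A_M a mult.assoc)
   also have "... = tau (a * m * n)" using t[of "a * m"] by (simp add: mult m A_M a rho_mult mult.assoc)
   also have "... = tau (m * n * a)" using FM.tr_comm[of a "m * n"] by (simp add: mult m n A_M a mult.assoc)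
   finally show "tau (m * (a * n)) = tau (m * (n * a))" by (simp add: mult.assoc)
  qed (intro mult n A_M a)+
 qed
 then obtain c where c: "n = cscale c 1" using irreducible[OF lam n(1)] by blast
 have "star n = n"
 proof (rule tau_separates[OF star[OF n(1)] n(1)])
  fix m assume m: "m \<in> M"
  have "tau (m * star n) = tau (n * star m)" using FM.tr_star[of "n * star m"] by (simp add: star_mult mult star n m)
  also have "... = tau (star m * n)" by (rule FM.tr_comm) (intro n star m)+
  also have "... = tn (star (rho m * z))" by (simp add: t star m star_mult z rho_star)
  also have "... = tn (z * rho m)" using FN.tr_star FN.tr_comm by (simp add: N.mult rho_N m zN)
  finally show "tau (m * star n) = tau (m * n)" using t[OF m] by simp
 qed
 hence nr: "n = Re c *\<^sub>R 1" unfolding c by (rule self_adjoint_scalar)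
 have tm: "tn (z * rho m) = Re c * tau m" if "m \<in> M" for m
  using t[OF that] unfolding nr by (simp add: FM.tr_scaleR that)
 from tm[OF one] tm[OF m] show ?thesis by simp
qed

text \<open>The operator \<open>B = rho w * e * rho w\<close> satisfies
  \<open>B * B = c *\<^sub>R B\<close>, hence \<open>B <= c *\<^sub>R rho w\<close>; the traces of
  the two sides are \<open>lam * tau w\<close> and \<open>c * tau w\<close>.\<close>

lemma weak_pimsner_popa:
 assumes w: "w \<in> M" "isproj w" "w ~= 0" and p: "p \<in> A" "isproj p" "p * w = w" and c: "E w = c *\<^sub>R p"
 shows "lam <= c"
proof -
 have tw: "0 < tau w" by (rule FM.tr_pos_strict[OF w(1) isproj_pos[OF w(2)] w(3)])
 have "tau w = c * tau p" using tau_E[OF w(1)] FM.tr_scaleR[OF A_M[OF p(1)]] c by simp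
 moreover have "0 <= tau p" by (rule FM.tr_pos[OF A_M[OF p(1)] isproj_pos[OF p(2)]])
 ultimately have c0: "0 < c" using tw by (metis less_asym mult_nonpos_nonneg not_less)
 have rw: "isproj (rho w)" "star (rho w) = rho w" "rho w * rho w = rho w"
  using isproj_rho[OF w(1,2)] by (simp_all add: isproj_def)
 define B where "B = rho w * e * rho w"
 have BN: "B \<in> comm A" unfolding B_def by (intro N.mult rho_N w e_comm)
 have sB: "star B = B" by (simp add: B_def star_mult rw e_star mult.assoc)
 have "B * B = rho w * (e * (rho w * rho w) * e) * rho w" by (simp only: B_def mult.assoc)
 also have "... = rho w * (rho (c *\<^sub>R p) * e) * rho w" by (simp only: rw(3) e_rho_e[OF w(1)] c)
 also have "... = c *\<^sub>R (rho w * rho p * e * rho w)"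
  by (simp only: rho_scaleR[OF A_M[OF p(1)]] mult_scaleR_left mult_scaleR_right mult.assoc)
 also have "rho w * rho p = rho w" using rho_mult[OF A_M[OF p(1)] w(1)] p(3) by simp
 finally have BB: "B * B = c *\<^sub>R B" by (simp add: B_def)
 have B0: "0 <= B" using conj_pos[OF isproj_pos[OF e_proj], of "rho w"] rw by (simp add: B_def)
 have "qf B v <= c * (norm v)\<^sup>2" for v
 proof -
  have "(norm (B $ v))\<^sup>2 = c * qf B v" using qf_simps(7)[of B v] by (simp add: sB BB qf_simps)
  moreover have "qf B v <= norm (B $ v) * norm v" using Re_cinner_le[of "B $ v" v] by (simp add: qf_def)
  ultimately have "norm (B $ v) * norm (B $ v) <= norm (B $ v) * (c * norm v)"
   using mult_left_mono[of "qf B v" "norm (B $ v) * norm v" c] c0 by (simp add: power2_eq_square mult_ac)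
  hence "norm (B $ v) <= c * norm v" using c0 by (cases "norm (B $ v) = 0") auto
  hence "norm (B $ v) * norm v <= c * norm v * norm v" by (intro mult_right_mono) auto
  thus ?thesis using \<open>qf B v <= norm (B $ v) * norm v\<close> by (simp add: power2_eq_square mult_ac)
 qed
 hence "B <= c *\<^sub>R 1" by (simp add: le_iff_qf sB star_simps qf_simps)
 from conj_mono[OF this, of "rho w"] have "B <= c *\<^sub>R rho w"
  using rw by (simp add: B_def mult.assoc) (simp flip: mult.assoc)
 hence "tn B <= c * tau w" using FN.tr_mono[OF BN N.scaleR[OF rho_N[OF w(1)]]] by (simp add: FN.tr_scaleR rho_N w tn_rho)
 moreover have "tn B = lam * tau w"
 proof -
  have "tn B = tn (rho w * rho w * e)" unfolding B_def by (rule FN.tr_cyc) (intro rho_N w e_comm)+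
  also have "... = tn (e * rho w)" using FN.tr_comm[of "rho w" e] by (simp add: rw rho_N w e_comm)
  finally show ?thesis by (simp add: tn_e_rho w)
 qed
 ultimately show ?thesis using tw by simp
qed

text \<open>A sub-bimodule of left dimension below \<open>1/(1 - lam)\<close> has dimension one: after cutting by a small
 projection \<open>a\<close> of \<open>A\<close> it embeds into \<open>L\<^sup>2(A)\<close>, and the defect \<open>w\<close> of the embedding is excluded by
 \<open>weak_pimsner_popa\<close>.\<close>

lemma small_bimodule:
 assumes lam: "1 / 4 < lam" "lam <= 1 / 2" and inf: "\<nexists>S. finite S & A \<subseteq> span S"
  and z: "z \<in> C" "isproj z" "z ~= 0" and small: "tn z * (1 - lam) < lam"
 shows "tn z = lam"
proof -
 have sz: "star z = z" "z * z = z" using z(2) by (simp_all add: isproj_def)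
 have zN: "z \<in> comm A" by (rule C_comm[OF z(1)])
 have tz: "0 < tn z" by (rule FN.tr_pos_strict[OF zN isproj_pos[OF z(2)] z(3)])
 \<comment> \<open>\<open>r\<close> is the left dimension. The assumption \<open>small\<close> reads
   r < 1 / (1 - lam), and \<open>lam <= 1 / 2\<close> turns this into \<open>r <= 2\<close>.\<close>
 define r where "r = tn z / lam"
 have r: "0 < r" "tn z = r * lam" "r * (1 - lam) < 1" using tz lam_pos small by (simp_all add: r_def field_simps)
 have "r * (1/2) <= r * (1 - lam)" using lam r(1) by (intro mult_left_mono) auto
 hence r2: "r <= 2" using r(3) by linarith
 \<comment> \<open>Trace 1/2 is small enough: as \<open>r <= 2\<close>, the projection
   \<open>z * rho a\<close> has at most the trace of \<open>e\<close> and embeds below it.\<close>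
 obtain a where a: "a \<in> A" "isproj a" "tau a = 1 / 2" using FA.projection_of_trace[OF inf, of "1/2"] by auto
 have sa: "star a = a" "a * a = a" using a(2) by (simp_all add: isproj_def)
 have ra: "isproj (rho a)" by (rule isproj_rho[OF A_M[OF a(1)] a(2)])
 define f where "f = z * rho a"
 have fN: "f \<in> comm A" unfolding f_def by (intro N.mult zN rho_N A_M a)
 have fp: "isproj f" using C_rho[OF z(1) a(1)] ra sz by (simp add: f_def isproj_def star_mult) (metis mult.assoc)
 have tf: "tn f = r * lam / 2" using tn_C_rho[OF lam(1) z(1) sz(1) A_M[OF a(1)]] by (simp add: f_def a r)
 moreover have "r * lam <= 2 * lam" using r2 lam_pos by (intro mult_right_mono) auto
 ultimately have "tn f <= tn e" unfolding lam_def[symmetric] by linarith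
 then obtain v where v: "v \<in> comm A" "star v * v = f" "e * v = v" using FN.comparison[OF fN fp e_comm e_proj] by blast
 obtain n where n: "n \<in> M" "v = e * rho n" using pushdown[OF v(1,3)] by blast
 define p where "p = E (star n * n)"
 have pA: "p \<in> A" unfolding p_def by (intro E_mem mult star n)
 have nn: "n * star n = r *\<^sub>R a"
 proof (rule tau_separates)
  fix m assume m: "m \<in> M"
  have "lam * tau (m * (n * star n)) = tn (f * rho m)" using tn_initial_e_rho[OF n(1) m] v(2) n(2) by simp
  also have "... = tn (z * rho (m * a))" by (simp add: f_def rho_mult m A_M a mult.assoc)
  also have "... = r * lam * tau (m * a)" using tn_C_rho[OF lam(1) z(1) sz(1) mult[OF m A_M[OF a(1)]]] r(2) by simp
  finally show "tau (m * (n * star n)) = tau (m * r *\<^sub>R a)" using lam_pos by (simp add: FM.tr_scaleR mult m A_M a)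
 qed (intro mult star scaleR n A_M a)+
 have vp: "v * star v = rho p * e" using range_e_rho[OF n(1)] by (simp add: n(2) p_def)
 have vi: "v * star v * v = v" by (rule isproj_star_mult_isometry) (simp add: v(2) fp)
 have pvv: "isproj (rho p * e)" using partial_isometry_proj(2)[OF vi] vp by simp
 have "rho (p * p) * e = rho p * e * (rho p * e)"
  using rho_e[OF pA] by (simp add: rho_mult A_M pA mult.assoc) (simp add: e_e flip: mult.assoc)
 hence "rho (p * p) * e = rho p * e" using pvv by (simp add: isproj_def)
 hence pp: "p * p = p" by (rule rho_e_inj[OF A.mult[OF pA pA] pA])
 have sp: "star p = p" using E_star[OF mult[OF star[OF n(1)] n(1)]] by (simp add: p_def star_mult)
 have p: "isproj p" using pp sp by (simp add: isproj_def)
 have an: "a * n = n"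
 proof -
  have "(n - a * n) * star (n - a * n) = n * star n - a * (n * star n) - n * star n * a + a * (n * star n) * a"
   by (simp add: star_simps sa algebra_simps)
  also have "... = 0" by (simp add: nn sa)
  finally have "star (star (n - a * n)) * star (n - a * n) = 0" by simp
  hence "star (n - a * n) = 0" by (rule star_mult_self_eq_0)
  hence "n - a * n = 0" using star_inj[of "n - a * n" 0] by simp
  thus ?thesis by simp
 qed
 have np: "n * p = n"
 proof -
  define y where "y = n * (1 - p)"
  have "tau (star y * y) = tau (E (star n * n * (1 - p)) )"
  proof -
   have "tau (star y * y) = tau ((1 - p) * (star n * n * (1 - p)))" by (simp add: y_def star_mult star_diff sp mult.assoc)
   also have "... = tau (star n * n * (1 - p) * (1 - p))"
    by (rule FM.tr_comm) (intro diff mult one A_M pA star n)+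
   also have "star n * n * (1 - p) * (1 - p) = star n * n * (1 - p)" by (simp add: pp algebra_simps)
   finally show ?thesis by (simp add: tau_E mult star diff one A_M pA n)
  qed
  also have "E (star n * n * (1 - p)) = p * (1 - p)" unfolding p_def[symmetric]
   using E_right[OF A.diff[OF A.one pA] mult[OF star[OF n(1)] n(1)]] by (simp add: p_def)
  also have "p * (1 - p) = 0" by (simp add: pp algebra_simps)
  finally have "y = 0" using FM.faithful_star[of y] FM.tr_zero by (simp add: y_def mult diff one A_M pA n)
  thus ?thesis by (simp add: y_def algebra_simps)
 qed
 \<comment> \<open>\<open>g\<close> is the right support of \<open>n\<close>, a projection below
   \<open>p\<close>. The expectation of the defect \<open>w = p - g\<close> is
   \<open>(1 - 1 / r) *\<^sub>R p\<close>, so \<open>w = 0\<close> is the same as r = 1.\<close>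
 define g where "g = (1 / r) *\<^sub>R (star n * n)"
 define w where "w = p - g"
 have gM: "g \<in> M" unfolding g_def by (intro scaleR mult star n)
 have "star n * n * (star n * n) = star n * (n * star n) * n" by (simp only: mult.assoc)
 also have "... = r *\<^sub>R (star n * n)" by (simp add: nn an mult.assoc)
 finally have gg: "g * g = g" using r(1) by (simp add: g_def)
 have sg: "star g = g" by (simp add: g_def star_simps)
 have gp: "g * p = g" by (simp add: g_def np mult.assoc)
 have pg: "p * g = g" using arg_cong[OF gp, of star] by (simp add: star_mult sp sg)
 have wp: "isproj w" by (simp add: w_def isproj_def star_simps sp sg algebra_simps pp gg gp pg)
 have wM: "w \<in> M" unfolding w_def by (intro diff A_M pA gM)
 have Ew: "E w = (1 - 1 / r) *\<^sub>R p"
  by (simp add: w_def g_def E_diff E_id E_scaleR A_M pA scaleR mult star n p_def[symmetric] scaleR_diff_left)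
 have p0: "p ~= 0"
 proof
  assume "p = 0"
  hence "v * star v = 0" using vp by simp
  hence "v = 0" using vi by simp
  thus False using v(2) tf tz r lam_pos FN.tr_zero by auto
 qed
 have "w = 0"
 proof (rule ccontr)
  assume "w ~= 0"
  have "lam <= 1 - 1 / r" by (rule weak_pimsner_popa[OF wM wp \<open>w ~= 0\<close> pA p _ Ew]) (simp add: w_def algebra_simps pp pg)
  hence "1 / r <= 1 - lam" by simp
  hence "1 <= r * (1 - lam)" using r(1) by (simp add: field_simps)
  with r(3) show False by simp
 qed
 hence "(1 - 1 / r) *\<^sub>R p = 0" using Ew E_id[OF A.zero] by simp
 hence "r = 1" using p0 r(1) by (simp add: field_simps)
 thus ?thesis using r(2) by simp
qed

end


section \<open>Index 2 + sqrt 2: Jones projections and the bimodule endomorphisms\<close>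

lemma mult_eq_if_range_proj:
 assumes "n * star n = r *\<^sub>R a" "isproj a" shows "a * n = n"
proof -
 have sa: "star a = a" "a * a = a" using assms(2) by (simp_all add: isproj_def)
 have "(n - a * n) * star (n - a * n) = n * star n - a * (n * star n) - n * star n * a + a * (n * star n) * a"
  by (simp add: star_simps sa algebra_simps)
 also have "... = 0" by (simp add: assms(1) sa)
 finally have "star (star (n - a * n)) * star (n - a * n) = 0" by simp
 hence "star (n - a * n) = 0" by (rule star_mult_self_eq_0)
 hence "n - a * n = 0" using star_inj[of "n - a * n" 0] by simp
 thus ?thesis by simp
qed

lemma isproj_scaleR:
 assumes "star y = y" "y * y = c *\<^sub>R y" "c ~= 0" shows "isproj ((1 / c) *\<^sub>R y)"
 using assms by (simp add: isproj_def star_simps)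

locale index_two_plus_sqrt2 = finite_index +
 assumes lam_eq: "lam = 1 - sqrt 2 / 2"
  and infinite_M: "\<nexists>S. finite S & M \<subseteq> span S" and infinite_A: "\<nexists>S. finite S & A \<subseteq> span S"
begin

lemma sqrt2_bounds: "1.4 < sqrt 2" "sqrt 2 < 1.42"
 by (rule real_less_rsqrt, simp add: power2_eq_square) (rule real_less_lsqrt, simp_all add: power2_eq_square)

lemma lam_bounds: "0.29 < lam" "lam < 0.3" "1 / 4 < lam" "lam <= 1 / 2"
 using sqrt2_bounds by (simp_all add: lam_eq)

lemma lam_sq: "lam * lam = 2 * lam - 1 / 2"
 by (simp add: lam_eq algebra_simps)

text \<open>A downward basic construction below \<open>x\<close>. A projection \<open>q0\<close> of
  the right trace makes \<open>rho q0\<close> equivalent to \<open>rho x * e\<close>; pushing the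
  equivalence down gives \<open>n\<close> with \<open>E (star n * n) = x\<close> and
  \<open>n * star n = (1 / lam) *\<^sub>R q0\<close>, and \<open>q\<close> is the other support of
  \<open>n\<close>.\<close>

lemma jones_projection:
 assumes x: "x \<in> A" "isproj x" shows "\<exists>q\<in>M. isproj q & E q = lam *\<^sub>R x & x * q = q"
proof -
 have sx: "star x = x" "x * x = x" using x(2) by (simp_all add: isproj_def)
 have "0 <= tau x" "tau x <= 1" using FM.tr_pos[OF A_M[OF x(1)] isproj_pos[OF x(2)]] FM.tr_proj_mono[OF x(2) A_M[OF x(1)]] by simp_all
 hence "0 <= lam * tau x" "lam * tau x <= tau 1" using lam_bounds mult_mono[of lam 1 "tau x" 1] by simp_all
 then obtain q0 where q0: "q0 \<in> M" "isproj q0" "tau q0 = lam * tau x" using FM.projection_of_trace[OF infinite_M] by blast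
 have rx: "star (rho x) = rho x" "rho x * rho x = rho x"
  using isproj_rho[OF A_M[OF x(1)] x(2)] by (simp_all add: isproj_def)
 have "rho x * e * (rho x * e) = rho x * (e * rho x) * e" by (simp only: mult.assoc)
 also have "... = rho x * rho x * (e * e)" by (simp only: rho_e[OF x(1), symmetric] mult.assoc)
 also have "... = rho x * e" by (simp only: rx e_e)
 finally have fp: "isproj (rho x * e)" using rho_e[OF x(1)] by (simp add: isproj_def star_mult rx e_star)
 have "tn (rho q0) = tn (rho x * e)" by (simp add: tn_rho q0 tn_rho_e x)
 then obtain v where v: "v \<in> comm A" "star v * v = rho q0" "v * star v = rho x * e"
  using FN.equivalence[OF rho_N[OF q0(1)] isproj_rho[OF q0(1,2)] N.mult[OF rho_N[OF A_M[OF x(1)]] e_comm] fp] by blast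
 have vi: "v * star v * v = v" by (rule isproj_star_mult_isometry) (simp add: v(2) isproj_rho q0)
 have "e * v = e * rho x * e * v" using vi v(3) by (metis mult.assoc)
 also have "... = rho x * (e * e) * v" by (simp only: rho_e[OF x(1), symmetric] mult.assoc)
 also have "... = v" using vi v(3) by (simp only: e_e)
 finally obtain n where n: "n \<in> M" "v = e * rho n" using pushdown[OF v(1)] by blast
 have Ex: "E (star n * n) = x"
  by (rule rho_e_inj[OF E_mem x(1)]) (use n range_e_rho[OF n(1)] v(3) mult star in simp_all)
 have "lam *\<^sub>R (n * star n) = q0"
 proof (rule tau_separates)
  fix m assume m: "m \<in> M"
  have "tau (m * lam *\<^sub>R (n * star n)) = tn (rho q0 * rho m)"
   using tn_initial_e_rho[OF n(1) m] v(2) n(2) by (simp add: FM.tr_scaleR mult star n m)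
  thus "tau (m * lam *\<^sub>R (n * star n)) = tau (m * q0)" by (simp add: m q0 mult tn_rho flip: rho_mult)
 qed (intro mult star scaleR n q0)+
 hence nn: "n * star n = (1 / lam) *\<^sub>R q0" using lam_pos by auto
 have qn: "q0 * n = n" by (rule mult_eq_if_range_proj[OF nn q0(2)])
 define q where "q = lam *\<^sub>R (star n * n)"
 have qM: "q \<in> M" unfolding q_def by (intro scaleR mult star n)
 have "star n * n * (star n * n) = star n * (n * star n) * n" by (simp only: mult.assoc)
 also have "... = (1 / lam) *\<^sub>R (star n * n)" by (simp add: nn qn mult.assoc)
 finally have q: "isproj q" using lam_pos by (simp add: q_def isproj_def star_simps)
 have Eq: "E q = lam *\<^sub>R x" by (simp add: q_def E_scaleR mult star n Ex)
 \<comment> \<open>\<open>E (star y * y)\<close> is a multiple of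
   \<open>(1 - x) * x * (1 - x)\<close>, so \<open>q\<close> lies below \<open>x\<close> by
   faithfulness.\<close>
 define y where "y = q * (1 - x)"
 have yM: "y \<in> M" unfolding y_def by (intro mult qM diff one A_M x)
 have sq: "star q = q" "q * q = q" using q by (simp_all add: isproj_def)
 have "star y * y = (1 - x) * (q * q) * (1 - x)" by (simp only: y_def star_mult star_diff star_one sx sq(1) mult.assoc)
 hence "star y * y = (1 - x) * (q * (1 - x))" by (simp only: sq mult.assoc)
 hence "E (star y * y) = (1 - x) * (lam *\<^sub>R x * (1 - x))"
  by (simp only: E_left[OF A.diff[OF A.one x(1)] mult[OF qM diff[OF one A_M[OF x(1)]]]] E_right[OF A.diff[OF A.one x(1)] qM] Eq)
 also have "... = 0" by (simp add: algebra_simps sx)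
 finally have "tau (star y * y) = 0" using tau_E[OF mult[OF star[OF yM] yM]] FM.tr_zero by simp
 hence "y = 0" by (rule FM.faithful_star[OF yM])
 hence "q * x = q" by (simp add: y_def algebra_simps)
 hence "star (q * x) = star q" by simp
 hence "x * q = q" using q by (simp add: star_mult sx isproj_def)
 thus ?thesis using qM q Eq by blast
qed

text \<open>Pushing down for a projection \<open>q\<close> with \<open>E q = lam\<close>: the subprojection \<open>rho q e rho q / lam\<close> of
 \<open>rho q\<close> has the same trace.\<close>

lemma jones_pushdown:
 assumes q: "q \<in> M" "isproj q" "E q = lam *\<^sub>R 1" and y: "y \<in> M"
 shows "y * q = (1 / lam) *\<^sub>R (E (y * q) * q)"
proof -
 have rq: "isproj (rho q)" "star (rho q) = rho q" "rho q * rho q = rho q"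
  using isproj_rho[OF q(1,2)] by (simp_all add: isproj_def)
 define f where "f = (1 / lam) *\<^sub>R (rho q * e * rho q)"
 have fN: "f \<in> comm A" unfolding f_def by (intro N.scaleR N.mult rho_N q e_comm)
 have "rho q * e * rho q * (rho q * e * rho q) = rho q * (e * (rho q * rho q) * e) * rho q" by (simp only: mult.assoc)
 also have "... = lam *\<^sub>R (rho q * e * rho q)"
  by (simp only: rq(3) e_rho_e[OF q(1)] q(3) rho_scaleR[OF one] rho_one mult_scaleR_left mult_scaleR_right mult_1_left)
 finally have f: "isproj f" using lam_pos by (simp add: isproj_def f_def star_simps rq e_star mult.assoc)
 have "rho q * f = f" by (simp add: f_def rq flip: mult.assoc)
 hence le: "f <= rho q" using isproj_le_iff[OF f rq(1)] by simp
 have "tn (rho q * e * rho q) = tn (rho q * rho q * e)" by (rule FN.tr_cyc) (intro rho_N q e_comm)+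
 also have "... = lam * tau q" using FN.tr_comm[OF e_comm rho_N[OF q(1)]] by (simp add: rq tn_e_rho q)
 also have "tau q = lam" using tau_E[OF q(1)] FM.tr_scaleR[OF one] by (simp add: q(3))
 finally have "tn (rho q - f) = 0" using lam_pos
  by (simp add: FN.tr_diff FN.tr_scaleR fN rho_N q) (simp add: f_def FN.tr_scaleR N.mult rho_N q e_comm tn_rho tau_E[OF q(1), symmetric] FM.tr_scaleR one)
 hence fq: "rho q = f" using FN.faithful[OF N.diff[OF rho_N[OF q(1)] fN]] le by simp
 have "(y * q) $ Om = f $ y $ Om" by (simp add: rho_orbit y q flip: fq)
 also have "... = (1 / lam) *\<^sub>R (rho q $ e $ (y * q) $ Om)" by (simp add: f_def rho_orbit y q)
 also have "... = (1 / lam) *\<^sub>R (rho q $ E (y * q) $ Om)" by (simp only: E_Om[OF mult[OF y q(1)]])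
 also have "... = ((1 / lam) *\<^sub>R (E (y * q) * q)) $ Om" by (simp add: rho_orbit q A_M E_mem mult y)
 finally show ?thesis by (rule separating_eq[rotated 2]) (intro mult scaleR y q A_M E_mem)+
qed

text \<open>\<open>star y * E y\<close> commutes with \<open>A\<close>, since \<open>E\<close>
  respects the relation \<open>b * y = y * a\<close>; irreducibility makes it a scalar, so
  \<open>E y\<close> is a multiple of \<open>y\<close>.\<close>

lemma normalizer_dichotomy:
 assumes y: "y \<in> M" "star y * y = 1" and nz: "!!a. a \<in> A ==> y * a * star y \<in> A"
 shows "E y = 0 \<or> y \<in> A"
proof -
 have yy: "y * star y = 1" by (rule FM.isometry_unitary[OF y])
 have yc: "star y * E y \<in> comm A"
 proof (rule commI)
  fix a assume a: "a \<in> A"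
  define b where "b = y * a * star y"
  have b: "b \<in> A" unfolding b_def by (rule nz[OF a])
  have yb: "b * y = y * a" by (simp add: b_def y(2) mult.assoc)
  have by': "star y * b = a * star y" by (simp add: b_def y(2) flip: mult.assoc)
  have "star y * E y * a = star y * E (y * a)" by (simp add: E_right a y mult.assoc)
  also have "... = star y * b * E y" by (simp add: E_left b y mult.assoc flip: yb)
  finally show "a * (star y * E y) = star y * E y * a" by (simp add: by' mult.assoc)
 qed
 obtain d where d: "star y * E y = cscale d 1" using irreducible[OF lam_bounds(3) _ yc] mult star A_M E_mem y(1) by blast
 have c: "E y = cscale d y" using arg_cong[OF d, of "%s. y * s"] yy by (simp add: cscale_mult flip: mult.assoc)
 show ?thesis
 proof (cases "d = 0")
  case False
  hence "y = cscale (1 / d) (E y)" by (simp add: c cscale_cscale)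
  thus ?thesis using A.cscale[OF E_mem[OF y(1)]] by metis
 qed (simp add: c)
qed

text \<open>If \<open>s\<close> differs from \<open>q\<close>, then \<open>weak_pimsner_popa\<close>
  applies to \<open>s - q\<close>. It rules out expectations 1/2 and 1/3 above \<open>q\<close>,
  which differ from \<open>lam\<close> but lie below \<open>2 * lam\<close>.\<close>

lemma projection_over_jones:
 assumes q: "q \<in> M" "isproj q" "E q = lam *\<^sub>R 1" and s: "s \<in> M" "isproj s" "E s = c *\<^sub>R 1" "s * q = q"
 shows "c = lam \<or> 2 * lam <= c"
proof (cases "s = q")
 case True
 have "tau (E s) = c" "tau (E q) = lam" using FM.tr_scaleR[OF one] by (simp_all add: q s)
 thus ?thesis using True by simp
next
 case False
 have qs: "q * s = q" using arg_cong[OF s(4), of star] q(2) s(2) by (simp add: star_mult isproj_def)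
 have "lam <= c - lam"
 proof (rule weak_pimsner_popa)
  show "isproj (s - q)" using q(2) s(2) by (simp add: isproj_def star_simps algebra_simps qs s(4))
  show "E (s - q) = (c - lam) *\<^sub>R 1" by (simp add: E_diff q s scaleR_diff_left)
 qed (use False in \<open>auto intro: diff s q A.one\<close>)
 thus ?thesis by simp
qed

text \<open>Averages of powers of \<open>W\<close> fix \<open>q\<close>. If \<open>W2\<close> or
  \<open>W3\<close> lies in \<open>A\<close>, then it is 1 and the average over the cyclic group is
  a projection of expectation 1/2 or 1/3 above \<open>q\<close>; otherwise four successive powers
  are orthogonal and \<open>q\<close> is too large for them.\<close>

lemma no_normalizer_fixing_jones:
 assumes q: "q \<in> M" "isproj q" "E q = lam *\<^sub>R 1" and W: "W \<in> M" "star W * W = 1" "W * q = q" "E W = 0"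
  and nz: "!!a. a \<in> A ==> W * a * star W \<in> A"
 shows False
proof -
 have WW: "W * star W = 1" by (rule FM.isometry_unitary[OF W(1,2)])
 have lW: "lam *\<^sub>R x = lam *\<^sub>R 1 ==> x = 1" for x :: "'a cop" using lam_pos by simp
 have 3: "3 *\<^sub>R x = x + x + x" for x :: "'a cop" using scaleR_left_distrib[of 2 1 x] by (simp add: scaleR_2)
 have 4: "4 *\<^sub>R x = x + x + x + x" for x :: "'a cop" using scaleR_left_distrib[of 2 2 x] by (simp add: scaleR_2)
 have cancel: "star W * (W * z) = z" for z using W(2) by (simp flip: mult.assoc)
 define W2 where "W2 = W * W"
 define W3 where "W3 = W * (W * W)"
 have W2: "W2 \<in> M" "star W2 * W2 = 1" "W2 * q = q" "!!a. a \<in> A ==> W2 * a * star W2 \<in> A"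
 proof -
  show "W2 * a * star W2 \<in> A" if a: "a \<in> A" for a
   using nz[OF nz[OF a]] by (simp add: W2_def star_mult mult.assoc)
 qed (simp_all add: W2_def mult W star_mult cancel mult.assoc)
 have W3: "W3 \<in> M" "star W3 * W3 = 1" "W3 * q = q" "!!a. a \<in> A ==> W3 * a * star W3 \<in> A"
 proof -
  show "W3 * a * star W3 \<in> A" if a: "a \<in> A" for a
   using nz[OF nz[OF nz[OF a]]] by (simp add: W3_def star_mult mult.assoc)
 qed (simp_all add: W3_def mult W star_mult cancel mult.assoc)
 \<comment> \<open>Applying \<open>E\<close> to \<open>w * q = q\<close> gives lam w = lam.\<close>
 have one_if: "w = 1" if "w \<in> A" "w * q = q" for w
  using E_left[OF that(1) q(1)] by (intro lW) (simp add: that(2) q(3))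
 show False
 proof (cases "W2 \<in> A")
  case True
  have w: "W * W = 1" using one_if[OF True W2(3)] by (simp add: W2_def)
  have sW: "star W = W" using cancel[of W] w by simp
  have "isproj ((1/2) *\<^sub>R (1 + W))" by (rule isproj_scaleR) (simp_all add: star_add sW scaleR_2 algebra_simps w)
  moreover have "E ((1/2) *\<^sub>R (1 + W)) = (1/2) *\<^sub>R 1" by (simp add: W add one E_scaleR E_add E_id A.one)
  moreover have "(1/2) *\<^sub>R (1 + W) * q = q" by (simp add: W distrib_right)
  moreover have "(1/2) *\<^sub>R (1 + W) \<in> M" by (intro scaleR add one W)
  ultimately have "1/2 = lam \<or> 2 * lam <= 1/2" using projection_over_jones[OF q] by blast
  thus False using lam_bounds by simp
 next
  case False
  hence E2: "E W2 = 0" using normalizer_dichotomy[OF W2(1,2,4)] by blast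
  show False
  proof (cases "W3 \<in> A")
   case True
   have w: "W * (W * W) = 1" using one_if[OF True W3(3)] by (simp add: W3_def)
   have sW: "star W = W * W" using cancel[of "W * W"] w by simp
   have "star (W * W) = W * (W * (W * W))" by (simp add: star_mult sW mult.assoc)
   hence sW2: "star (W * W) = W" by (simp add: w)
   have w4: "W * (W * (W * W)) = W" by (simp add: w)
   have "isproj ((1/3) *\<^sub>R (1 + W + W2))"
    by (rule isproj_scaleR) (simp_all add: 3 star_add sW sW2 W2_def algebra_simps w w4)
   moreover have "E ((1/3) *\<^sub>R (1 + W + W2)) = (1/3) *\<^sub>R 1" by (simp add: W W2 E2 add one E_scaleR E_add E_id A.one)
   moreover have "(1 + W + W2) * q = 3 *\<^sub>R q" by (simp add: 3 distrib_right W W2)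
   hence "(1/3) *\<^sub>R (1 + W + W2) * q = q" by simp
   moreover have "(1/3) *\<^sub>R (1 + W + W2) \<in> M" by (intro scaleR add one W W2)
   ultimately have "1/3 = lam \<or> 2 * lam <= 1/3" using projection_over_jones[OF q] by blast
   thus False using lam_bounds by simp
  next
   case False
   hence E3: "E W3 = 0" using normalizer_dichotomy[OF W3(1,2,4)] by blast
   \<comment> \<open>Orthogonality gives \<open>X\<close> the squared trace norm 4, while
     \<open>X * q = 4 *\<^sub>R q\<close> puts \<open>16 *\<^sub>R q\<close> below
     \<open>X * star X\<close>; together \<open>16 * lam <= 4\<close>.\<close>
   define X where "X = 1 + W + W2 + W3"
   have XM: "X \<in> M" unfolding X_def by (intro add one W W2 W3)
   have t: "tau W = 0" "tau W2 = 0" "tau W3 = 0"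
    using tau_E[OF W(1)] tau_E[OF W2(1)] tau_E[OF W3(1)] by (simp_all add: W E2 E3 FM.tr_zero)
   have "star X * X = 4 *\<^sub>R 1 + 3 *\<^sub>R W + 2 *\<^sub>R W2 + W3 + 3 *\<^sub>R star W + 2 *\<^sub>R star W2 + star W3"
    by (simp add: X_def W2_def W3_def star_add star_mult algebra_simps cancel W(2)) (simp add: scaleR_2 3 4)
   hence "tau (star X * X) = 4" using t FM.tr_star[OF W(1)] FM.tr_star[OF W2(1)] FM.tr_star[OF W3(1)]
    by (simp add: FM.tr_add FM.tr_scaleR add scaleR one W W2 W3 star)
   hence tX: "tau (X * star X) = 4" using FM.tr_comm[OF XM star[OF XM]] by simp
   have Xq: "X * q = 4 *\<^sub>R q" by (simp add: X_def distrib_right W W2 W3 4)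
   have qX: "q * star X = 4 *\<^sub>R q" using arg_cong[OF Xq, of star] q(2) by (simp add: star_simps isproj_def)
   have "X * q * star X = 16 *\<^sub>R q" by (simp add: Xq qX mult.assoc)
   moreover have "X * q * star X <= X * 1 * star X" using conj_mono[OF isproj_le_one[OF q(2)], of "star X"] by simp
   ultimately have "tau (16 *\<^sub>R q) <= tau (X * star X)" by (intro FM.tr_mono scaleR q mult star XM) simp
   moreover have "tau q = lam" using tau_E[OF q(1)] FM.tr_scaleR[OF one] by (simp add: q(3))
   ultimately show False using tX lam_bounds by (simp add: FM.tr_scaleR q)
  qed
 qed
qed

text \<open>Equality of traces makes \<open>z\<close> equivalent to \<open>e\<close>, and pushing
  the equivalence down gives a unitary \<open>n\<close> with \<open>E n = 0\<close> whose adjoint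
  conjugates \<open>A\<close> into \<open>A\<close>. On a Jones projection \<open>q\<close> it
  agrees with a unitary \<open>b\<close> of \<open>A\<close>, so \<open>star n * b\<close> fixes
  \<open>q\<close>.\<close>

lemma no_trivial_bimodule:
 assumes z: "z \<in> C" "isproj z" "tn z = lam" "z * e = 0" shows False
proof -
 have sz: "star z = z" "z * z = z" using z(2) by (simp_all add: isproj_def)
 have "tn z = tn e" using z(3) by (simp add: lam_def)
 then obtain v where v: "v \<in> comm A" "star v * v = z" "v * star v = e"
  using FN.equivalence[OF C_comm[OF z(1)] z(2) e_comm e_proj] by blast
 have vi: "v * star v * v = v" by (rule isproj_star_mult_isometry) (simp add: v(2) z)
 have ev: "e * v = v" using vi by (simp add: v(3))
 obtain n where n: "n \<in> M" "v = e * rho n" using pushdown[OF v(1) ev] by blast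
 have "E (star n * n) = 1"
  by (rule rho_e_inj[OF E_mem A.one]) (use n range_e_rho[OF n(1)] v(3) mult star in simp_all)
 have nn: "n * star n = 1"
 proof (rule tau_separates)
  fix m assume m: "m \<in> M"
  have "lam * tau (m * (n * star n)) = tn (z * rho m)" using tn_initial_e_rho[OF n(1) m] v(2) n(2) by simp
  also have "... = lam * tau m" using tn_C_rho[OF lam_bounds(3) z(1) sz(1) m] z(3) by simp
  finally have "lam * tau (m * (n * star n)) = lam * tau m" .
  thus "tau (m * (n * star n)) = tau (m * 1)" using lam_pos by simp
 qed (intro mult star n one)+
 have n'n: "star n * n = 1" using FM.isometry_unitary[OF star[OF n(1)]] nn by simp
 have En: "E n = 0"
 proof (rule rho_e_inj[OF E_mem[OF n(1)] A.zero])
  have "v * e = v * (star v * v * e)" using vi by (simp flip: mult.assoc)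
  hence "v * e = 0" by (simp add: v(2) z(4))
  thus "rho (E n) * e = rho 0 * e" by (simp add: n flip: e_rho_e)
 qed
 have rn: "rho n * rho (star n) = 1" "rho (star n) * rho n = 1" using n'n nn n star by (simp_all flip: rho_mult)
 have ze: "rho (star n) * e * rho n = z"
  using v(2) by (simp add: n star_mult e_star rho_star mult.assoc) (simp add: e_e flip: mult.assoc)
 have er: "rho n * z * rho (star n) = e"
 proof -
  have "rho n * z * rho (star n) = rho n * rho (star n) * e * (rho n * rho (star n))" by (simp only: ze[symmetric] mult.assoc)
  thus ?thesis by (simp add: rn)
 qed
 \<comment> \<open>\<open>rho n\<close> carries \<open>z\<close> to \<open>e\<close>, so commutation
   of \<open>z\<close> with \<open>rho a\<close> becomes commutation of \<open>e\<close> with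
   \<open>rho y\<close>, and evaluation at \<open>Om\<close> gives \<open>y = E y\<close>.\<close>
 have nz: "star n * a * n \<in> A" if a: "a \<in> A" for a
 proof -
  define y where "y = star n * a * n"
  have yM: "y \<in> M" unfolding y_def by (intro mult star n A_M a)
  have ry: "rho y = rho n * rho a * rho (star n)" by (simp add: y_def rho_mult mult star n A_M a mult.assoc)
  have "rho y * e = rho n * rho a * (rho (star n) * rho n) * z * rho (star n)" by (simp only: ry er[symmetric] mult.assoc)
  also have "... = rho n * (rho a * z) * rho (star n)" by (simp add: rn mult.assoc)
  also have "... = rho n * (z * rho a) * rho (star n)" by (simp only: C_rho[OF z(1) a])
  also have "... = rho n * z * (rho (star n) * rho n) * rho a * rho (star n)" by (simp add: rn mult.assoc)
  also have "... = e * rho y" by (simp only: ry er[symmetric] mult.assoc)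
  finally have "rho y * e = e * rho y" .
  from arg_cong[OF this, of "%s. s $ Om"] have "y $ Om = E y $ Om" by (simp add: rho_Om yM E_Om)
  hence "y = E y" by (rule separating_eq[OF yM A_M[OF E_mem[OF yM]]])
  thus ?thesis using E_mem[OF yM] by (simp add: y_def)
 qed
 obtain q where q: "q \<in> M" "isproj q" "E q = lam *\<^sub>R 1" using jones_projection[OF A.one isproj_simps(2)] by auto
 define b where "b = (1 / lam) *\<^sub>R E (n * q)"
 have bA: "b \<in> A" unfolding b_def by (intro A.scaleR E_mem mult n q)
 have nq: "n * q = b * q" using jones_pushdown[OF q n(1)] by (simp add: b_def)
 \<comment> \<open>Conjugation by \<open>star n\<close> keeps \<open>A\<close> inside
   \<open>A\<close>, so the value of \<open>E q\<close> is carried over by the trace. It will make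
   \<open>b\<close> unitary.\<close>
 have Enq: "E (n * q * star n) = lam *\<^sub>R 1"
 proof -
  define x where "x = E (n * q * star n) - lam *\<^sub>R 1"
  have nqM: "n * q * star n \<in> M" by (intro mult star n q)
  have xA: "x \<in> A" unfolding x_def by (intro A.diff A.scaleR A.one E_mem nqM)
  have "x = 0"
  proof (rule FA.faithful_all[OF xA])
   fix a assume a: "a \<in> A"
   have "tau (a * E (n * q * star n)) = tau (a * (n * q * star n))"
    using tau_E[OF mult[OF A_M[OF a] nqM]] by (simp add: E_left a nqM)
   also have "... = tau (star n * a * n * q)"
    using FM.tr_comm[of "a * n * q" "star n"] by (simp add: mult star n A_M a q mult.assoc)
   also have "... = tau (star n * a * n * E q)" using tau_E[of "star n * a * n * q"] by (simp add: E_left[OF nz[OF a] q(1)] mult star n A_M a q)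
   also have "... = lam * tau (star n * (a * n))" by (simp add: q(3) FM.tr_scaleR mult star n A_M a mult.assoc)
   also have "tau (star n * (a * n)) = tau (a * n * star n)" by (rule FM.tr_comm) (intro mult star n A_M a)+
   also have "... = tau a" by (simp add: nn mult.assoc)
   finally show "tau (a * x) = 0"
    by (simp add: x_def right_diff_distrib FM.tr_diff FM.tr_scaleR mult A_M a E_mem nqM scaleR)
  qed
  thus ?thesis by (simp add: x_def)
 qed
 have sq: "star q = q" "q * q = q" using q(2) by (simp_all add: isproj_def)
 have "n * q * star n = n * (q * q) * star n" by (simp only: sq)
 also have "... = (n * q) * star (n * q)" by (simp only: star_mult sq(1) mult.assoc)
 also have "... = b * (q * q) * star b" unfolding nq by (simp only: star_mult sq(1) mult.assoc)
 also have "... = b * (q * star b)" by (simp only: sq mult.assoc)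
 finally have "E (n * q * star n) = b * (lam *\<^sub>R 1 * star b)"
  by (simp only: E_left[OF bA mult[OF q(1) A_M[OF A.star[OF bA]]]] E_right[OF A.star[OF bA] q(1)] q(3))
 hence bb: "b * star b = 1" using Enq lam_pos by simp
 have b'b: "star b * b = 1" using FA.isometry_unitary[OF A.star[OF bA]] bb by simp
 define W where "W = star n * b"
 show False
 proof (rule no_normalizer_fixing_jones[OF q])
  show "W \<in> M" unfolding W_def by (intro mult star n A_M bA)
  have "star W * W = star b * (n * star n) * b" by (simp only: W_def star_mult star_star mult.assoc)
  thus "star W * W = 1" by (simp add: nn b'b)
  have "W * q = star n * (b * q)" by (simp add: W_def mult.assoc)
  also have "... = star n * n * q" by (simp only: nq mult.assoc)
  finally show "W * q = q" by (simp add: n'n)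
  show "E W = 0" by (simp add: W_def E_right bA star n E_star En)
  show "W * a * star W \<in> A" if a: "a \<in> A" for a
  proof -
   have "b * a * star b \<in> A" by (intro A.mult A.star bA a)
   from nz[OF this] show ?thesis by (simp add: W_def star_mult mult.assoc)
  qed
 qed
qed

lemma C_trace_lower:
 assumes z: "z \<in> C" "isproj z" "z ~= 0" "z * e = 0" shows "lam <= tn z * (1 - lam)"
proof (rule ccontr)
 assume "\<not> ?thesis"
 hence "tn z = lam" by (intro small_bimodule[OF lam_bounds(3,4) infinite_A z(1-3)]) simp
 thus False by (rule no_trivial_bimodule[OF z(1,2) _ z(4)])
qed

lemma C_structure:
 assumes x: "x \<in> C" "star x = x" shows "\<exists>a b. x = a *\<^sub>R e + b *\<^sub>R (1 - e)"
proof -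
 interpret C: vn_algebra C by (rule C_vn)
 have xN: "x \<in> comm A" by (rule C_comm[OF x(1)])
 have "e * (e * x) = e * x" by (simp add: e_e flip: mult.assoc)
 from pushdown[OF N.mult[OF e_comm xN] this] obtain n where n: "n \<in> M" "e * x = e * rho n" by blast
 \<comment> \<open>\<open>x\<close> commutes with the right action of \<open>A\<close>, and so does
   its push-down; irreducibility then makes \<open>x\<close> scalar on the range of
   \<open>e\<close>.\<close>
 have "n \<in> comm A"
 proof (rule commI)
  fix a assume a: "a \<in> A"
  have "e * rho (a * n) = e * x * rho a" by (simp add: rho_mult A_M a n mult.assoc)
  also have "... = rho a * e * x" using C_rho[OF x(1) a] rho_e[OF a] by (simp add: mult.assoc)
  also have "... = rho a * e * rho n" by (simp add: n(2) mult.assoc)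
  also have "... = e * rho (n * a)" by (simp only: rho_e[OF a] rho_mult[OF n(1) A_M[OF a]] mult.assoc)
  finally have h: "e * rho (a * n) = e * rho (n * a)" .
  from arg_cong[OF h, of star] have "star (rho (a * n)) * e = star (rho (n * a)) * e" by (simp only: star_mult e_star)
  hence "rho (star (a * n)) * e = rho (star (n * a)) * e"
   by (simp only: rho_star[OF mult[OF A_M[OF a] n(1)]] rho_star[OF mult[OF n(1) A_M[OF a]]])
  from arg_cong[OF this, of "%s. s $ Om"] have "rho (star (a * n)) $ Om = rho (star (n * a)) $ Om" by simp
  hence "star (a * n) $ Om = star (n * a) $ Om"
   by (simp only: rho_Om[OF star[OF mult[OF A_M[OF a] n(1)]]] rho_Om[OF star[OF mult[OF n(1) A_M[OF a]]]])
  hence "star (a * n) = star (n * a)" by (rule separating_eq[rotated 2]) (intro star mult n A_M a)+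
  thus "a * n = n * a" by (simp add: star_inj)
 qed
 then obtain c where "n = cscale c 1" using irreducible[OF lam_bounds(3) n(1)] by blast
 hence ex: "e * x = cscale c e" using n(2) by (simp add: rho_cscale one cscale_mult)
 hence exe: "e * x * e = e * x" by (simp add: cscale_mult e_e)
 from arg_cong[OF this, of star] have xe: "x * e = e * x" using exe by (simp add: star_mult x e_star mult.assoc)
 from arg_cong[OF ex, of star] have "e * x = cscale (cnj c) e" using xe by (simp add: star_simps x e_star)
 hence "2 *\<^sub>R (e * x) = cscale (c + cnj c) e" using ex by (simp add: scaleR_2 cscale_add)
 also have "... = (2 * Re c) *\<^sub>R e" unfolding complex_add_cnj by (rule cscale_of_real)
 finally have "(1/2) *\<^sub>R (2 *\<^sub>R (e * x)) = (1/2) *\<^sub>R ((2 * Re c) *\<^sub>R e)" by simp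
 hence ex': "e * x = Re c *\<^sub>R e" by simp
 define f where "f = 1 - e"
 have f: "f \<in> C" "isproj f" unfolding f_def by (intro C.diff C.one e_C) (rule isproj_compl[OF e_proj])
 have "\<exists>b. x * f = b *\<^sub>R f"
 proof (rule C.minimal_projection_scalar[OF f])
  show "x * f \<in> C" by (intro C.mult x f)
  show "star (x * f) = x * f" by (simp add: f_def star_simps x e_star algebra_simps xe)
  show "x * f * f = x * f" using f(2) by (simp add: isproj_def mult.assoc)
  fix p assume p: "p \<in> C" "isproj p" "p <= f"
  have ep: "e * p = 0" using isproj_le_compl_iff[OF p(2) e_proj] p(3) by (simp add: f_def)
  have pe: "p * e = 0" by (rule isproj_zero_prod(1)[OF e_proj p(2) ep])
  have fp: "isproj (f - p)" by (rule isproj_diff[OF p(2) f(2) p(3)])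
  show "p = 0 \<or> p = f"
  proof (rule ccontr)
   assume n: "\<not> ?thesis"
   have "lam <= tn p * (1 - lam)" using C_trace_lower[OF p(1,2) _ pe] n by blast
   moreover have "f - p ~= 0" "(f - p) * e = 0" using n by (auto simp: f_def left_diff_distrib pe e_e)
   hence "lam <= tn (f - p) * (1 - lam)" by (rule C_trace_lower[OF C.diff[OF f(1) p(1)] fp])
   moreover have "tn (f - p) = 1 - lam - tn p"
    by (simp add: f_def FN.tr_diff N.diff N.one e_comm C_comm p tn_one lam_def)
   \<comment> \<open>Two pieces of trace at least lam / (1 - lam) add up to 1 - lam. But (1 - lam)^2
     = 1/2, which is less than 2 lam.\<close>
   ultimately have "2 * lam <= (1 - lam) * (1 - lam)" by (simp add: algebra_simps)
   thus False using lam_sq lam_bounds by (simp add: algebra_simps)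
  qed
 qed
 then obtain b where "x * f = b *\<^sub>R f" by blast
 hence "x = Re c *\<^sub>R e + b *\<^sub>R (1 - e)" using ex' xe by (simp add: f_def algebra_simps)
 thus ?thesis by blast
qed

end


section \<open>The lower bound\<close>

text \<open>A self-adjoint contraction \<open>a\<close> is the real part of the unitary a + i sqrt(1
  - a^2), so the unitaries span \<open>Q\<close>; the rule packages this as an induction.\<close>

lemma (in vn_algebra) unitary_induct [consumes 1, case_names add cscale unitary]:
 assumes x: "x \<in> Q"
  and padd: "!!y z. y \<in> Q ==> z \<in> Q ==> P y ==> P z ==> P (y + z)"
  and pcs: "!!y c. y \<in> Q ==> P y ==> P (cscale c y)"
  and pu: "!!u. u \<in> Q ==> star u * u = 1 ==> u * star u = 1 ==> P u"
 shows "P x"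
proof -
 have contraction: "P a" if a: "a \<in> Q" "star a = a" "nrm a <= 1" for a
 proof -
  have "a * a <= 1"
  proof -
   have "a * a <= (nrm a)\<^sup>2 *\<^sub>R 1" using star_mult_self_le[of a] a(2) by simp
   also have "... <= 1 *\<^sub>R 1" using power_mono[OF a(3), of 2] by (intro scaleR_right_mono) auto
   finally show ?thesis by simp
  qed
  hence b0: "0 <= 1 - a * a" by simp
  define b where "b = psqrt (1 - a * a)"
  have bQ: "b \<in> Q" unfolding b_def by (intro psqrt_mem diff one mult a b0)
  have b: "star b = b" "b * b = 1 - a * a" "a * b = b * a"
   unfolding b_def using psqrt(1,2)[OF b0] psqrt(3)[OF b0, of a] pos_self_adjoint by (auto simp: algebra_simps mult.assoc)
  define u where "u = a + cscale \<i> b"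
  have uQ: "u \<in> Q" unfolding u_def by (intro add a cscale bQ)
  have su: "star u = a + cscale (- \<i>) b" by (simp add: u_def star_simps a b)
  have ic: "cscale \<i> (cscale (- \<i>) z) = z" "cscale (- \<i>) (cscale \<i> z) = z" "cscale \<i> z + cscale (- \<i>) z = 0" "cscale (- \<i>) z + cscale \<i> z = 0" for z :: "'h::complex_hilbert_space cop"
   by (simp_all add: cscale_cscale flip: cscale_add)
  have "star u * u = a * a + (cscale \<i> (a * b) + cscale (- \<i>) (a * b)) + b * b"
   unfolding su unfolding u_def by (simp add: distrib_left distrib_right cscale_mult cscale_add(1) ic(1,2) b(3) add_ac )
  hence u1: "star u * u = 1" by (simp add: ic b)
  have "u * star u = a * a + (cscale (- \<i>) (a * b) + cscale \<i> (a * b)) + b * b"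
   unfolding su unfolding u_def by (simp add: distrib_left distrib_right cscale_mult cscale_add(1) ic(1,2) b(3) add_ac )
  hence u2: "u * star u = 1" by (simp add: ic b)
  have "P (cscale (of_real (1/2)) (u + star u))"
   by (intro pcs padd pu uQ u1 u2 add star) (simp_all add: u1 u2)
  moreover have "u + star u = (a + a) + (cscale \<i> b + cscale (- \<i>) b)" unfolding su unfolding u_def by (simp only: add_ac)
  hence "u + star u = 2 *\<^sub>R a" unfolding ic(3) by (simp add: scaleR_2)
  hence "cscale (of_real (1/2)) (u + star u) = a" by (simp only: cscale_of_real) simp
  ultimately show ?thesis by simp
 qed
 have sa: "P a" if a: "a \<in> Q" "star a = a" for a
 proof -
  define r where "r = nrm a + 1"
  have r: "0 < r" by (simp add: r_def add_nonneg_pos)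
  have "P ((1 / r) *\<^sub>R a)"
   by (rule contraction) (use r in \<open>auto simp: star_simps a nrm_scaleR r_def field_simps intro: scaleR\<close>)
  hence "P (cscale (of_real r) ((1 / r) *\<^sub>R a))" by (intro pcs scaleR a)
  thus ?thesis using r by (simp add: cscale_of_real)
 qed
 obtain a b where ab: "star a = a" "star b = b" "x = a + cscale \<i> b"
  "a = (1/2) *\<^sub>R (x + star x)" "b = (1/2) *\<^sub>R cscale (- \<i>) (x - star x)" by (rule complex_decomposition)
 have "a \<in> Q" "b \<in> Q" unfolding ab(4,5) by (intro scaleR add diff cscale star x)+
 thus ?thesis unfolding ab(3) by (intro padd pcs sa ab(1,2) cscale)
qed

context finite_index
begin

lemma tn_slim:
 assumes "slim f x" "!!n. f n \<in> comm A" shows "(%n. tn (f n)) ----> tn x"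
proof -
 have x: "x \<in> comm A" by (rule comm_slim[OF assms(2,1)])
 obtain I and v :: "nat => 'a cop" where
  v: "!!x. x \<in> comm A ==> tn x = lam * (\<Sum>i\<in>I. qf x (star (v i) $ Om))" by (rule tn_vector_states) blast
 have "(%n. lam * (\<Sum>i\<in>I. qf (f n) (star (v i) $ Om))) ----> lam * (\<Sum>i\<in>I. qf x (star (v i) $ Om))"
  by (intro tendsto_mult tendsto_const tendsto_sum slim_qf assms(1))
 thus ?thesis by (simp only: v assms(2) x)
qed

text \<open>Averaging over the unitary group of \<open>A\<close>: the element of minimal 2-norm in the closed convex hull of
 the orbit of \<open>k\<close>.\<close>

lemma average_exists:
 assumes k: "k \<in> comm A" "0 <= k" "k <= 1"
 defines "S \<equiv> convex hull {star (rho v) * k * rho v | v. v \<in> A & star v * v = 1 & v * star v = 1}"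
 shows "\<exists>f h. (\<forall>n. f n \<in> S) & slim f h & h \<in> comm (rho ` A)"
proof -
 define G where "G = {star (rho v) * k * rho v | v. v \<in> A & star v * v = 1 & v * star v = 1}"
 obtain I and w :: "nat => 'a cop" where I: "finite I" and w: "!!i. i \<in> I ==> w i \<in> comm A" "!!i. i \<in> I ==> e * w i = w i"
  "(\<Sum>i\<in>I. star (w i) * w i) = 1" and tn: "!!x. x \<in> comm A ==> tn x = lam * (\<Sum>i\<in>I. qf x (star (w i) $ Om))"
  by (rule tn_vector_states) blast
 \<comment> \<open>On the commutant of \<open>A\<close> this is
   \<open>tn (star x * x) / lam\<close>. Written as a sum of vector norms it obeys the parallelogram
   law for all operators.\<close>
 define q where "q x = (\<Sum>i\<in>I. (norm (x $ star (w i) $ Om))\<^sup>2)" for x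
 have tq: "tn (star x * x) = lam * q x" if "x \<in> comm A" for x
  using tn[of "star x * x"] that by (simp add: q_def N.mult N.star qf_simps)
 have GN: "x \<in> comm A & 0 <= x & x <= 1" if x: "x \<in> G" for x
 proof -
  obtain v where v: "v \<in> A" "star v * v = 1" "v * star v = 1" "x = star (rho v) * k * rho v" using x unfolding G_def by blast
  have "star (rho v) * rho v = rho (v * star v)" using v(1) by (simp add: rho_mult rho_star A_M A.star)
  hence "star (rho v) * 1 * rho v = 1" using v by simp
  moreover have "star (rho v) * k * rho v \<in> comm A" by (intro N.mult N.star rho_N A_M v k)
  ultimately show ?thesis using conj_pos[OF k(2), of "rho v"] conj_mono[OF k(3), of "rho v"] unfolding v(4) by simp
 qed
 have "convex {x \<in> comm A. 0 <= x & x <= 1}"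
 proof (rule convexI)
  fix x y and r s :: real
  assume x: "x \<in> {x \<in> comm A. 0 <= x & x <= 1}" and y: "y \<in> {x \<in> comm A. 0 <= x & x <= 1}" and rs: "0 <= r" "0 <= s" "r + s = 1"
  have "r *\<^sub>R x + s *\<^sub>R y <= r *\<^sub>R 1 + s *\<^sub>R 1" using x y rs by (intro add_mono scaleR_left_mono) auto
  also have "... = 1" by (simp add: rs(3) flip: scaleR_left_distrib)
  finally show "r *\<^sub>R x + s *\<^sub>R y \<in> {x \<in> comm A. 0 <= x & x <= 1}"
   using x y rs by (auto intro!: N.add N.scaleR add_nonneg_nonneg scaleR_nonneg_nonneg)
 qed
 moreover have "G \<subseteq> {x \<in> comm A. 0 <= x & x <= 1}" using GN by blast
 ultimately have "convex hull G \<subseteq> {x \<in> comm A. 0 <= x & x <= 1}" by (simp add: hull_minimal)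
 moreover have "S = convex hull G" by (simp add: S_def G_def)
 ultimately have SN: "x \<in> comm A" "0 <= x" "x <= 1" if "x \<in> S" for x using that by blast+
 have SG: "S = convex hull G" by (simp add: S_def G_def)
 have "\<exists>x d. (\<forall>n. x n \<in> S) & (\<forall>s\<in>S. d <= q s) & (\<forall>n. q (x n) <= d + 1 / (real n + 1)) \<and>
  (\<forall>n. \<forall>s\<in>S. q (x n - s) <= 2 * (1 / (real n + 1)) + 2 * (q s - d))"
 proof (rule minimising_sequence)
  show "convex S" by (simp add: SG)
  have "star (rho 1) * k * rho 1 \<in> G" unfolding G_def using A.one by force
  thus "S ~= {}" by (auto simp: SG)
  show "0 <= q x" for x by (simp add: q_def sum_nonneg)
  show "q (x + y) + q (x - y) = 2 * q x + 2 * q y" for x y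
   by (simp add: q_def norm_add_sq norm_diff_sq sum.distrib sum_subtractf flip: sum_distrib_left)
  show "q (r *\<^sub>R x) = r\<^sup>2 * q x" for r x
   by (simp add: q_def power_mult_distrib flip: sum_distrib_left)
 qed
 then obtain f d where f: "!!n. f n \<in> S" "!!s. s \<in> S ==> d <= q s" "!!n. q (f n) <= d + 1 / (real n + 1)"
  "!!n s. s \<in> S ==> q (f n - s) <= 2 * (1 / (real n + 1)) + 2 * (q s - d)" by blast
 have close: "q (f n - s) <= 2 * (1 / (real n + 1) + 1 / (real m + 1))" if "s \<in> S" "q s = q (f m)" for n m s
  using f(4)[OF that(1), of n] f(3)[of m] that(2) by (simp add: algebra_simps)
 have fN: "f n \<in> comm A" "nrm (f n) <= 1" for n
  using SN[OF f(1), of n] nrm_pos_le[of "f n" 1] by auto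
 have single: "(norm (x $ star (w i) $ Om))\<^sup>2 <= q x" if "i \<in> I" for x i
  unfolding q_def by (rule member_le_sum) (use that I in auto)
 have cz: "convergent (%n. f n $ star (w i) $ Om)" if i: "i \<in> I" for i
 proof (rule Cauchy_convergent, rule Cauchy_if_norm_sq_le)
  fix m n
  show "(norm (f m $ star (w i) $ Om - f n $ star (w i) $ Om))\<^sup>2 <= 2 * (1 / (real m + 1) + 1 / (real n + 1))"
   using single[OF i, of "f m - f n"] close[OF f(1) refl, of m n] by simp
 qed
 \<comment> \<open>\<open>close\<close> controls only the vectors \<open>star (w i) $ Om\<close>.
   The \<open>f n\<close> commute with \<open>A\<close>, which gives convergence of
   \<open>f n * star (w i)\<close> on a dense set, and the \<open>w i\<close> reassemble
   \<open>f n\<close>.\<close>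
 have conv: "convergent (%n. f n $ x)" for x
 proof -
  have "convergent (%n. (f n * star (w i)) $ x)" if i: "i \<in> I" for i x
  proof (rule convergent_dense[where D = "{x. \<exists>a\<in>A. e $ x = a $ Om}"])
   show "nrm (f n * star (w i)) <= nrm (star (w i))" for n
    using nrm_mult[of "f n" "star (w i)"] mult_right_mono[OF fN(2)[of n], of "nrm (star (w i))"] by simp
   show "closure {x. \<exists>a\<in>A. e $ x = a $ Om} = UNIV"
   proof (intro equalityI subset_UNIV subsetI)
    fix x
    obtain g where g: "!!n. g n \<in> A" "(%n. g n $ Om) ----> e $ x" using e_approx by blast
    have "(%n. g n $ Om + (x - e $ x)) ----> e $ x + (x - e $ x)" by (intro tendsto_intros g)
    moreover have "g n $ Om + (x - e $ x) \<in> {x. \<exists>a\<in>A. e $ x = a $ Om}" for n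
     using g(1)[of n] by (auto simp: e_orbit)
    ultimately show "x \<in> closure {x. \<exists>a\<in>A. e $ x = a $ Om}" unfolding closure_sequential
     by (intro exI[of _ "%n. g n $ Om + (x - e $ x)"]) auto
   qed
   fix x assume "x \<in> {x. \<exists>a\<in>A. e $ x = a $ Om}"
   then obtain a where a: "a \<in> A" "e $ x = a $ Om" by blast
   have "(f n * star (w i)) $ x = a $ f n $ star (w i) $ Om" for n
   proof -
    have "star (w i) = star (w i) * e" using arg_cong[OF w(2)[OF i], of star] by (simp add: star_mult e_star)
    hence "star (w i) $ x = (star (w i) * e) $ x" by simp
    hence "(f n * star (w i)) $ x = (f n * star (w i) * a) $ Om" by (simp add: a)
    also have "f n * star (w i) * a = a * (f n * star (w i))"
     using commD[OF N.mult[OF fN(1) N.star[OF w(1)[OF i]]] a(1)] by simp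
    finally show ?thesis by simp
   qed
   moreover obtain l where "(%n. f n $ star (w i) $ Om) ----> l" using cz[OF i] convergent_def by blast
   hence "convergent (%n. a $ f n $ star (w i) $ Om)" using tendsto_appl convergent_def by blast
   ultimately show "convergent (%n. (f n * star (w i)) $ x)" by simp
  qed
  hence "convergent (%n. \<Sum>i\<in>I. (f n * star (w i)) $ w i $ x)" by (intro convergent_sum) blast
  moreover have "(\<Sum>i\<in>I. (f n * star (w i)) $ w i $ x) = f n $ x" for n
  proof -
   have "(\<Sum>i\<in>I. (f n * star (w i)) $ w i $ x) = f n $ (\<Sum>i\<in>I. star (w i) * w i) $ x"
    by (simp add: sum_appl appl_sum)
   thus ?thesis by (simp add: w(3))
  qed
  ultimately show ?thesis by simp
 qed
 obtain h where h: "slim f h" using slim_exists[OF conv fN(2)] by blast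
 have hN: "h \<in> comm A" by (rule comm_slim[OF fN(1) h])
 have "rho a * h = h * rho a" if "a \<in> A" for a
  using that
 proof (induction a rule: A.unitary_induct)
  case (add y z)
  thus ?case by (simp add: rho_add A_M algebra_simps)
 next
  case (cscale y c)
  thus ?case by (simp add: rho_cscale A_M cscale_mult)
 next
  case (unitary v)
  have rv: "star (rho v) = rho (star v)" "rho (star v) * rho v = 1" "rho v * rho (star v) = 1"
   using unitary by (simp_all add: A_M A.star flip: rho_mult rho_star)
  \<comment> \<open>\<open>T\<close> preserves \<open>S\<close> and \<open>q\<close>, so
    \<open>T (f n)\<close> is as nearly minimal as \<open>f n\<close> and the two approach each
    other; in the limit \<open>T\<close> fixes \<open>h\<close>.\<close>
  define T where "T x = rho (star v) * x * rho v" for x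
  have TN: "T x \<in> comm A" if "x \<in> comm A" for x unfolding T_def by (intro N.mult rho_N A_M A.star unitary that)
  have "T ` G \<subseteq> G"
  proof
   fix y assume "y \<in> T ` G"
   then obtain u where u: "u \<in> A" "star u * u = 1" "u * star u = 1" "y = T (star (rho u) * k * rho u)" unfolding G_def by blast
   have "y = star (rho (v * u)) * k * rho (v * u)"
    using u(1) unitary(1) by (simp add: u(4) T_def rho_mult rho_star A_M A.star star_mult mult.assoc)
   moreover have "v * u \<in> A" "star (v * u) * (v * u) = 1" "v * u * star (v * u) = 1"
    using u unitary by (auto intro: A.mult simp: star_mult) (metis mult.assoc mult_1_right mult_1_left)+
   ultimately show "y \<in> G" unfolding G_def by blast
  qed
  have "linear T" by (rule linearI) (simp_all add: T_def algebra_simps)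
  hence TS: "T ` S \<subseteq> S" using \<open>T ` G \<subseteq> G\<close> hull_mono[of "T ` G" G convex] unfolding SG by (simp add: convex_hull_linear_image)
  have qT: "q (T x) = q x" if x: "x \<in> comm A" for x
  proof -
   have "star (T x) * T x = rho (star v) * star x * (rho v * rho (star v)) * x * rho v"
    using rho_star[OF A_M[OF A.star[OF unitary(1)]]] by (simp add: T_def star_mult rv(1) mult.assoc)
   hence "tn (star (T x) * T x) = tn (rho (star v) * (star x * x) * rho v)" by (simp add: rv mult.assoc)
   also have "... = tn (rho v * rho (star v) * (star x * x))" by (rule FN.tr_cyc) (intro rho_N A_M A.star unitary N.mult N.star x)+
   finally have "lam * q (T x) = lam * q x" using tq[OF x] tq[OF TN[OF x]] by (simp add: rv)
   thus ?thesis using lam_pos by simp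
  qed
  have le: "q (f n - T (f n)) <= 4 * (1 / (real n + 1))" for n
   using close[of "T (f n)" n n] TS f(1)[of n] qT[OF fN(1)] by (auto simp: image_subset_iff)
  have "(%n. q (f n - T (f n))) ----> 0"
  proof (rule tendsto_sandwich[OF _ _ tendsto_const])
   show "(%n. 4 * (1 / (real n + 1))) ----> 0" using tendsto_mult_right_zero[OF LIMSEQ_inverse_real_of_nat, of 4] by (simp add: inverse_eq_divide add.commute)
   show "\<forall>\<^sub>F n in sequentially. 0 <= q (f n - T (f n))" by (simp add: q_def sum_nonneg)
  qed (use le in auto)
  moreover have "slim (%n. f n - T (f n)) (h - T h)" unfolding T_def by (intro slim_diff slim_mult_left slim_mult_right h)
  hence "(%n. q (f n - T (f n))) ----> q (h - T h)" unfolding q_def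
   by (intro tendsto_sum tendsto_power tendsto_norm slimD)
  ultimately have "q (h - T h) = 0" using LIMSEQ_unique by blast
  hence "tn (star (h - T h) * (h - T h)) = 0" using tq[OF N.diff[OF hN TN[OF hN]]] by simp
  hence "h - T h = 0" by (rule FN.faithful_star[OF N.diff[OF hN TN[OF hN]]])
  hence "rho v * h = rho v * (rho (star v) * h * rho v)" by (simp add: T_def)
  also have "... = rho v * rho (star v) * h * rho v" by (simp only: mult.assoc)
  finally show ?case by (simp add: rv)
 qed
 hence "h \<in> comm (rho ` A)" by (auto intro: commI)
 thus ?thesis using f(1) h by blast
qed

end

context index_two_plus_sqrt2
begin

text \<open>The average \<open>h\<close> of the conjugates of \<open>k\<close> has trace
  \<open>lam\<close> and \<open>tn (e * h) = lam * t\<close>, which determines it as a combination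
  of \<open>e\<close> and \<open>1 - e\<close>. Pairing \<open>k\<close> with a single conjugate
  gives \<open>lam\<close> times the quantity in the hypothesis, so \<open>tn (k * h)\<close> is at
  least \<open>lam * c\<close>.\<close>

lemma average_lower_bound:
 assumes u: "u \<in> M" "star u * u = 1"
  and c: "!!v. v \<in> A ==> star v * v = 1 ==> v * star v = 1 ==> c <= (norm (E (u * v * star u) $ Om))\<^sup>2"
 defines "t \<equiv> (norm (E u $ Om))\<^sup>2"
 shows "c <= t\<^sup>2 + lam * (1 - t)\<^sup>2 / (1 - lam)"
proof -
 have uu: "u * star u = 1" by (rule FM.isometry_unitary[OF u])
 have ru: "star (rho u) * rho u = 1" "rho u * star (rho u) = 1" using u uu by (simp_all add: star flip: rho_mult rho_star)
 define k where "k = rho u * e * star (rho u)"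
 have kN: "k \<in> comm A" unfolding k_def by (intro N.mult N.star rho_N u e_comm)
 have k0: "0 <= k" unfolding k_def by (rule conj_pos'[OF isproj_pos[OF e_proj]])
 have k1: "k <= 1" using conj_mono[OF isproj_le_one[OF e_proj], of "star (rho u)"] ru by (simp add: k_def)
 have tk: "tn k = lam"
  using FN.tr_cyc[OF rho_N[OF u(1)] e_comm N.star[OF rho_N[OF u(1)]]] by (simp add: k_def ru lam_def)
 have tek: "tn (e * k) = lam * t"
 proof -
  have "tn (e * k) = tn (e * rho u * e * star (rho u))" by (simp add: k_def mult.assoc)
  also have "e * rho u * e * star (rho u) = rho (E u) * (e * star (rho u))" by (simp only: e_rho_e[OF u(1)]) (rule mult.assoc)
  also have "tn (rho (E u) * (e * star (rho u))) = tn (e * star (rho u) * rho (E u))" by (rule FN.tr_comm) (intro N.mult N.star rho_N u e_comm A_M E_mem)+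
  finally have 1: "tn (e * k) = tn (e * star (rho u) * rho (E u))" .
  have "star (rho u) * rho (E u) = rho (E u * star u)" by (simp add: rho_mult rho_star A_M E_mem u star)
  hence "e * star (rho u) * rho (E u) = e * rho (E u * star u)" by (simp add: mult.assoc)
  hence "tn (e * star (rho u) * rho (E u)) = tn (e * rho (E u * star u))" by simp
  also have "... = lam * tau (E u * star u)" by (simp add: tn_e_rho mult A_M E_mem u star)
  also have "tau (E u * star u) = tau (E u * E (star u))"
   using tau_E[of "E u * star u"] by (simp add: E_left E_mem u star mult A_M)
  also have "... = tau (star (E u) * E u)" using FM.tr_comm[of "E u" "star (E u)"] by (simp add: E_star u star A_M E_mem)
  finally show ?thesis using 1 by (simp add: tau_star_mult t_def)
 qed
 define G where "G = {star (rho v) * k * rho v | v. v \<in> A & star v * v = 1 & v * star v = 1}"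
 \<comment> \<open>These are convex conditions, so they hold on the whole hull and can be passed to
   the limit \<open>h\<close>.\<close>
 define T where "T = {x \<in> comm A. 0 <= x & tn x = lam & tn (e * x) = lam * t & lam * c <= tn (k * x)}"
 have "G \<subseteq> T"
 proof
  fix x assume "x \<in> G"
  then obtain v where v: "v \<in> A" "star v * v = 1" "v * star v = 1" "x = star (rho v) * k * rho v" unfolding G_def by blast
  have rv: "star (rho v) * rho v = 1" "rho v * star (rho v) = 1" using v by (simp_all add: A_M star flip: rho_mult rho_star)
  have vN: "rho v \<in> comm A" "star (rho v) \<in> comm A" by (intro N.star rho_N A_M v)+
  have xN: "x \<in> comm A" unfolding v(4) by (intro N.mult vN kN)
  moreover have "0 <= x" unfolding v(4) by (rule conj_pos[OF k0])
  moreover have "tn x = lam" using FN.tr_cyc[OF vN(2) kN vN(1)] by (simp add: v(4) rv tk)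
  moreover have "tn (e * x) = lam * t"
  proof -
   have "e * star (rho v) = star (rho v) * e" using rho_e[OF A.star[OF v(1)]] by (simp add: rho_star A_M v)
   hence "e * x = star (rho v) * (e * k) * rho v" by (simp add: v(4) flip: mult.assoc)
   thus ?thesis using FN.tr_cyc[OF vN(2) N.mult[OF e_comm kN] vN(1)] by (simp add: rv tek)
  qed
  moreover have "lam * c <= tn (k * x)"
  proof -
   define y where "y = u * v * star u"
   have yM: "y \<in> M" unfolding y_def by (intro mult star u A_M v)
   have ry: "rho y = star (rho u) * rho v * rho u" by (simp add: y_def rho_mult rho_star mult star u A_M v mult.assoc)
   have "k * x = rho u * (e * (star (rho u) * star (rho v) * rho u) * e) * (star (rho u) * rho v)"
    by (simp only: k_def v(4) mult.assoc)
   hence "tn (k * x) = tn (star (rho u) * rho v * rho u * (e * (star (rho u) * star (rho v) * rho u) * e))"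
    using FN.tr_cyc[of "rho u" "e * (star (rho u) * star (rho v) * rho u) * e" "star (rho u) * rho v"]
    by (simp add: N.mult N.star rho_N u e_comm vN)
   also have "... = tn (rho y * (e * star (rho y) * e))" by (simp add: ry star_mult mult.assoc)
   also have "... = tn (rho y * rho (E (star y)) * e)" using e_rho_e[OF star[OF yM]] by (simp add: rho_star yM mult.assoc)
   also have "... = tn (e * rho (E (star y) * y))"
    using FN.tr_comm[of "rho y * rho (E (star y))" e] by (simp add: rho_mult A_M E_mem star yM N.mult rho_N e_comm)
   also have "... = lam * tau (E (star y) * E y)"
    using tau_E[of "E (star y) * y"] by (simp add: tn_e_rho mult A_M E_mem star yM E_left)
   also have "... = lam * (norm (E y $ Om))\<^sup>2" by (simp add: E_star yM tau_star_mult)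
   finally show ?thesis using c[OF v(1-3)] lam_pos by (simp add: y_def)
  qed
  ultimately show "x \<in> T" by (simp add: T_def)
 qed
 moreover have "convex T"
 proof (rule convexI)
  fix x y and r s :: real
  assume xy: "x \<in> T" "y \<in> T" and rs: "0 <= r" "0 <= s" "r + s = 1"
  have x: "x \<in> comm A" "0 <= x" "tn x = lam" "tn (e * x) = lam * t" "lam * c <= tn (k * x)"
   and y: "y \<in> comm A" "0 <= y" "tn y = lam" "tn (e * y) = lam * t" "lam * c <= tn (k * y)" using xy by (auto simp: T_def)
  have lin: "tn (z * (r *\<^sub>R x + s *\<^sub>R y)) = r * tn (z * x) + s * tn (z * y)" if "z \<in> comm A" for z
   using that x y by (simp add: distrib_left FN.tr_add FN.tr_scaleR N.mult N.scaleR)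
  have rs': "r * d + s * d = d" for d :: real using rs(3) by (simp flip: distrib_right)
  have "lam * c = r * (lam * c) + s * (lam * c)" by (simp add: rs')
  also have "... <= r * tn (k * x) + s * tn (k * y)" using x y rs by (intro add_mono mult_left_mono) auto
  finally have "lam * c <= tn (k * (r *\<^sub>R x + s *\<^sub>R y))" by (simp add: lin kN)
  thus "r *\<^sub>R x + s *\<^sub>R y \<in> T" using lin[OF N.one] lin[OF e_comm] x y rs
   by (simp add: T_def N.add N.scaleR rs' scaleR_nonneg_nonneg)
 qed
 ultimately have hT: "convex hull G \<subseteq> T" by (simp add: hull_minimal)
 obtain f h where f: "!!n. f n \<in> T" "slim f h" "h \<in> comm (rho ` A)"
  using average_exists[OF kN k0 k1] hT unfolding G_def by blast
 have fN: "f n \<in> comm A" "0 <= f n" "tn (f n) = lam" "tn (e * f n) = lam * t" "lam * c <= tn (k * f n)" for n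
  using f(1)[of n] by (auto simp: T_def)
 have hC: "h \<in> C" using comm_slim[OF fN(1) f(2)] f(3) by (simp add: C_def)
 have sh: "star h = h" by (rule pos_self_adjoint[OF slim_pos[OF f(2) fN(2)]])
 obtain a b where h: "h = a *\<^sub>R e + b *\<^sub>R (1 - e)" using C_structure[OF hC sh] by blast
 have "lam = tn h" using tn_slim[OF f(2) fN(1)] LIMSEQ_unique[OF tendsto_const] by (simp add: fN)
 hence 1: "lam = a * lam + b * (1 - lam)"
  by (simp add: h FN.tr_add FN.tr_scaleR FN.tr_diff N.scaleR N.diff N.one e_comm tn_one lam_def)
 have "lam * t = tn (e * h)" using tn_slim[OF slim_mult_left[OF f(2)] N.mult[OF e_comm fN(1)]] LIMSEQ_unique[OF tendsto_const] by (simp add: fN)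
 also have "e * h = a *\<^sub>R e" by (simp add: h distrib_left right_diff_distrib e_e)
 finally have a: "a = t" using lam_pos by (simp add: FN.tr_scaleR e_comm lam_def)
 have b: "b = lam * (1 - t) / (1 - lam)" using 1 lam_bounds by (simp add: a field_simps)
 have kh: "lam * c <= tn (k * h)"
  by (rule LIMSEQ_le_const[OF tn_slim[OF slim_mult_left[OF f(2)] N.mult[OF kN fN(1)]]]) (use fN in auto)
 have "tn (k * h) = a * tn (e * k) + b * (tn k - tn (e * k))"
  using FN.tr_comm[OF kN e_comm] by (simp add: h distrib_left right_diff_distrib scaleR_diff_right FN.tr_add FN.tr_scaleR FN.tr_diff N.scaleR N.diff N.mult kN e_comm)
 also have "... = lam * (t\<^sup>2 + b * (1 - t))" by (simp add: tek tk a algebra_simps power2_eq_square)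
 finally have "c <= t\<^sup>2 + b * (1 - t)" using kh lam_pos by simp
 thus ?thesis by (simp add: b power2_eq_square mult.assoc)
qed

end

section \<open>The upper bound\<close>

text \<open>On the range of \<open>p\<close> the operator \<open>K star K\<close> is a function of \<open>Z = L star L\<close>, whose spectrum avoids the open
 interval from \<open>0\<close> to \<open>\<alpha>\<close>; so the spectrum of \<open>star K K\<close> avoids the \<open>\<alpha>\<close>-neighbourhood of \<open>1\<close>.\<close>

lemma spectral_gap:
 fixes K L p :: "'h::complex_hilbert_space cop"
 assumes \<alpha>: "0 < \<alpha>" "\<alpha> < 1" "\<alpha>\<^sup>2 = 1 - 2 * \<alpha>"
  and KK: "K * star K = (1 - \<alpha>) *\<^sub>R p + 2 *\<^sub>R (L * star L)" and p: "isproj p" "p * K = K" "p * L = L"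
  and L: "!!y. \<alpha> * (norm (star L $ y))\<^sup>2 <= (norm (L $ star L $ y))\<^sup>2"
 shows "\<alpha> * norm v <= norm (star K $ K $ v - v)"
proof -
 have sp: "star p = p" "p * p = p" using p(1) by (simp_all add: isproj_def)
 define Z where "Z = L * star L"
 have sZ: "star Z = Z" by (simp add: Z_def star_mult)
 have pZ: "p * Z = Z" by (simp add: Z_def p(3) flip: mult.assoc)
 have Zp: "Z * p = Z" using arg_cong[OF pZ, of star] by (simp add: star_mult sZ sp)
 \<comment> \<open>\<open>Q\<close> agrees with \<open>K * star K\<close> on the range of
   \<open>p\<close> but is invertible on the whole space.\<close>
 define Q where "Q = (1 - \<alpha>) *\<^sub>R 1 + 2 *\<^sub>R Z"
 have sQ: "star Q = Q" by (simp add: Q_def star_simps sZ)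
 have Qp: "Q * p = p * Q" by (simp add: Q_def algebra_simps pZ Zp)
 have KQ: "K * star K = Q * p" by (simp add: KK Q_def Z_def[symmetric] algebra_simps Zp)
 have "0 <= 2 *\<^sub>R Z" by (simp add: Z_def scaleR_nonneg_nonneg)
 hence "(1 - \<alpha>) *\<^sub>R 1 <= Q" by (simp add: Q_def)
 from inverse_exists[OF _ this] \<alpha> obtain Qi where Qi: "Q * Qi = 1" "Qi * Q = 1" by auto
 define b where "b = Qi $ K $ v"
 have Qib: "Q $ b = K $ v" using arg_cong[OF Qi(1), of "%s. s $ K $ v"] by (simp add: b_def)
 have pQi: "p * Qi = Qi * p" by (rule inverse_commutes[OF Qi]) (simp add: Qp)
 have pKv: "p $ K $ v = K $ v" using arg_cong[OF p(2), of "%s. s $ v"] by simp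
 have pb: "p $ b = b" using arg_cong[OF pQi, of "%s. s $ K $ v"] pKv by (simp add: b_def)
 \<comment> \<open>This splits \<open>v\<close> orthogonally into \<open>star K $ b\<close> and a
   vector in the kernel of \<open>K\<close>; the operator \<open>star K * K - 1\<close> respects the
   splitting and is -1 on the kernel.\<close>
 define w where "w = v - star K $ b"
 have "K $ star K $ b = Q $ p $ b" using arg_cong[OF KQ, of "%s. s $ b"] by simp
 hence KKb: "K $ star K $ b = K $ v" by (simp add: pb Qib)
 hence Kw: "K $ w = 0" by (simp add: w_def)
 have orth: "Re (cinner (star K $ z) w) = 0" for z by (simp add: cinner_star' Kw)
 have norm_K: "(norm (star K $ z))\<^sup>2 = qf Q z" if "p $ z = z" for z
 proof -
  have "(norm (star K $ z))\<^sup>2 = qf (K * star K) z" using qf_simps(7)[of "star K" z] by simp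
  also have "... = qf Q z" using that by (simp add: KQ qf_def)
  finally show ?thesis .
 qed
 define d where "d = Q $ b - b"
 have pd: "p $ d = d" using arg_cong[OF Qp, of "%s. s $ b"] pb by (simp add: d_def)
 have "star K $ K $ v - v = star K $ d - w" by (simp add: d_def w_def Qib)
 hence n1: "(norm (star K $ K $ v - v))\<^sup>2 = qf Q d + (norm w)\<^sup>2" by (simp add: norm_diff_sq orth norm_K pd)
 have "v = star K $ b + w" by (simp add: w_def)
 hence n2: "(norm v)\<^sup>2 = qf Q b + (norm w)\<^sup>2" using norm_add_sq[of "star K $ b" w] by (simp add: orth norm_K pb)
 define D where "D = Z * Z - \<alpha> *\<^sub>R Z"
 have "qf (\<alpha> *\<^sub>R Z) y <= qf (Z * Z) y" for y
 proof -
  have "qf Z y = (norm (star L $ y))\<^sup>2" using qf_simps(7)[of "star L" y] by (simp add: Z_def)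
  moreover have "qf (Z * Z) y = (norm (L $ star L $ y))\<^sup>2" using qf_simps(7)[of Z y] sZ by (simp add: Z_def)
  ultimately show ?thesis using L[of y] by (simp add: qf_simps)
 qed
 hence "\<alpha> *\<^sub>R Z <= Z * Z" by (simp add: le_iff_qf star_simps sZ)
 hence D0: "0 <= D" by (simp add: D_def)
 have Q0: "0 <= Q" using \<open>0 <= 2 *\<^sub>R Z\<close> \<alpha> by (simp add: Q_def scaleR_nonneg_nonneg add_nonneg_nonneg)
 have QD: "D * Q = Q * D" by (simp add: D_def Q_def algebra_simps)
 have r: "star (psqrt Q) = psqrt Q" "psqrt Q * psqrt Q = Q" "D * psqrt Q = psqrt Q * D"
  using psqrt(1,2)[OF Q0] psqrt(3)[OF Q0 QD] pos_self_adjoint by auto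
 have "star (psqrt Q) * D * psqrt Q = Q * D" by (simp add: r mult.assoc) (simp add: r flip: mult.assoc)
 hence QD0: "0 <= Q * D" using conj_pos[OF D0, of "psqrt Q"] by simp
 have "qf Q d = qf ((Q - 1) * Q * (Q - 1)) b" using qf_conj[of "Q - 1" Q b] by (simp add: star_diff sQ d_def)
 \<comment> \<open>\<open>Q - 1\<close> is 2 Z - \<alpha>, whose square is the square of \<alpha>
   plus 4 D; the gap of \<open>Z\<close> above 0 enters as positivity of \<open>D\<close>.\<close>
 also have "(Q - 1) * Q * (Q - 1) = \<alpha>\<^sup>2 *\<^sub>R Q + 4 *\<^sub>R (Q * D)"
 proof -
  have Q1: "Q - 1 = 2 *\<^sub>R Z - \<alpha> *\<^sub>R 1" by (simp add: Q_def algebra_simps)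
  have "(Q - 1) * Q * (Q - 1) = Q * ((Q - 1) * (Q - 1))" by (simp add: algebra_simps)
  also have "(Q - 1) * (Q - 1) = \<alpha>\<^sup>2 *\<^sub>R 1 + 4 *\<^sub>R D"
   unfolding Q1 D_def by (simp add: algebra_simps power2_eq_square) (simp flip: scaleR_left_distrib)
  finally show ?thesis by (simp add: distrib_left)
 qed
 finally have "qf Q d \<ge> \<alpha>\<^sup>2 * qf Q b" using QD0 by (simp add: qf_simps pos_iff)
 moreover have "\<alpha>\<^sup>2 * (norm w)\<^sup>2 <= (norm w)\<^sup>2" using mult_right_mono[OF power_le_one[of \<alpha> 2], of "(norm w)\<^sup>2"] \<alpha>(1,2) by simp
 ultimately have "(\<alpha> * norm v)\<^sup>2 <= (norm (star K $ K $ v - v))\<^sup>2"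
  unfolding n1 power_mult_distrib n2 by (simp add: distrib_left)
 thus ?thesis by (rule power2_le_imp_le) simp
qed

context index_two_plus_sqrt2
begin

text \<open>The traces are tuned to fit. From (1 - lam)^2 = 1/2 comes \<open>tau g = 1 / 2\<close>,
  and as 1 / (1 - lam) = sqrt 2 the operator \<open>sqrt 2 *\<^sub>R G\<close> is a projection,
  whose complement \<open>f\<close> in \<open>rho g\<close> has the trace of \<open>e\<close>.
  Pushing down the equivalence of \<open>f\<close> and \<open>e\<close> gives
  \<open>E (star n * n) = 1\<close> and \<open>n * star n = 2 *\<^sub>R g\<close>, so half of
  \<open>star n * n\<close> is a projection of expectation 1/2.\<close>

lemma symmetry_exists:
 "\<exists>U\<in>M. star U = U & U * U = 1 & E U = 0 & (\<forall>a\<in>A. (sqrt 2 - 1) * norm (a $ Om) <= norm (E (U * a * U) $ Om))"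
proof -
 have l: "1 - lam = sqrt 2 / 2" "sqrt 2 * (1 - lam) = 1" "1 - sqrt 2 * lam = 2 * lam" "1 - 2 * lam = sqrt 2 - 1"
  by (simp_all add: lam_eq algebra_simps)
 obtain x where x: "x \<in> A" "isproj x" "tau x = 1 - lam" using FA.projection_of_trace[OF infinite_A, of "1 - lam"] lam_bounds by auto
 have sx: "star x = x" "x * x = x" using x(2) by (simp_all add: isproj_def)
 obtain q where q: "q \<in> M" "isproj q" "E q = lam *\<^sub>R x" "x * q = q" using jones_projection[OF x(1,2)] by blast
 have sq: "star q = q" "q * q = q" using q(2) by (simp_all add: isproj_def)
 have qx: "q * x = q" using arg_cong[OF q(4), of star] by (simp add: star_mult sq sx)
 define g where "g = x - q"
 have gM: "g \<in> M" unfolding g_def by (intro diff A_M x q)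
 have sg: "star g = g" "g * g = g" by (simp_all add: g_def star_diff sx sq q(4) qx algebra_simps)
 have gp: "isproj g" using sg by (simp add: isproj_def)
 have gx: "g * x = g" "x * g = g" by (simp_all add: g_def algebra_simps sx qx q(4))
 have Eg: "E g = (1 - lam) *\<^sub>R x" by (simp add: g_def E_diff E_id A_M x q scaleR_diff_left)
 have tg: "tau g = 1 / 2"
 proof -
  have "tau g = (1 - lam) * (1 - lam)" using tau_E[OF gM] FM.tr_scaleR[OF A_M[OF x(1)]] by (simp add: Eg x)
  thus ?thesis unfolding l by simp
 qed
 have rg: "star (rho g) = rho g" "rho g * rho g = rho g" using isproj_rho[OF gM gp] by (simp_all add: isproj_def)
 have rgx: "rho g * rho x = rho g" using rho_mult[OF A_M[OF x(1)] gM] gx by simp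
 define G where "G = rho g * e * rho g"
 have GN: "G \<in> comm A" unfolding G_def by (intro N.mult rho_N gM e_comm)
 have sG: "star G = G" by (simp add: G_def star_mult rg e_star mult.assoc)
 have "G * G = rho g * (e * (rho g * rho g) * e) * rho g" by (simp only: G_def mult.assoc)
 also have "... = rho g * (rho ((1 - lam) *\<^sub>R x) * e) * rho g" by (simp only: rg(2) e_rho_e[OF gM] Eg)
 also have "... = (1 - lam) *\<^sub>R (rho g * rho x * e * rho g)"
  by (simp only: rho_scaleR[OF A_M[OF x(1)]] mult_scaleR_left mult_scaleR_right mult.assoc)
 finally have GG: "G * G = (1 - lam) *\<^sub>R G" by (simp add: rgx G_def)
 have Gg: "G * rho g = G" "rho g * G = G" by (simp_all add: G_def rg mult.assoc) (simp add: rg flip: mult.assoc)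
 define f where "f = rho g - sqrt 2 *\<^sub>R G"
 have fN: "f \<in> comm A" unfolding f_def by (intro N.diff N.scaleR rho_N gM GN)
 have l': "sqrt 2 - sqrt 2 * lam = 1" using l(2) by (simp add: right_diff_distrib)
 have fp: "isproj f" unfolding isproj_def f_def
  by (simp add: star_simps sG rg left_diff_distrib right_diff_distrib Gg GG) (simp add: l')
 have tnG: "tn (G * rho m) = lam * tau (m * g)" if m: "m \<in> M" for m
 proof -
  have "tn (G * rho m) = tn (e * (rho g * rho m) * rho g)"
   using FN.tr_comm[of "rho g" "e * (rho g * rho m)"] by (simp add: G_def mult.assoc N.mult rho_N gM m e_comm)
  also have "e * (rho g * rho m) * rho g = e * rho (g * (m * g))" by (simp add: rho_mult mult gM m mult.assoc)
  also have "tn ... = lam * tau (g * (m * g))" by (rule tn_e_rho) (intro mult gM m)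
  also have "tau (g * (m * g)) = tau (m * g * g)" by (rule FM.tr_comm) (intro mult gM m)+
  finally show ?thesis by (simp add: sg mult.assoc)
 qed
 have tnf: "tn (f * rho m) = 2 * lam * tau (m * g)" if m: "m \<in> M" for m
 proof -
  have "tn (f * rho m) = tn (rho (m * g)) - sqrt 2 * tn (G * rho m)"
   by (simp add: f_def left_diff_distrib FN.tr_diff FN.tr_scaleR N.scaleR N.mult rho_N gM m GN rho_mult)
  also have "... = (1 - sqrt 2 * lam) * tau (m * g)" using tnG[OF m] by (simp add: tn_rho mult m gM algebra_simps)
  finally show ?thesis by (simp add: l)
 qed
 have "tn f = tn e" using tnf[OF one] by (simp add: tg lam_def)
 then obtain v where v: "v \<in> comm A" "star v * v = f" "v * star v = e" using FN.equivalence[OF fN fp e_comm e_proj] by blast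
 have vi: "v * star v * v = v" by (rule isproj_star_mult_isometry) (simp add: v(2) fp)
 hence "e * v = v" by (simp add: v(3))
 then obtain n where n: "n \<in> M" "v = e * rho n" using pushdown[OF v(1)] by blast
 have En: "E (star n * n) = 1"
  by (rule rho_e_inj[OF E_mem A.one]) (use n range_e_rho[OF n(1)] v(3) mult star in simp_all)
 have nn: "n * star n = 2 *\<^sub>R g"
 proof (rule tau_separates)
  fix m assume m: "m \<in> M"
  have "lam * tau (m * (n * star n)) = tn (f * rho m)" using tn_initial_e_rho[OF n(1) m] v(2) n(2) by simp
  thus "tau (m * (n * star n)) = tau (m * 2 *\<^sub>R g)" using lam_pos by (simp add: tnf m FM.tr_scaleR mult gM)
 qed (intro mult star scaleR n gM)+
 have gn: "g * n = n" by (rule mult_eq_if_range_proj[OF nn gp])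
 have ng: "star n * g = star n" using arg_cong[OF gn, of star] by (simp add: star_mult sg)
 have rn: "star (rho n) = rho (star n)" "star (rho (star n)) = rho n" using rho_star[OF n(1)] rho_star[OF star[OF n(1)]] by simp_all
 have fe: "rho (star n) * e * rho n = f"
  using v(2) by (simp add: n star_mult e_star rn mult.assoc) (simp add: e_e flip: mult.assoc)
 \<comment> \<open>Evaluated at \<open>y $ Om\<close>, the identity \<open>fe\<close> between
   operators becomes one inside \<open>M\<close>. Taking adjoints there moves it from the right
   action to the left one, where it reads \<open>nen\<close>.\<close>
 have mirror: "E (y * n) * star n = y * g - sqrt 2 *\<^sub>R (E (y * g) * g)" if y: "y \<in> M" for y
 proof (rule separating_eq)
  have "(E (y * n) * star n) $ Om = rho (star n) $ E (y * n) $ Om" by (simp add: rho_orbit star n A_M E_mem mult y)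
  also have "E (y * n) $ Om = e $ (y * n) $ Om" by (rule E_Om[OF mult[OF y n(1)]])
  also have "rho (star n) $ e $ (y * n) $ Om = (rho (star n) * e * rho n) $ y $ Om" by (simp add: rho_orbit y n)
  also have "... = rho g $ y $ Om - sqrt 2 *\<^sub>R (rho g $ e $ rho g $ y $ Om)" by (simp only: fe) (simp add: f_def G_def)
  also have "rho g $ e $ rho g $ y $ Om = rho g $ e $ (y * g) $ Om" by (simp add: rho_orbit y gM)
  also have "e $ (y * g) $ Om = E (y * g) $ Om" by (rule E_Om[OF mult[OF y gM], symmetric])
  also have "rho g $ y $ Om - sqrt 2 *\<^sub>R (rho g $ E (y * g) $ Om) = (y * g - sqrt 2 *\<^sub>R (E (y * g) * g)) $ Om"
   by (simp add: rho_orbit gM y A_M E_mem mult)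
  finally show "(E (y * n) * star n) $ Om = (y * g - sqrt 2 *\<^sub>R (E (y * g) * g)) $ Om" .
 qed (intro diff mult scaleR A_M E_mem star n gM y)+
 have nen: "n * e * star n = g - sqrt 2 *\<^sub>R (g * e * g)"
 proof (rule orbit_eqI)
  fix y assume y: "y \<in> M"
  have "star (E (star y * n) * star n) = star (star y * g - sqrt 2 *\<^sub>R (E (star y * g) * g))"
   by (simp only: mirror[OF star[OF y]])
  hence "n * E (star n * y) = g * y - sqrt 2 *\<^sub>R (g * E (g * y))"
   by (simp add: star_simps sg) (simp add: E_star[symmetric] mult star n y gM star_mult sg)
  from arg_cong[OF this, of "%s. s $ Om"]
  show "(n * e * star n) $ y $ Om = (g - sqrt 2 *\<^sub>R (g * e * g)) $ y $ Om"
   by (simp add: E_Om mult star n y gM)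
 qed
 define p where "p = g * rho g"
 define L where "L = p * e"
 \<comment> \<open>On \<open>A Om\<close> the operator \<open>star K * K\<close> sends
   \<open>a\<close> to \<open>E (star n * n * a * (star n * n))\<close>, which exceeds
   \<open>E (U * a * U)\<close> by \<open>a\<close>. So a gap of \<open>star K * K\<close> around 1
   is what is wanted.\<close>
 define K where "K = n * rho (star n) * e"
 have rc: "rho g * y = y * rho g" if "y \<in> M" for y by (rule rho_commutes[OF gM that])
 have p: "isproj p"
 proof -
  have "p * p = g * (rho g * g) * rho g" by (simp only: p_def mult.assoc)
  also have "... = g * g * (rho g * rho g)" by (simp only: rc[OF gM] mult.assoc)
  finally show ?thesis by (simp add: isproj_def p_def star_mult rg sg rc[OF gM])
 qed
 have sp: "star p = p" "p * p = p" using p by (simp_all add: isproj_def)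
 have pL: "p * L = L" by (simp add: L_def sp flip: mult.assoc)
 have rgn: "rho g * rho (star n) = rho (star n)" using rho_mult[OF star[OF n(1)] gM] by (simp add: ng)
 have pK: "p * K = K"
 proof -
  have "p * K = g * (rho g * n) * rho (star n) * e" by (simp only: p_def K_def mult.assoc)
  also have "... = g * n * (rho g * rho (star n)) * e" by (simp only: rc[OF n(1)] mult.assoc)
  finally show ?thesis by (simp add: gn rgn K_def)
 qed
 have LL: "L * star L = p * e * p"
  by (simp add: L_def star_mult sp e_star mult.assoc) (simp add: e_e flip: mult.assoc)
 have KK: "K * star K = (2 - sqrt 2) *\<^sub>R p + 2 *\<^sub>R (L * star L)"
 proof -
  have "K * star K = n * (rho (star n) * (e * e) * rho n) * star n"
   by (simp only: K_def star_mult rn(2) e_star mult.assoc)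
  also have "... = n * f * star n" by (simp only: e_e fe)
  also have "... = n * rho g * star n - sqrt 2 *\<^sub>R (n * rho g * e * (rho g * star n))"
   by (simp add: f_def G_def left_diff_distrib right_diff_distrib mult.assoc)
  also have "... = rho g * (n * star n) - sqrt 2 *\<^sub>R (rho g * (n * e * star n) * rho g)"
   by (simp only: rc[OF n(1), symmetric] rc[OF star[OF n(1)]]) (simp only: mult.assoc)
  also have "... = 2 *\<^sub>R (rho g * g) - sqrt 2 *\<^sub>R (rho g * g * rho g) + 2 *\<^sub>R (rho g * (g * e * g) * rho g)"
   unfolding nn nen by (simp add: algebra_simps)
  also have "rho g * g * rho g = p" by (simp add: p_def rc[OF gM] rg mult.assoc)
  also have "rho g * g = p" by (simp add: p_def rc[OF gM])
  also have "rho g * (g * e * g) * rho g = L * star L"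
   unfolding LL using rc[OF gM] by (simp add: p_def mult.assoc) (simp flip: mult.assoc)
  finally show ?thesis by (simp add: scaleR_diff_left)
 qed
 have rx: "rho x * y = y * rho x" if "y \<in> M" for y by (rule rho_commutes[OF A_M[OF x(1)] that])
 define xx where "xx = x * rho x"
 have xe: "x * e = e * x" by (rule e_A[OF x(1), symmetric])
 \<comment> \<open>Expanding \<open>g = x - q\<close> on the left and on the right, each mixed term
   costs \<open>lam\<close> and the pure \<open>q\<close> term is positive. Hence
   \<open>e * p * e\<close> is at least 1 - 2 lam = sqrt 2 - 1 where \<open>xx * e\<close> acts as
   the identity, in particular on the range of \<open>star L\<close>.\<close>
 have R: "e * p * e = (1 - 2 * lam) *\<^sub>R (xx * e) + star (q * rho q * e) * (q * rho q * e)"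
 proof -
  have rrq: "star (rho q) = rho q" "rho q * rho q = rho q" using isproj_rho[OF q(1,2)] by (simp_all add: isproj_def)
  have rqq: "rho q * q = q * rho q" by (rule rho_commutes) (rule q)+
  have peq: "p = x * rho x - x * rho q - rho x * q + q * rho q"
   by (simp add: p_def g_def rho_diff A_M x q rx algebra_simps)
  have "e * p * e = e * x * rho x * e - e * x * rho q * e - e * rho x * q * e + e * (q * rho q) * e"
   unfolding peq by (simp add: algebra_simps)
  also have "e * x * rho x * e = xx * e"
  proof -
   have "e * x * rho x * e = x * (e * rho x) * e" by (simp only: xe[symmetric] mult.assoc)
   also have "... = x * (rho x * e) * e" by (simp only: rho_e[OF x(1)])
   finally show ?thesis by (simp only: xx_def e_e mult.assoc)
  qed
  also have "e * x * rho q * e = lam *\<^sub>R (xx * e)"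
  proof -
   have "e * x * rho q * e = x * (e * rho q * e)" by (simp only: xe[symmetric] mult.assoc)
   also have "... = x * (rho (lam *\<^sub>R x) * e)" by (simp only: e_rho_e[OF q(1)] q(3))
   finally show ?thesis by (simp add: rho_scaleR A_M x xx_def mult.assoc)
  qed
  also have "e * rho x * q * e = lam *\<^sub>R (xx * e)"
  proof -
   have "e * rho x * q * e = rho x * (e * q * e)" by (simp only: rho_e[OF x(1), symmetric] mult.assoc)
   also have "... = lam *\<^sub>R (rho x * x * e)" unfolding e_M_e[OF q(1)] q(3) by (simp add: mult.assoc)
   finally show ?thesis by (simp only: xx_def rx[OF A_M[OF x(1)]])
  qed
  also have "e * (q * rho q) * e = star (q * rho q * e) * (q * rho q * e)"
  proof -
   have "star (q * rho q * e) * (q * rho q * e) = e * (rho q * (q * q) * rho q) * e"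
    by (simp only: star_mult e_star rrq(1) sq(1) mult.assoc)
   also have "rho q * (q * q) * rho q = q * (rho q * rho q)" by (simp only: sq(2) rqq mult.assoc)
   finally show ?thesis by (simp add: rrq)
  qed
  finally have "e * p * e = xx * e - (lam *\<^sub>R (xx * e) + lam *\<^sub>R (xx * e)) + star (q * rho q * e) * (q * rho q * e)" by simp
  also have "lam *\<^sub>R (xx * e) + lam *\<^sub>R (xx * e) = (2 * lam) *\<^sub>R (xx * e)" by (simp flip: scaleR_left_distrib)
  finally show ?thesis by (simp add: scaleR_diff_left)
 qed
 have Lb: "(sqrt 2 - 1) * (norm (star L $ y))\<^sup>2 <= (norm (L $ star L $ y))\<^sup>2" for y
 proof -
  define c where "c = star L $ y"
  have sL: "star L = e * p" by (simp add: L_def star_mult sp e_star)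
  have "xx * e * star L = star L"
  proof -
   have "xx * e * star L = x * (rho x * (e * e)) * p" by (simp only: xx_def sL mult.assoc)
   also have "... = x * e * (rho x * g) * rho g" by (simp only: e_e rho_e[OF x(1)] p_def mult.assoc)
   also have "... = e * (x * g) * (rho x * rho g)" by (simp only: xe rx[OF gM] mult.assoc)
   also have "rho x * rho g = rho g" using rho_mult[OF gM A_M[OF x(1)]] gx by simp
   finally show ?thesis by (simp add: gx sL p_def mult.assoc)
  qed
  from arg_cong[OF this, of "%s. s $ y"] have xc: "xx $ e $ c = c" by (simp add: c_def)
  have "(norm (L $ c))\<^sup>2 = qf (star L * L) c" by (simp add: qf_simps)
  also have "star L * L = e * p * e"
   unfolding sL unfolding L_def by (simp add: mult.assoc) (simp add: sp flip: mult.assoc)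
  also have "qf (e * p * e) c = (1 - 2 * lam) * (norm c)\<^sup>2 + (norm ((q * rho q * e) $ c))\<^sup>2"
   unfolding R using xc by (simp add: qf_simps) (simp add: qf_def cinner_self_Re)
  finally show ?thesis by (simp add: l c_def)
 qed
 have gap: "(sqrt 2 - 1) * norm w <= norm (star K $ K $ w - w)" for w
 proof (rule spectral_gap[OF _ _ _ _ p pK pL Lb])
  show "0 < sqrt 2 - 1" "sqrt 2 - 1 < 1" using sqrt2_bounds by simp_all
  show "(sqrt 2 - 1)\<^sup>2 = 1 - 2 * (sqrt 2 - 1)" by (simp add: power2_eq_square algebra_simps)
  show "K * star K = (1 - (sqrt 2 - 1)) *\<^sub>R p + 2 *\<^sub>R (L * star L)" using KK by simp
 qed
 define U where "U = 1 - star n * n"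
 have UM: "U \<in> M" unfolding U_def by (intro diff one mult star n)
 have "star n * n * (star n * n) = star n * (n * star n) * n" by (simp only: mult.assoc)
 also have "... = 2 *\<^sub>R (star n * n)" by (simp add: nn gn mult.assoc)
 finally have "U * U = 1" by (simp add: U_def left_diff_distrib right_diff_distrib scaleR_2)
 moreover have "star U = U" by (simp add: U_def star_simps)
 moreover have "E U = 0" by (simp add: U_def E_diff E_id A.one one mult star n En)
 moreover have "(sqrt 2 - 1) * norm (a $ Om) <= norm (E (U * a * U) $ Om)" if a: "a \<in> A" for a
 proof -
  have aM: "a \<in> M" by (rule A_M[OF a])
  have snn: "star n * n \<in> M" by (intro mult star n)
  have "U * a * U = a - star n * n * a - a * (star n * n) + star n * n * a * (star n * n)"
   by (simp add: U_def algebra_simps)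
  hence "E (U * a * U) = E (star n * n * a * (star n * n)) - a"
   by (simp add: E_add E_diff E_left E_right E_id aM a snn mult diff En)
  hence "E (U * a * U) $ Om = e $ (star n * n * a * (star n * n)) $ Om - a $ Om"
   using E_Om[OF mult[OF mult[OF snn aM] snn]] by simp
  also have "e $ (star n * n * a * (star n * n)) $ Om = star K $ K $ a $ Om"
  proof -
   have "K $ a $ Om = (n * a * star n) $ Om" by (simp add: K_def e_orbit a rho_orbit star n aM)
   moreover have "star K $ (n * a * star n) $ Om = e $ rho n $ (star n * n * a * star n) $ Om"
    by (simp add: K_def star_mult e_star rn)
   ultimately show ?thesis using rho_orbit[OF n(1) mult[OF mult[OF snn aM] star[OF n(1)]]] by simp
  qed
  finally show ?thesis using gap[of "a $ Om"] by simp
 qed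
 ultimately show ?thesis using UM by blast
qed

end


section \<open>The coupling constant\<close>

context vn_algebra
begin

text \<open>As \<open>x\<close> commutes with \<open>Q\<close>, the orbit of \<open>x $ z\<close>
  lies in the closed range of \<open>x\<close>, whose projection is equivalent to the right support
  of \<open>x\<close> and hence to a subprojection of \<open>s\<close>.\<close>

lemma trace_orbp_le:
 assumes t: "traced_algebra (comm Q) t" and x: "x \<in> comm Q" and s: "s \<in> comm Q" "isproj s" "x * s = x"
 shows "t (orbp Q (x $ z)) <= t s"
proof -
 interpret N: traced_algebra "comm Q" t by (rule t)
 obtain w where w: "w \<in> comm Q" "isproj (star w * w)" "isproj (w * star w)" "w * star w * x = x" "!!z. x * z = 0 ==> w * z = 0"
  using N.polar_decomposition[OF x] by blast
 have "w * (1 - s) = 0" by (rule w(5)) (simp add: right_diff_distrib s)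
 hence ws: "w * s = w" by (simp add: right_diff_distrib)
 hence "star w * w * s = star w * w" by (simp add: mult.assoc)
 from arg_cong[OF this, of star] have "s * (star w * w) = star w * w" using s(2) by (simp add: star_mult isproj_def mult.assoc)
 hence 1: "star w * w <= s" using isproj_le_iff[OF w(2) s(2)] by simp
 have "w * star w * orbp Q (x $ z) = orbp Q (x $ z)"
 proof (rule orbp_least)
  fix a assume a: "a \<in> Q"
  have "(w * star w) $ a $ x $ z = (w * star w * (a * x)) $ z" by simp
  also have "w * star w * (a * x) = w * star w * (x * a)" using commD[OF x a] by simp
  also have "... = x * a" using w(4) by (simp flip: mult.assoc)
  also have "... = a * x" using commD[OF x a] by simp
  finally show "(w * star w) $ a $ x $ z = a $ x $ z" by simp
 qed
 hence "orbp Q (x $ z) <= w * star w" using isproj_le_iff[OF orbp(1) w(3)] by simp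
 hence "t (orbp Q (x $ z)) <= t (w * star w)" by (intro N.tr_mono orbp_comm N.mult N.star w)
 also have "... = t (star w * w)" by (rule N.tr_comm[OF w(1) N.star[OF w(1)]])
 also have "... <= t s" by (intro N.tr_mono N.mult N.star w s 1)
 finally show ?thesis .
qed

text \<open>Lower semicontinuity of the trace of a cyclic projection. With \<open>P\<close> and
  \<open>p n\<close> the projections of \<open>w\<close> and \<open>z n\<close>, the compressions
  \<open>P * (p n * P)\<close> tend strongly to \<open>P\<close>, and by traciality their traces do
  not exceed those of \<open>p n\<close>.\<close>

lemma trace_orbp_lsc:
 assumes t: "traced_algebra (comm Q) t"
  and cont: "!!f x. slim f x ==> (!!n. f n \<in> comm Q) ==> (%n. t (f n)) ----> t x"
  and lim: "z ----> w" and le: "!!n. t (orbp Q (z n)) <= c"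
 shows "t (orbp Q w) <= c"
proof -
 interpret N: traced_algebra "comm Q" t by (rule t)
 define P where "P = orbp Q w"
 define p where "p n = orbp Q (z n)" for n
 have P: "P \<in> comm Q" "isproj P" "star P = P" "P * P = P" and p: "p n \<in> comm Q" "isproj (p n)" "star (p n) = p n" "p n * p n = p n" for n
  unfolding P_def p_def using orbp(1) orbp_comm by (auto simp: isproj_def)
 have npv: "norm (p n $ v) <= norm v" for n v
  using norm_appl[of "p n" v] mult_right_mono[OF isproj_nrm_le[OF p(2)[of n]], of "norm v"] by simp
 have orb: "(%n. p n $ a $ w) ----> a $ w" if a: "a \<in> Q" for a
 proof (rule LIM_zero_cancel, rule Lim_null_comparison)
  have "(%n. a $ (z n - w)) ----> 0" using tendsto_appl[OF LIM_zero[OF lim], of a] by simp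
  thus "(%n. 2 * norm (a $ (z n - w))) ----> 0" by (intro tendsto_mult_right_zero tendsto_norm_zero)
  show "\<forall>\<^sub>F n in sequentially. norm (p n $ a $ w - a $ w) <= 2 * norm (a $ (z n - w))"
  proof (rule always_eventually, rule allI)
   fix n
   have "p n $ a $ z n = a $ z n" unfolding p_def by (rule orbp_orbit[OF a])
   hence "p n $ a $ w - a $ w = a $ (z n - w) - p n $ a $ (z n - w)" by simp
   thus "norm (p n $ a $ w - a $ w) <= 2 * norm (a $ (z n - w))"
    using norm_triangle_ineq4[of "a $ (z n - w)" "p n $ a $ (z n - w)"] npv[of n "a $ (z n - w)"] by simp
  qed
 qed
 have "slim (%n. P * (p n * P)) (P * P)"
  unfolding slim_def
 proof
  fix v
  have "(%n. p n $ P $ v) ----> P $ v"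
  proof (rule metric_LIMSEQ_I)
   fix r :: real assume r: "0 < r"
   have "P $ v \<in> closure ((%x. x $ w) ` Q)" unfolding P_def by (rule orbp(2))
   then obtain y where "y \<in> (%x. x $ w) ` Q" "dist y (P $ v) < r / 3"
    using r by (meson closure_approachable divide_pos_pos zero_less_numeral)
   then obtain a where a: "a \<in> Q" "norm (a $ w - P $ v) < r / 3" by (auto simp: dist_norm)
   obtain n0 where n0: "!!n. n \<ge> n0 ==> norm (p n $ a $ w - a $ w) < r / 3"
    using LIMSEQ_D[OF orb[OF a(1)], of "r / 3"] r by auto
   have "dist (p n $ P $ v) (P $ v) < r" if n: "n \<ge> n0" for n
   proof -
    have "p n $ P $ v - P $ v = p n $ (P $ v - a $ w) + (p n $ a $ w - a $ w) + (a $ w - P $ v)" by simp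
    hence "norm (p n $ P $ v - P $ v) <= norm (p n $ (P $ v - a $ w)) + norm (p n $ a $ w - a $ w) + norm (a $ w - P $ v)"
     using norm_triangle_mono[OF norm_triangle_ineq order_refl] by metis
    thus ?thesis using npv[of n "P $ v - a $ w"] a(2) n0[OF n] by (simp add: dist_norm norm_minus_commute)
   qed
   thus "\<exists>n0. \<forall>n\<ge>n0. dist (p n $ P $ v) (P $ v) < r" by blast
  qed
  from tendsto_appl[OF this, of P] show "(%n. (P * (p n * P)) $ v) ----> (P * P) $ v" by simp
 qed
 hence lim': "(%n. t (P * (p n * P))) ----> t (P * P)" by (rule cont) (intro N.mult P p)
 have "t (P * (p n * P)) <= c" for n
 proof -
  have "t (P * (p n * P)) = t (p n * P * P)" by (rule N.tr_comm) (intro N.mult P p)+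
  also have "... = t (p n * (p n * P))" by (simp add: P p mult.assoc) (simp add: p flip: mult.assoc)
  also have "... = t (p n * P * p n)" by (rule N.tr_comm) (intro N.mult P p)+
  also have "... <= t (p n)"
  proof (rule N.tr_mono)
   show "p n * P * p n <= p n" using conj_mono[OF isproj_le_one[OF P(2)], of "p n"] by (simp add: p)
  qed (intro N.mult P p)+
  also have "... <= c" unfolding p_def by (rule le)
  finally show ?thesis .
 qed
 with LIMSEQ_le_const2[OF lim'] have "t (P * P) <= c" by blast
 thus ?thesis unfolding P(4) by (simp only: P_def)
qed

end

context finite_index
begin

text \<open>With \<open>p\<close> the projection of the orbit of \<open>w\<close> under the
  commutant, \<open>w\<close> is a limit of vectors \<open>p $ m $ Om\<close>, each the image of
  \<open>Om\<close> under \<open>rho m * (rho p * e)\<close>. Their cyclic projections have trace at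
  most \<open>tn (rho p * e) = lam * tau p\<close>.\<close>

lemma tn_orbp_le: "tn (orbp A w) <= lam * tau (orbp (comm A) w)"
proof -
 define p where "p = orbp (comm A) w"
 have p: "p \<in> A" "isproj p" unfolding p_def using N.orbp_comm[of w] N.orbp(1) by (simp_all add: A.bicomm)
 have pw: "p $ w = w" unfolding p_def by (rule N.orbp_self)
 obtain m where m: "!!n. m n \<in> M" "(%n. m n $ Om) ----> w" using dense_sequence by blast
 have rp: "star (rho p) = rho p" "rho p * rho p = rho p"
  using isproj_rho[OF A_M[OF p(1)] p(2)] by (simp_all add: isproj_def)
 have "rho p * e * (rho p * e) = rho p * (e * rho p) * e" by (simp only: mult.assoc)
 also have "... = rho p * rho p * (e * e)" by (simp only: rho_e[OF p(1), symmetric] mult.assoc)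
 also have "... = rho p * e" by (simp only: rp e_e)
 finally have s: "isproj (rho p * e)" using rho_e[OF p(1)] by (simp add: isproj_def star_mult rp e_star)
 have sN: "rho p * e \<in> comm A" by (intro N.mult rho_N A_M p e_comm)
 show ?thesis unfolding p_def[symmetric]
 proof (rule A.trace_orbp_lsc[where z = "%n. (rho (m n) * (rho p * e)) $ Om"])
  show "traced_algebra (comm A) tn" by (rule FN.traced_algebra_axioms)
  show "(%n. tn (f n)) ----> tn x" if "slim f x" "!!n. f n \<in> comm A" for f x by (rule tn_slim[OF that])
  have "(rho (m n) * (rho p * e)) $ Om = p $ m n $ Om" for n by (simp add: rho_Om rho_orbit A_M p m)
  thus "(%n. (rho (m n) * (rho p * e)) $ Om) ----> w" using tendsto_appl[OF m(2), of p] by (simp add: pw)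
  fix n
  have "tn (orbp A ((rho (m n) * (rho p * e)) $ Om)) <= tn (rho p * e)"
  proof (rule A.trace_orbp_le[OF FN.traced_algebra_axioms _ sN s])
   show "rho (m n) * (rho p * e) \<in> comm A" by (intro N.mult rho_N A_M p m e_comm)
   show "rho (m n) * (rho p * e) * (rho p * e) = rho (m n) * (rho p * e)" using s by (simp add: isproj_def mult.assoc)
  qed
  thus "tn (orbp A ((rho (m n) * (rho p * e)) $ Om)) <= lam * tau p" by (simp add: tn_rho_e p)
 qed
qed

text \<open>The first inequality makes \<open>orbp A w\<close> no larger than \<open>e\<close>, so a
  partial isometry of the commutant moves \<open>w\<close> to a vector \<open>y\<close> of L^2(A)
  without losing its orbit under the commutant. There \<open>y\<close> is a limit of vectors
  \<open>a $ b $ Om\<close> with \<open>b\<close> in \<open>A\<close> of the right trace.\<close>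

theorem coupling: "tn (orbp A w) = lam * tau (orbp (comm A) w)"
proof (rule antisym[OF tn_orbp_le])
 define q where "q = orbp A w"
 have q: "q \<in> comm A" "isproj q" unfolding q_def using A.orbp_comm A.orbp(1) by simp_all
 have qw: "q $ w = w" unfolding q_def by (rule A.orbp_self)
 have "tau (orbp (comm A) w) <= tau 1"
  using FM.tr_proj_mono[OF N.orbp(1), of w] N.orbp_comm[of w] A_M by (simp add: A.bicomm)
 hence "lam * tau (orbp (comm A) w) <= lam * 1" using lam_pos by (intro mult_left_mono) auto
 hence "tn q <= tn e" using tn_orbp_le[of w] unfolding q_def lam_def[symmetric] by linarith
 then obtain v where v: "v \<in> comm A" "star v * v = q" "e * v = v" using FN.comparison[OF q e_comm e_proj] by blast
 obtain n where n: "n \<in> M" "v = e * rho n" using pushdown[OF v(1,3)] by blast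
 define b where "b = E (star n * n)"
 have bA: "b \<in> A" unfolding b_def by (intro E_mem mult star n)
 have vv: "v * star v = rho b * e" unfolding n(2) b_def by (rule range_e_rho[OF n(1)])
 have vi: "v * star v * v = v" by (rule isproj_star_mult_isometry) (simp add: v(2) q)
 have vvp: "isproj (rho b * e)" using partial_isometry_proj(2)[OF vi] vv by simp
 have "rho (b * b) * e = rho b * e * (rho b * e)"
  using rho_e[OF bA] by (simp add: rho_mult A_M bA mult.assoc) (simp add: e_e flip: mult.assoc)
 hence "rho (b * b) * e = rho b * e" using vvp by (simp add: isproj_def)
 hence bb: "b * b = b" by (rule rho_e_inj[OF A.mult[OF bA bA] bA])
 have "star b = b" using E_star[OF mult[OF star[OF n(1)] n(1)]] by (simp add: b_def star_mult)
 hence b: "isproj b" using bb by (simp add: isproj_def)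
 have "tn q = tn (v * star v)" using FN.tr_comm[OF v(1) N.star[OF v(1)]] v(2) by simp
 hence tq: "tn q = lam * tau b" by (simp add: vv tn_rho_e bA)
 define y where "y = v $ w"
 have ey: "e $ y = y" using arg_cong[OF v(3), of "%s. s $ w"] by (simp add: y_def)
 have "(v * star v) $ y = y" using arg_cong[OF vi, of "%s. s $ w"] by (simp add: y_def)
 hence by': "rho b $ y = y" by (simp add: vv ey)
 obtain a where a: "!!n. a n \<in> A" "(%n. a n $ Om) ----> e $ y" using e_approx by blast
 have bs: "b \<in> comm (comm A)" using bA by (simp add: A.bicomm)
 have tt: "traced_algebra (comm (comm A)) tau" unfolding A.bicomm by (rule FA.traced_algebra_axioms)
 have "tau (orbp (comm A) y) <= tau b"
 proof (rule N.trace_orbp_lsc[where z = "%n. (a n * b) $ Om"])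
  show "traced_algebra (comm (comm A)) tau" by (rule tt)
  show "(%n. tau (f n)) ----> tau x" if "slim f x" for f x unfolding tau_def by (rule slim_qf[OF that])
  have "(a n * b) $ Om = rho b $ a n $ Om" for n by (simp add: rho_orbit A_M bA a)
  thus "(%n. (a n * b) $ Om) ----> y" using tendsto_appl[OF a(2), of "rho b"] by (simp only: ey by')
  show "tau (orbp (comm A) ((a n * b) $ Om)) <= tau b" for n
  proof (rule N.trace_orbp_le[OF tt _ bs b])
   show "a n * b \<in> comm (comm A)" unfolding A.bicomm by (intro A.mult a bA)
   show "a n * b * b = a n * b" by (simp add: bb mult.assoc)
  qed
 qed
 moreover have "orbp (comm A) w <= orbp (comm A) y"
 proof -
  have wy: "w = star v $ y" using qw v(2) by (simp add: y_def flip: appl_mult)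
  have "orbp (comm A) y * orbp (comm A) w = orbp (comm A) w"
  proof (rule N.orbp_least)
   fix x assume x: "x \<in> comm A"
   have "orbp (comm A) y $ (x * star v) $ y = (x * star v) $ y" by (rule N.orbp_orbit) (intro N.mult N.star x v)
   thus "orbp (comm A) y $ x $ w = x $ w" by (simp flip: wy)
  qed
  thus ?thesis using isproj_le_iff[OF N.orbp(1) N.orbp(1)] by simp
 qed
 hence "tau (orbp (comm A) w) <= tau (orbp (comm A) y)"
  using FA.tr_mono N.orbp_comm by (simp add: A.bicomm)
 ultimately show "lam * tau (orbp (comm A) w) <= tn (orbp A w)" using tq lam_pos by (simp add: q_def)
qed

end


section \<open>Normal traces\<close>

context finite_algebra
begin

lemma increasing_limit_eq:
 assumes f: "!!n. f n \<in> Q" "incseq f" "slim f z" and z: "z <= x" "x \<in> Q" "!!n. t x <= t (f n) + 1 / (real n + 1)"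
 shows "z = x"
proof -
 have zQ: "z \<in> Q" by (rule slim_closed[OF f(1,3)])
 have "(%n. t (f n) + inverse (real (Suc n))) ----> t z + 0"
  by (intro tendsto_add tr_lim f LIMSEQ_inverse_real_of_nat)
 hence "t x <= t z + 0" by (rule LIMSEQ_le_const) (use z(3) in \<open>simp add: inverse_eq_divide add.commute\<close>)
 hence "t (x - z) = 0" using tr_mono[OF zQ z(2,1)] by (simp add: tr_diff z zQ)
 hence "x - z = 0" using faithful[OF diff[OF z(2) zQ]] z(1) by simp
 thus ?thesis by simp
qed

text \<open>The bridge from nets to sequences. An increasing sequence in \<open>D\<close> whose
  traces tend to their supremum has a limit \<open>z\<close> above all of \<open>D\<close>: a
  sequence dominating it and a given element has a limit of the same trace, which is
  \<open>z\<close> by faithfulness.\<close>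

lemma directed_lub_sequence:
 assumes D: "D ~= {}" "D \<subseteq> Q" "!!a b. a \<in> D ==> b \<in> D ==> \<exists>c\<in>D. a <= c & b <= c"
  and x: "x \<in> Q" "!!d. d \<in> D ==> d <= x" "!!y. y \<in> Q ==> (!!d. d \<in> D ==> d <= y) ==> x <= y"
 shows "\<exists>f. (\<forall>n. f n \<in> D) & incseq f & slim f x"
proof -
 define S where "S = (SUP d\<in>D. t d)"
 have bdd: "bdd_above (t ` D)" by (rule bdd_aboveI2[of _ _ "t x"]) (use tr_mono D x in blast)
 have tS: "t d <= S" if "d \<in> D" for d unfolding S_def by (rule cSUP_upper[OF that bdd])
 have "\<exists>d\<in>D. S <= t d + 1 / (real n + 1)" for n
 proof -
  have "S - 1 / (real n + 1) < (SUP d\<in>D. t d)" by (simp add: S_def)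
  then obtain d where "d \<in> D" "S - 1 / (real n + 1) < t d" using less_cSUP_iff[OF D(1) bdd] by blast
  thus ?thesis by (intro bexI[of _ d]) auto
 qed
 then obtain d where d: "!!n. d n \<in> D" "!!n. S <= t (d n) + 1 / (real n + 1)" by metis
 obtain ub where ub: "!!a b. a \<in> D ==> b \<in> D ==> ub a b \<in> D & a <= ub a b & b <= ub a b" using D(3) by metis
 have seq: "\<exists>h. (\<forall>n. h n \<in> D) & incseq h & (\<forall>n. g n <= h n) & a <= h 0" if g: "!!n. g n \<in> D" and a: "a \<in> D" for g a
 proof -
  define h where "h = rec_nat (ub a (g 0)) (%n y. ub y (g (Suc n)))"
  have h: "h 0 = ub a (g 0)" "h (Suc n) = ub (h n) (g (Suc n))" for n by (simp_all add: h_def)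
  have hD: "h n \<in> D" for n by (induction n) (simp_all add: h ub g a)
  have "g n <= h n" for n using ub[OF a g] ub[OF hD g] by (cases n) (simp_all add: h)
  moreover have "incseq h" by (rule incseq_SucI) (simp add: h ub hD g)
  moreover have "a <= h 0" using ub[OF a g] by (simp add: h)
  ultimately show ?thesis using hD by blast
 qed
 obtain f where f: "!!n. f n \<in> D" "incseq f" "!!n. d n <= f n" using seq[of d "d 0"] d(1) by blast
 have lim: "\<exists>z. slim h z & (\<forall>n. h n <= z) & z <= x" if "!!n. h n \<in> D" "incseq h" for h
  by (rule increasing_slim_exists[OF that(2) x(2)[OF that(1)]])
 obtain z where z: "slim f z" "!!n. f n <= z" "z <= x" using lim[OF f(1,2)] by blast
 have zQ: "z \<in> Q" by (rule slim_closed[OF _ z(1)]) (use f(1) D(2) in blast)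
 have "a <= z" if a: "a \<in> D" for a
 proof -
  obtain h where h: "!!n. h n \<in> D" "incseq h" "!!n. f n <= h n" "a <= h 0" using seq[of f a] f(1) a by blast
  obtain y where y: "slim h y" "!!n. h n <= y" "y <= x" using lim[OF h(1,2)] by blast
  have yQ: "y \<in> Q" by (rule slim_closed[OF _ y(1)]) (use h(1) D(2) in blast)
  have "z = y"
  proof (rule increasing_limit_eq[OF _ f(2) z(1) _ yQ])
   show "z <= y" by (rule slim_le[OF z(1) slim_const]) (use h(3) y(2) order_trans in blast)
   have "(%n. t (h n)) ----> t y" by (rule tr_lim[OF _ h(2) y(1)]) (use h(1) D(2) in blast)
   hence "t y <= S" by (rule LIMSEQ_le_const2) (use tS h(1) in blast)
   moreover have "t (d n) <= t (f n)" for n by (rule tr_mono) (use f d(1) D(2) in blast)+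
   ultimately show "t y <= t (f n) + 1 / (real n + 1)" for n using d(2)[of n] by (smt (verit))
  qed (use f(1) D(2) in blast)
  thus ?thesis using h(4) y(2)[of 0] by simp
 qed
 hence "x <= z" by (rule x(3)[OF zQ])
 hence "z = x" using z(3) by simp
 thus ?thesis using f z(1) by blast
qed

end

section \<open>Completeness in the trace norm\<close>

text \<open>Expanding the positive operator \<open>star (b - a) * x * (b - a)\<close> and replacing
  \<open>x\<close> by \<open>y\<close> in \<open>b * x * b\<close> leaves
  \<open>a - b\<close>.\<close>

lemma inverse_antimono:
 fixes x y :: "'h::complex_hilbert_space cop"
 assumes x: "0 <= x" "x * a = 1" "a * x = 1" "star a = a" and y: "y * b = 1" "b * y = 1" "star b = b" and le: "x <= y"
 shows "b <= a"
proof -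
 have "0 <= star (b - a) * x * (b - a)" by (rule conj_pos[OF x(1)])
 also have "... = b * x * b - 2 *\<^sub>R b + a"
  by (simp add: star_diff x y left_diff_distrib right_diff_distrib scaleR_2 mult.assoc)
 also have "... <= b * y * b - 2 *\<^sub>R b + a" using conj_mono[OF le, of b] y(3) by simp
 also have "... = a - b" by (simp add: y scaleR_2)
 finally show ?thesis by simp
qed

lemma geometric_convergence:
 fixes f :: "nat => 'v::banach"
 assumes "!!n. k <= n ==> norm (f (Suc n) - f n) <= C * (1/2) ^ n"
 shows "\<exists>l. f ----> l & (\<forall>n\<ge>k. norm (f n - l) <= 2 * C * (1/2) ^ n)"
proof -
 have step: "norm (f (n + j) - f n) <= 2 * C * (1/2) ^ n * (1 - (1/2) ^ j)" if n: "k <= n" for n j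
 proof (induction j)
  case (Suc j)
  have "norm (f (n + Suc j) - f n) <= norm (f (Suc (n + j)) - f (n + j)) + norm (f (n + j) - f n)"
   using norm_triangle_ineq[of "f (Suc (n + j)) - f (n + j)" "f (n + j) - f n"] by simp
  also have "... <= C * (1/2) ^ (n + j) + 2 * C * (1/2) ^ n * (1 - (1/2) ^ j)"
   using assms[of "n + j"] n Suc by (intro add_mono) auto
  finally show ?case by (simp add: power_add algebra_simps)
 qed simp
 have C0: "0 <= C" using order_trans[OF norm_ge_zero assms[OF order_refl]] zero_less_power[of "1/2::real" k]
  by (metis half_gt_zero_iff less_numeral_extra(1) not_less zero_le_mult_iff)
 have bd: "norm (f (n + j) - f n) <= 2 * C * (1/2) ^ n" if "k <= n" for n j
 proof -
  have "2 * C * (1/2) ^ n * (1 - (1/2) ^ j) <= 2 * C * (1/2) ^ n * 1" using C0 by (intro mult_left_mono) auto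
  thus ?thesis using step[OF that, of j] by simp
 qed
 have lim0: "(%n. 2 * C * (1/2) ^ n) ----> 0" by (intro tendsto_mult_right_zero LIMSEQ_realpow_zero) auto
 have "Cauchy f"
 proof (rule CauchyI')
  fix r :: real assume "0 < r"
  then obtain N where N: "!!n. n \<ge> N ==> norm (2 * C * (1/2) ^ n - 0) < r" using LIMSEQ_D[OF lim0] by blast
  have "dist (f m) (f n) < r" if m: "m \<ge> max N k" and n: "m < n" for m n
  proof -
   have "norm (f (m + (n - m)) - f m) <= 2 * C * (1/2) ^ m" by (rule bd) (use m in simp)
   moreover have "2 * C * (1/2) ^ m < r" using N[of m] m C0 by simp
   ultimately show ?thesis using n by (simp add: dist_norm norm_minus_commute)
  qed
  thus "\<exists>M. \<forall>m\<ge>M. \<forall>n>m. dist (f m) (f n) < r" by blast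
 qed
 then obtain l where l: "f ----> l" using Cauchy_convergent convergent_def by blast
 have "norm (f n - l) <= 2 * C * (1/2) ^ n" if n: "k <= n" for n
 proof -
  have "(%j. f (n + j)) ----> l" using LIMSEQ_ignore_initial_segment[OF l, of n] by (simp add: add.commute)
  hence "(%j. norm (f (n + j) - f n)) ----> norm (l - f n)" by (intro tendsto_intros)
  hence "norm (l - f n) <= 2 * C * (1/2) ^ n" by (rule LIMSEQ_le_const2) (use bd[OF n] in blast)
  thus ?thesis by (simp add: norm_minus_commute)
 qed
 thus ?thesis using l by blast
qed

text \<open>With \<open>d n = g (n + 1) - g n\<close> the operator \<open>c k\<close> is the decreasing limit of the inverses of
 \<open>1 + (\<Sum>n\<in>{k..<m}. 4 ^ n d n d n)\<close>; it dominates the unbounded tail sums, and it tends to 1 in trace.\<close>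

lemma (in finite_algebra) summable_differences_limit:
 assumes P: "vn_algebra P" "P \<subseteq> Q" and g: "!!n. g n \<in> P" "!!n. star (g n) = g n" "!!n. nrm (g n) <= K"
  and small: "!!n. t ((g (Suc n) - g n) * (g (Suc n) - g n)) <= (1/16) ^ n"
 shows "\<exists>a c. a \<in> P & star a = a & (\<forall>k. c k \<in> P & 0 <= c k & c k <= 1 & t (1 - c k) <= 2 * (1/4) ^ k) \<and>
  (\<forall>k n. k <= n --> nrm ((g n - a) * c k) <= 2 * (1/2) ^ n)"
proof -
 interpret P: vn_algebra P by (rule P(1))
 have PQ: "x \<in> Q" if "x \<in> P" for x using that P(2) by blast
 define d where "d n = g (Suc n) - g n" for n
 have d: "d n \<in> P" "star (d n) = d n" for n by (auto simp: d_def star_diff g intro: P.diff g)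
 \<comment> \<open>The weight shares out the decay 16 ^ -n: \<open>s n\<close> keeps trace at most 4
   ^ -n, while the inverses built from its sums damp \<open>d n\<close> to norm 2 ^ -n.\<close>
 define s where "s n = (4::real) ^ n *\<^sub>R (d n * d n)" for n
 have sP: "s n \<in> P" for n unfolding s_def by (intro P.scaleR P.mult d)
 have s0: "0 <= s n" for n unfolding s_def using star_mult_self_pos[of "d n"] by (intro scaleR_nonneg_nonneg) (simp_all add: d)
 have ts: "t (s n) <= (1/4) ^ n" for n
 proof -
  have "t (s n) = 4 ^ n * t (d n * d n)" unfolding s_def by (rule tr_scaleR) (intro mult PQ d)
  also have "... <= 4 ^ n * (1/16) ^ n" using small[of n] by (intro mult_left_mono) (simp_all add: d_def)
  finally show ?thesis by (simp flip: power_mult_distrib)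
 qed
 define b where "b k m = (\<Sum>n\<in>{k..<m}. s n)" for k m
 have bP: "b k m \<in> P" and b0: "0 <= b k m" for k m unfolding b_def by (intro P.sum sP) (intro sum_nonneg s0)
 have bmono: "b k m <= b k (Suc m)" "b (Suc k) m <= b k m" for k m
  unfolding b_def by (intro sum_mono2; auto simp: s0)+
 have tb: "t (b k m) <= 2 * (1/4) ^ k" for k m
 proof -
  have "(\<Sum>n\<in>{k..<m}. (1/4::real) ^ n) <= 2 * (1/4) ^ k"
  proof (cases "k <= m")
   case True
   then obtain j where j: "m = k + j" using le_Suc_ex by blast
   have "(\<Sum>n\<in>{k..<k+j}. (1/4::real) ^ n) <= 2 * (1/4) ^ k - 4/3 * (1/4) ^ (k + j)" by (induction j) auto
   also have "... <= 2 * (1/4) ^ k" by simp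
   finally show ?thesis unfolding j .
  qed simp
  moreover have "t (b k m) <= (\<Sum>n\<in>{k..<m}. (1/4) ^ n)"
   unfolding b_def by (subst tr_sum) (auto intro: PQ sP sum_mono ts)
  ultimately show ?thesis by linarith
 qed
 have "\<exists>c. (1 + b k m) * c = 1 & c * (1 + b k m) = 1 & 0 <= c & c <= 1" for k m
  using inverse_exists[of 1 "1 + b k m"] b0[of k m] by simp
 then obtain c where c: "!!k m. (1 + b k m) * c k m = 1" "!!k m. c k m * (1 + b k m) = 1" "!!k m. 0 <= c k m" "!!k m. c k m <= 1" by metis
 have cP: "c k m \<in> P" for k m by (rule P.inverse_mem[OF _ c(1,2)]) (intro P.add P.one bP)
 have sc: "star (c k m) = c k m" for k m by (rule pos_self_adjoint[OF c(3)])
 have ob: "0 <= 1 + b k m" for k m using b0[of k m] by simp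
 have cmono: "c k (Suc m) <= c k m" "c k m <= c (Suc k) m" for k m
  by (rule inverse_antimono[OF ob c(1,2) sc c(1,2) sc], use bmono in simp)+
 have tc: "t (1 - c k m) <= 2 * (1/4) ^ k" for k m
 proof -
  have cb: "c k m * b k m = 1 - c k m" "b k m * c k m = 1 - c k m" using c(1,2)[of k m] by (simp_all add: algebra_simps)
  have "0 <= b k m * c k m * b k m" using conj_pos[OF c(3), of "b k m" k m] pos_self_adjoint[OF b0] by simp
  also have "b k m * c k m * b k m = b k m - (1 - c k m)" by (simp add: cb left_diff_distrib)
  finally have "1 - c k m <= b k m" by simp
  hence "t (1 - c k m) <= t (b k m)" by (intro tr_mono PQ P.diff P.one cP bP)
  thus ?thesis using tb[of k m] by linarith
 qed
 have "\<exists>w. slim (%m. 1 - c k m) w & (\<forall>m. 1 - c k m <= w) & w <= 1" for k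
  by (rule increasing_slim_exists) (use cmono c in \<open>auto intro: incseq_SucI\<close>)
 then obtain w where w: "!!k. slim (%m. 1 - c k m) (w k)" "!!k m. 1 - c k m <= w k" "!!k. w k <= 1" by metis
 define e where "e k = 1 - w k" for k
 have wP: "w k \<in> P" for k by (rule P.slim_closed[OF _ w(1)]) (intro P.diff P.one cP)
 have eP: "e k \<in> P" for k unfolding e_def by (intro P.diff P.one wP)
 have lime: "slim (%m. c k m) (e k)" for k using slim_diff[OF slim_const[of 1] w(1)[of k]] by (simp add: e_def)
 have e0: "0 <= e k" for k using w(3)[of k] by (simp add: e_def)
 have e1: "e k <= 1" for k by (rule slim_le[OF lime slim_const c(4)])
 have emono: "e k <= e (Suc k)" for k by (rule slim_le[OF lime lime cmono(2)])
 have te: "t (1 - e k) <= 2 * (1/4) ^ k" for k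
 proof -
  have "(%m. t (1 - c k m)) ----> t (w k)" by (rule tr_lim[OF _ _ w(1)]) (use cmono in \<open>auto intro: PQ P.diff P.one cP incseq_SucI\<close>)
  from LIMSEQ_le_const2[OF this] tc[of k] have "t (w k) <= 2 * (1/4) ^ k" by blast
  thus ?thesis by (simp add: e_def)
 qed
 have de: "norm (d n $ e k $ v) <= (1/2) ^ n * norm v" if n: "k <= n" for n k v
 proof -
  \<comment> \<open>The index \<open>l + Suc n\<close> makes \<open>s n\<close> one of the summands
    of \<open>b\<close>, and \<open>s n <= 1 + b\<close> bounds the form of \<open>s n\<close> at
    \<open>c $ v\<close> by that of \<open>c\<close> at \<open>v\<close>.\<close>
  have "norm (d n $ c k (l + Suc n) $ v) <= (1/2) ^ n * norm v" for l
  proof -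
   let ?c = "c k (l + Suc n)" and ?b = "b k (l + Suc n)"
   have "s n <= ?b" using sum_mono2[of "{k..<l + Suc n}" "{n}" s] n s0 by (simp add: b_def)
   hence "s n <= 1 + ?b" using pos_one by (metis add_increasing)
   hence "qf (s n) (?c $ v) <= qf (1 + ?b) (?c $ v)" by (rule qf_mono)
   also have "... = qf ?c v" using arg_cong[OF c(1)[of k "l + Suc n"], of "%x. x $ v"]
    cinner_star[of ?c v v] by (simp add: qf_def sc cinner_commute_Re)
   also have "... <= (norm v)\<^sup>2" using qf_mono[OF c(4), of k "l + Suc n" v] by (simp add: qf_simps)
   finally have "4 ^ n * (norm (d n $ ?c $ v))\<^sup>2 <= (norm v)\<^sup>2"
    using qf_simps(7)[of "d n" "?c $ v"] by (simp add: s_def qf_simps d)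
   hence "(2 ^ n * norm (d n $ ?c $ v))\<^sup>2 <= (norm v)\<^sup>2"
    by (simp add: power_mult_distrib power2_eq_square[of "2 ^ n"] flip: power_mult_distrib[of 2 2])
   hence "2 ^ n * norm (d n $ ?c $ v) <= norm v" by (rule power2_le_imp_le) simp
   thus ?thesis by (simp add: power_one_over field_simps)
  qed
  moreover have "(%l. norm (d n $ c k (l + Suc n) $ v)) ----> norm (d n $ e k $ v)"
   by (intro tendsto_norm tendsto_appl LIMSEQ_ignore_initial_segment slimD[OF lime])
  ultimately show ?thesis by (intro LIMSEQ_le_const2) auto
 qed
 have geo: "\<exists>l. (%n. g n $ e k $ v) ----> l & (\<forall>n\<ge>k. norm (g n $ e k $ v - l) <= 2 * norm v * (1/2) ^ n)" for k v
  by (rule geometric_convergence) (use de in \<open>simp add: d_def mult.commute\<close>)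
 have "slim e 1"
 proof -
  have inc: "incseq e" by (rule incseq_SucI) (rule emono)
  obtain z where z: "slim e z" "!!n. e n <= z" "z <= 1" using increasing_slim_exists[OF inc e1] by blast
  have zP: "z \<in> P" by (rule P.slim_closed[OF eP z(1)])
  have "t (1 - z) <= 2 * (1/4) ^ k" for k
   using te[of k] tr_mono[of "1 - z" "1 - e k"] z(2)[of k] by (simp add: PQ P.diff P.one zP eP)
  moreover have lim0: "(%k. 2 * (1/4::real) ^ k) ----> 0" by (intro tendsto_mult_right_zero LIMSEQ_realpow_zero) auto
  ultimately have "t (1 - z) <= 0" using LIMSEQ_le_const[OF lim0] by blast
  moreover have "0 <= t (1 - z)" by (rule tr_pos) (use z(3) in \<open>auto intro: PQ P.diff P.one zP\<close>)
  ultimately have "1 - z = 0" by (intro faithful) (use z(3) in \<open>auto intro: PQ P.diff P.one zP\<close>)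
  thus ?thesis using z(1) by simp
 qed
 hence dense: "closure (\<Union>k. range (appl (e k))) = UNIV"
 proof (intro equalityI subset_UNIV subsetI)
  fix v assume "slim e 1"
  from slimD[OF this, of v] have "(%k. e k $ v) ----> v" by simp
  thus "v \<in> closure (\<Union>k. range (appl (e k)))" unfolding closure_sequential by (intro exI[of _ "%k. e k $ v"]) auto
 qed
 have conv: "convergent (%n. g n $ v)" for v
 proof (rule convergent_dense[OF g(3) dense])
  fix x assume "x \<in> (\<Union>k. range (appl (e k)))"
  then obtain k u where "x = e k $ u" by blast
  thus "convergent (%n. g n $ x)" using geo[of k u] convergent_def by blast
 qed
 obtain a where a: "slim g a" using slim_exists[of g, OF conv g(3)] by blast
 have "nrm ((g n - a) * e k) <= 2 * (1/2) ^ n" if n: "k <= n" for k n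
 proof (rule nrm_leI)
  fix v
  obtain l where l: "(%n. g n $ e k $ v) ----> l" "\<forall>n\<ge>k. norm (g n $ e k $ v - l) <= 2 * norm v * (1/2) ^ n" using geo by blast
  have "l = a $ e k $ v" by (rule LIMSEQ_unique[OF l(1) slimD[OF a]])
  thus "norm (((g n - a) * e k) $ v) <= 2 * (1/2) ^ n * norm v" using l(2) n by (simp add: mult_ac)
 qed simp
 moreover have "a \<in> P" by (rule P.slim_closed[OF g(1) a])
 moreover have "star a = a" by (rule slim_self_adjoint[OF a g(2)])
 ultimately show ?thesis using eP e0 e1 te by (intro exI[of _ a] exI[of _ e]) simp
qed


section \<open>The trace representation\<close>

locale trace_representation = finite_algebra Q t for Q :: "'h::complex_hilbert_space cop set" and t +
 fixes phi :: "'h cop => 'k::complex_hilbert_space cop" and Om :: 'k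
 assumes t_one: "t 1 = 1" and phi_one: "phi 1 = 1"
  and phi_add: "x \<in> Q ==> y \<in> Q ==> phi (x + y) = phi x + phi y"
  and phi_mult: "x \<in> Q ==> y \<in> Q ==> phi (x * y) = phi x * phi y"
  and phi_star: "x \<in> Q ==> phi (star x) = star (phi x)"
  and phi_cscale: "x \<in> Q ==> phi (cscale c x) = cscale c (phi x)"
  and phi_cyclic: "closure ((%x. phi x $ Om) ` Q) = UNIV"
  and phi_state: "x \<in> Q ==> qf (phi x) Om = t x"
begin

lemma phi_scaleR: "x \<in> Q ==> phi (r *\<^sub>R x) = r *\<^sub>R phi x"
 using phi_cscale[of x "of_real r"] by (simp add: cscale_of_real)

lemma phi_zero: "phi 0 = 0"
 using phi_scaleR[OF zero, of 0] by simp

lemma phi_diff: "x \<in> Q ==> y \<in> Q ==> phi (x - y) = phi x - phi y"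
 using phi_add[OF _ uminus, of x y] phi_scaleR[of y "-1"] by simp

lemma phi_norm: "x \<in> Q ==> (norm (phi x $ Om))\<^sup>2 = t (star x * x)"
 using phi_state[of "star x * x"] by (simp add: phi_mult phi_star mult star qf_simps)

lemma phi_inj: "x \<in> Q ==> y \<in> Q ==> phi x = phi y ==> x = y"
 using phi_norm[of "x - y"] faithful_star[of "x - y"] by (simp add: diff phi_diff)

lemma star_algebra_image:
 assumes "star_algebra P" "P \<subseteq> Q" shows "star_algebra (phi ` P)"
proof -
 interpret P: star_algebra P by (rule assms(1))
 have PQ: "x \<in> Q" if "x \<in> P" for x using that assms(2) by blast
 show ?thesis
 proof
  show "1 \<in> phi ` P" using P.one phi_one by (metis imageI)
  fix x assume "x \<in> phi ` P"
  then obtain a where a: "a \<in> P" "x = phi a" by blast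
  show "star x \<in> phi ` P" by (rule image_eqI[OF _ P.star[OF a(1)]]) (simp add: a phi_star PQ)
  show "cscale c x \<in> phi ` P" for c by (rule image_eqI[OF _ P.cscale[OF a(1)]]) (simp add: a phi_cscale PQ)
  fix y assume "y \<in> phi ` P"
  then obtain b where b: "b \<in> P" "y = phi b" by blast
  show "x + y \<in> phi ` P" by (rule image_eqI[OF _ P.add[OF a(1) b(1)]]) (simp add: a b phi_add PQ)
  show "x * y \<in> phi ` P" by (rule image_eqI[OF _ P.mult[OF a(1) b(1)]]) (simp add: a b phi_mult PQ)
 qed
qed

sublocale T: tracial_vector "phi ` Q" Om
proof (intro tracial_vector.intro tracial_vector_axioms.intro)
 show "star_algebra (phi ` Q)" by (rule star_algebra_image) (unfold_locales, simp)
 show "closure ((%x. x $ Om) ` phi ` Q) = UNIV" using phi_cyclic by (simp add: image_image)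
 show "norm Om = 1" using phi_norm[OF one] norm_ge_zero[of Om] by (simp add: phi_one t_one power2_eq_1_iff)
 fix x y assume "x \<in> phi ` Q" "y \<in> phi ` Q"
 then obtain a b where ab: "a \<in> Q" "x = phi a" "b \<in> Q" "y = phi b" by blast
 have re: "Re (cinner (phi a $ phi b $ Om) Om) = Re (cinner (phi b $ phi a $ Om) Om)" if "a \<in> Q" "b \<in> Q" for a b
  using phi_state[of "a * b"] phi_state[of "b * a"] tr_comm[OF that] that by (simp add: qf_def phi_mult mult)
 have "Re (- \<i> * cinner (phi a $ phi b $ Om) Om) = Re (- \<i> * cinner (phi b $ phi a $ Om) Om)"
  using re[OF cscale[OF ab(1)] ab(3), of "- \<i>"] by (simp add: phi_cscale ab cinner_scaleC_left)
 with re[OF ab(1,3)] show "cinner (x $ y $ Om) Om = cinner (y $ x $ Om) Om" by (simp add: ab complex_eq_iff)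
qed

lemma phi_pos: assumes "x \<in> Q" "0 <= x" shows "0 <= phi x"
proof -
 have s: "psqrt x \<in> Q" "star (psqrt x) = psqrt x" using psqrt_mem[OF assms] pos_self_adjoint psqrt(1)[OF assms(2)] by auto
 have "phi x = star (phi (psqrt x)) * phi (psqrt x)"
  using phi_mult[OF s(1) s(1)] psqrt(2)[OF assms(2)] phi_star[OF s(1)] s(2) by simp
 thus ?thesis by simp
qed

lemma phi_mono: "x \<in> Q ==> y \<in> Q ==> x <= y ==> phi x <= phi y"
 using phi_pos[OF diff, of y x] by (simp add: phi_diff)

text \<open>At \<open>phi n $ Om\<close>, with \<open>n\<close> the negative part of
  \<open>x\<close>, the form of \<open>phi x\<close> is minus the trace of n^3; faithfulness gives n
  = 0.\<close>

lemma phi_reflect: assumes x: "x \<in> Q" "star x = x" "0 <= phi x" shows "0 <= x"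
proof -
 obtain p n where pn: "0 <= p" "0 <= n" "x = p - n" "p * n = 0" "n * p = 0"
   "!!t. t * x = x * t ==> t * p = p * t & t * n = n * t"
  using jordan_decomposition[OF x(2)] by blast
 have nQ: "n \<in> Q" by (rule bicommutant_memI[OF x(1)]) (use pn(6) in blast)
 have sn: "star n = n" by (rule pos_self_adjoint[OF pn(2)])
 define m where "m = psqrt n"
 have mQ: "m \<in> Q" unfolding m_def by (rule psqrt_mem[OF nQ pn(2)])
 have m: "star m = m" "m * m = n" unfolding m_def using psqrt(1,2)[OF pn(2)] pos_self_adjoint by auto
 have "0 <= qf (phi x) (phi n $ Om)" using x(3) pos_iff by blast
 also have "... = qf (phi (star n * x * n)) Om" by (simp add: phi_mult phi_star mult star nQ x qf_conj)
 also have "... = t (star n * x * n)" by (intro phi_state mult star nQ x)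
 also have "star n * x * n = - (star (m * n) * (m * n))"
 proof -
  have "n * x * n = - (n * n * n)" by (simp add: pn(3) left_diff_distrib right_diff_distrib pn(4,5) mult.assoc)
  also have "n * n * n = n * (m * m) * n" by (simp only: m(2))
  finally show ?thesis by (simp add: sn star_mult m(1) mult.assoc)
 qed
 finally have "t (star (m * n) * (m * n)) <= 0" by (simp add: tr_uminus mult star mQ nQ)
 moreover have "0 <= t (star (m * n) * (m * n))" by (intro tr_pos mult star mQ nQ) simp
 ultimately have "m * n = 0" by (intro faithful_star mult mQ nQ) simp
 hence "n * n = 0" using m(2) by (metis mult.assoc mult_zero_right)
 hence "n = 0" using star_mult_self_eq_0[of n] sn by simp
 thus ?thesis using pn(1,3) by simp
qed

lemma phi_nrm_le: assumes x: "x \<in> Q" shows "nrm (phi x) <= nrm x"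
proof (rule nrm_leI)
 fix v
 have "phi (star x * x) <= phi ((nrm x)\<^sup>2 *\<^sub>R 1)" by (intro phi_mono mult star x scaleR one star_mult_self_le)
 hence "star (phi x) * phi x <= (nrm x)\<^sup>2 *\<^sub>R 1" by (simp add: phi_mult phi_star x star phi_scaleR one phi_one)
 from qf_mono[OF this, of v] have "(norm (phi x $ v))\<^sup>2 <= (nrm x * norm v)\<^sup>2" by (simp add: qf_simps power_mult_distrib)
 thus "norm (phi x $ v) <= nrm x * norm v" by (rule power2_le_imp_le) simp
qed simp

text \<open>A strong limit in the original space need not be respected by \<open>phi\<close>, which
  is not known to be normal. Norm estimates are respected, and
  \<open>summable_differences_limit\<close> provides them after multiplication by
  \<open>c k\<close>: they show that \<open>rho (phi (c k))\<close> kills the error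
  \<open>y\<close>.\<close>

lemma self_adjoint_complete:
 assumes P: "vn_algebra P" "P \<subseteq> Q" and a: "!!n. a n \<in> P" "!!n. star (a n) = a n" "!!n. nrm (a n) <= K"
  and lim: "(%n. phi (a n) $ Om) ----> v"
 shows "\<exists>x\<in>P. phi x $ Om = v"
proof -
 have PQ: "x \<in> Q" if "x \<in> P" for x using that P(2) by blast
 \<comment> \<open>At this rate consecutive terms differ by at most 4 ^ -n in trace norm, so the
   squares are at most 16 ^ -n.\<close>
 have "\<exists>m. norm (phi (a m) $ Om - v) <= (1/4) ^ n / 2" for n
 proof -
  obtain N where "!!m. m \<ge> N ==> norm (phi (a m) $ Om - v) < (1/4) ^ n / 2" using LIMSEQ_D[OF lim, of "(1/4) ^ n / 2"] by auto
  from this[of N] show ?thesis by (auto intro: less_imp_le)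
 qed
 then obtain r where r: "!!n. norm (phi (a (r n)) $ Om - v) <= (1/4) ^ n / 2" by metis
 define g where "g n = a (r n)" for n
 have gQ: "g n \<in> Q" for n unfolding g_def by (rule PQ[OF a(1)])
 have "t ((g (Suc n) - g n) * (g (Suc n) - g n)) <= (1/16) ^ n" for n
 proof -
  have "norm (phi (g (Suc n)) $ Om - phi (g n) $ Om) <= (1/4) ^ Suc n / 2 + (1/4) ^ n / 2"
   using norm_triangle_ineq4[of "phi (g (Suc n)) $ Om - v" "phi (g n) $ Om - v"] r[of n] r[of "Suc n"]
   unfolding g_def by simp
  also have "... <= (1/4) ^ n" by simp
  finally have "(norm (phi (g (Suc n) - g n) $ Om))\<^sup>2 <= ((1/4) ^ n)\<^sup>2" by (simp add: phi_diff gQ power_mono)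
  also have "((1/4) ^ n)\<^sup>2 = (1/16::real) ^ n" by (simp add: power2_eq_square flip: power_mult_distrib)
  finally show ?thesis by (simp add: phi_norm diff gQ star_diff) (simp add: g_def a)
 qed
 from summable_differences_limit[OF P _ _ _ this, of K] a obtain x c where x: "x \<in> P" "star x = x"
  and c: "!!k. c k \<in> P & 0 <= c k & c k <= 1 & t (1 - c k) <= 2 * (1/4) ^ k"
  and gx: "!!k n. k <= n ==> nrm ((g n - x) * c k) <= 2 * (1/2) ^ n" unfolding g_def by metis
 have cQ: "c k \<in> Q" for k using c PQ by blast
 define y where "y = v - phi x $ Om"
 have limg: "(%n. phi (g n - x) $ Om) ----> y"
 proof (rule LIM_zero_cancel, rule Lim_null_comparison)
  show "\<forall>\<^sub>F n in sequentially. norm (phi (g n - x) $ Om - y) <= (1/4) ^ n / 2"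
   using r[folded g_def] by (intro always_eventually allI) (simp add: phi_diff gQ PQ x y_def)
  show "(%n. (1/4::real) ^ n / 2) ----> 0" by (intro tendsto_divide_zero LIMSEQ_realpow_zero) auto
 qed
 have cy: "T.rho (phi (c k)) $ y = 0" for k
 proof (rule LIMSEQ_unique[OF tendsto_appl[OF limg]])
  show "(%n. T.rho (phi (c k)) $ phi (g n - x) $ Om) ----> 0"
  proof (rule Lim_null_comparison)
   show "\<forall>\<^sub>F n in sequentially. norm (T.rho (phi (c k)) $ phi (g n - x) $ Om) <= 2 * (1/2) ^ n"
    unfolding eventually_sequentially
   proof (intro exI[of _ k] allI impI)
    fix n assume n: "k <= n"
    have "T.rho (phi (c k)) $ phi (g n - x) $ Om = phi ((g n - x) * c k) $ Om"
     by (simp add: T.rho_orbit phi_mult diff gQ PQ x cQ)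
    also have "norm ... <= nrm (phi ((g n - x) * c k)) * norm Om" by (rule norm_appl)
    also have "... <= nrm ((g n - x) * c k)" by (simp add: T.norm_Om phi_nrm_le mult diff gQ PQ x cQ)
    also have "... <= 2 * (1/2) ^ n" by (rule gx[OF n])
    finally show "norm (T.rho (phi (c k)) $ phi (g n - x) $ Om) <= 2 * (1/2) ^ n" .
   qed
   show "(%n. 2 * (1/2::real) ^ n) ----> 0" by (intro tendsto_mult_right_zero LIMSEQ_realpow_zero) auto
  qed
 qed
 \<comment> \<open>The self-adjoint operators \<open>rho (phi (c k))\<close> kill \<open>y\<close>
   and tend to the identity on the dense orbit, so \<open>y\<close> is orthogonal to the
   orbit.\<close>
 have orth: "cinner y (phi m $ Om) = 0" if m: "m \<in> Q" for m
 proof -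
  have "(%k. T.rho (phi (c k)) $ phi m $ Om) ----> phi m $ Om"
  proof (rule LIM_zero_cancel, rule Lim_null_comparison)
   show "\<forall>\<^sub>F k in sequentially. norm (T.rho (phi (c k)) $ phi m $ Om - phi m $ Om) <= nrm m * (2 * (1/2) ^ k)"
   proof (intro always_eventually allI)
    fix k
    have i: "1 - c k \<in> Q" by (intro diff one cQ)
    have "T.rho (phi (c k)) $ phi m $ Om - phi m $ Om = - (phi m $ phi (1 - c k) $ Om)"
     by (simp add: T.rho_orbit m cQ phi_diff one phi_one)
    hence "norm (T.rho (phi (c k)) $ phi m $ Om - phi m $ Om) = norm (phi m $ phi (1 - c k) $ Om)" by simp
    also have "... <= nrm (phi m) * norm (phi (1 - c k) $ Om)" by (rule norm_appl)
    also have "... <= nrm m * (2 * (1/2) ^ k)"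
    proof (intro mult_mono phi_nrm_le m)
     have 1: "(norm (phi (1 - c k) $ Om))\<^sup>2 <= nrm (phi (1 - c k)) * qf (phi (1 - c k)) Om"
      by (rule norm_pos_appl_nrm) (use c i in \<open>auto intro: phi_pos\<close>)
     have "nrm (phi (1 - c k)) <= 1"
      using phi_nrm_le[OF i] nrm_pos_le[of "1 - c k" 1] c[of k] by simp
     moreover have "0 <= t (1 - c k)" by (rule tr_pos[OF i]) (use c in simp)
     ultimately have "nrm (phi (1 - c k)) * t (1 - c k) <= 1 * t (1 - c k)" by (intro mult_right_mono)
     hence "(norm (phi (1 - c k) $ Om))\<^sup>2 <= 2 * (1/4) ^ k" using 1 c[of k] by (simp add: phi_state i)
     also have "... <= (2 * (1/2) ^ k)\<^sup>2" by (simp add: power_mult_distrib power2_eq_square flip: power_mult_distrib)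
     finally show "norm (phi (1 - c k) $ Om) <= 2 * (1/2) ^ k" by (rule power2_le_imp_le) simp
    qed simp_all
    finally show "norm (T.rho (phi (c k)) $ phi m $ Om - phi m $ Om) <= nrm m * (2 * (1/2) ^ k)" .
   qed
   show "(%k. nrm m * (2 * (1/2::real) ^ k)) ----> 0" by (intro tendsto_mult_right_zero LIMSEQ_realpow_zero) auto
  qed
  hence "(%k. cinner y (T.rho (phi (c k)) $ phi m $ Om)) ----> cinner y (phi m $ Om)" by (intro tendsto_cinner tendsto_const)
  moreover have "cinner y (T.rho (phi (c k)) $ phi m $ Om) = 0" for k
  proof -
   have "star (T.rho (phi (c k))) = T.rho (phi (c k))"
    using T.rho_star[of "phi (c k)"] phi_star[OF cQ, of k] pos_self_adjoint[of "c k"] c[of k] cQ by simp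
   thus ?thesis using cinner_star[of "T.rho (phi (c k))" y] cy[of k] by simp
  qed
  ultimately show ?thesis by (simp add: LIMSEQ_const_iff)
 qed
 obtain h where h: "!!n. h n \<in> phi ` Q" "(%n. h n $ Om) ----> y" using T.dense_sequence by blast
 have "cinner y (h n $ Om) = 0" for n using h(1)[of n] orth by auto
 moreover have "(%n. cinner y (h n $ Om)) ----> cinner y y" by (intro tendsto_cinner tendsto_const h)
 ultimately have "y = 0" by (simp add: LIMSEQ_const_iff cinner_norm)
 thus ?thesis using x(1) by (intro bexI[of _ x]) (simp_all add: y_def)
qed

theorem vn_algebra_image:
 assumes P: "vn_algebra P" "P \<subseteq> Q" shows "vn_algebra (phi ` P)"
proof -
 interpret P: vn_algebra P by (rule P(1))
 have PQ: "x \<in> Q" if "x \<in> P" for x using that P(2) by blast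
 interpret S: star_algebra "phi ` P" by (rule star_algebra_image[OF P.star_algebra_axioms P(2)])
 interpret S1: star_algebra "comm (phi ` P)" by (rule S.star_algebra_comm)
 interpret S2: star_algebra "comm (comm (phi ` P))" by (rule S1.star_algebra_comm)
 have SQ: "x \<in> phi ` Q" if "x \<in> phi ` P" for x using that PQ by blast
 have contraction: "T \<in> phi ` P" if T: "T \<in> comm (comm (phi ` P))" "0 <= T" "T <= 1" for T
 proof -
  have sT: "star T = T" by (rule pos_self_adjoint[OF T(2)])
  have Tr: "T.rho b $ T $ Om = T $ b $ Om" if "b \<in> phi ` Q" for b
  proof -
   have "T.rho b \<in> comm (phi ` P)" using T.rho_comm[OF that] comm_antimono[OF image_mono[OF P(2), of phi]] by blast
   from arg_cong[OF commD[OF T(1) this], of "%s. s $ Om"] show ?thesis by (simp add: T.rho_Om that)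
  qed
  have "\<exists>f. (\<forall>n. f n \<in> phi ` P & 0 <= f n & f n <= 1) & (%n. f n $ Om) ----> T $ Om"
  proof (rule S.contraction_approximation)
   show "T $ Om \<in> closure ((%x. x $ Om) ` phi ` P)" by (rule S.bicommutant_approx[OF T(1)])
   fix b assume b: "b \<in> phi ` P"
   show "Re (cinner (star b $ Om) (c $ Om)) = Re (cinner (b $ Om) (c $ Om))" if "c \<in> phi ` P" "star c = c" for c
    using T.cinner_star_swap[of "star b" c] that SQ b by (simp add: T.star cinner_commute_Re)
   have "star b $ Om = star (T.rho b) $ Om" using T.rho_Om[OF T.star[OF SQ[OF b]]] T.rho_star[OF SQ[OF b]] by simp
   hence "cinner (star b $ Om) (T $ Om) = cinner Om (T $ b $ Om)" by (simp add: cinner_star' Tr SQ b)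
   thus "Re (cinner (star b $ Om) (T $ Om)) = Re (cinner (b $ Om) (T $ Om))"
    using cinner_star[of T Om "b $ Om"] by (simp add: sT cinner_commute_Re)
   obtain a where a: "a \<in> P" "b = phi a" using b by blast
   show "\<exists>r r' s. r \<in> phi ` P & r' \<in> phi ` P & s \<in> phi ` P & star r = r & star r' = r' & isproj s \<and>
     b = r * r - r' * r' & s * r = r & s * r' = 0" if "star b = b"
   proof -
    have "star a = a" using that phi_inj[OF star[OF PQ[OF a(1)]] PQ[OF a(1)]] by (simp add: a phi_star PQ)
    then obtain r r' s where r: "r \<in> P" "r' \<in> P" "s \<in> P" "star r = r" "star r' = r'" "isproj s" "a = r * r - r' * r'" "s * r = r" "s * r' = 0"
     using P.self_adjoint_decomposition[OF a(1)] by blast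
    have "b = phi r * phi r - phi r' * phi r'" by (simp add: a(2) r(7) phi_diff phi_mult mult PQ r(1,2))
    thus ?thesis using r phi_star[OF PQ[OF r(1)]] phi_star[OF PQ[OF r(2)]] phi_star[OF PQ[OF r(3)]]
     phi_mult[OF PQ[OF r(3)] PQ[OF r(1)]] phi_mult[OF PQ[OF r(3)] PQ[OF r(2)]] phi_mult[OF PQ[OF r(3)] PQ[OF r(3)]]
     by (intro exI[of _ "phi r"] exI[of _ "phi r'"] exI[of _ "phi s"]) (simp add: isproj_def phi_zero)
   qed
   show "0 <= Re (cinner ((b * b) $ Om) (T $ Om)) & Re (cinner ((b * b) $ Om) (T $ Om)) <= (norm (b $ Om))\<^sup>2" if sb: "star b = b"
   proof -
    have "(b * b) $ Om = star (T.rho b) $ b $ Om" using T.rho_star[OF SQ[OF b]] by (simp add: sb T.rho_orbit SQ b)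
    hence "Re (cinner ((b * b) $ Om) (T $ Om)) = qf T (b $ Om)" by (simp add: cinner_star' Tr SQ b qf_def cinner_commute_Re)
    thus ?thesis using qf_mono[OF T(3), of "b $ Om"] T(2) unfolding pos_iff by (simp add: qf_simps)
   qed
  qed
  then obtain f where "\<forall>n. f n \<in> phi ` P & 0 <= f n & f n <= 1" and flim: "(%n. f n $ Om) ----> T $ Om" by (elim exE conjE)
  hence f: "f n \<in> phi ` P" "0 <= f n" "f n <= 1" for n by simp_all
  have "\<forall>n. \<exists>x\<in>P. f n = phi x" using f(1) by blast
  then obtain g where g: "!!n. g n \<in> P" "!!n. f n = phi (g n)" by metis
  have sg: "star (g n) = g n" for n
   by (rule phi_inj) (use pos_self_adjoint[OF f(2)[of n]] g in \<open>simp_all add: PQ star phi_star\<close>)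
  have "0 <= g n" for n using phi_reflect[OF PQ[OF g(1)] sg] f(2)[of n] by (simp add: g(2))
  moreover have "0 <= 1 - g n" for n
   by (rule phi_reflect) (use f(3)[of n] in \<open>simp_all add: g diff one PQ star_diff sg phi_diff phi_one\<close>)
  ultimately have ng: "nrm (g n) <= 1" for n using nrm_pos_le[of "g n" 1] by simp
  obtain x where x: "x \<in> P" "phi x $ Om = T $ Om"
   using self_adjoint_complete[OF P g(1) sg ng flim[unfolded g(2)]] by blast
  have "T = phi x"
  proof (rule T.orbit_eqI)
   fix c assume c: "c \<in> phi ` Q"
   have "T $ c $ Om = T.rho c $ phi x $ Om" by (simp add: Tr c x(2))
   thus "T $ c $ Om = phi x $ c $ Om" using T.rho_orbit[OF c imageI[OF PQ[OF x(1)]]] by simp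
  qed
  thus ?thesis using x(1) by blast
 qed
 have sa: "T \<in> phi ` P" if T: "T \<in> comm (comm (phi ` P))" "star T = T" for T
 proof -
  obtain r R where R: "0 <= R" "R <= 1" "T = r *\<^sub>R R - nrm T *\<^sub>R 1" "R = (1 / r) *\<^sub>R (T + nrm T *\<^sub>R 1)"
   using self_adjoint_rescale[OF T(2)] by blast
  have "R \<in> comm (comm (phi ` P))" unfolding R(4) by (intro S2.scaleR S2.add S2.one T)
  thus ?thesis using contraction[OF _ R(1,2)] by (subst R(3)) (intro S.diff S.scaleR S.one)
 qed
 have "comm (comm (phi ` P)) \<subseteq> phi ` P"
 proof
  fix T assume T: "T \<in> comm (comm (phi ` P))"
  obtain X Y where XY: "star X = X" "star Y = Y" "T = X + cscale \<i> Y"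
   "X = (1/2) *\<^sub>R (T + star T)" "Y = (1/2) *\<^sub>R cscale (- \<i>) (T - star T)" by (rule complex_decomposition)
  have "X \<in> comm (comm (phi ` P))" "Y \<in> comm (comm (phi ` P))" unfolding XY(4,5)
   by (intro S2.scaleR S2.add S2.diff S2.cscale S2.star T)+
  thus "T \<in> phi ` P" unfolding XY(3) by (intro S.add S.cscale sa XY(1,2))
 qed
 thus ?thesis by (intro vn_algebra.intro vn_algebra_axioms.intro S.star_algebra_axioms) (use comm_comm_superset in blast)
qed

lemma factor_algebra_image:
 assumes P: "factor_algebra P" "P \<subseteq> Q" shows "factor_algebra (phi ` P)"
proof -
 interpret P: factor_algebra P by (rule P(1))
 have PQ: "x \<in> Q" if "x \<in> P" for x using that P(2) by blast
 have "phi ` P \<inter> comm (phi ` P) = range (%c. cscale c (phi 1))"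
 proof (intro equalityI subsetI)
  fix z assume "z \<in> phi ` P \<inter> comm (phi ` P)"
  then obtain a where a: "a \<in> P" "z = phi a" "phi a \<in> comm (phi ` P)" by blast
  have "a \<in> comm P"
  proof (rule commI)
   fix x assume x: "x \<in> P"
   have h: "phi (x * a) = phi (a * x)" using commD[OF a(3) imageI[OF x]] by (simp add: phi_mult PQ x a)
   show "x * a = a * x" by (rule phi_inj[OF _ _ h]) (intro mult PQ x a)+
  qed
  then obtain c where "a = cscale c 1" using P.center a(1) by blast
  thus "z \<in> range (%c. cscale c (phi 1))" using a(2) by (simp add: phi_cscale one phi_one)
 next
  fix z assume "z \<in> range (%c. cscale c (phi 1))"
  then obtain c where c: "z = cscale c 1" by (auto simp: phi_one)
  have "z = phi (cscale c 1)" by (simp add: c phi_cscale one phi_one)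
  moreover have "z \<in> comm (phi ` P)" by (rule commI) (simp add: c cscale_mult)
  ultimately show "z \<in> phi ` P \<inter> comm (phi ` P)" using P.cscale[OF P.one] by blast
 qed
 thus ?thesis unfolding phi_one by (intro factor_algebra.intro factor_algebra_axioms.intro vn_algebra_image P P.vn_algebra_axioms)
qed

lemma finite_dim_reflect:
 assumes S: "finite S" "phi ` Q \<subseteq> span S" shows "\<exists>S. finite S & Q \<subseteq> span S"
proof -
 obtain B where B: "B \<subseteq> phi ` Q" "independent B" "phi ` Q \<subseteq> span B" by (rule maximal_independent_subset)
 have fB: "finite B" using independent_span_bound[OF S(1) B(2)] B(1) S(2) by blast
 obtain C where C: "C \<subseteq> Q" "finite C" "B = phi ` C" using finite_subset_image[OF fB B(1)] by blast
 have "x \<in> span C" if x: "x \<in> Q" for x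
 proof -
  have "phi x \<in> span (phi ` C)" using B(3) x C(3) by blast
  then obtain u where u: "phi x = (\<Sum>b\<in>phi ` C. u b *\<^sub>R b)" using span_finite[of "phi ` C"] C(2) by auto
  have inj: "inj_on phi C" using phi_inj C(1) by (meson inj_onI subsetD)
  have "phi (\<Sum>c\<in>D. u (phi c) *\<^sub>R c) = (\<Sum>c\<in>D. u (phi c) *\<^sub>R phi c)" if "D \<subseteq> C" "finite D" for D
   using that(2,1)
  proof (induction D rule: finite_induct)
   case (insert d D)
   have "(\<Sum>c\<in>D. u (phi c) *\<^sub>R c) \<in> Q" by (rule sum) (use insert C(1) in \<open>auto intro: scaleR\<close>)
   thus ?case using insert C(1) by (simp add: phi_add scaleR phi_scaleR subset_iff)
  qed (simp add: phi_zero)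
  from this[OF subset_refl C(2)] have "phi (\<Sum>c\<in>C. u (phi c) *\<^sub>R c) = phi x"
   using u inj by (simp add: sum.reindex)
  moreover have "(\<Sum>c\<in>C. u (phi c) *\<^sub>R c) \<in> Q" by (rule sum) (use C(1) in \<open>auto intro: scaleR\<close>)
  ultimately have "x = (\<Sum>c\<in>C. u (phi c) *\<^sub>R c)" using phi_inj x by metis
  also have "... \<in> span C" by (intro span_sum span_scale span_base)
  finally show ?thesis .
 qed
 thus ?thesis using C(2) by blast
qed

end

text \<open>Pushing down the pieces of \<open>exhaustion\<close> gives a Pimsner-Popa basis: every
  \<open>m\<close> is a sum of \<open>E (m * n i) * star (n i)\<close>. So a finite-dimensional
  \<open>A\<close> would make \<open>M\<close> finite-dimensional.\<close>

lemma (in finite_index) finite_dim_subfactor: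
 assumes S: "finite S" "A \<subseteq> span S" shows "\<exists>S. finite S & M \<subseteq> span S"
proof -
 obtain I and v :: "nat => 'a cop" where I: "finite I" and v: "!!i. i \<in> I ==> v i \<in> comm A" "!!i. i \<in> I ==> e * v i = v i"
  "(\<Sum>i\<in>I. star (v i) * v i) = 1" by (rule tn_vector_states) blast
 have "\<exists>n\<in>M. v i = e * rho n" if "i \<in> I" for i by (rule pushdown[OF v(1,2)[OF that]])
 then obtain n where n: "!!i. i \<in> I ==> n i \<in> M" "!!i. i \<in> I ==> v i = e * rho (n i)" by metis
 have "m \<in> span ((%(i, s). s * star (n i)) ` (I \<times> S))" if m: "m \<in> M" for m
 proof -
  have "m = (\<Sum>i\<in>I. E (m * n i) * star (n i))"
  proof (rule separating_eq[OF m])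
   show "(\<Sum>i\<in>I. E (m * n i) * star (n i)) \<in> M" by (rule sum) (intro mult A_M E_mem star n m)
   have "m $ Om = (\<Sum>i\<in>I. star (v i) * v i) $ m $ Om" by (simp add: v(3))
   also have "... = (\<Sum>i\<in>I. star (v i) $ v i $ m $ Om)" by (simp add: sum_appl)
   also have "... = (\<Sum>i\<in>I. E (m * n i) $ star (n i) $ Om)"
   proof (rule sum.cong[OF refl])
    fix i assume i: "i \<in> I"
    have "v i $ m $ Om = E (m * n i) $ Om" using E_Om[OF mult[OF m n(1)[OF i]]] by (simp add: n(2)[OF i] rho_orbit n(1)[OF i] m)
    hence "star (v i) $ v i $ m $ Om = rho (star (n i)) $ e $ E (m * n i) $ Om"
     by (simp add: n(2)[OF i] star_mult e_star rho_star n(1)[OF i])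
    thus "star (v i) $ v i $ m $ Om = E (m * n i) $ star (n i) $ Om"
     by (simp add: e_orbit rho_orbit E_mem mult m n(1)[OF i] star A_M)
   qed
   finally show "m $ Om = (\<Sum>i\<in>I. E (m * n i) * star (n i)) $ Om" by (simp add: sum_appl)
  qed
  also have "... \<in> span ((%(i, s). s * star (n i)) ` (I \<times> S))"
  proof (rule span_sum)
   fix i assume i: "i \<in> I"
   have "E (m * n i) \<in> span S" using S(2) E_mem[OF mult[OF m n(1)[OF i]]] by blast
   thus "E (m * n i) * star (n i) \<in> span ((%(i, s). s * star (n i)) ` (I \<times> S))"
   proof (induction rule: span_induct_alt)
    case (step c x y)
    have "x * star (n i) \<in> span ((%(i, s). s * star (n i)) ` (I \<times> S))" using step(1) i by (intro span_base) force
    thus ?case using step(2) by (simp add: distrib_right span_add span_scale)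
   qed (simp add: span_zero)
  qed
  finally show ?thesis .
 qed
 thus ?thesis using I S(1) by (intro exI[of _ "(%(i, s). s * star (n i)) ` (I \<times> S)"]) auto
qed


section \<open>Operators as bounded real-linear maps\<close>

lemma oper_of_image_iff [simp]: "oper_of x \<in> oper_of ` P \<longleftrightarrow> x \<in> P"
 by (auto simp: oper_of_inject)

lemma bounded_ops_image: "M \<subseteq> bounded_ops ==> \<exists>P. M = oper_of ` P"
 by (metis subset_imageE type_definition.univ type_definition_cop type_definition.Rep_range)

lemma commutant_image: "commutant (oper_of ` P) = oper_of ` comm P"
proof (intro equalityI subsetI)
 fix T assume T: "T \<in> commutant (oper_of ` P)"
 hence "T \<in> bounded_ops" by (simp add: commutant_def)
 then obtain t where t: "T = oper_of t" using Cop_inverse by metis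
 have "t \<in> comm P" using T by (auto simp: comm_def commutant_def t oper_of_inject simp flip: oper_of_mult)
 thus "T \<in> oper_of ` comm P" using t by blast
next
 fix T assume "T \<in> oper_of ` comm P"
 then obtain t where t: "T = oper_of t" "t \<in> comm P" by blast
 thus "T \<in> commutant (oper_of ` P)" using oper_of[of t] by (auto simp: comm_def commutant_def simp flip: oper_of_mult)
qed

lemma scalar_op_eq: "scalar_op c = oper_of (cscale c 1)"
 by (rule blinfun_eqI) (simp flip: appl_def)

lemma star_algebra_if_star_subalgebra:
 assumes "star_subalgebra (oper_of ` P)" shows "star_algebra P"
proof
 note s = assms[unfolded star_subalgebra_def]
 show "1 \<in> P" using s by (simp add: oper_of_one[symmetric])
 fix x assume x: "x \<in> P"
 show "star x \<in> P" "cscale c x \<in> P" for c using s x by (simp_all add: oper_of_star[symmetric] oper_of_cscale[symmetric])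
 fix y assume y: "y \<in> P"
 show "x + y \<in> P" "x * y \<in> P" using s x y by (simp_all add: oper_of_add[symmetric] oper_of_mult[symmetric])
qed

lemma vn_algebra_if_von_neumann_algebra:
 assumes "von_neumann_algebra (oper_of ` P)" shows "vn_algebra P"
proof (intro vn_algebra.intro star_algebra_if_star_subalgebra vn_algebra_axioms.intro)
 show "star_subalgebra (oper_of ` P)" using assms by (simp add: von_neumann_algebra_def)
 have "oper_of ` comm (comm P) = oper_of ` P" using assms by (simp add: von_neumann_algebra_def commutant_image)
 thus "comm (comm P) = P" by (simp add: inj_image_eq_iff inj_def oper_of_inject)
qed

lemma factor_algebra_if_factor:
 assumes "factor (oper_of ` P)" shows "factor_algebra P"
proof (intro factor_algebra.intro vn_algebra_if_von_neumann_algebra factor_algebra_axioms.intro)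
 show "von_neumann_algebra (oper_of ` P)" using assms by (simp add: factor_def)
 have "oper_of ` P \<inter> oper_of ` comm P = range scalar_op" using assms by (simp add: factor_def commutant_image)
 also have "... = oper_of ` range (%c. cscale c 1)" by (auto simp: scalar_op_eq)
 also have "oper_of ` P \<inter> oper_of ` comm P = oper_of ` (P \<inter> comm P)" by (auto simp: oper_of_inject)
 finally show "P \<inter> comm P = range (%c. cscale c 1)" by (simp add: inj_image_eq_iff inj_def oper_of_inject)
qed

lemma factor_image:
 assumes "factor M" obtains P where "M = oper_of ` P" "factor_algebra P"
proof -
 have "M \<subseteq> bounded_ops" using assms by (simp add: factor_def von_neumann_algebra_def star_subalgebra_def)
 then obtain P where "M = oper_of ` P" using bounded_ops_image by blast
 thus ?thesis using that factor_algebra_if_factor assms by blast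
qed

lemma finite_dim_image:
 assumes S: "finite S" "P \<subseteq> span S" shows "finite_dim (oper_of ` P)"
proof -
 have "linear (oper_of :: 'a cop => _)" by (rule linearI) (simp_all add: oper_of_add oper_of_scaleR)
 hence "oper_of ` span S = span (oper_of ` S)" by (rule linear_span_image[symmetric])
 hence "oper_of ` P \<subseteq> span (oper_of ` S)" using image_mono[OF S(2), of oper_of] by simp
 thus ?thesis unfolding finite_dim_def using S(1) by blast
qed

context star_algebra
begin

lemma proj_onto_orbp: "orbit_proj (oper_of ` Q) v = oper_of (orbp Q v)"
proof -
 let ?V = "closure ((%x. x $ v) ` Q)"
 have V: "closure ((%T. blinfun_apply T v) ` oper_of ` Q) = ?V" by (simp add: image_image appl_def)
 have ran: "range (appl (orbp Q v)) = ?V"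
 proof (intro equalityI subsetI)
  show "w \<in> range (appl (orbp Q v))" if "w \<in> ?V" for w using orbp(3)[OF that] by (metis rangeI)
 qed (use orbp(2) in blast)
 show ?thesis unfolding orbit_proj_def proj_onto_def V
 proof (rule the_equality)
  show "oper_of (orbp Q v) \<in> bounded_ops & oper_of (orbp Q v) o\<^sub>L oper_of (orbp Q v) = oper_of (orbp Q v) \<and>
   adj (oper_of (orbp Q v)) = oper_of (orbp Q v) & range (blinfun_apply (oper_of (orbp Q v))) = ?V"
   using orbp(1)[of v] oper_of ran by (simp add: isproj_def appl_def[abs_def] flip: oper_of_mult oper_of_star)
  fix P assume P: "P \<in> bounded_ops & P o\<^sub>L P = P & adj P = P & range (blinfun_apply P) = ?V"
  then obtain p where p: "P = oper_of p" using Cop_inverse by metis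
  have "isproj p" using P by (simp add: p isproj_def oper_of_inject flip: oper_of_mult oper_of_star)
  moreover have "range (appl p) = range (appl (orbp Q v))" using P ran by (simp add: p appl_def[abs_def])
  ultimately have "p = orbp Q v" by (intro isproj_eqI orbp(1))
  thus "P = oper_of (orbp Q v)" by (simp add: p)
 qed
qed

end

lemma (in finite_algebra) directed_op_lub_sequence:
 assumes "directed_positive (oper_of ` Q) D" "is_op_lub (oper_of ` Q) D X"
 obtains x d f where "x \<in> Q" "X = oper_of x" "D = oper_of ` d" "d \<subseteq> Q" "\<forall>a\<in>d. a <= x"
  "\<forall>n. f n \<in> d" "incseq f" "slim f x"
proof -
 obtain x where x: "x \<in> Q" "X = oper_of x" using assms(2) by (auto simp: is_op_lub_def)
 have "D \<subseteq> oper_of ` Q" using assms by (simp add: directed_positive_def)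
 then obtain d where d: "D = oper_of ` d" "d \<subseteq> Q" by (auto simp: subset_image_iff)
 have dx: "a <= x" if "a \<in> d" for a using assms that unfolding is_op_lub_def d x(2) by (auto simp: op_le_iff)
 have "\<exists>f. (\<forall>n. f n \<in> d) & incseq f & slim f x"
 proof (rule directed_lub_sequence)
  show "d ~= {}" "d \<subseteq> Q" using assms d by (auto simp: directed_positive_def)
  show "\<exists>c\<in>d. a <= c & b <= c" if "a \<in> d" "b \<in> d" for a b
   using assms that unfolding directed_positive_def d by (auto simp: op_le_iff)
  show "x <= y" if "y \<in> Q" "!!a. a \<in> d ==> a <= y" for y
   using assms that unfolding is_op_lub_def d x(2) by (auto simp: op_le_iff)
 qed (use x(1) dx in auto)
 thus ?thesis using that[OF x d] dx by blast
qed

section \<open>Complex-valued traces\<close>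

text \<open>A complex-linear functional is determined by its real part: the imaginary part at
  \<open>x\<close> is the real part at -i x.\<close>

definition complex_trace :: "('h::complex_hilbert_space cop => real) => 'h cop => complex" where
 "complex_trace t x = Complex (t x) (t (cscale (- \<i>) x))"

context traced_algebra
begin

lemma tr_cscale: "x \<in> Q ==> t (cscale c x) = Re c * t x - Im c * t (cscale (- \<i>) x)"
proof -
 assume x: "x \<in> Q"
 have "c = of_real (Re c) + of_real (- Im c) * (- \<i>)" by (simp add: complex_eq_iff)
 hence "cscale c x = Re c *\<^sub>R x + (- Im c) *\<^sub>R cscale (- \<i>) x"
  by (metis cscale_add(2) cscale_cscale cscale_of_real)
 hence "t (cscale c x) = t (Re c *\<^sub>R x) + t ((- Im c) *\<^sub>R cscale (- \<i>) x)"
  by (simp only: tr_add[OF scaleR[OF x] scaleR[OF cscale[OF x]]])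
 thus ?thesis by (simp only: tr_scaleR x cscale)
qed

lemma complex_trace_add: "x \<in> Q ==> y \<in> Q ==> complex_trace t (x + y) = complex_trace t x + complex_trace t y"
 by (simp add: complex_trace_def cscale_add tr_add cscale complex_eq_iff)

lemma complex_trace_cscale: "x \<in> Q ==> complex_trace t (cscale c x) = c * complex_trace t x"
 using tr_cscale[of x c] tr_cscale[of x "- \<i> * c"] by (simp add: complex_trace_def cscale_cscale complex_eq_iff)

lemma complex_trace_comm: "x \<in> Q ==> y \<in> Q ==> complex_trace t (x * y) = complex_trace t (y * x)"
 using tr_comm[of x y] tr_comm[of "cscale (- \<i>) x" y] by (simp add: complex_trace_def cscale cscale_mult)

lemma tr_imaginary: assumes "x \<in> Q" "star x = x" shows "t (cscale (- \<i>) x) = 0"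
proof -
 have "t (cscale \<i> x) = - t (cscale (- \<i>) x)" using tr_cscale[OF assms(1), of \<i>] by simp
 moreover have "t (cscale \<i> x) = t (cscale (- \<i>) x)"
  using tr_star[OF cscale[OF assms(1)], of "- \<i>"] by (simp add: star_cscale assms(2))
 ultimately show ?thesis by simp
qed

lemma complex_trace_pos: "x \<in> Q ==> 0 <= x ==> complex_trace t x \<in> \<real>\<^sub>\<ge>\<^sub>0"
 using tr_imaginary[of x] tr_pos[of x] by (simp add: complex_trace_def complex_nonneg_Reals_iff pos_self_adjoint)

end

lemma (in finite_algebra) normal_faithful_tracial_stateI:
 assumes t1: "t 1 = 1" and \<tau>: "!!x. x \<in> Q ==> \<tau> (oper_of x) = complex_trace t x"
 shows "normal_faithful_tracial_state (oper_of ` Q) \<tau>"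
 unfolding normal_faithful_tracial_state_def state_on_def
proof (intro conjI ballI allI impI)
 fix X Y assume "X \<in> oper_of ` Q" "Y \<in> oper_of ` Q"
 then obtain x y where xy: "x \<in> Q" "X = oper_of x" "y \<in> Q" "Y = oper_of y" by blast
 show "\<tau> (X + Y) = \<tau> X + \<tau> Y" by (simp add: xy \<tau> add complex_trace_add flip: oper_of_add)
 show "\<tau> (X o\<^sub>L Y) = \<tau> (Y o\<^sub>L X)" using complex_trace_comm[OF xy(1,3)] by (simp add: xy \<tau> mult flip: oper_of_mult)
next
 fix X assume "X \<in> oper_of ` Q"
 then obtain x where x: "x \<in> Q" "X = oper_of x" by blast
 show "\<tau> (scale_op c X) = c * \<tau> X" for c by (simp add: x \<tau> cscale complex_trace_cscale flip: oper_of_cscale)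
 show "\<tau> X \<in> \<real>\<^sub>\<ge>\<^sub>0" if "positive_op X" using that x by (simp add: \<tau> complex_trace_pos positive_op_iff)
 show "X = 0" if z: "\<tau> (adj X o\<^sub>L X) = 0"
 proof -
  have "complex_trace t (star x * x) = 0" using z x by (simp add: \<tau> mult star flip: oper_of_mult oper_of_star)
  hence "t (star x * x) = 0" by (simp add: complex_trace_def complex_eq_iff)
  thus ?thesis using faithful_star[OF x(1)] x(2) by (simp add: oper_of_zero)
 qed
next
 show "\<tau> id_blinfun = 1" using tr_imaginary[OF one] by (simp add: \<tau> one complex_trace_def t1 one_complex.ctr flip: oper_of_one)
next
 show "normal_functional (oper_of ` Q) \<tau>"
  unfolding normal_functional_def
 proof (intro allI impI)
  fix D X assume D: "directed_positive (oper_of ` Q) D & is_op_lub (oper_of ` Q) D X"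
  obtain x d f where x: "x \<in> Q" "X = oper_of x" and d: "D = oper_of ` d" "d \<subseteq> Q"
   and df: "\<forall>a\<in>d. a <= x" "\<forall>n. f n \<in> d" "incseq f" "slim f x"
   by (rule directed_op_lub_sequence[OF D[THEN conjunct1] D[THEN conjunct2]])
  note dx = df(1)[rule_format] and f = df(2)[rule_format] df(3,4)
  have re: "Re (\<tau> (oper_of a)) = t a" if "a \<in> Q" for a using that by (simp add: \<tau> complex_trace_def)
  have le: "t a <= t x" if "a \<in> d" for a using that d(2) by (intro tr_mono dx x(1)) auto
  have "(SUP D\<in>D. Re (\<tau> D)) = (SUP a\<in>d. t a)" unfolding d(1) image_image by (rule SUP_cong) (use re d(2) in auto)
  also have "... = t x"
  proof (rule antisym)
   show "(SUP a\<in>d. t a) <= t x" by (rule cSUP_least) (use f(1) le in auto)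
   have "(%n. t (f n)) ----> t x" by (rule tr_lim[OF _ f(2,3)]) (use f(1) d(2) in blast)
   moreover have "t (f n) <= (SUP a\<in>d. t a)" for n by (rule cSUP_upper[OF f(1) bdd_aboveI2[OF le]])
   ultimately show "t x <= (SUP a\<in>d. t a)" by (intro LIMSEQ_le_const2) auto
  qed
  finally show "Re (\<tau> X) = (SUP D\<in>D. Re (\<tau> D))" by (simp add: re x)
 qed
qed

lemma normal_faithful_tracial_stateD:
 assumes P: "vn_algebra P" and \<tau>: "normal_faithful_tracial_state (oper_of ` P) \<tau>"
 defines "t \<equiv> %x. Re (\<tau> (oper_of x))"
 shows "finite_algebra P t" "t 1 = 1" "!!x. x \<in> P ==> \<tau> (oper_of x) = complex_trace t x"
proof -
 interpret P: vn_algebra P by (rule P)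
 note T = \<tau>[unfolded normal_faithful_tracial_state_def state_on_def]
 have tadd: "\<tau> (oper_of (x + y)) = \<tau> (oper_of x) + \<tau> (oper_of y)" if "x \<in> P" "y \<in> P" for x y
  using T that by (simp add: oper_of_add)
 have tcs: "\<tau> (oper_of (cscale c x)) = c * \<tau> (oper_of x)" if "x \<in> P" for x c using T that by (simp add: oper_of_cscale)
 have tpos: "\<tau> (oper_of x) \<in> \<real>\<^sub>\<ge>\<^sub>0" if "x \<in> P" "0 <= x" for x using T that by (simp add: positive_op_iff)
 show t1: "t 1 = 1" using T by (simp add: t_def oper_of_one)
 show ct: "\<tau> (oper_of x) = complex_trace t x" if "x \<in> P" for x
  using tcs[OF that, of "- \<i>"] by (simp add: complex_trace_def t_def complex_eq_iff)
 have real: "Im (\<tau> (oper_of x)) = 0" if x: "x \<in> P" "star x = x" for x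
 proof -
  have "x <= nrm x *\<^sub>R 1" using self_adjoint_le_nrm[OF x(2)] by blast
  hence "\<tau> (oper_of (nrm x *\<^sub>R 1 - x)) \<in> \<real>\<^sub>\<ge>\<^sub>0" by (intro tpos P.diff P.scaleR P.one x) simp
  moreover have "\<tau> (oper_of (nrm x *\<^sub>R 1)) \<in> \<real>\<^sub>\<ge>\<^sub>0" by (intro tpos P.scaleR P.one scaleR_nonneg_nonneg) simp_all
  moreover have "\<tau> (oper_of (nrm x *\<^sub>R 1)) = \<tau> (oper_of (nrm x *\<^sub>R 1 - x)) + \<tau> (oper_of x)"
   using tadd[OF P.diff[OF P.scaleR[OF P.one] x(1)] x(1)] by simp
  ultimately show ?thesis by (simp add: complex_nonneg_Reals_iff)
 qed
 have "rtrace P t" unfolding rtrace_def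
 proof (intro conjI ballI allI impI)
  fix x y assume xy: "x \<in> P" "y \<in> P"
  show "t (x + y) = t x + t y" by (simp add: t_def tadd xy)
  show "t (x * y) = t (y * x)" using T xy by (simp add: t_def oper_of_mult)
 next
  fix x r assume x: "x \<in> P"
  show "t (r *\<^sub>R x) = r * t x" using tcs[OF x, of "of_real r"] by (simp add: t_def cscale_of_real)
 next
  fix x assume "x \<in> P" "0 <= x"
  thus "0 <= t x" using tpos[of x] by (simp add: t_def complex_nonneg_Reals_iff)
 next
  fix x assume x: "x \<in> P"
  obtain a b where ab: "star a = a" "star b = b" "x = a + cscale \<i> b"
   "a = (1/2) *\<^sub>R (x + star x)" "b = (1/2) *\<^sub>R cscale (- \<i>) (x - star x)" by (rule complex_decomposition)
  have abP: "a \<in> P" "b \<in> P" unfolding ab(4,5) by (intro P.scaleR P.add P.diff P.cscale P.star x)+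
  have sx: "star x = a + cscale (- \<i>) b" by (simp add: ab(3) star_simps ab(1,2))
  show "t (star x) = t x" unfolding sx unfolding ab(3) t_def
   using real[OF abP(2) ab(2)] by (simp add: tadd tcs abP P.cscale)
 next
  fix f x assume f: "(\<forall>n. f n \<in> P) & incseq f & slim f x"
  have xP: "x \<in> P" by (rule P.slim_closed[of f]) (use f in auto)
  have fx: "f n <= x" for n
   by (rule slim_le[OF slim_const slim_ignore[of f x n]]) (use f in \<open>auto simp: incseqD\<close>)
  \<comment> \<open>Normality is stated for directed sets of positive operators, so the sequence is
    shifted by its first term.\<close>
  define D where "D = range (%n. oper_of (f n - f 0))"
  have "directed_positive (oper_of ` P) D"
   unfolding directed_positive_def
  proof (intro conjI ballI)
   show "D ~= {}" by (simp add: D_def)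
   show "D \<subseteq> oper_of ` P" using f by (auto simp: D_def intro: P.diff)
   show "positive_op d" if "d \<in> D" for d using that f by (auto simp: D_def positive_op_iff incseqD)
   fix a b assume "a \<in> D" "b \<in> D"
   then obtain m n where mn: "a = oper_of (f m - f 0)" "b = oper_of (f n - f 0)" by (auto simp: D_def)
   show "\<exists>c\<in>D. op_le a c & op_le b c"
    by (rule bexI[of _ "oper_of (f (max m n) - f 0)"]) (use f in \<open>auto simp: mn op_le_iff D_def incseqD\<close>)
  qed
  moreover have "is_op_lub (oper_of ` P) D (oper_of (x - f 0))"
   unfolding is_op_lub_def
  proof (intro conjI ballI impI)
   show "oper_of (x - f 0) \<in> oper_of ` P" using f xP by (simp add: P.diff)
   show "op_le d (oper_of (x - f 0))" if "d \<in> D" for d using that fx by (auto simp: D_def op_le_iff)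
   fix Y assume Y: "Y \<in> oper_of ` P" "\<forall>d\<in>D. op_le d Y"
   then obtain y where y: "Y = oper_of y" by blast
   have le: "f n - f 0 <= y" for n using Y(2) by (auto simp: D_def y op_le_iff)
   have "slim f x" using f by blast
   from slim_le[OF slim_diff[OF this slim_const] slim_const le] have "x - f 0 <= y" .
   thus "op_le (oper_of (x - f 0)) Y" by (simp add: y op_le_iff)
  qed
  ultimately have "t (x - f 0) = (SUP d\<in>D. Re (\<tau> d))" using T by (auto simp: normal_functional_def t_def)
  also have "... = (SUP n. t (f n - f 0))" unfolding D_def image_image t_def ..
  finally have sup: "t (x - f 0) = (SUP n. t (f n - f 0))" .
  have tle: "t a <= t b" if ab: "a \<in> P" "b \<in> P" "a <= b" for a b
   using tpos[OF P.diff[OF ab(2,1)]] tadd[OF P.diff[OF ab(2,1)] ab(1)] ab(3) by (simp add: t_def complex_nonneg_Reals_iff)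
  have tfx: "t (f n - f 0) <= t (x - f 0)" "t (f n - f 0) <= t (f (Suc n) - f 0)" for n
   by (rule tle; use f xP fx in \<open>simp add: P.diff incseq_SucD\<close>)+
  have "(%n. t (f n - f 0)) ----> (SUP n. t (f n - f 0))"
  proof (rule LIMSEQ_incseq_SUP)
   show "bdd_above (range (%n. t (f n - f 0)))" by (rule bdd_aboveI2[OF tfx(1)])
   show "incseq (%n. t (f n - f 0))" by (rule incseq_SucI) (rule tfx(2))
  qed
  hence "(%n. t (f n - f 0) + t (f 0)) ----> t (x - f 0) + t (f 0)" unfolding sup[symmetric] by (intro tendsto_add tendsto_const)
  moreover have "t (y - f 0) + t (f 0) = t y" if "y \<in> P" for y
   using tadd[of "y - f 0" "f 0"] that f by (simp add: t_def P.diff)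
  ultimately show "(%n. t (f n)) ----> t x" using f xP by simp
 qed
 then interpret traced_algebra P t by (intro traced_algebra.intro P traced_algebra_axioms.intro)
 show "finite_algebra P t"
 proof
  fix x assume x: "x \<in> P" "0 <= x" "t x = 0"
  define s where "s = psqrt x"
  have sP: "s \<in> P" unfolding s_def by (rule P.psqrt_mem[OF x(1,2)])
  have s: "star s = s" "s * s = x" unfolding s_def using psqrt(1,2)[OF x(2)] pos_self_adjoint by auto
  have "\<tau> (oper_of x) = 0" using tpos[OF x(1,2)] x(3) by (simp add: t_def complex_nonneg_Reals_iff complex_eq_iff)
  hence "\<tau> (adj (oper_of s) o\<^sub>L oper_of s) = 0" by (simp add: s flip: oper_of_star oper_of_mult)
  hence "oper_of s = 0" using T sP by blast
  hence "s = 0" by (simp add: oper_of_inject flip: oper_of_zero)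
  thus "x = 0" using s(2) by simp
 qed
qed

text \<open>\<open>trace_of\<close> is a definite description; \<open>trace_unique\<close>, applied
  to the real part of a competitor, supplies the uniqueness.\<close>

lemma (in finite_factor) trace_of_eq:
 assumes t1: "t 1 = 1" and x: "x \<in> Q" shows "trace_of (oper_of ` Q) (oper_of x) = complex_trace t x"
proof -
 define \<tau> where "\<tau> X = (if X \<in> oper_of ` Q then complex_trace t (Cop X) else 0)" for X
 have \<tau>: "\<tau> (oper_of x) = complex_trace t x" if "x \<in> Q" for x using that by (simp add: \<tau>_def oper_of_inverse)
 have "trace_of (oper_of ` Q) = \<tau>" unfolding trace_of_def
 proof (rule the_equality)
  show "normal_faithful_tracial_state (oper_of ` Q) \<tau> & (\<forall>x. x \<notin> oper_of ` Q --> \<tau> x = 0)"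
   using normal_faithful_tracial_stateI[of \<tau>, OF t1 \<tau>] \<tau>_def by auto
  fix \<sigma> assume \<sigma>: "normal_faithful_tracial_state (oper_of ` Q) \<sigma> & (\<forall>x. x \<notin> oper_of ` Q --> \<sigma> x = 0)"
  define s where "s x = Re (\<sigma> (oper_of x))" for x
  have s: "finite_algebra Q s" "s 1 = 1" "!!x. x \<in> Q ==> \<sigma> (oper_of x) = complex_trace s x"
   unfolding s_def[abs_def] using normal_faithful_tracial_stateD[OF vn_algebra_axioms] \<sigma> by blast+
  have rs: "rtrace Q s" using s(1) by (simp add: finite_algebra_def traced_algebra_def traced_algebra_axioms_def)
  hence "s x = t x" if "x \<in> Q" for x using trace_unique[OF rs that] s(2) t1 by simp
  hence "\<sigma> (oper_of x) = \<tau> (oper_of x)" if "x \<in> Q" for x using that by (simp add: s(3) \<tau> complex_trace_def cscale)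
  hence "\<sigma> X = \<tau> X" for X using \<sigma> by (cases "X \<in> oper_of ` Q") (auto simp: \<tau>_def)
  thus "\<sigma> = \<tau>" by blast
 qed
 thus ?thesis using \<tau>[OF x] by simp
qed

section \<open>Conditional expectations\<close>

text \<open>Faithfulness makes the identity \<open>Ft\<close> characterise \<open>F x\<close> inside
  \<open>P\<close>, and linearity, the bimodule property and normality follow. Any other conditional
  expectation satisfies the same identity, because it preserves the trace and commutes with
  multiplication by \<open>P\<close>.\<close>

lemma (in finite_factor) cond_exp_eq:
 assumes t1: "t 1 = 1" and P: "star_algebra P" "P \<subseteq> Q"
  and F: "!!x. x \<in> Q ==> F x \<in> P" "!!x. x \<in> Q ==> 0 <= x ==> 0 <= F x"
  and Ft: "!!x b. x \<in> Q ==> b \<in> P ==> t (F x * b) = t (x * b)"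
  and x: "x \<in> Q"
 shows "cond_exp (oper_of ` Q) (oper_of ` P) (oper_of x) = oper_of (F x)"
proof -
 interpret P: star_algebra P by (rule P(1))
 have PQ: "x \<in> Q" if "x \<in> P" for x using that P(2) by blast
 have FQ: "F x \<in> Q" if "x \<in> Q" for x by (rule PQ[OF F(1)[OF that]])
 have eqI: "F x = a" if x: "x \<in> Q" and a: "a \<in> P" "!!b. b \<in> P ==> t (x * b) = t (a * b)" for x a
 proof -
  define d where "d = F x - a"
  have dP: "d \<in> P" unfolding d_def by (intro P.diff F x a)
  have "t (d * star d) = t (F x * star d) - t (a * star d)"
   unfolding d_def left_diff_distrib by (rule tr_diff) (intro mult PQ F x a P.star P.diff)+
  hence "t (star (star d) * star d) = 0" using Ft[OF x P.star[OF dP]] a(2)[OF P.star[OF dP]] by simp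
  hence "star d = 0" by (rule faithful_star[OF PQ[OF P.star[OF dP]]])
  hence "d = 0" using star_inj[of d 0] by simp
  thus ?thesis by (simp add: d_def)
 qed
 have Fadd: "F (x + y) = F x + F y" if "x \<in> Q" "y \<in> Q" for x y
  by (rule eqI) (use that in \<open>auto simp: distrib_right tr_add mult PQ FQ Ft intro: add P.add F\<close>)
 have Fcs: "F (cscale c x) = cscale c (F x)" if x: "x \<in> Q" for x c
 proof (rule eqI)
  fix b assume b: "b \<in> P"
  have "t (cscale c (x * b)) = t (cscale c (F x * b))"
   using Ft[OF x b] Ft[OF x P.cscale[OF b, of "- \<i>"]] by (subst (1 2) tr_cscale) (simp_all add: mult x PQ b FQ cscale_mult)
  thus "t (cscale c x * b) = t (cscale c (F x) * b)" by (simp add: cscale_mult)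
 qed (use x in \<open>auto intro: cscale P.cscale F\<close>)
 have Fid: "F b = b" if "b \<in> P" for b by (rule eqI) (use that PQ in auto)
 have Fbimod: "F (b * x * c) = b * F x * c" if x: "x \<in> Q" and bc: "b \<in> P" "c \<in> P" for x b c
 proof (rule eqI)
  fix d assume d: "d \<in> P"
  have "t (b * x * c * d) = t (x * (c * d * b))"
   using tr_comm[of b "x * c * d"] by (simp add: mult PQ x bc d mult.assoc)
  also have "... = t (F x * (c * d * b))" by (rule Ft[symmetric]) (intro x P.mult bc d)+
  also have "... = t (b * F x * c * d)"
   using tr_comm[of b "F x * c * d"] by (simp add: mult PQ FQ x bc d mult.assoc)
  finally show "t (b * x * c * d) = t (b * F x * c * d)" .
 qed (use x bc in \<open>auto intro: mult P.mult F PQ\<close>)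
 have tF: "t (F x) = t x" if "x \<in> Q" for x using Ft[OF that P.one] by simp
 have trF: "complex_trace t (F x) = complex_trace t x" if x: "x \<in> Q" for x
  using tF[OF x] tF[OF cscale[OF x], of "- \<i>"] by (simp add: complex_trace_def Fcs x)
 define G where "G X = (if X \<in> oper_of ` Q then oper_of (F (Cop X)) else 0)" for X
 have G: "G (oper_of x) = oper_of (F x)" if "x \<in> Q" for x using that by (simp add: G_def oper_of_inverse)
 have "is_cond_exp (oper_of ` Q) (oper_of ` P) G" unfolding is_cond_exp_def
 proof (intro conjI ballI allI impI)
  fix X Y assume "X \<in> oper_of ` Q" "Y \<in> oper_of ` Q"
  then obtain x y where xy: "x \<in> Q" "X = oper_of x" "y \<in> Q" "Y = oper_of y" by blast
  show "G (X + Y) = G X + G Y" by (simp add: xy G add Fadd flip: oper_of_add)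
 next
  fix X assume "X \<in> oper_of ` Q"
  then obtain x where x: "x \<in> Q" "X = oper_of x" by blast
  show "G (scale_op c X) = scale_op c (G X)" for c by (simp add: x G cscale Fcs flip: oper_of_cscale)
  show "positive_op (G X)" if "positive_op X" using that x by (simp add: G F positive_op_iff)
  show "X = 0" if "G (adj X o\<^sub>L X) = 0"
  proof -
   have "oper_of (F (star x * x)) = oper_of 0" using that x by (simp add: G mult star oper_of_zero flip: oper_of_mult oper_of_star)
   hence "F (star x * x) = 0" by (simp only: oper_of_inject)
   hence "t (star x * x) = 0" using tF[of "star x * x"] x by (simp add: mult star tr_zero)
   thus ?thesis using faithful_star[OF x(1)] x(2) by (simp add: oper_of_zero)
  qed
  show "trace_of (oper_of ` Q) (G X) = trace_of (oper_of ` Q) X" by (simp add: x G trace_of_eq t1 FQ trF)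
  fix B C assume "B \<in> oper_of ` P" "C \<in> oper_of ` P"
  then obtain b c where bc: "b \<in> P" "B = oper_of b" "c \<in> P" "C = oper_of c" by blast
  show "G (B o\<^sub>L X o\<^sub>L C) = B o\<^sub>L G X o\<^sub>L C"
   by (simp add: x bc G mult PQ Fbimod flip: oper_of_mult)
 next
  show "G ` oper_of ` Q \<subseteq> oper_of ` P" by (auto simp: G F)
  show "G B = B" if "B \<in> oper_of ` P" for B using that by (auto simp: G PQ Fid)
 next
  fix D X assume D: "directed_positive (oper_of ` Q) D & is_op_lub (oper_of ` Q) D X"
  obtain x d f where x: "x \<in> Q" "X = oper_of x" and d: "D = oper_of ` d" "d \<subseteq> Q"
   and df: "\<forall>a\<in>d. a <= x" "\<forall>n. f n \<in> d" "incseq f" "slim f x"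
   by (rule directed_op_lub_sequence[OF D[THEN conjunct1] D[THEN conjunct2]])
  note dx = df(1)[rule_format] and f = df(2)[rule_format] df(3,4)
  have Fdiff: "F (y - z) = F y - F z" if "y \<in> Q" "z \<in> Q" for y z
   using Fadd[OF diff[OF that] that(2)] by simp
  have Fmono: "F y <= F z" if "y \<in> Q" "z \<in> Q" "y <= z" for y z
   using F(2)[OF diff[OF that(2,1)]] that by (simp add: Fdiff)
  have fQ: "f n \<in> Q" for n using f(1) d(2) by blast
  have incF: "incseq (%n. F (f n))" by (rule incseq_SucI) (use f(2) in \<open>simp add: Fmono fQ incseq_SucD\<close>)
  have bF: "F (f n) <= F x" for n by (rule Fmono) (simp_all add: fQ x dx f)
  obtain z where z: "slim (%n. F (f n)) z" "z <= F x" using increasing_slim_exists[OF incF bF] by blast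
  have zQ: "z \<in> Q" by (rule slim_closed[OF _ z(1)]) (intro FQ fQ)
  have l1: "(%n. t (f n)) ----> t z" using tr_lim[OF _ incF z(1)] by (simp add: FQ fQ tF)
  have l2: "(%n. t (f n)) ----> t x" by (rule tr_lim[OF fQ f(2,3)])
  have "t (F x - z) = 0" using LIMSEQ_unique[OF l1 l2] by (simp add: tr_diff FQ x zQ tF)
  hence "F x - z = 0" using z(2) by (intro faithful diff FQ x zQ) simp_all
  hence Fx: "slim (%n. F (f n)) (F x)" using z(1) by simp
  show "is_op_lub (oper_of ` Q) (G ` D) (G X)" unfolding is_op_lub_def
  proof (intro conjI ballI impI)
   show "G X \<in> oper_of ` Q" by (simp add: x G FQ)
   show "op_le E (G X)" if "E \<in> G ` D" for E using that d(2) by (auto simp: d(1) x G op_le_iff subset_iff intro!: Fmono dx)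
   fix Y assume Y: "Y \<in> oper_of ` Q" "\<forall>E\<in>G ` D. op_le E Y"
   then obtain y where y: "Y = oper_of y" by blast
   have "F (f n) <= y" for n using Y(2) f(1)[of n] by (auto simp: d(1) y G fQ op_le_iff)
   from slim_le[OF Fx slim_const this] show "op_le (G X) Y" by (simp add: x G y op_le_iff)
  qed
 qed
 moreover have "H = G" if H: "is_cond_exp (oper_of ` Q) (oper_of ` P) H & (\<forall>X. X \<notin> oper_of ` Q --> H X = 0)" for H
 proof
  fix X
  note h = H[unfolded is_cond_exp_def]
  show "H X = G X"
  proof (cases "X \<in> oper_of ` Q")
   case True
   then obtain x where x: "x \<in> Q" "X = oper_of x" by blast
   have "H X \<in> oper_of ` P" using h True by blast
   then obtain a where a: "a \<in> P" "H X = oper_of a" by blast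
   have "F x = a"
   proof (rule eqI[OF x(1) a(1)])
    fix b assume b: "b \<in> P"
    have "\<forall>X\<in>oper_of ` Q. \<forall>B\<in>oper_of ` P. \<forall>C\<in>oper_of ` P. H (B o\<^sub>L X o\<^sub>L C) = B o\<^sub>L H X o\<^sub>L C" using h by blast
    from this[rule_format, OF True imageI[OF P.one] imageI[OF b]]
    have "H (oper_of (x * b)) = oper_of (a * b)" by (simp add: x(2) a(2)[unfolded x(2)] flip: oper_of_mult)
    moreover have "trace_of (oper_of ` Q) (H (oper_of (x * b))) = trace_of (oper_of ` Q) (oper_of (x * b))"
     using h x b by (simp add: mult PQ)
    ultimately have "complex_trace t (a * b) = complex_trace t (x * b)" by (simp add: trace_of_eq t1 mult PQ x a b)
    thus "t (x * b) = t (a * b)" by (simp add: complex_trace_def)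
   qed
   thus ?thesis using x a by (simp add: G)
  qed (use H in \<open>simp add: G_def\<close>)
 qed
 moreover have "\<forall>X. X \<notin> oper_of ` Q --> G X = 0" by (simp add: G_def)
 ultimately have "cond_exp (oper_of ` Q) (oper_of ` P) = G" unfolding cond_exp_def by (intro the_equality) blast+
 thus ?thesis using G[OF x] by simp
qed


section \<open>Distances between conjugate subalgebras\<close>

lemma isometry_norm: "star u * u = 1 ==> norm (u $ v) = norm v" for u :: "'h::complex_hilbert_space cop"
 using qf_simps(7)[of u v] by (simp add: qf_simps power2_eq_iff_nonneg)

text \<open>\<open>e - f\<close> is the difference of (1 - f) e and f (1 - e), whose values are
  orthogonal and which start from orthogonal parts of \<open>v\<close>. The second is the adjoint of
  (1 - e) f, so both are controlled by the hypotheses.\<close>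

lemma two_projections:
 assumes e: "isproj e" and f: "isproj f" and g: "0 <= g"
  and ef: "!!v. (norm (e $ v))\<^sup>2 - (norm (f $ e $ v))\<^sup>2 <= g * (norm (e $ v))\<^sup>2"
  and fe: "!!v. (norm (f $ v))\<^sup>2 - (norm (e $ f $ v))\<^sup>2 <= g * (norm (f $ v))\<^sup>2"
 shows "(norm (e $ v - f $ v))\<^sup>2 <= g * (norm v)\<^sup>2"
proof -
 have pyth: "(norm (p $ w))\<^sup>2 + (norm (w - p $ w))\<^sup>2 = (norm w)\<^sup>2" and orth: "Re (cinner (w - p $ w) (p $ z)) = 0"
  if p: "isproj p" for p :: "'a cop" and w z
 proof -
  have o: "cinner (w - p $ w) (p $ z) = 0" for z
  proof -
   have "cinner (w - p $ w) (p $ z) = cinner (star p $ (w - p $ w)) z" by (rule cinner_star'[symmetric])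
   also have "star p $ (w - p $ w) = 0" using p isproj_appl[OF p] by (simp add: isproj_def)
   finally show ?thesis by simp
  qed
  thus "Re (cinner (w - p $ w) (p $ z)) = 0" by simp
  show "(norm (p $ w))\<^sup>2 + (norm (w - p $ w))\<^sup>2 = (norm w)\<^sup>2"
   using norm_add_sq[of "w - p $ w" "p $ w"] o[of w] by simp
 qed
 define x where "x = e $ v"
 define y where "y = v - e $ v"
 define z where "z = f $ y"
 have ex: "e $ x = x" unfolding x_def by (rule isproj_appl[OF e])
 have ey: "e $ y = 0" by (simp add: y_def isproj_appl[OF e])
 have fz: "f $ z = z" unfolding z_def by (rule isproj_appl[OF f])
 have "e $ v - f $ v = (x - f $ x) - f $ y" by (simp add: x_def y_def)
 hence "(norm (e $ v - f $ v))\<^sup>2 = (norm (x - f $ x))\<^sup>2 + (norm z)\<^sup>2"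
  using orth[OF f, of x y] by (simp add: norm_diff_sq[of "x - f $ x"] z_def)
 moreover have "(norm (x - f $ x))\<^sup>2 <= g * (norm x)\<^sup>2" using ef[of v] pyth[OF f, of x] by (simp add: x_def)
 moreover have "(norm z)\<^sup>2 <= g * (norm y)\<^sup>2"
 proof -
  have "(norm z)\<^sup>2 = Re (cinner z y)" using isproj_norm[OF f, of y] by (simp add: z_def qf_def)
  also have "... = Re (cinner (z - e $ z) y)"
   using e ey cinner_star[of e z y] by (simp add: cinner_diff_left isproj_def)
  also have "... <= norm (z - e $ z) * norm y" using Re_cinner_le[of "z - e $ z" y] by simp
  finally have 1: "(norm z)\<^sup>2 <= norm (z - e $ z) * norm y" .
  have 2: "(norm (z - e $ z))\<^sup>2 <= g * (norm z)\<^sup>2" using fe[of z] pyth[OF e, of z] by (simp add: fz)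
  have "(norm z)\<^sup>2 * (norm z)\<^sup>2 <= (norm (z - e $ z))\<^sup>2 * (norm y)\<^sup>2"
   using power_mono[OF 1, of 2] by (simp add: power2_eq_square mult_ac)
  also have "... <= g * (norm z)\<^sup>2 * (norm y)\<^sup>2" by (intro mult_right_mono 2) simp
  finally have 3: "(norm z)\<^sup>2 * (norm z)\<^sup>2 <= (norm z)\<^sup>2 * (g * (norm y)\<^sup>2)" by (simp only: mult_ac)
  show ?thesis
  proof (cases "z = 0")
   case False
   hence "0 < (norm z)\<^sup>2" by simp
   with 3 show ?thesis by (rule mult_left_le_imp_le)
  qed (simp add: g)
 qed
 moreover have "(norm v)\<^sup>2 = (norm x)\<^sup>2 + (norm y)\<^sup>2" using pyth[OF e, of v] by (simp add: x_def y_def)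
 ultimately show ?thesis by (simp add: distrib_left)
qed

context inclusion
begin

lemma E_pos: assumes x: "x \<in> M" "0 <= x" shows "0 <= E x"
proof (rule order_reflection[OF _ AM E_mem[OF x(1)]])
 show "vn_algebra A" ..
 show "star (E x) = E x" using E_star[OF x(1)] pos_self_adjoint[OF x(2)] by simp
 fix a assume a: "a \<in> A"
 have "qf (E x) (a $ Om) = Re (cinner (e $ (x * a) $ Om) (a $ Om))"
  using E_Om[OF mult[OF x(1) A_M[OF a]]] by (simp add: qf_def E_right a x)
 also have "... = qf x (a $ Om)" using cinner_star[of e "x $ a $ Om" "a $ Om"] by (simp add: qf_def e_star e_orbit a)
 finally show "0 <= qf (E x) (a $ Om)" using x(2) unfolding pos_iff[of x] by simp
qed

lemma norm_conj_Om:
 assumes u: "u \<in> M" "star u * u = 1" "u * star u = 1" and z: "z \<in> M"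
 shows "norm ((u * z * star u) $ Om) = norm (z $ Om)"
proof -
 have "norm ((u * z * star u) $ Om) = norm ((z * star u) $ Om)" using isometry_norm[OF u(2)] by (simp add: mult.assoc)
 also have "... = norm ((u * star z) $ Om)" using norm_star_Om[OF mult[OF z star[OF u(1)]]] by (simp add: star_mult)
 also have "... = norm (z $ Om)" using isometry_norm[OF u(2)] norm_star_Om[OF z] by simp
 finally show ?thesis .
qed

lemma E_norm_le: "x \<in> M ==> norm (E x $ Om) <= norm (x $ Om)"
 using norm_appl[of e "x $ Om"] mult_right_mono[OF isproj_nrm_le[OF e_proj], of "norm (x $ Om)"] by (simp add: E_Om)

lemma E_pythagoras: "x \<in> M ==> (norm ((x - E x) $ Om))\<^sup>2 = (norm (x $ Om))\<^sup>2 - (norm (E x $ Om))\<^sup>2"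
proof -
 assume x: "x \<in> M"
 have "Re (cinner (x $ Om) (e $ x $ Om)) = (norm (e $ x $ Om))\<^sup>2"
  using isproj_norm[OF e_proj, of "x $ Om"] by (simp add: qf_def cinner_commute_Re)
 thus ?thesis by (simp add: norm_diff_sq E_Om x)
qed

text \<open>The value at \<open>x\<close> of the difference of the expectations onto
  \<open>A\<close> and onto its conjugate by \<open>u\<close>; the second one is the first
  conjugated by \<open>u\<close>.\<close>

definition conjugate_difference :: "'k cop => 'k cop => 'k cop" where
 "conjugate_difference u x = E x - u * E (star u * x * u) * star u"

lemma conjugate_difference_le:
 assumes u: "u \<in> M" "star u * u = 1" "u * star u = 1" and x: "x \<in> M"
 shows "norm (conjugate_difference u x $ Om) <= 2 * norm (x $ Om)"
proof -
 have yM: "star u * x * u \<in> M" by (intro mult star u x)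
 have "norm ((u * E (star u * x * u) * star u) $ Om) <= norm ((star u * x * star (star u)) $ Om)"
  using norm_conj_Om[OF u A_M[OF E_mem[OF yM]]] E_norm_le[OF yM] by simp
 also have "... = norm (x $ Om)" by (rule norm_conj_Om) (simp_all add: star u x)
 finally show ?thesis
  using norm_triangle_ineq4[of "E x $ Om" "(u * E (star u * x * u) * star u) $ Om"] E_norm_le[OF x]
  by (simp add: conjugate_difference_def)
qed

end

context index_two_plus_sqrt2
begin

text \<open>It suffices to test with \<open>x = u * v * star u\<close>, \<open>v\<close> a unitary
  of \<open>A\<close>: the conjugate expectation fixes \<open>x\<close>, so the squared distance is
  1 minus that of \<open>E x\<close>. With lam / (1 - lam) = sqrt 2 - 1 the average bound leaves (1
  - t)(2 - sqrt 2 + sqrt 2 t).\<close>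

lemma conjugate_difference_lower:
 assumes u: "u \<in> M" "star u * u = 1" and s: "0 <= s"
  and le: "!!x. x \<in> M ==> star x * x = 1 ==> norm (conjugate_difference u x $ Om) <= s"
 shows "(2 - sqrt 2) * (norm ((u - E u) $ Om))\<^sup>2 <= s\<^sup>2"
proof -
 have uu: "u * star u = 1" by (rule FM.isometry_unitary[OF u])
 define t where "t = (norm (E u $ Om))\<^sup>2"
 have t: "0 <= t" "(norm ((u - E u) $ Om))\<^sup>2 = 1 - t"
  using E_pythagoras[OF u(1)] by (simp_all add: t_def isometry_norm u norm_Om)
 have "1 - s\<^sup>2 <= t\<^sup>2 + lam * (1 - t)\<^sup>2 / (1 - lam)" unfolding t_def
 proof (rule average_lower_bound[OF u])
  fix v assume v: "v \<in> A" "star v * v = 1" "v * star v = 1"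
  define x where "x = u * v * star u"
  have xM: "x \<in> M" unfolding x_def by (intro mult star u A_M v)
  have "star x * x = u * (star v * (star u * u) * v) * star u" by (simp only: x_def star_mult star_star mult.assoc)
  hence x1: "star x * x = 1" by (simp add: u v uu)
  have "star u * x * u = star u * u * v * (star u * u)" by (simp only: x_def mult.assoc)
  hence "conjugate_difference u x = - (x - E x)" by (simp add: conjugate_difference_def u E_id v) (simp add: x_def)
  hence "norm ((x - E x) $ Om) <= s" using le[OF xM x1] by (simp only: appl_cop_simps norm_minus_cancel)
  hence "(norm ((x - E x) $ Om))\<^sup>2 <= s\<^sup>2" by (rule power_mono) simp
  thus "1 - s\<^sup>2 <= (norm (E (u * v * star u) $ Om))\<^sup>2"
   unfolding E_pythagoras[OF xM] x_def[symmetric] by (simp add: isometry_norm[OF x1] norm_Om)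
 qed
 moreover have "lam * (1 - t)\<^sup>2 / (1 - lam) = (sqrt 2 - 1) * (1 - t)\<^sup>2"
 proof -
  have "lam = (sqrt 2 - 1) * (1 - lam)" by (simp add: lam_eq algebra_simps)
  hence "lam / (1 - lam) = sqrt 2 - 1" using lam_bounds by (simp add: field_simps)
  thus ?thesis by (metis times_divide_eq_left mult.commute)
 qed
 ultimately have "1 - t\<^sup>2 - (sqrt 2 - 1) * (1 - t)\<^sup>2 <= s\<^sup>2" by simp
 moreover have "1 - t\<^sup>2 - (sqrt 2 - 1) * (1 - t)\<^sup>2 = (2 - sqrt 2) * (1 - t) + sqrt 2 * t * (1 - t)"
  by (simp add: power2_eq_square algebra_simps)
 moreover have "0 <= sqrt 2 * t * (1 - t)"
  using t zero_le_power2[of "norm ((u - E u) $ Om)"] by simp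
 ultimately show ?thesis unfolding t(2) by simp
qed

text \<open>\<open>W = u * rho u\<close> implements conjugation by the symmetry \<open>u\<close>, so
  the conjugate expectation is the projection \<open>f = W * e * W\<close> on vectors. The gap of
  the symmetry bounds both defects of \<open>e\<close> and \<open>f\<close> by 1 - (sqrt 2 -
  1)^2.\<close>

lemma conjugate_difference_upper:
 "\<exists>u\<in>M. star u * u = 1 & u * star u = 1 & norm ((u - E u) $ Om) = 1 \<and>
  (\<forall>x\<in>M. nrm x <= 1 --> norm (conjugate_difference u x $ Om) <= sqrt (2 * (sqrt 2 - 1)))"
proof -
 obtain u where u: "u \<in> M" "star u = u" "u * u = 1" "E u = 0"
  and gap: "!!a. a \<in> A ==> (sqrt 2 - 1) * norm (a $ Om) <= norm (E (u * a * u) $ Om)" using symmetry_exists by blast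
 have ru: "star (rho u) = rho u" "rho u * rho u = 1" using u by (simp_all flip: rho_star rho_mult)
 have ruu: "rho u * u = u * rho u" by (rule rho_commutes) (rule u)+
 define W where "W = u * rho u"
 have sW: "star W = W" by (simp add: W_def star_mult ru u ruu)
 have "W * W = u * (rho u * u) * rho u" by (simp only: W_def mult.assoc)
 also have "... = u * u * (rho u * rho u)" by (simp only: ruu mult.assoc)
 finally have WW: "W * W = 1" by (simp add: u ru)
 have nW: "norm (W $ v) = norm v" for v by (rule isometry_norm) (simp add: sW WW)
 have WWv: "W $ W $ v = v" for v using arg_cong[OF WW, of "%s. s $ v"] by simp
 define f where "f = W * e * W"
 have f: "isproj f"
 proof -
  have "f * f = W * e * (W * W) * e * W" by (simp only: f_def mult.assoc)
  also have "... = W * (e * e) * W" by (simp add: WW mult.assoc)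
  finally show ?thesis by (simp add: isproj_def f_def star_mult sW e_star e_e mult.assoc)
 qed
 have W_orbit: "W $ x $ Om = (u * x * u) $ Om" if "x \<in> M" for x by (simp add: W_def rho_orbit u that)
 have gap': "(sqrt 2 - 1) * norm (e $ v) <= norm (e $ W $ e $ v)" for v
 proof -
  obtain a where a: "!!n. a n \<in> A" "(%n. a n $ Om) ----> e $ v" using e_approx by blast
  show ?thesis
  proof (rule LIMSEQ_le)
   show "(%n. (sqrt 2 - 1) * norm (a n $ Om)) ----> (sqrt 2 - 1) * norm (e $ v)" by (intro tendsto_intros a)
   show "(%n. norm (e $ W $ a n $ Om)) ----> norm (e $ W $ e $ v)" by (intro tendsto_norm tendsto_appl a)
   have "e $ W $ a n $ Om = E (u * a n * u) $ Om" for n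
    using E_Om[OF mult[OF mult[OF u(1) A_M[OF a(1)]] u(1)]] W_orbit[OF A_M[OF a(1)]] by simp
   thus "\<exists>N. \<forall>n\<ge>N. (sqrt 2 - 1) * norm (a n $ Om) <= norm (e $ W $ a n $ Om)" using gap[OF a(1)] by simp
  qed
 qed
 have \<alpha>: "1 - (sqrt 2 - 1)\<^sup>2 = 2 * (sqrt 2 - 1)" "0 <= sqrt 2 - 1" using sqrt2_bounds by (simp_all add: power2_eq_square algebra_simps)
 have sq: "r\<^sup>2 - s\<^sup>2 <= 2 * (sqrt 2 - 1) * r\<^sup>2" if rs: "(sqrt 2 - 1) * r <= s" "0 <= r" for r s :: real
 proof -
  have "(sqrt 2 - 1)\<^sup>2 * r\<^sup>2 <= s\<^sup>2"
   using power_mono[OF rs(1) mult_nonneg_nonneg[OF \<alpha>(2) rs(2)], of 2] by (simp only: power_mult_distrib)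
  thus ?thesis unfolding \<alpha>(1)[symmetric] by (simp add: left_diff_distrib)
 qed
 have main: "(norm (e $ v - f $ v))\<^sup>2 <= 2 * (sqrt 2 - 1) * (norm v)\<^sup>2" for v
 proof (rule two_projections[OF e_proj f])
  fix v
  show "(norm (e $ v))\<^sup>2 - (norm (f $ e $ v))\<^sup>2 <= 2 * (sqrt 2 - 1) * (norm (e $ v))\<^sup>2"
   by (rule sq) (use gap'[of v] in \<open>simp_all add: f_def nW\<close>)
  show "(norm (f $ v))\<^sup>2 - (norm (e $ f $ v))\<^sup>2 <= 2 * (sqrt 2 - 1) * (norm (f $ v))\<^sup>2"
   by (rule sq) (use gap'[of "W $ v"] in \<open>simp_all add: f_def nW\<close>)
 qed (use \<alpha> in simp)
 have "norm (conjugate_difference u x $ Om) <= sqrt (2 * (sqrt 2 - 1))" if x: "x \<in> M" "nrm x <= 1" for x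
 proof -
  have yM: "u * x * u \<in> M" by (intro mult u x)
  have "f $ x $ Om = W $ E (u * x * u) $ Om" using E_Om[OF yM] W_orbit[OF x(1)] by (simp add: f_def)
  also have "... = (u * E (u * x * u) * u) $ Om" by (rule W_orbit[OF A_M[OF E_mem[OF yM]]])
  finally have "conjugate_difference u x $ Om = e $ x $ Om - f $ x $ Om"
   by (simp add: conjugate_difference_def E_Om x u)
  hence "(norm (conjugate_difference u x $ Om))\<^sup>2 <= 2 * (sqrt 2 - 1) * (norm (x $ Om))\<^sup>2" using main by simp
  also have "... <= 2 * (sqrt 2 - 1) * 1"
  proof (rule mult_left_mono)
   have "norm (x $ Om) <= 1" using norm_appl[of x Om] x(2) by (simp add: norm_Om)
   thus "(norm (x $ Om))\<^sup>2 <= 1" by (simp add: power_le_one)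
  qed (use \<alpha> in simp)
  finally show ?thesis by (simp add: real_le_rsqrt)
 qed
 moreover have "norm ((u - E u) $ Om) = 1" using isometry_norm[of u Om] by (simp add: u norm_Om)
 ultimately show ?thesis using u by (intro bexI[of _ u]) auto
qed

end

section \<open>The index as a coupling constant\<close>

text \<open>A finite value of \<open>vn_dim\<close> provides the trace on the commutant. By
  \<open>coupling\<close> the quotient in its definition is \<open>1 / lam\<close> at every nonzero
  vector, and \<open>Om\<close> is one, so the definite description has this value.\<close>

lemma (in subfactor_inclusion) index_eq:
 assumes "vn_dim (oper_of ` A) = ereal d"
 shows "\<exists>tn. finite_index M A Om tn & tn e * d = 1"
proof -
 have "\<exists>\<tau>. normal_faithful_tracial_state (commutant (oper_of ` A)) \<tau>"
 proof (rule ccontr)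
  assume "\<not> ?thesis"
  hence "vn_dim (oper_of ` A) = \<infinity>" by (simp add: vn_dim_def)
  thus False using assms by simp
 qed
 then obtain \<tau> where \<tau>: "normal_faithful_tracial_state (commutant (oper_of ` A)) \<tau>" by blast
 define tn where "tn x = Re (\<tau> (oper_of x))" for x
 have tn: "finite_algebra (comm A) tn" "tn 1 = 1"
  unfolding tn_def[abs_def] using normal_faithful_tracial_stateD(1,2)[OF N.vn_algebra_axioms \<tau>[unfolded commutant_image]] by simp_all
 interpret FI: finite_index M A Om tn
  by (intro finite_index.intro subfactor_inclusion_axioms finite_factor.intro tn(1) AF.comm_factor finite_index_axioms.intro tn(2))
 have tr: "Re (trace_of (oper_of ` A) (orbit_proj (commutant (oper_of ` A)) w)) = tau (orbp (comm A) w)"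
  "Re (trace_of (commutant (oper_of ` A)) (orbit_proj (oper_of ` A) w)) = tn (orbp A w)" for w
  using FA.trace_of_eq[OF tau_one, of "orbp (comm A) w"] FI.FN.trace_of_eq[OF tn(2) A.orbp_comm[of w]] N.orbp_comm[of w]
  by (simp_all add: commutant_image N.proj_onto_orbp A.proj_onto_orbp complex_trace_def A.bicomm)
 have ratio: "tau (orbp (comm A) w) / tn (orbp A w) = 1 / FI.lam" if w: "w ~= 0" for w
 proof -
  have "orbp A w ~= 0" using A.orbp_self[of w] w by force
  hence "0 < tn (orbp A w)" by (intro FI.FN.tr_pos_strict A.orbp_comm isproj_pos[OF A.orbp(1)])
  hence "tau (orbp (comm A) w) ~= 0" using FI.coupling[of w] by auto
  thus ?thesis using FI.coupling[of w] FI.lam_pos by simp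
 qed
 have "Om ~= 0" using norm_Om by auto
 have the: "(THE d. \<forall>\<xi>. \<xi> ~= 0 --> d = Re (trace_of (oper_of ` A) (orbit_proj (commutant (oper_of ` A)) \<xi>))
   / Re (trace_of (commutant (oper_of ` A)) (orbit_proj (oper_of ` A) \<xi>))) = 1 / FI.lam"
  unfolding tr by (rule the_equality) (use ratio \<open>Om ~= 0\<close> in auto)
 have "vn_dim (oper_of ` A) = ereal (1 / FI.lam)" unfolding vn_dim_def the using \<tau> by auto
 hence "d = 1 / FI.lam" using assms by simp
 hence "tn e * d = 1" using FI.lam_pos by (simp add: FI.lam_def)
 thus ?thesis using FI.finite_index_axioms by blast
qed


section \<open>The optimal constant\<close>

text \<open>For each unitary the condition is linear in the constant, so the supremum satisfies it
  as soon as there is any admissible constant.\<close>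

lemma admissible_maximum:
 assumes a: "a \<in> admissible M A" shows "\<exists>\<alpha>\<in>admissible M A. \<forall>\<beta>\<in>admissible M A. \<beta> <= \<alpha>"
proof -
 define s where "s = Sup (admissible M A)"
 have bdd: "bdd_above (admissible M A)" by (rule bdd_aboveI[of _ 1]) (simp add: admissible_def)
 have le: "b <= s" if "b \<in> admissible M A" for b unfolding s_def by (rule cSup_upper[OF that bdd])
 have least: "s <= c" if "!!b. b \<in> admissible M A ==> b <= c" for c unfolding s_def by (rule cSup_least) (use a that in auto)
 have "s \<in> admissible M A" unfolding admissible_def
 proof (intro CollectI conjI ballI)
  have "s <= 1" by (rule least) (simp add: admissible_def)
  moreover have "0 < s" using le[OF a] a by (simp add: admissible_def)
  ultimately show "s \<in> {0<..1}" by simp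
  fix u assume u: "u \<in> unitaries M"
  define n r where "n = norm2 M (u - cond_exp M A u)"
   and "r = norm_inf2 M (%x. cond_exp M A x - cond_exp M (conj_by u A) x)"
  have b: "b * n <= r" if "b \<in> admissible M A" for b using that u by (simp add: admissible_def n_def r_def)
  have "s * n <= r"
  \<comment> \<open>For arbitrary \<open>M\<close> and \<open>A\<close> the number \<open>n\<close>
    is a root of a real number of unknown sign. If it is not positive, the smaller constant
    \<open>a\<close> gives the stronger inequality.\<close>
  proof (cases "0 < n")
   case True
   hence "s <= r / n" by (intro least) (use b in \<open>simp add: field_simps\<close>)
   thus ?thesis using True by (simp add: field_simps)
  next
   case False
   hence "s * n <= a * n" using le[OF a] by (intro mult_right_mono_neg) auto
   thus ?thesis using b[OF a] by simp
  qed
  thus "s * norm2 M (u - cond_exp M A u) <= norm_inf2 M (%x. cond_exp M A x - cond_exp M (conj_by u A) x)"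
   by (simp add: n_def r_def)
 qed
 thus ?thesis using le by blast
qed

text \<open>\<open>phi\<close> carries \<open>norm2\<close> to the vector norm at \<open>Om\<close>.
  The expectation \<open>F\<close> on \<open>Q\<close> is \<open>K.E\<close> pulled back along
  \<open>phi\<close>, and \<open>cond_exp_eq\<close> identifies it and its conjugates with the
  definite descriptions of the statement.\<close>

lemma (in trace_representation) admissible_bounds:
 assumes QF: "factor_algebra Q" and PF: "factor_algebra P" and PQ: "P \<subseteq> Q"
  and K: "index_two_plus_sqrt2 (phi ` Q) (phi ` P) Om tn"
 defines "M \<equiv> oper_of ` Q" and "A \<equiv> oper_of ` P"
 shows "sqrt (2 - sqrt 2) \<in> admissible M A" "!!b. b \<in> admissible M A ==> b <= sqrt (2 * (sqrt 2 - 1))"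
proof -
 interpret K: index_two_plus_sqrt2 "phi ` Q" "phi ` P" Om tn by (rule K)
 interpret P: factor_algebra P by (rule PF)
 have ff: "finite_factor Q t" by (intro finite_factor.intro finite_algebra_axioms QF)
 have PQ': "x \<in> Q" if "x \<in> P" for x using that PQ by blast
 have tau: "K.tau (phi x) = t x" if "x \<in> Q" for x using phi_state[OF that] by (simp add: K.tau_def)
 define F where "F x = (SOME y. y \<in> P & phi y = K.E (phi x))" for x
 have F: "F x \<in> P & phi (F x) = K.E (phi x)" if x: "x \<in> Q" for x
 proof -
  have "\<exists>y. y \<in> P & phi y = K.E (phi x)" using K.E_mem[OF imageI[OF x]] by (metis imageE)
  thus ?thesis unfolding F_def by (rule someI_ex)
 qed
 have FQ: "F x \<in> Q" if "x \<in> Q" for x using F[OF that] PQ' by blast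
 have Fpos: "0 <= F x" if x: "x \<in> Q" "0 <= x" for x
 proof (rule phi_reflect[OF FQ[OF x(1)]])
  have "0 <= phi (F x)" using F[OF x(1)] K.E_pos[OF imageI[OF x(1)] phi_pos[OF x]] by simp
  moreover from this have "phi (star (F x)) = phi (F x)" using pos_self_adjoint by (simp add: phi_star FQ x)
  ultimately show "star (F x) = F x" "0 <= phi (F x)" using phi_inj[OF star[OF FQ[OF x(1)]] FQ[OF x(1)]] by auto
 qed
 have Ft: "t (F x * b) = t (x * b)" if x: "x \<in> Q" and b: "b \<in> P" for x b
 proof -
  have "t (F x * b) = K.tau (K.E (phi x) * phi b)" using tau[of "F x * b"] F[OF x] by (simp add: mult FQ x PQ' b phi_mult)
  also have "... = K.tau (K.E (phi x * phi b))" using K.E_right[OF imageI[OF b] imageI[OF x]] by simp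
  also have "... = K.tau (phi (x * b))" using K.tau_E[OF T.mult[OF imageI[OF x] imageI[OF PQ'[OF b]]]] by (simp add: phi_mult x PQ' b)
  finally show ?thesis using tau[of "x * b"] by (simp add: mult x PQ' b)
 qed
 have ce: "cond_exp M A (oper_of x) = oper_of (F x)" if x: "x \<in> Q" for x
  unfolding M_def A_def
  by (rule finite_factor.cond_exp_eq[OF ff t_one P.star_algebra_axioms PQ _ Fpos Ft x]) (use F in auto)
 have ceu: "cond_exp M (conj_by (oper_of u) A) (oper_of x) = oper_of (u * F (star u * x * u) * star u)"
  if u: "u \<in> Q" "star u * u = 1" "u * star u = 1" and x: "x \<in> Q" for u x
 proof -
  define B where "B = (%a. u * a * star u) ` P"
  have BI: "u * a * star u \<in> B" if "a \<in> P" for a using that by (simp add: B_def)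
  have cu: "star u * (u * z) = z" for z using u(2) by (simp flip: mult.assoc)
  have B: "conj_by (oper_of u) A = oper_of ` B"
   unfolding conj_by_def A_def B_def by (simp add: image_image flip: oper_of_star oper_of_mult)
  have BQ: "B \<subseteq> Q" unfolding B_def by (auto intro: mult star u PQ')
  have yQ: "star u * x * u \<in> Q" if "x \<in> Q" for x by (intro mult star u that)
  have "cond_exp (oper_of ` Q) (oper_of ` B) (oper_of x) = oper_of (u * F (star u * x * u) * star u)"
  proof (rule finite_factor.cond_exp_eq[OF ff t_one _ BQ _ _ _ x])
   show "star_algebra B"
   proof
    show "1 \<in> B" using BI[OF P.one] by (simp add: u)
    fix x assume "x \<in> B"
    then obtain a where a: "a \<in> P" "x = u * a * star u" by (auto simp: B_def)
    show "star x \<in> B" using BI[OF P.star[OF a(1)]] by (simp add: a star_mult mult.assoc)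
    show "cscale c x \<in> B" for c using BI[OF P.cscale[OF a(1)], of c] by (simp add: a cscale_mult)
    fix y assume "y \<in> B"
    then obtain b where b: "b \<in> P" "y = u * b * star u" by (auto simp: B_def)
    show "x + y \<in> B" using BI[OF P.add[OF a(1) b(1)]] by (simp add: a b distrib_left distrib_right)
    show "x * y \<in> B" using BI[OF P.mult[OF a(1) b(1)]] by (simp add: a b mult.assoc cu)
   qed
   show "u * F (star u * x * u) * star u \<in> B" if "x \<in> Q" for x using BI F yQ[OF that] by blast
   show "0 <= u * F (star u * x * u) * star u" if "x \<in> Q" "0 <= x" for x
    by (intro conj_pos' Fpos yQ that conj_pos)
   fix x b assume x: "x \<in> Q" and "b \<in> B"
   then obtain a where a: "a \<in> P" "b = u * a * star u" by (auto simp: B_def)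
   have aQ: "a \<in> Q" by (rule PQ'[OF a(1)])
   have fQ: "F (star u * x * u) \<in> Q" by (rule FQ[OF yQ[OF x]])
   have "t (u * F (star u * x * u) * star u * b) = t (u * (F (star u * x * u) * a * star u))" by (simp add: a mult.assoc cu)
   also have "... = t (F (star u * x * u) * a * star u * u)" by (rule tr_comm) (intro mult star u fQ aQ)+
   also have "... = t (F (star u * x * u) * a)" by (simp add: mult.assoc u)
   also have "... = t (star u * x * u * a)" by (rule Ft[OF yQ[OF x] a(1)])
   also have "... = t (star u * (x * u * a))" by (simp only: mult.assoc)
   also have "... = t (x * u * a * star u)" by (rule tr_comm) (intro mult star u x aQ)+
   finally show "t (u * F (star u * x * u) * star u * b) = t (x * b)" by (simp add: a mult.assoc)
  qed
  thus ?thesis by (simp add: M_def B)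
 qed
 have n2: "norm2 M (oper_of x) = norm (phi x $ Om)" if x: "x \<in> Q" for x
 proof -
  have "Re (trace_of M (oper_of (star x * x))) = (norm (phi x $ Om))\<^sup>2"
   unfolding M_def using finite_factor.trace_of_eq[OF ff t_one mult[OF star[OF x] x]] by (simp add: complex_trace_def phi_norm x)
  thus ?thesis by (simp add: norm2_def flip: oper_of_star oper_of_mult)
 qed
 define N where "N u = norm_inf2 M (%x. cond_exp M A x - cond_exp M (conj_by (oper_of u) A) x)" for u
 have ndiff: "norm2 M (cond_exp M A (oper_of x) - cond_exp M (conj_by (oper_of u) A) (oper_of x))
   = norm (K.conjugate_difference (phi u) (phi x) $ Om)"
  if u: "u \<in> Q" "star u * u = 1" "u * star u = 1" and x: "x \<in> Q" for u x
 proof -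
  have yQ: "star u * x * u \<in> Q" by (intro mult star u x)
  have "phi (F x - u * F (star u * x * u) * star u) = K.conjugate_difference (phi u) (phi x)"
   using F[OF x] F[OF yQ] by (simp add: K.conjugate_difference_def phi_diff phi_mult phi_star mult star u FQ x yQ)
  moreover have "F x - u * F (star u * x * u) * star u \<in> Q" by (intro diff mult star u FQ x yQ)
  ultimately show ?thesis using n2[of "F x - u * F (star u * x * u) * star u"] by (simp add: ce ceu u x oper_of_diff)
 qed
 have phiu: "star (phi u) * phi u = 1" if "u \<in> Q" "star u * u = 1" for u
  using that by (simp add: phi_one flip: phi_star phi_mult[OF star])
 have phiu': "phi u * star (phi u) = 1" if "u \<in> Q" "u * star u = 1" for u
  using that by (simp add: phi_one flip: phi_star phi_mult[OF _ star])
 have N: "N u = (SUP x\<in>{x \<in> Q. nrm x <= 1}. norm (K.conjugate_difference (phi u) (phi x) $ Om))"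
  if u: "u \<in> Q" "star u * u = 1" "u * star u = 1" for u
 proof -
  have "{X \<in> M. norm X <= 1} = oper_of ` {x \<in> Q. nrm x <= 1}" by (auto simp: M_def nrm_def)
  thus ?thesis unfolding N_def norm_inf2_def by (simp add: image_image) (rule SUP_cong, simp_all add: ndiff u)
 qed
 have pn: "norm (phi x $ Om) <= 1" if "x \<in> Q" "nrm x <= 1" for x
  using norm_appl[of "phi x" Om] phi_nrm_le[OF that(1)] that(2) by (simp add: T.norm_Om)
 have upper: "norm (K.conjugate_difference (phi u) (phi x) $ Om) <= N u"
  if u: "u \<in> Q" "star u * u = 1" "u * star u = 1" and x: "x \<in> Q" "nrm x <= 1" for u x
  unfolding N[OF u]
 proof (rule cSUP_upper)
  show "x \<in> {x \<in> Q. nrm x <= 1}" using x by simp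
  \<comment> \<open>A real supremum dominates its members only if they are bounded; the bound 2
    comes from the triangle inequality.\<close>
  show "bdd_above ((%x. norm (K.conjugate_difference (phi u) (phi x) $ Om)) ` {x \<in> Q. nrm x <= 1})"
  proof (rule bdd_aboveI2[of _ _ 2])
   fix x assume "x \<in> {x \<in> Q. nrm x <= 1}"
   hence x: "x \<in> Q" "nrm x <= 1" by auto
   show "norm (K.conjugate_difference (phi u) (phi x) $ Om) <= 2"
    using K.conjugate_difference_le[OF imageI[OF u(1)] phiu[OF u(1,2)] phiu'[OF u(1,3)] imageI[OF x(1)]] pn[OF x] by simp
  qed
 qed
 have nu: "norm2 M (oper_of u - cond_exp M A (oper_of u)) = norm ((phi u - K.E (phi u)) $ Om)" if u: "u \<in> Q" for u
  using n2[of "u - F u"] F[OF u] by (simp add: ce u oper_of_diff diff FQ phi_diff)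
 have unit: "\<exists>u. U = oper_of u & u \<in> Q & star u * u = 1 & u * star u = 1" if U: "U \<in> unitaries M" for U
 proof -
  obtain u where u: "u \<in> Q" "U = oper_of u" using U by (auto simp: unitaries_def M_def)
  have "oper_of (star u * u) = oper_of 1" "oper_of (u * star u) = oper_of 1"
   using U by (simp_all add: unitaries_def u oper_of_mult oper_of_star oper_of_one)
  thus ?thesis using u by (simp add: oper_of_inject)
 qed
 have s2: "0 < 2 - sqrt 2" "2 - sqrt 2 <= 1" using K.sqrt2_bounds by simp_all
 show "sqrt (2 - sqrt 2) \<in> admissible M A" unfolding admissible_def
 proof (intro CollectI conjI ballI)
  show "sqrt (2 - sqrt 2) \<in> {0<..1}" using s2 by simp
  fix U assume "U \<in> unitaries M"
  then obtain u where u: "U = oper_of u" "u \<in> Q" "star u * u = 1" "u * star u = 1" using unit by blast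
  have N0: "0 <= N u" using order_trans[OF norm_ge_zero upper[OF u(2-4) zero]] by (simp add: nrm_def oper_of_zero)
  have "(2 - sqrt 2) * (norm ((phi u - K.E (phi u)) $ Om))\<^sup>2 <= (N u)\<^sup>2"
  proof (rule K.conjugate_difference_lower[OF imageI[OF u(2)] phiu[OF u(2,3)] N0])
   fix y assume y: "y \<in> phi ` Q" "star y * y = 1"
   then obtain x where x: "x \<in> Q" "y = phi x" by blast
   have "phi (star x * x) = phi 1" using y(2) x by (simp add: phi_mult phi_star star phi_one)
   hence "star x * x = 1" by (rule phi_inj[OF mult[OF star[OF x(1)] x(1)] one])
   hence "norm (x $ v) = norm v" for v by (rule isometry_norm)
   hence "nrm x <= 1" by (intro nrm_leI) simp_all
   thus "norm (K.conjugate_difference (phi u) y $ Om) <= N u" using upper[OF u(2-4) x(1)] x(2) by simp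
  qed
  hence "(sqrt (2 - sqrt 2) * norm ((phi u - K.E (phi u)) $ Om))\<^sup>2 <= (N u)\<^sup>2" using s2 by (simp add: power_mult_distrib)
  hence "sqrt (2 - sqrt 2) * norm ((phi u - K.E (phi u)) $ Om) <= N u" by (rule power2_le_imp_le[OF _ N0])
  thus "sqrt (2 - sqrt 2) * norm2 M (U - cond_exp M A U) <= norm_inf2 M (%x. cond_exp M A x - cond_exp M (conj_by U A) x)"
   by (simp add: u(1) nu[OF u(2)] N_def)
 qed
 fix b assume b: "b \<in> admissible M A"
 obtain y where y: "y \<in> phi ` Q" "star y * y = 1" "y * star y = 1" "norm ((y - K.E y) $ Om) = 1"
  "!!x. x \<in> phi ` Q ==> nrm x <= 1 ==> norm (K.conjugate_difference y x $ Om) <= sqrt (2 * (sqrt 2 - 1))"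
  using K.conjugate_difference_upper by blast
 obtain u where u: "u \<in> Q" "y = phi u" using y(1) by blast
 have "phi (star u * u) = phi 1" "phi (u * star u) = phi 1" using y(2,3) u by (simp_all add: phi_mult phi_star star phi_one)
 hence uu: "star u * u = 1" "u * star u = 1" using phi_inj[OF mult[OF star[OF u(1)] u(1)] one] phi_inj[OF mult[OF u(1) star[OF u(1)]] one] by auto
 have "oper_of u \<in> unitaries M" by (simp add: unitaries_def M_def u uu oper_of_one flip: oper_of_star oper_of_mult)
 with b have "b * norm2 M (oper_of u - cond_exp M A (oper_of u)) <= N u" unfolding admissible_def N_def by blast
 hence "b * 1 <= N u" using y(4) by (simp only: nu[OF u(1)] u(2))
 also have "N u <= sqrt (2 * (sqrt 2 - 1))" unfolding N[OF u(1) uu]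
 proof (rule cSUP_least)
  have "0 \<in> {x \<in> Q. nrm x <= 1}" using zero by (simp add: nrm_def oper_of_zero)
  thus "{x \<in> Q. nrm x <= 1} ~= {}" by blast
  fix x assume "x \<in> {x \<in> Q. nrm x <= 1}"
  thus "norm (K.conjugate_difference (phi u) (phi x) $ Om) <= sqrt (2 * (sqrt 2 - 1))"
   using y(5)[of "phi x"] phi_nrm_le[of x] u(2) by auto
 qed
 finally show "b <= sqrt (2 * (sqrt 2 - 1))" by simp
qed

lemma trace_representation_if_standard_rep:
 assumes rep: "standard_rep (oper_of ` Q) \<pi> Om" and ff: "finite_factor Q t" "t 1 = 1"
 defines "phi \<equiv> %x. Cop (\<pi> (oper_of x))"
 shows "trace_representation Q t phi Om" "!!P. P \<subseteq> Q ==> \<pi> ` oper_of ` P = oper_of ` phi ` P"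
proof -
 interpret finite_factor Q t by (rule ff)
 note r = rep[unfolded standard_rep_def]
 have phi: "oper_of (phi x) = \<pi> (oper_of x)" if "x \<in> Q" for x
  unfolding phi_def by (rule Cop_inverse) (use r that in blast)
 show "\<pi> ` oper_of ` P = oper_of ` phi ` P" if "P \<subseteq> Q" for P
  unfolding image_image by (rule image_cong[OF refl]) (use phi that in auto)
 show "trace_representation Q t phi Om"
 proof
  show "t 1 = 1" by (rule ff)
  have "oper_of (phi 1) = oper_of 1" using r by (simp add: phi one oper_of_one)
  thus "phi 1 = 1" by (simp only: oper_of_inject)
  fix x assume x: "x \<in> Q"
  have "oper_of (phi (star x)) = oper_of (star (phi x))" using r x by (simp add: phi star oper_of_star)
  thus "phi (star x) = star (phi x)" by (simp only: oper_of_inject)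
  have "oper_of (phi (cscale c x)) = oper_of (cscale c (phi x))" for c using r x by (simp add: phi cscale oper_of_cscale)
  thus "phi (cscale c x) = cscale c (phi x)" for c by (simp only: oper_of_inject)
  have "cinner (phi x $ Om) Om = complex_trace t x" using r x trace_of_eq[OF ff(2) x] by (simp add: appl_def phi)
  thus "qf (phi x) Om = t x" by (simp add: qf_def complex_trace_def)
  fix y assume y: "y \<in> Q"
  have "oper_of (phi (x + y)) = oper_of (phi x + phi y)" using r x y by (simp add: phi add oper_of_add)
  thus "phi (x + y) = phi x + phi y" by (simp only: oper_of_inject)
  have "oper_of (phi (x * y)) = oper_of (phi x * phi y)" using r x y by (simp add: phi mult oper_of_mult)
  thus "phi (x * y) = phi x * phi y" by (simp only: oper_of_inject)
 next
  have "(%x. phi x $ Om) ` Q = (%x. blinfun_apply (\<pi> x) Om) ` oper_of ` Q"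
   unfolding image_image by (rule image_cong[OF refl]) (simp add: appl_def phi)
  thus "closure ((%x. phi x $ Om) ` Q) = UNIV" using r by simp
 qed
qed

theorem mainTheorem4:
  fixes M A :: "'h::complex_hilbert_space oper set"
  assumes "II1_factor M" and "hyperfinite M"
    and "subfactor A M"
    and "has_jones_index TYPE('k::complex_hilbert_space) M A (ereal (2 + sqrt 2))"
  shows "\<exists>\<alpha>\<in>admissible M A. (\<forall>\<beta>\<in>admissible M A. \<beta> \<le> \<alpha>) \<and>
           sqrt (sqrt 2 * (sqrt 2 - 1)) \<le> \<alpha> \<and> \<alpha> \<le> sqrt (2 * (sqrt 2 - 1))"
proof -
 obtain Q where Q: "M = oper_of ` Q" "factor_algebra Q" using assms(1) factor_image unfolding II1_factor_def by metis
 obtain P where P: "A = oper_of ` P" "factor_algebra P" using assms(3) factor_image unfolding subfactor_def by metis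
 interpret Q: factor_algebra Q by (rule Q(2))
 have "oper_of ` P \<subseteq> oper_of ` Q" using assms(3) by (simp add: subfactor_def P Q)
 hence PQ: "P \<subseteq> Q" by (auto simp: oper_of_inject)
 have PV: "vn_algebra P" using P(2) by (rule factor_algebra.axioms(1))
 obtain \<tau> where \<tau>: "normal_faithful_tracial_state (oper_of ` Q) \<tau>" using assms(1) by (auto simp: II1_factor_def Q)
 obtain t where t: "finite_algebra Q t" "t 1 = 1"
  using normal_faithful_tracial_stateD(1,2)[OF Q.vn_algebra_axioms \<tau>] by blast
 have ff: "finite_factor Q t" by (intro finite_factor.intro t(1) Q(2))
 obtain \<pi> :: "'h oper => 'k oper" and Om where \<pi>: "standard_rep M \<pi> Om" "vn_dim (\<pi> ` A) = ereal (2 + sqrt 2)"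
  using assms(4) by (auto simp: has_jones_index_def)
 define phi where "phi = (%x. Cop (\<pi> (oper_of x)))"
 interpret R: trace_representation Q t phi Om
  unfolding phi_def by (rule trace_representation_if_standard_rep[OF \<pi>(1)[unfolded Q(1)] ff t(2)])
 have dim: "vn_dim (oper_of ` phi ` P) = ereal (2 + sqrt 2)"
  using \<pi>(2) trace_representation_if_standard_rep(2)[OF \<pi>(1)[unfolded Q(1)] ff t(2) PQ] by (simp add: P(1) phi_def)
 have QK: "vn_algebra (phi ` Q)" by (rule R.vn_algebra_image[OF Q.vn_algebra_axioms order_refl])
 interpret K: subfactor_inclusion "phi ` Q" "phi ` P" Om
  by (intro subfactor_inclusion.intro inclusion.intro standard_form.intro inclusion_axioms.intro R.T.tracial_vector_axioms
    QK R.vn_algebra_image[OF PV PQ] image_mono[OF PQ] R.factor_algebra_image[OF Q(2) order_refl] R.factor_algebra_image[OF P(2) PQ])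
 obtain tn where tn: "finite_index (phi ` Q) (phi ` P) Om tn" "tn K.e * (2 + sqrt 2) = 1" using K.index_eq[OF dim] by blast
 interpret FI: finite_index "phi ` Q" "phi ` P" Om tn by (rule tn(1))
 have inf: "\<nexists>S. finite S & phi ` Q \<subseteq> span S"
  using R.finite_dim_reflect finite_dim_image assms(1) unfolding II1_factor_def Q(1) by blast
 \<comment> \<open>The product of the two numerical factors is 1, and
   \<open>lam * (2 + sqrt 2) = 1\<close> is the index hypothesis.\<close>
 have "FI.lam = (1 - sqrt 2 / 2) * (2 + sqrt 2) * FI.lam" by (simp add: algebra_simps)
 also have "... = 1 - sqrt 2 / 2" using tn(2) by (simp add: FI.lam_def mult.assoc mult.commute)
 finally have K: "index_two_plus_sqrt2 (phi ` Q) (phi ` P) Om tn"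
  by (intro index_two_plus_sqrt2.intro index_two_plus_sqrt2_axioms.intro tn(1) inf) (use FI.finite_dim_subfactor inf in blast)+
 have "sqrt 2 * (sqrt 2 - 1) = 2 - sqrt 2" by (simp add: algebra_simps)
 thus ?thesis
  using R.admissible_bounds[OF Q(2) P(2) PQ K] admissible_maximum[of "sqrt (2 - sqrt 2)" M A] by (auto simp: P(1) Q(1))
qed

end
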